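(* Let $p\ge2$, $0<\alpha<2$, $\frac1p<\beta<\alpha+\frac1p$, and $c_1:=\frac{2(\alpha+1/p-\beta)}\alpha$. Let $\varepsilon$ and $\delta$ be constants satisfying $$\frac1p<\beta-\frac\alpha2\varepsilon,\qquad\beta-\alpha<\frac1p-\delta<\frac1p.$$ Then there is a constant $C$ depending only on $\alpha,\beta,d,p,\varepsilon,\delta$ and $T$ such that for every $g\in C_c^\infty((0,\infty)\times\mathbb R^d)$, $$\int_0^T\int_0^t\int_{\mathbb R^d}\Big|\big((-\Delta)^{\frac{c_1+\varepsilon}2}q_{\alpha,\beta}(t-s,\cdot)\ast g(s,\cdot)\big)(x)\Big|^p\,dx\,ds\,dt\le C\int_0^T\|g(t,\cdot)\|^p_{B^\varepsilon_p}\,dt .$$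
   Context: $T\in(0,\infty)$. $\mathcal F$ is the Fourier transform on $\mathbb R^d$ and $(-\Delta)^af=\mathcal F^{-1}(|\xi|^{2a}\mathcal F f)$. $p(t,x)$ is the fundamental solution of $\partial_t^\alpha u=\Delta u$, $u(0,\cdot)=u_0$, $1_{\alpha>1}\partial_tu(0,\cdot)=0$ on $\mathbb R^d$ ($\partial_t^\alpha$ the Caputo derivative), i.e. $u=p(t,\cdot)*u_0$. For $\beta<\alpha+\frac12$, $q_{\alpha,\beta}(t,x)=I_t^{\alpha-\beta}p(t,x)$ if $\alpha\ge\beta$ and $q_{\alpha,\beta}(t,x)=D_t^{\beta-\alpha}p(t,x)$ if $\alpha<\beta$ (Riemann–Liouville fractional integral and derivative in $t$). One has $\mathcal F\{q_{\alpha,\beta}(t,\cdot)\}(\xi)=t^{\alpha-\beta}E_{\alpha,1+\alpha-\beta}(-t^\alpha|\xi|^2)$ with the Mittag-Leffler function $E_{a,b}(z)=\sum_{k\ge0}\frac{z^k}{\Gamma(ak+b)}$. The convolution is in $x$. Besov space: fix $\Psi\in\mathcal S(\mathbb R^d)$ with $\hat\Psi$ supported in $\{\frac12\le|\xi|\le2\}$, $\hat\Psi>0$ on $\frac12<|\xi|<2$, $\sum_{j\in\mathbb Z}\hat\Psi(2^{-j}\xi)=1$ for $\xi\ne0$. Put $\hat\Psi_j(\xi)=\hat\Psi(2^{-j}\xi)$ for $j\ge1$, $\hat\Psi_0=1-\sum_{j\ge1}\hat\Psi_j$, and $u_j=\Psi_j*u$. For $1<p<\infty$, $s\in\mathbb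 R$, $\|u\|_{B^s_p}=\|u_0\|_{L_p}+\big(\sum_{j\ge1}2^{spj}\|u_j\|^p_{L_p}\big)^{1/p}$.
   Formalization: The formal statement additionally assumes c_1+ε ≥ 0; for c_1+ε < 0 the estimate fails, as g(s,x)=η(s)φ(x/R) with R→∞ shows (low frequencies are amplified by |ξ|^{c_1+ε}). *)

theory Defs
  imports "HOL-Analysis.Analysis"
begin

section \<open>Smooth functions on a Euclidean space\<close>

primrec partials :: "'a::euclidean_space list \<Rightarrow> ('a \<Rightarrow> 'b::real_normed_vector) \<Rightarrow> 'a \<Rightarrow> 'b" where
  "partials [] f = f"
| "partials (v # vs) f = (\<lambda>x. frechet_derivative (partials vs f) (at x) v)"

definition times_differentiable :: "nat \<Rightarrow> ('a::euclidean_space \<Rightarrow> 'b::real_normed_vector) \<Rightarrow> bool" where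
  "times_differentiable n f \<longleftrightarrow>
     (\<forall>vs. set vs \<subseteq> Basis \<and> length vs < n \<longrightarrow> (\<forall>x. partials vs f differentiable (at x)))"

definition smooth :: "('a::euclidean_space \<Rightarrow> 'b::real_normed_vector) \<Rightarrow> bool" where
  "smooth f \<longleftrightarrow> (\<forall>n. times_differentiable n f)"

definition laplacian :: "('a::euclidean_space \<Rightarrow> 'b::real_normed_vector) \<Rightarrow> 'a \<Rightarrow> 'b" where
  "laplacian f x = (\<Sum>b\<in>Basis. partials [b, b] f x)"

text \<open>The space \<open>C\<^sub>c\<^sup>\<infinity>(U)\<close>, its elements being extended by zero to the whole space.\<close>

definition test_function :: "'a::euclidean_space set \<Rightarrow> ('a \<Rightarrow> 'b::real_normed_vector) \<Rightarrow> bool" where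
  "test_function U f \<longleftrightarrow>
     smooth f \<and> compact (closure {x. f x \<noteq> 0}) \<and> closure {x. f x \<noteq> 0} \<subseteq> U"

definition schwartz :: "('a::euclidean_space \<Rightarrow> 'b::real_normed_vector) \<Rightarrow> bool" where
  "schwartz f \<longleftrightarrow> smooth f \<and>
     (\<forall>vs k. set vs \<subseteq> Basis \<longrightarrow> (\<exists>B. \<forall>x. (1 + norm x) ^ k * norm (partials vs f x) \<le> B))"


section \<open>Convolution, Fourier transform, fractional Laplacian\<close>

text \<open>
  Integrals are taken with respect to the complete Lebesgue measure: the kernels below are defined
  through time derivatives existing only almost everywhere in space, so they need not be Borel.
\<close>

definition conv :: "('a::euclidean_space \<Rightarrow> complex) \<Rightarrow> ('a \<Rightarrow> complex) \<Rightarrow> 'a \<Rightarrow> complex" where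
  "conv f g x = (LINT y|lebesgue. f (x - y) * g y)"

definition fourier :: "('a::euclidean_space \<Rightarrow> complex) \<Rightarrow> 'a \<Rightarrow> complex" where
  "fourier f \<xi> = (LINT x|lebesgue. cis (- (x \<bullet> \<xi>)) * f x)"

definition inv_fourier :: "('a::euclidean_space \<Rightarrow> complex) \<Rightarrow> 'a \<Rightarrow> complex" where
  "inv_fourier m x = (LINT \<xi>|lebesgue. cis (x \<bullet> \<xi>) * m \<xi>) /\<^sub>R (2 * pi) ^ DIM('a)"

text \<open>
  For a function \<open>m\<close> of polynomial growth that need not be integrable, \<open>\<F>\<^sup>-\<^sup>1 m\<close> is a tempered
  distribution, \<open>\<langle>\<F>\<^sup>-\<^sup>1 m, \<phi>\<rangle> = \<langle>m, \<F>\<^sup>-\<^sup>1 \<phi>\<rangle>\<close>, represented by its action on test functions.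
  The fractional Laplacian needs this generality: the symbol \<open>|\<xi>|\<^sup>2\<^sup>a \<F> f(\<xi>)\<close> may decay
  arbitrarily slowly. If the distribution is given by an integrable function \<open>h\<close>, then
  \<open>conv_distr\<close> is the usual convolution of \<open>h\<close> and \<open>\<phi>\<close>.
\<close>

definition inv_fourier_distr ::
    "('a::euclidean_space \<Rightarrow> complex) \<Rightarrow> ('a \<Rightarrow> complex) \<Rightarrow> complex" where
  "inv_fourier_distr m \<phi> = (LINT \<xi>|lebesgue. m \<xi> * inv_fourier \<phi> \<xi>)"

definition frac_laplacian ::
    "real \<Rightarrow> ('a::euclidean_space \<Rightarrow> complex) \<Rightarrow> ('a \<Rightarrow> complex) \<Rightarrow> complex" where
  "frac_laplacian a f = inv_fourier_distr (\<lambda>\<xi>. of_real (norm \<xi> powr (2 * a)) * fourier f \<xi>)"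

definition conv_distr ::
    "(('a::euclidean_space \<Rightarrow> complex) \<Rightarrow> complex) \<Rightarrow> ('a \<Rightarrow> complex) \<Rightarrow> 'a \<Rightarrow> complex" where
  "conv_distr \<Lambda> \<phi> x = \<Lambda> (\<lambda>y. \<phi> (x - y))"


section \<open>Fractional calculus on the half-line\<close>

text \<open>The derivative on \<open>[0,\<infinity>)\<close>: one-sided at \<open>0\<close>, two-sided at positive times.\<close>

definition time_deriv :: "(real \<Rightarrow> 'b::real_normed_vector) \<Rightarrow> real \<Rightarrow> 'b" where
  "time_deriv f t = vector_derivative f (at t within {0..})"

definition time_C :: "nat \<Rightarrow> (real \<Rightarrow> 'b::real_normed_vector) \<Rightarrow> bool" where
  "time_C m f \<longleftrightarrow>
     (\<forall>k\<le>m. continuous_on {0..} ((time_deriv ^^ k) f)) \<and>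
     (\<forall>k<m. (time_deriv ^^ k) f differentiable_on {0..})"

definition RL_integral ::
    "real \<Rightarrow> (real \<Rightarrow> 'b::{banach, second_countable_topology}) \<Rightarrow> real \<Rightarrow> 'b" where
  "RL_integral \<gamma> f t =
     (if \<gamma> = 0 then f t
      else (LINT s:{0..t}|lebesgue. (t - s) powr (\<gamma> - 1) *\<^sub>R f s) /\<^sub>R Gamma \<gamma>)"

definition RL_deriv ::
    "real \<Rightarrow> (real \<Rightarrow> 'b::{banach, second_countable_topology}) \<Rightarrow> real \<Rightarrow> 'b" where
  "RL_deriv \<gamma> f = (let n = nat \<lceil>\<gamma>\<rceil> in (time_deriv ^^ n) (RL_integral (real n - \<gamma>) f))"

definition RL_differentiable ::
    "real \<Rightarrow> (real \<Rightarrow> 'b::{banach, second_countable_topology}) \<Rightarrow> bool" where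
  "RL_differentiable \<gamma> f \<longleftrightarrow> (let n = nat \<lceil>\<gamma>\<rceil> in
     \<forall>k<n. (time_deriv ^^ k) (RL_integral (real n - \<gamma>) f) differentiable_on {0<..})"

text \<open>The Caputo derivative is the Riemann--Liouville derivative of \<open>f\<close> minus its Taylor polynomial.\<close>

definition taylor_remainder :: "nat \<Rightarrow> (real \<Rightarrow> 'b::real_normed_vector) \<Rightarrow> real \<Rightarrow> 'b" where
  "taylor_remainder n f t = f t - (\<Sum>k<n. (t ^ k / fact k) *\<^sub>R (time_deriv ^^ k) f 0)"

definition caputo_deriv ::
    "real \<Rightarrow> (real \<Rightarrow> 'b::{banach, second_countable_topology}) \<Rightarrow> real \<Rightarrow> 'b" where
  "caputo_deriv \<alpha> f = RL_deriv \<alpha> (taylor_remainder (nat \<lceil>\<alpha>\<rceil>) f)"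

definition caputo_differentiable ::
    "real \<Rightarrow> (real \<Rightarrow> 'b::{banach, second_countable_topology}) \<Rightarrow> bool" where
  "caputo_differentiable \<alpha> f \<longleftrightarrow>
     time_C (nat \<lceil>\<alpha>\<rceil> - 1) f \<and> RL_differentiable \<alpha> (taylor_remainder (nat \<lceil>\<alpha>\<rceil>) f)"


section \<open>The fundamental solution and the kernels \<open>q\<close>\<close>

definition frac_heat_solution ::
    "real \<Rightarrow> ('a::euclidean_space \<Rightarrow> complex) \<Rightarrow> (real \<Rightarrow> 'a \<Rightarrow> complex) \<Rightarrow> bool" where
  "frac_heat_solution \<alpha> u0 u \<longleftrightarrow>
     (\<forall>x. caputo_differentiable \<alpha> (\<lambda>t. u t x)) \<and>
     (\<forall>t>0. times_differentiable 2 (u t)) \<and>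
     (\<forall>t>0. \<forall>x. caputo_deriv \<alpha> (\<lambda>t. u t x) t = laplacian (u t) x) \<and>
     (\<forall>x. u 0 x = u0 x) \<and>
     (\<alpha> > 1 \<longrightarrow> (\<forall>x. time_deriv (\<lambda>t. u t x) 0 = 0))"

text \<open>
  The \<open>L\<^sub>1\<close> bound, locally uniform in time, is the growth condition that singles out the
  fundamental solution; without one the Cauchy problem is not uniquely solvable (already for the
  heat equation). It determines \<open>P t\<close> almost everywhere, for every \<open>t > 0\<close>.
\<close>

definition fundamental_solution :: "real \<Rightarrow> (real \<Rightarrow> 'a::euclidean_space \<Rightarrow> complex) \<Rightarrow> bool" where
  "fundamental_solution \<alpha> P \<longleftrightarrow>
     (\<lambda>(t, x). P t x) \<in> borel_measurable (restrict_space borel ({0<..} \<times> UNIV)) \<and>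
     (\<forall>t>0. integrable lborel (P t)) \<and>
     (\<forall>\<tau>. \<exists>M. \<forall>t\<in>{0<..\<tau>}. (LINT x|lborel. norm (P t x)) \<le> M) \<and>
     (\<forall>u0. test_function UNIV u0 \<longrightarrow>
        frac_heat_solution \<alpha> u0 (\<lambda>t. if t = 0 then u0 else conv (P t) u0))"

definition q_kernel ::
    "(real \<Rightarrow> 'a::euclidean_space \<Rightarrow> complex) \<Rightarrow> real \<Rightarrow> real \<Rightarrow> real \<Rightarrow> 'a \<Rightarrow> complex" where
  "q_kernel P \<alpha> \<beta> t x =
     (if \<alpha> \<ge> \<beta> then RL_integral (\<alpha> - \<beta>) (\<lambda>s. P s x) t
      else RL_deriv (\<beta> - \<alpha>) (\<lambda>s. P s x) t)"


section \<open>Besov norms\<close>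

text \<open>Powers of extended nonnegative reals, for exponents \<open>r > 0\<close>.\<close>

definition epowr :: "ennreal \<Rightarrow> real \<Rightarrow> ennreal" where
  "epowr a r = (if a = \<infinity> then \<infinity> else ennreal (enn2real a powr r))"

definition Lp_norm :: "real \<Rightarrow> ('a::euclidean_space \<Rightarrow> complex) \<Rightarrow> ennreal" where
  "Lp_norm p f = epowr (\<integral>\<^sup>+x. ennreal (norm (f x) powr p) \<partial>lebesgue) (1 / p)"

definition littlewood_paley :: "('a::euclidean_space \<Rightarrow> complex) \<Rightarrow> bool" where
  "littlewood_paley \<Psi> \<longleftrightarrow>
     schwartz \<Psi> \<and>
     (\<forall>\<xi>. fourier \<Psi> \<xi> \<noteq> 0 \<longrightarrow> 1/2 \<le> norm \<xi> \<and> norm \<xi> \<le> 2) \<and>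
     (\<forall>\<xi>. 1/2 < norm \<xi> \<and> norm \<xi> < 2 \<longrightarrow> fourier \<Psi> \<xi> \<in> \<real> \<and> Re (fourier \<Psi> \<xi>) > 0) \<and>
     (\<forall>\<xi>. \<xi> \<noteq> 0 \<longrightarrow> ((\<lambda>j::int. fourier \<Psi> ((2 powi (- j)) *\<^sub>R \<xi>)) has_sum 1) UNIV)"

definition dyadic_symbol :: "('a::euclidean_space \<Rightarrow> complex) \<Rightarrow> nat \<Rightarrow> 'a \<Rightarrow> complex" where
  "dyadic_symbol \<Psi> j \<xi> =
     (if j = 0 then 1 - (\<Sum>k. fourier \<Psi> (\<xi> /\<^sub>R 2 ^ Suc k)) else fourier \<Psi> (\<xi> /\<^sub>R 2 ^ j))"

definition dyadic_block ::
    "('a::euclidean_space \<Rightarrow> complex) \<Rightarrow> nat \<Rightarrow> ('a \<Rightarrow> complex) \<Rightarrow> 'a \<Rightarrow> complex" where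
  "dyadic_block \<Psi> j u = conv (inv_fourier (dyadic_symbol \<Psi> j)) u"

definition besov_norm ::
    "('a::euclidean_space \<Rightarrow> complex) \<Rightarrow> real \<Rightarrow> real \<Rightarrow> ('a \<Rightarrow> complex) \<Rightarrow> ennreal" where
  "besov_norm \<Psi> s p u =
     Lp_norm p (dyadic_block \<Psi> 0 u) +
     epowr (\<Sum>k. ennreal (2 powr (s * p * real (Suc k))) *
                  epowr (Lp_norm p (dyadic_block \<Psi> (Suc k) u)) p) (1 / p)"

end

theory Submission
  imports Defs "HOL-Probability.Probability" "HOL-Complex_Analysis.Complex_Analysis"
begin

text \<open>
  By deforming Hankel's contour, the Mittag-Leffler symbol becomes a superposition of complex
  Gaussians, so that \<open>E(-|\<xi>|\<^sup>2)\<close> and, by scaling, the symbol of \<open>q(u, \<cdot>)\<close> are Fourier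
  transforms of integrable functions. Cut off to the annulus \<open>|\<xi>| \<sim> 2\<^sup>j\<close>, the symbol of
  \<open>(-\<Delta>)\<^bsup>(c\<^sub>1+\<epsilon>)/2\<^esup>q(u, \<cdot>)\<close> has a kernel of \<open>L\<^sub>1\<close> norm at most \<open>2\<^bsup>j\<epsilon>\<^esup>k\<^sub>j(u)\<close> with
  \<open>k\<^sub>j(u) = D 2\<^bsup>jc\<^sub>1\<^esup> u\<^bsup>\<alpha>-\<beta>\<^esup> min(1, (4\<^sup>ju\<^sup>\<alpha>)\<^sup>-\<^sup>1)\<close>. Since \<open>\<Sum>\<^sub>j k\<^sub>j(u) \<le> A u\<^bsup>-1/p\<^esup>\<close> and
  \<open>\<integral> u\<^bsup>-(p-1)/p\<^esup> k\<^sub>j(u) du \<le> B\<close>, the estimate follows from Young's and Jensen's inequalities and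
  Tonelli's theorem. The formula for the symbol is not a definition but a consequence of the
  equation: tested against smooth functions, the fundamental solution satisfies a Volterra
  equation in time, whose only bounded solution is the Mittag-Leffler function.
\<close>


text \<open>The exponent c1 is chosen so that at the crossover 4^j u^\<alpha> = 1 the bound k_j(u)
  is of size u^(-1/p); the condition 1/p < \<beta> < \<alpha> + 1/p is exactly 0 < c1 < 2, which
  makes the terms decay geometrically on both sides of the crossover. The factor (4^j
  u^\<alpha>)^(-1) is paid for with two powers of |\<xi>|, so it is available on annuli only; on the
  ball around the origin, finiteness of T and c1 + \<epsilon> >= 0 take over. The bound \<alpha> < 2
  leaves room for a contour in the left half-plane, where exp decays, on which z^\<alpha> +
  |\<xi>|^2 has no zero; one fixed rotation then writes the reciprocal of this sum as an exponential
  integral. The delicate case of the symbol is \<alpha> < \<beta>: there q is a time derivative at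
  fixed x, while the equation determines P, for each time, only almost everywhere in x. The expected
  kernel is therefore built explicitly, continuous off x = 0, and P is recognised as its fractional
  integral; the fundamental theorem of calculus then gives the derivative at almost every x.\<close>

abbreviation L1 :: "('a::euclidean_space \<Rightarrow> 'b::{banach, second_countable_topology}) \<Rightarrow> bool" where
 "L1 \<equiv> integrable lborel"

abbreviation Borel :: "('a::topological_space \<Rightarrow> 'b::topological_space) set" where
 "Borel \<equiv> borel_measurable borel"

abbreviation L1_norm :: "('a::euclidean_space \<Rightarrow> 'b::real_normed_vector) \<Rightarrow> real" where
 "L1_norm f \<equiv> LINT x|lborel. norm (f x)"

abbreviation Lp_integral :: "real \<Rightarrow> ('a::euclidean_space \<Rightarrow> complex) \<Rightarrow> ennreal" where
 "Lp_integral p f \<equiv> \<integral>\<^sup>+x. ennreal (norm (f x) powr p) \<partial>lborel"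

lemmas lebesgue_integrable_bound = Bochner_Integration.integrable_bound
lemmas lebesgue_integrable_diff = Bochner_Integration.integrable_diff
lemmas lebesgue_integrable_sum = Bochner_Integration.integrable_sum
lemmas lebesgue_integral_add = Bochner_Integration.integral_add
lemmas lebesgue_integral_cnj = Bochner_Integration.integral_cnj
lemmas lebesgue_integral_cong = Bochner_Integration.integral_cong
lemmas lebesgue_integral_diff = Bochner_Integration.integral_diff
lemmas lebesgue_integral_nonneg = Bochner_Integration.integral_nonneg
lemmas lebesgue_integral_sum = Bochner_Integration.integral_sum

section \<open>Holomorphy of Laplace transforms and the complex Gamma integral\<close>

lemma laplace_transform_holomorphic:
 fixes h :: "'b \<Rightarrow> complex" and u :: "'b \<Rightarrow> real"
 assumes [measurable]: "h \<in> borel_measurable M" "u \<in> borel_measurable M"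
  and int: "\<And>a. a > 0 \<Longrightarrow> integrable M (\<lambda>x. norm (h x) * exp (- (a * u x)))"
  and u: "\<And>x. x \<in> space M \<Longrightarrow> 0 \<le> u x"
 shows "(\<lambda>z. LINT x|M. h x * exp (- (z * of_real (u x)))) holomorphic_on {z. 0 < Re z}"
proof -
 let ?F = "\<lambda>z. LINT x|M. h x * exp (- (z * of_real (u x)))"
 \<comment> \<open>The disc of radius \<open>Re z0\<close> is the largest one about
   \<open>z0\<close> inside the half-plane. Expanding exp(-(w - z0) u) on it yields a power series
   in w - z0.\<close>
 have "?F holomorphic_on ball z0 (Re z0)" if z0: "0 < Re z0" for z0
 proof (rule power_series_holomorphic)
  fix w assume w: "w \<in> ball z0 (Re z0)"
  define d where "d = norm (w - z0)"
  have d: "d < Re z0" "0 \<le> d" using w by (auto simp: d_def dist_norm norm_minus_commute)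
  define f where "f = (\<lambda>k x. h x * exp (- (z0 * of_real (u x))) * (- of_real (u x)) ^ k / fact k * (w - z0) ^ k)"
  have nf: "norm (f k x) = norm (h x) * exp (- (Re z0 * u x)) * ((u x * d) ^ k / fact k)"
   if "x \<in> space M" for k x
   using u[OF that] by (simp add: f_def d_def norm_mult norm_power norm_divide power_mult_distrib norm_exp_eq_Re)
  have bnd: "(\<Sum>k<n. (y::real) ^ k / fact k) \<le> exp y" if "0 \<le> y" for y n
  proof -
   have "(\<lambda>k. y ^ k / fact k) sums exp y" using exp_converges[of y] by (simp add: scaleR_conv_of_real field_simps)
   then show ?thesis using that by (intro sum_le_suminf[THEN order_trans, of _ _ ]) (auto simp: sums_iff)
  qed
  \<comment> \<open>This dominates all partial sums at once: the factor exp(d u) lost to the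
    expansion leaves the positive rate \<open>Re z0 - d\<close>.\<close>
  have G: "integrable M (\<lambda>x. norm (h x) * exp (- ((Re z0 - d) * u x)))" using d by (intro int) auto
  have sumb: "(\<Sum>k<n. norm (f k x)) \<le> norm (h x) * exp (- ((Re z0 - d) * u x))" if x: "x \<in> space M" for n x
  proof -
   have "(\<Sum>k<n. norm (f k x)) = norm (h x) * exp (- (Re z0 * u x)) * (\<Sum>k<n. (u x * d) ^ k / fact k)"
    by (simp add: nf[OF x] sum_distrib_left)
   also have "\<dots> \<le> norm (h x) * exp (- (Re z0 * u x)) * exp (u x * d)"
    using u[OF x] d by (intro mult_left_mono bnd) auto
   also have "\<dots> = norm (h x) * exp (- ((Re z0 - d) * u x))"
    by (simp add: algebra_simps flip: exp_add)
   finally show ?thesis .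
  qed
  have intf: "integrable M (f k)" for k
  proof (rule lebesgue_integrable_bound[OF G])
   show "f k \<in> borel_measurable M" unfolding f_def by measurable
   show "AE x in M. norm (f k x) \<le> norm (norm (h x) * exp (- ((Re z0 - d) * u x)))"
   proof (rule AE_I2)
    fix x assume x: "x \<in> space M"
    have "norm (f k x) \<le> (\<Sum>i<Suc k. norm (f i x))" by (simp add: sum_nonneg)
    also note sumb[OF x]
    finally show "norm (f k x) \<le> norm (norm (h x) * exp (- ((Re z0 - d) * u x)))" by simp
   qed
  qed
  have summ: "summable (\<lambda>k. norm (f k x))" if "x \<in> space M" for x
   by (rule bounded_imp_summable[of _ "norm (h x) * exp (- ((Re z0 - d) * u x))"])
    (use sumb[OF that, of "Suc _"] in \<open>auto simp: lessThan_Suc_atMost\<close>)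
  have "(\<lambda>k. integral\<^sup>L M (f k)) sums (LINT x|M. (\<Sum>k. f k x))"
  proof (rule sums_integral[OF intf])
   show "AE x in M. summable (\<lambda>i. norm (f i x))" using summ by auto
   have "(\<Sum>k\<le>n. LINT x|M. norm (f k x)) \<le> (LINT x|M. norm (h x) * exp (- ((Re z0 - d) * u x)))" for n
   proof -
    have "(\<Sum>k\<le>n. LINT x|M. norm (f k x)) = (LINT x|M. (\<Sum>k\<le>n. norm (f k x)))"
     using intf by (subst lebesgue_integral_sum) auto
    also have "\<dots> \<le> (LINT x|M. norm (h x) * exp (- ((Re z0 - d) * u x)))"
     using sumb[of _ "Suc n"] intf G by (intro integral_mono lebesgue_integrable_sum) (auto simp: lessThan_Suc_atMost)
    finally show ?thesis .
   qed
   then show "summable (\<lambda>i. LINT x|M. norm (f i x))"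
    by (intro bounded_imp_summable) auto
  qed
  moreover have "(\<Sum>k. f k x) = h x * exp (- (w * of_real (u x)))" for x
  proof -
   have "(\<lambda>k. (- of_real (u x) * (w - z0)) ^ k /\<^sub>R fact k) sums exp (- of_real (u x) * (w - z0))"
    by (rule exp_converges)
   then have "(\<lambda>k. h x * exp (- (z0 * of_real (u x))) * ((- of_real (u x) * (w - z0)) ^ k /\<^sub>R fact k)) sums
     (h x * exp (- (z0 * of_real (u x))) * exp (- of_real (u x) * (w - z0)))"
    by (rule sums_mult)
   also have "(\<lambda>k. h x * exp (- (z0 * of_real (u x))) * ((- of_real (u x) * (w - z0)) ^ k /\<^sub>R fact k)) = (\<lambda>k. f k x)"
    unfolding f_def by (rule ext) (simp only: scaleR_conv_of_real power_mult_distrib, simp add: divide_inverse)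
   also have "h x * exp (- (z0 * of_real (u x))) * exp (- of_real (u x) * (w - z0)) = h x * exp (- (w * of_real (u x)))"
    by (simp add: algebra_simps flip: exp_add)
   finally show ?thesis by (simp add: sums_iff)
  qed
  moreover have "integral\<^sup>L M (f k) = (LINT x|M. h x * exp (- (z0 * of_real (u x))) * (- of_real (u x)) ^ k / fact k) * (w - z0) ^ k" for k
   unfolding f_def by (rule integral_mult_left_zero)
  ultimately show "(\<lambda>k. (LINT x|M. h x * exp (- (z0 * of_real (u x))) * (- of_real (u x)) ^ k / fact k) * (w - z0) ^ k)
    sums ?F w" by simp
 qed
 then have "?F field_differentiable at z0" if "0 < Re z0" for z0
  using that by (intro holomorphic_on_imp_differentiable_at[OF _ open_ball]) auto
 then show ?thesis
  by (auto simp: holomorphic_on_def intro: field_differentiable_at_within)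
qed

lemma has_bochner_integral_Gamma_real:
 assumes "0 < s" "0 < (a::real)"
 shows "has_bochner_integral lborel (\<lambda>x. indicator {0<..} x * (x powr (s - 1) * exp (- (a * x)))) (Gamma s * a powr (- s))"
proof (rule has_bochner_integral_nn_integral)
 have "ennreal (Gamma s) = (\<integral>\<^sup>+ t. ennreal (indicator {0..} t * t powr (s - 1) / exp t) \<partial>lborel)"
  using assms by (simp add: Gamma_conv_nn_integral_real)
 also have "\<dots> = a * (\<integral>\<^sup>+ t. ennreal (indicator {0..} (0 + a * t) * (0 + a * t) powr (s - 1) / exp (0 + a * t)) \<partial>lborel)"
  using assms by (subst nn_integral_real_affine[where c=a and t=0]) auto
 also have "\<dots> = (\<integral>\<^sup>+ t. ennreal (a powr s) * ennreal (indicator {0<..} t * (t powr (s - 1) * exp (- (a * t)))) \<partial>lborel)"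
 proof (subst nn_integral_cmult[symmetric], measurable, intro nn_integral_cong)
  fix t :: real
  have "a * (indicator {0..} (0 + a * t) * (0 + a * t) powr (s - 1) / exp (0 + a * t)) = a powr s * (indicator {0<..} t * (t powr (s - 1) * exp (- (a * t))))"
  proof (cases "0 < t")
   case True
   have "a * (a * t) powr (s - 1) = a powr s * t powr (s - 1)"
    using True assms by (simp add: powr_mult powr_mult_base)
   then show ?thesis using True assms by (simp add: exp_minus field_simps)
  next
   case False
   then show ?thesis using assms by (cases "t = 0") (auto simp: indicator_def zero_le_mult_iff)
  qed
  then show "ennreal a * ennreal (indicator {0..} (0 + a * t) * (0 + a * t) powr (s - 1) / exp (0 + a * t)) =
    ennreal (a powr s) * ennreal (indicator {0<..} t * (t powr (s - 1) * exp (- (a * t))))"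
   using assms by (subst (1 2) ennreal_mult'[symmetric]) auto
 qed
 also have "\<dots> = ennreal (a powr s) * (\<integral>\<^sup>+ t. ennreal (indicator {0<..} t * (t powr (s - 1) * exp (- (a * t)))) \<partial>lborel)"
  by (intro nn_integral_cmult) measurable
 finally have eq: "ennreal (Gamma s) = ennreal (a powr s) * (\<integral>\<^sup>+ t. ennreal (indicator {0<..} t * (t powr (s - 1) * exp (- (a * t)))) \<partial>lborel)" .
 have "ennreal (Gamma s * a powr (- s)) = ennreal (a powr (-s)) * ennreal (Gamma s)"
  using assms by (simp add: ennreal_mult Gamma_real_nonneg mult.commute)
 also have "\<dots> = ennreal (a powr (-s) * a powr s) * (\<integral>\<^sup>+ t. ennreal (indicator {0<..} t * (t powr (s - 1) * exp (- (a * t)))) \<partial>lborel)"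
  by (subst eq) (simp add: ennreal_mult mult.assoc)
 also have "a powr (-s) * a powr s = 1" using assms by (simp flip: powr_add)
 finally show "(\<integral>\<^sup>+ t. ennreal (indicator {0<..} t * (t powr (s - 1) * exp (- (a * t)))) \<partial>lborel) = ennreal (Gamma s * a powr (- s))"
  by simp
qed (use assms in \<open>auto intro!: Gamma_real_nonneg\<close>)

text \<open>The positive reals accumulate at 1, inside the half-plane, so the identity theorem
  applies. Both the Gamma integral and the Gaussian transform are continued from real parameters
  this way.\<close>

lemma eq_on_right_half_plane:
 assumes f: "f holomorphic_on {z. 0 < Re z}" and g: "g holomorphic_on {z. 0 < Re z}"
  and eq: "\<And>a::real. 0 < a \<Longrightarrow> f (of_real a) = g (of_real a)" and z: "0 < Re z"
 shows "f z = g z"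
proof -
 have "f z - g z = 0"
 proof (rule analytic_continuation[of "\<lambda>z. f z - g z" "{z. 0 < Re z}" "of_real ` {0<..}" 1])
  show "(1::complex) islimpt of_real ` {0<..}"
   unfolding islimpt_approachable
  proof (intro allI impI)
   fix e :: real assume "0 < e"
   then show "\<exists>x'\<in>of_real ` {0<..}. x' \<noteq> (1::complex) \<and> dist x' 1 < e"
    by (intro bexI[of _ "of_real (1 + e/2)"] imageI) (auto simp: dist_norm norm_divide)
  qed
  show "connected {z. 0 < Re z}" by (intro convex_connected convex_halfspace_Re_gt)
  show "open {z. 0 < Re z}" by (rule open_halfspace_Re_gt)
 qed (use assms in \<open>auto intro!: holomorphic_intros\<close>)
 then show ?thesis by simp
qed

text \<open>Both sides are holomorphic in \<open>a\<close> and agree for real \<open>a\<close>. The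
  continuation stands in for a rotation of the line of integration and is what evaluates integrals
  along rays.\<close>

lemma Gamma_integral_complex_scale:
 assumes "0 < s" "0 < Re a"
 shows "L1 (\<lambda>x. indicator {0<..} x *\<^sub>R (of_real (x powr (s - 1)) * exp (- (a * of_real x)) :: complex))" (is ?I)
  and "(LINT x|lborel. indicator {0<..} x *\<^sub>R (of_real (x powr (s - 1)) * exp (- (a * of_real x)))) = of_real (Gamma s) * a powr (- of_real s)" (is ?E)
proof -
 have R: "L1 (\<lambda>x. indicator {0<..} x * (x powr (s - 1) * exp (- (a * x))))"
  "(LINT x|lborel. indicator {0<..} x * (x powr (s - 1) * exp (- (a * x)))) = Gamma s * a powr (- s)" if "0 < a" for a
  using has_bochner_integral_Gamma_real[OF assms(1) that] by (auto simp: has_bochner_integral_iff)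
 show ?I
  by (rule lebesgue_integrable_bound[OF R(1)[OF assms(2)]])
   (auto simp: norm_mult norm_exp_eq_Re abs_mult indicator_def)
 define h where "h x = (indicator {0<..} x *\<^sub>R of_real (x powr (s - 1)) :: complex)" for x :: real
 \<comment> \<open>Truncated so that the exponent is non-negative on the whole line, as
   \<open>laplace_transform_holomorphic\<close> demands.\<close>
 define u where "u x = indicator {0<..} x * x" for x :: real
 have [measurable]: "h \<in> Borel" "u \<in> Borel"
  unfolding h_def u_def by measurable
 have e: "h x * exp (- (z * of_real (u x))) = indicator {0<..} x *\<^sub>R (of_real (x powr (s - 1)) * exp (- (z * of_real x)))" for x z
  by (auto simp: h_def u_def indicator_def)
 have "(LINT x|lborel. h x * exp (- (a * of_real (u x)))) = of_real (Gamma s) * a powr (- of_real s)"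
 proof (rule eq_on_right_half_plane[where z=a])
  show "(\<lambda>z. LINT x|lborel. h x * exp (- (z * of_real (u x)))) holomorphic_on {z. 0 < Re z}"
  proof (rule laplace_transform_holomorphic)
   show "L1 (\<lambda>x. norm (h x) * exp (- (a * u x)))" if "0 < a" for a
    by (rule lebesgue_integrable_bound[OF R(1)[OF that]]) (auto simp: h_def u_def indicator_def)
  qed (auto simp: u_def indicator_def)
  show "(\<lambda>z. of_real (Gamma s) * z powr (- of_real s)) holomorphic_on {z. 0 < Re z}"
   by (intro holomorphic_intros) (auto simp: complex_nonpos_Reals_iff)
  fix a :: real assume a: "0 < a"
  have "(LINT x|lborel. h x * exp (- (of_real a * of_real (u x)))) = (LINT x|lborel. of_real (indicator {0<..} x * (x powr (s - 1) * exp (- (a * x)))))"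
   unfolding e by (intro lebesgue_integral_cong) (auto simp: indicator_def exp_of_real[symmetric])
  also have "\<dots> = of_real (Gamma s * a powr (- s))"
   by (subst integral_complex_of_real) (simp add: R(2)[OF a])
  finally show "(LINT x|lborel. h x * exp (- (of_real a * of_real (u x)))) = of_real (Gamma s) * of_real a powr (- of_real s)"
   using a by (simp add: powr_of_real[symmetric] flip: of_real_minus)
 qed (use assms in auto)
 then show ?E unfolding e .
qed

section \<open>Fourier integrals of Borel functions and affine changes of variables\<close>

lemma borel_measurable_cis [measurable]: "cis \<in> Borel"
 by (intro borel_measurable_continuous_onI continuous_intros)

lemma scaleR_integrable_iff:
 fixes f :: "'b \<Rightarrow> 'c::{banach, second_countable_topology}"
 shows "r \<noteq> 0 \<Longrightarrow> integrable M (\<lambda>x. r *\<^sub>R f x) \<longleftrightarrow> integrable M f"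
 using integrable_scaleR_right[of "inverse r" M "\<lambda>x. r *\<^sub>R f x"] integrable_scaleR_right[of r M f] by auto

text \<open>For Borel integrands the completed measure may be replaced by \<open>lborel\<close>,
  where Tonelli and Fubini are applied.\<close>

lemma fourier_lborel:
 "f \<in> Borel \<Longrightarrow> fourier f \<xi> = (LINT x|lborel. cis (- (x \<bullet> \<xi>)) * f x)"
 unfolding fourier_def by (intro integral_completion) simp

lemma inv_fourier_lborel:
 "m \<in> Borel \<Longrightarrow>
  inv_fourier m x = (LINT \<xi>|lborel. cis (x \<bullet> \<xi>) * m \<xi>) /\<^sub>R (2 * pi) ^ DIM('a)"
 for m :: "'a::euclidean_space \<Rightarrow> complex"
 unfolding inv_fourier_def by (subst integral_completion) simp_all

lemma conv_lborel:
 "f \<in> Borel \<Longrightarrow> g \<in> Borel \<Longrightarrow>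
  conv f g x = (LINT y|lborel. f (x - y) * g y)"
 unfolding conv_def by (intro integral_completion) simp

lemma integrable_cis_mult [simp]:
 assumes "L1 f"
 shows "L1 (\<lambda>x. cis (x \<bullet> \<xi>) * f x)" "L1 (\<lambda>x. cis (- (x \<bullet> \<xi>)) * f x)"
  "L1 (\<lambda>x. cis (\<xi> \<bullet> x) * f x)" "L1 (\<lambda>x. cis (- (\<xi> \<bullet> x)) * f x)"
proof -
 have [measurable]: "f \<in> Borel" using assms by simp
 show "L1 (\<lambda>x. cis (x \<bullet> \<xi>) * f x)" "L1 (\<lambda>x. cis (- (x \<bullet> \<xi>)) * f x)"
  "L1 (\<lambda>x. cis (\<xi> \<bullet> x) * f x)" "L1 (\<lambda>x. cis (- (\<xi> \<bullet> x)) * f x)"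
  by (rule lebesgue_integrable_bound[OF assms]; simp add: norm_mult)+
qed

lemma norm_fourier_le:
 assumes "L1 f"
 shows "norm (fourier f \<xi>) \<le> L1_norm f"
proof -
 have "norm (LINT x|lborel. cis (- (x \<bullet> \<xi>)) * f x) \<le> (LINT x|lborel. norm (cis (- (x \<bullet> \<xi>)) * f x))"
  by (rule integral_norm_bound)
 then show ?thesis using assms by (simp add: fourier_lborel norm_mult borel_measurable_integrable)
qed

lemma continuous_on_fourier:
 assumes "L1 f"
 shows "continuous_on UNIV (fourier f)"
proof -
 have [measurable]: "f \<in> Borel" using assms by simp
 show ?thesis
  unfolding continuous_on_eq_continuous_within continuous_within_sequentially o_def
 proof (intro ballI allI impI)
  fix \<xi> and X :: "nat \<Rightarrow> 'a" assume X: "(\<forall>n. X n \<in> UNIV) \<and> X \<longlonglongrightarrow> \<xi>"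
  have "(\<lambda>n. LINT x|lborel. cis (- (x \<bullet> X n)) * f x) \<longlonglongrightarrow> (LINT x|lborel. cis (- (x \<bullet> \<xi>)) * f x)"
  proof (rule integral_dominated_convergence[where w="\<lambda>x. norm (f x)"])
   show "AE x in lborel. (\<lambda>n. cis (- (x \<bullet> X n)) * f x) \<longlonglongrightarrow> cis (- (x \<bullet> \<xi>)) * f x"
    using X by (intro AE_I2 tendsto_intros isCont_tendsto_compose[OF continuous_on_interior[OF continuous_on_cis[OF continuous_on_id]]]) auto
  qed (use assms in \<open>auto simp: norm_mult\<close>)
  then show "(\<lambda>n. fourier f (X n)) \<longlonglongrightarrow> fourier f \<xi>" by (simp add: fourier_lborel)
 qed
qed

lemma borel_measurable_fourier [measurable]:
 assumes "L1 f"
 shows "fourier f \<in> Borel"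
 by (intro borel_measurable_continuous_onI continuous_on_fourier assms)

lemma
 fixes f :: "'a::euclidean_space \<Rightarrow> 'b::{banach, second_countable_topology}"
 assumes [measurable]: "f \<in> Borel" and c: "c \<noteq> 0"
 shows lborel_integral_affine: "(LINT x|lborel. f x) = (\<bar>c\<bar> ^ DIM('a)) *\<^sub>R (LINT x|lborel. f (t + c *\<^sub>R x))"
  and lborel_integrable_affine_iff: "L1 (\<lambda>x. f (t + c *\<^sub>R x)) \<longleftrightarrow> L1 f"
proof -
 show "(LINT x|lborel. f x) = (\<bar>c\<bar> ^ DIM('a)) *\<^sub>R (LINT x|lborel. f (t + c *\<^sub>R x))"
  by (subst lborel_affine[OF c, of t]) (simp add: integral_density integral_distr)
 show "L1 (\<lambda>x. f (t + c *\<^sub>R x)) \<longleftrightarrow> L1 f"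
  using c by (subst (2) lborel_affine[OF c, of t]) (simp add: integrable_density integrable_distr_eq scaleR_integrable_iff)
qed

lemma nn_integral_lborel_affine:
 fixes f :: "'a::euclidean_space \<Rightarrow> ennreal"
 assumes [measurable]: "f \<in> Borel" and c: "c \<noteq> 0"
 shows "(\<integral>\<^sup>+x. f x \<partial>lborel) = ennreal (\<bar>c\<bar> ^ DIM('a)) * (\<integral>\<^sup>+x. f (t + c *\<^sub>R x) \<partial>lborel)"
 by (subst lborel_affine[OF c, of t]) (simp add: nn_integral_density nn_integral_distr nn_integral_cmult)

lemma
 fixes f :: "'a::euclidean_space \<Rightarrow> 'b::{banach, second_countable_topology}"
 assumes "f \<in> Borel"
 shows lborel_integral_translate: "(LINT x|lborel. f (x - t)) = (LINT x|lborel. f x)"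
  and lborel_integrable_translate_iff: "L1 (\<lambda>x. f (x - t)) \<longleftrightarrow> L1 f"
  and lborel_integral_reflect: "(LINT x|lborel. f (t - x)) = (LINT x|lborel. f x)"
  and lborel_integrable_reflect_iff: "L1 (\<lambda>x. f (t - x)) \<longleftrightarrow> L1 f"
 using lborel_integral_affine[OF assms, of 1 "-t"] lborel_integral_affine[OF assms, of "-1" t]
  lborel_integrable_affine_iff[OF assms, of 1 "-t"] lborel_integrable_affine_iff[OF assms, of "-1" t]
 by simp_all

lemma nn_integral_lborel_translate:
 fixes f :: "'a::euclidean_space \<Rightarrow> ennreal"
 assumes "f \<in> Borel"
 shows "(\<integral>\<^sup>+x. f (x - t) \<partial>lborel) = (\<integral>\<^sup>+x. f x \<partial>lborel)"
 using nn_integral_lborel_affine[OF assms, of 1 "-t"] by simp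

section \<open>Gaussians\<close>

context
begin

interpretation finite_product_sigma_finite "\<lambda>_. lborel :: real measure" "Basis :: 'a::euclidean_space set"
 by standard simp

lemma lborel_prod_Basis:
 fixes f :: "'a::euclidean_space \<Rightarrow> real \<Rightarrow> complex"
 assumes f: "\<And>b. b \<in> Basis \<Longrightarrow> L1 (f b)"
 shows integrable_lborel_prod_Basis: "L1 (\<lambda>x::'a. \<Prod>b\<in>Basis. f b (x \<bullet> b))"
  and integral_lborel_prod_Basis: "(LINT x|lborel. (\<Prod>b\<in>Basis. f b (x \<bullet> b))) = (\<Prod>b\<in>Basis. LINT t|lborel. f b t)"
proof -
 have [measurable]: "b \<in> Basis \<Longrightarrow> f b \<in> Borel" for b
  using f by fastforce
 show "L1 (\<lambda>x::'a. \<Prod>b\<in>Basis. f b (x \<bullet> b))"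
  using f by (subst lborel_eq) (simp add: integrable_distr_eq product_integrable_prod)
 show "(LINT x|lborel. (\<Prod>b\<in>Basis. f b (x \<bullet> b))) = (\<Prod>b\<in>Basis. LINT t|lborel. f b t)"
  using f by (subst lborel_eq) (simp add: integral_distr product_integral_prod)
qed

end

text \<open>A rescaling of the characteristic function of the standard normal distribution; the
  factor \<open>c\<close> turns x^2 / 2 into a x^2.\<close>

lemma gaussian_fourier_real:
 fixes a \<xi> :: real
 assumes a: "0 < a"
 shows "L1 (\<lambda>x. cis (- (x * \<xi>)) * exp (- (a * x\<^sup>2)))" (is ?I)
  and "(LINT x|lborel. cis (- (x * \<xi>)) * exp (- (a * x\<^sup>2))) = sqrt (pi / a) * exp (- (\<xi>\<^sup>2 / (4 * a)))" (is ?E)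
proof -
 define c where "c = sqrt (2 * a)"
 have c: "0 < c" "c\<^sup>2 = 2 * a" using a by (auto simp: c_def)
 define F where "F x = std_normal_density x *\<^sub>R cis (- (x * (\<xi> / c)))" for x
 have F: "(LINT x|lborel. F x) = exp (- (\<xi>\<^sup>2 / (4 * a)))"
 proof -
  have "char std_normal_distribution (- \<xi> / c) = (LINT x|lborel. F x)"
   unfolding char_def by (subst integral_density) (auto simp: F_def[abs_def] cis_conv_exp field_simps)
  then show ?thesis using c by (simp add: char_std_normal_distribution power_divide)
 qed
 have iF: "L1 F"
  unfolding F_def
  by (rule lebesgue_integrable_bound[of _ std_normal_density]) (auto simp: normal_density_nonneg)
 have "F (0 + c * x) = (1 / sqrt (2 * pi)) *\<^sub>R (cis (- (x * \<xi>)) * exp (- (a * x\<^sup>2)))" for x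
  using c by (simp add: F_def std_normal_density_def power_mult_distrib scaleR_conv_of_real field_simps)
 then have e: "(\<lambda>x. F (0 + c * x)) = (\<lambda>x. (1 / sqrt (2 * pi)) *\<^sub>R (cis (- (x * \<xi>)) * exp (- (a * x\<^sup>2))))"
  by blast
 have "L1 (\<lambda>x. F (0 + c * x))"
  using c iF by (intro lborel_integrable_real_affine) auto
 then show ?I
  unfolding e by (subst (asm) scaleR_integrable_iff) auto
 have "exp (- (\<xi>\<^sup>2 / (4 * a))) = (LINT x|lborel. F x)" by (simp add: F)
 also have "\<dots> = \<bar>c\<bar> *\<^sub>R (LINT x|lborel. F (0 + c * x))"
  using c by (intro lborel_integral_real_affine) auto
 also have "\<dots> = (c / sqrt (2 * pi)) *\<^sub>R (LINT x|lborel. cis (- (x * \<xi>)) * exp (- (a * x\<^sup>2)))"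
  using c unfolding e by simp
 finally have "(sqrt (2 * pi) / c) *\<^sub>R complex_of_real (exp (- (\<xi>\<^sup>2 / (4 * a)))) = (LINT x|lborel. cis (- (x * \<xi>)) * exp (- (a * x\<^sup>2)))"
  using c by simp
 moreover have "sqrt (2 * pi) / c = sqrt (pi / a)"
  by (simp add: c_def real_sqrt_divide[symmetric])
 ultimately show ?E by (simp add: scaleR_conv_of_real)
qed

lemma gaussian_fourier_euclidean:
 fixes \<xi> :: "'a::euclidean_space" and a :: real
 assumes a: "0 < a"
 shows "L1 (\<lambda>x::'a. cis (- (x \<bullet> \<xi>)) * exp (- (a * (norm x)\<^sup>2)))"
  and "(LINT x|lborel. cis (- (x \<bullet> \<xi>)) * exp (- (a * (norm x)\<^sup>2))) =
   (pi / a) powr (DIM('a) / 2) * exp (- ((norm \<xi>)\<^sup>2 / (4 * a)))"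
proof -
 define f where "f b x = cis (- (x * (\<xi> \<bullet> b))) * exp (- (a * x\<^sup>2))" for b :: 'a and x :: real
 have e: "(\<lambda>x::'a. cis (- (x \<bullet> \<xi>)) * exp (- (a * (norm x)\<^sup>2))) = (\<lambda>x. \<Prod>b\<in>Basis. f b (x \<bullet> b))"
 proof
  fix x :: 'a
  have "(\<Prod>b\<in>Basis. f b (x \<bullet> b)) = (\<Prod>b\<in>Basis. exp (\<i> * of_real (- (x \<bullet> b * (\<xi> \<bullet> b))) + of_real (- (a * (x \<bullet> b)\<^sup>2))))"
   by (simp only: f_def cis_conv_exp exp_add exp_of_real)
  also have "\<dots> = exp (\<Sum>b\<in>Basis. \<i> * of_real (- (x \<bullet> b * (\<xi> \<bullet> b))) + of_real (- (a * (x \<bullet> b)\<^sup>2)))"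
   by (rule exp_sum[symmetric]) simp
  also have "(\<Sum>b\<in>Basis. \<i> * of_real (- (x \<bullet> b * (\<xi> \<bullet> b))) + of_real (- (a * (x \<bullet> b)\<^sup>2))) =
    \<i> * of_real (- (\<Sum>b\<in>Basis. x \<bullet> b * (\<xi> \<bullet> b))) + of_real (- (a * (\<Sum>b\<in>Basis. (x \<bullet> b)\<^sup>2)))"
   by (simp add: sum.distrib sum_distrib_left sum_negf sum_subtractf)
  also have "(\<Sum>b\<in>Basis. x \<bullet> b * (\<xi> \<bullet> b)) = x \<bullet> \<xi>" by (rule euclidean_inner[symmetric])
  also have "(\<Sum>b\<in>Basis. (x \<bullet> b)\<^sup>2) = (norm x)\<^sup>2"
   by (subst power2_norm_eq_inner, subst euclidean_inner) (simp add: power2_eq_square)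
  also have "exp (\<i> * of_real (- (x \<bullet> \<xi>)) + of_real (- (a * (norm x)\<^sup>2))) = cis (- (x \<bullet> \<xi>)) * exp (- (a * (norm x)\<^sup>2))"
   by (simp only: exp_add cis_conv_exp exp_of_real)
  finally show "cis (- (x \<bullet> \<xi>)) * exp (- (a * (norm x)\<^sup>2)) = (\<Prod>b\<in>Basis. f b (x \<bullet> b))" by simp
 qed
 note f = gaussian_fourier_real[OF a, folded f_def]
 have fi: "L1 (f b)" for b unfolding f_def by (rule gaussian_fourier_real[OF a])
 show "L1 (\<lambda>x::'a. cis (- (x \<bullet> \<xi>)) * exp (- (a * (norm x)\<^sup>2)))"
  unfolding e by (intro integrable_lborel_prod_Basis fi)
 have "(LINT x|lborel. cis (- (x \<bullet> \<xi>)) * exp (- (a * (norm x)\<^sup>2))) = (\<Prod>b\<in>Basis. LINT t|lborel. f b t)"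
  unfolding e by (intro integral_lborel_prod_Basis fi)
 also have "\<dots> = (\<Prod>b\<in>Basis. of_real (sqrt (pi / a) * exp (- ((\<xi> \<bullet> b)\<^sup>2 / (4 * a)))))"
  unfolding f_def gaussian_fourier_real(2)[OF a] by simp
 also have "\<dots> = of_real (sqrt (pi / a) ^ DIM('a) * (\<Prod>b\<in>Basis. exp (- ((\<xi> \<bullet> b)\<^sup>2 / (4 * a)))))"
  by (simp add: prod.distrib)
 also have "(\<Prod>b\<in>Basis. exp (- ((\<xi> \<bullet> b)\<^sup>2 / (4 * a)))) = exp (- ((norm \<xi>)\<^sup>2 / (4 * a)))"
  unfolding power2_norm_eq_inner euclidean_inner[of \<xi> \<xi>]
  by (simp add: exp_sum[symmetric] sum_negf sum_divide_distrib power2_eq_square)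
 also have "sqrt (pi / a) ^ DIM('a) = (pi / a) powr (DIM('a) / 2)"
  using a by (simp add: powr_half_sqrt[symmetric] powr_powr flip: powr_realpow)
 finally show "(LINT x|lborel. cis (- (x \<bullet> \<xi>)) * exp (- (a * (norm x)\<^sup>2))) =
   (pi / a) powr (DIM('a) / 2) * exp (- ((norm \<xi>)\<^sup>2 / (4 * a)))" by simp
qed

lemma integrable_gaussian:
 fixes a :: real
 assumes "0 < a"
 shows "L1 (\<lambda>x::'a::euclidean_space. exp (- (a * (norm x)\<^sup>2)))"
  and "(LINT x|lborel. exp (- (a * (norm (x::'a))\<^sup>2))) = (pi / a) powr (DIM('a) / 2)"
proof -
 have e: "cis (- (x \<bullet> 0)) * exp (- (a * (norm x)\<^sup>2)) = of_real (exp (- (a * (norm x)\<^sup>2)))" for x :: 'a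
  by (simp add: exp_of_real)
 note * = gaussian_fourier_euclidean[OF assms, of "0 :: 'a", unfolded e]
 show "L1 (\<lambda>x::'a. exp (- (a * (norm x)\<^sup>2)))"
  using *(1) by (simp only: complex_of_real_integrable_eq)
 from *(2) have "complex_of_real (LINT x|lborel. exp (- (a * (norm (x::'a))\<^sup>2))) = of_real ((pi / a) powr (DIM('a) / 2))"
  by (simp flip: integral_complex_of_real)
 then show "(LINT x|lborel. exp (- (a * (norm (x::'a))\<^sup>2))) = (pi / a) powr (DIM('a) / 2)"
  unfolding of_real_eq_iff .
qed

text \<open>The Gaussian kernel of the heat semigroup, continued to complex time \<open>w\<close> in
  the right half-plane; the power is the principal branch.\<close>

definition heat_kernel :: "complex \<Rightarrow> 'a::euclidean_space \<Rightarrow> complex" where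
 "heat_kernel w x = (4 * of_real pi * w) powr (- of_nat DIM('a) / 2) * exp (- (of_real ((norm x)\<^sup>2) / (4 * w)))"

lemma borel_measurable_heat_kernel [measurable (raw)]:
 assumes [measurable]: "f \<in> borel_measurable M" "g \<in> borel_measurable M"
 shows "(\<lambda>x. heat_kernel (f x) (g x)) \<in> borel_measurable M"
 unfolding heat_kernel_def powr_def by measurable

lemma Re_inverse_quarter: "Re (1 / (4 * w)) = Re w / (4 * (norm w)\<^sup>2)"
proof -
 have d: "(Re (4 * w))\<^sup>2 + (Im (4 * w))\<^sup>2 = 4 * (4 * (norm w)\<^sup>2)"
  by (simp add: cmod_power2 power_mult_distrib)
 have "Re (1 / (4 * w)) = Re (4 * w) / ((Re (4 * w))\<^sup>2 + (Im (4 * w))\<^sup>2)"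
  by (simp add: Re_divide)
 then show ?thesis unfolding d by simp
qed

lemma norm_heat_kernel:
 "norm (heat_kernel w (x::'a::euclidean_space)) = (4 * pi * norm w) powr (- real DIM('a) / 2) * exp (- (Re w / (4 * (norm w)\<^sup>2) * (norm x)\<^sup>2))"
proof -
 have "of_real ((norm x)\<^sup>2) / (4 * w) = of_real ((norm x)\<^sup>2) * (1 / (4 * w))" by simp
 then have "Re (of_real ((norm x)\<^sup>2) / (4 * w)) = (norm x)\<^sup>2 * Re (1 / (4 * w))"
  by (simp only: times_complex.sel Re_complex_of_real Im_complex_of_real mult_zero_left diff_zero)
 then have "Re (of_real ((norm x)\<^sup>2) / (4 * w)) = Re w / (4 * (norm w)\<^sup>2) * (norm x)\<^sup>2"
  unfolding Re_inverse_quarter by (simp only: mult.commute)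
 moreover have "norm ((4 * of_real pi * w) powr (- of_nat DIM('a) / 2)) = (4 * pi * norm w) powr (- real DIM('a) / 2)"
  by (subst norm_powr_real_powr') (auto simp: norm_mult)
 ultimately show ?thesis
  by (simp only: heat_kernel_def norm_mult norm_exp_eq_Re uminus_complex.sel)
qed

text \<open>The L1 norm depends on the argument of \<open>w\<close> alone, so along a fixed ray a
  superposition of these kernels is controlled by the total mass of its density.\<close>

lemma
 assumes w: "0 < Re w"
 shows integrable_heat_kernel: "L1 (heat_kernel w :: 'a::euclidean_space \<Rightarrow> complex)"
  and integral_norm_heat_kernel: "(LINT x|lborel. norm (heat_kernel w (x::'a))) = (norm w / Re w) powr (DIM('a) / 2)"
proof -
 have nw: "0 < norm w" using w by auto
 have c: "0 < Re w / (4 * (norm w)\<^sup>2)" using w nw by (intro divide_pos_pos) auto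
 note g = integrable_gaussian[OF c, where 'a='a]
 show "L1 (heat_kernel w :: 'a \<Rightarrow> complex)"
 proof (subst integrable_norm_iff[symmetric])
  show "L1 (\<lambda>x::'a. norm (heat_kernel w x))"
   unfolding norm_heat_kernel using g(1) by (intro integrable_mult_right)
 qed measurable
 have "(LINT x|lborel. norm (heat_kernel w (x::'a))) = (4 * pi * norm w) powr (- real DIM('a) / 2) * (pi / (Re w / (4 * (norm w)\<^sup>2))) powr (DIM('a) / 2)"
  unfolding norm_heat_kernel integral_mult_right_zero g(2) ..
 also have "\<dots> = ((pi / (Re w / (4 * (norm w)\<^sup>2))) / (4 * pi * norm w)) powr (DIM('a) / 2)"
  using w nw by (subst powr_divide) (auto simp: powr_minus field_simps)
 also have "(pi / (Re w / (4 * (norm w)\<^sup>2))) / (4 * pi * norm w) = norm w / Re w"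
  using nw w by (simp add: field_simps power2_eq_square)
 finally show "(LINT x|lborel. norm (heat_kernel w (x::'a))) = (norm w / Re w) powr (DIM('a) / 2)" .
qed

lemma gaussian_fourier_complex:
 fixes \<xi> :: "'a::euclidean_space"
 assumes z: "0 < Re z"
 shows "(LINT x|lborel. cis (- (x \<bullet> \<xi>)) * exp (- (z * of_real ((norm x)\<^sup>2)))) =
  (of_real pi / z) powr (of_nat DIM('a) / 2) * exp (- (of_real ((norm \<xi>)\<^sup>2) / (4 * z)))"
proof (rule eq_on_right_half_plane[OF _ _ _ z])
 show "(\<lambda>z. LINT x|lborel. cis (- (x \<bullet> \<xi>)) * exp (- (z * of_real ((norm x)\<^sup>2)))) holomorphic_on {z. 0 < Re z}"
 proof (rule laplace_transform_holomorphic)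
  show "L1 (\<lambda>x. norm (cis (- (x \<bullet> \<xi>))) * exp (- (a * (norm x)\<^sup>2)))" if "0 < a" for a
   using integrable_gaussian(1)[OF that, where 'a='a] by simp
 qed auto
 show "(\<lambda>z. (of_real pi / z) powr (of_nat DIM('a) / 2) * exp (- (of_real ((norm \<xi>)\<^sup>2) / (4 * z)))) holomorphic_on {z. 0 < Re z}"
 proof (intro holomorphic_intros)
  fix z :: complex assume "z \<in> {z. 0 < Re z}"
  then have "0 < Re (of_real pi / z)" by (auto simp: Re_divide intro!: divide_pos_pos add_pos_nonneg)
  then show "of_real pi / z \<notin> \<real>\<^sub>\<le>\<^sub>0" by (auto simp: complex_nonpos_Reals_iff)
 qed auto
 fix a :: real assume a: "0 < a"
 have "complex_of_real pi / of_real a = of_real (pi / a)" by simp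
 moreover have "(of_nat DIM('a) / 2 :: complex) = of_real (real DIM('a) / 2)" by simp
 ultimately have "(complex_of_real pi / of_real a) powr (of_nat DIM('a) / 2) = of_real ((pi / a) powr (DIM('a) / 2))"
  using a powr_of_real[of "pi / a" "DIM('a) / 2"] by simp
 moreover have "cis (- (x \<bullet> \<xi>)) * exp (- (of_real a * of_real ((norm x)\<^sup>2))) = cis (- (x \<bullet> \<xi>)) * exp (- (a * (norm x)\<^sup>2))" for x
  by (simp add: exp_of_real[symmetric])
 ultimately show "(LINT x|lborel. cis (- (x \<bullet> \<xi>)) * exp (- (of_real a * of_real ((norm x)\<^sup>2)))) =
  (of_real pi / of_real a) powr (of_nat DIM('a) / 2) * exp (- (of_real ((norm \<xi>)\<^sup>2) / (4 * of_real a)))"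
  by (simp only: gaussian_fourier_euclidean(2)[OF a]) (simp add: exp_of_real[symmetric])
qed

lemma fourier_heat_kernel:
 fixes \<xi> :: "'a::euclidean_space"
 assumes w: "0 < Re w"
 shows "fourier (heat_kernel w) \<xi> = exp (- (w * of_real ((norm \<xi>)\<^sup>2)))"
proof -
 have w0: "w \<noteq> 0" using w by auto
 have r: "0 < Re (1 / (4 * w))" using w w0 by (simp add: Re_inverse_quarter)
 have "fourier (heat_kernel w) \<xi> = (4 * of_real pi * w) powr (- of_nat DIM('a) / 2) * (LINT x|lborel. cis (- (x \<bullet> \<xi>)) * exp (- (1 / (4 * w) * of_real ((norm x)\<^sup>2))))"
  by (subst fourier_lborel) (auto simp: heat_kernel_def mult_ac simp flip: integral_mult_right_zero)
 also have "\<dots> = (4 * of_real pi * w) powr (- of_nat DIM('a) / 2) * (of_real pi / (1 / (4 * w))) powr (of_nat DIM('a) / 2) * exp (- (of_real ((norm \<xi>)\<^sup>2) / (4 * (1 / (4 * w)))))"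
  by (subst gaussian_fourier_complex[OF r]) (simp add: mult.assoc)
 also have "of_real pi / (1 / (4 * w)) = 4 * of_real pi * w" by simp
 also have "(4 * of_real pi * w) powr (- of_nat DIM('a) / 2) * (4 * of_real pi * w) powr (of_nat DIM('a) / 2) = 1"
  using w0 by (simp flip: powr_add)
 finally show ?thesis using w0 by (simp add: mult.commute)
qed

section \<open>Convolution\<close>

lemma
 fixes f g :: "'a::euclidean_space \<Rightarrow> complex"
 assumes f: "L1 f" and g: "L1 g"
 shows integrable_conv_pair: "integrable (lborel \<Otimes>\<^sub>M lborel) (\<lambda>(x, y). f (x - y) * g y)"
  and integrable_conv: "L1 (conv f g)"
  and AE_integrable_conv: "AE x in lborel. L1 (\<lambda>y. f (x - y) * g y)"
  and norm_conv_L1_le: "L1_norm (conv f g) \<le> L1_norm f * L1_norm g"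
  and fourier_conv: "fourier (conv f g) \<xi> = fourier f \<xi> * fourier g \<xi>"
proof -
 have [measurable]: "f \<in> Borel" "g \<in> Borel" using f g by auto
 have fy: "L1 (\<lambda>x. f (x - y))" for y
  using f by (subst lborel_integrable_translate_iff) auto
 have nf: "(LINT x|lborel. norm (f (x - y))) = L1_norm f" for y
  by (subst lborel_integral_translate[of "\<lambda>x. norm (f x)"]) auto
 have yx: "integrable (lborel \<Otimes>\<^sub>M lborel) (\<lambda>(y, x). f (x - y) * g y)"
 proof (rule lborel_pair.Fubini_integrable)
  show "L1 (\<lambda>y. LINT x|lborel. norm (case (y, x) of (y, x) \<Rightarrow> f (x - y) * g y))"
   using g by (simp add: norm_mult nf)
  show "AE y in lborel. L1 (\<lambda>x. case (y, x) of (y, x) \<Rightarrow> f (x - y) * g y)"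
   using fy by auto
 qed measurable
 show xy: "integrable (lborel \<Otimes>\<^sub>M lborel) (\<lambda>(x, y). f (x - y) * g y)"
  using lborel_pair.integrable_product_swap[OF yx] by (simp add: split_beta')
 have c: "conv f g = (\<lambda>x. LINT y|lborel. f (x - y) * g y)"
  by (rule ext, rule conv_lborel) auto
 show conv: "L1 (conv f g)"
  using lborel_pair.integrable_fst'[OF xy] unfolding c by simp
 show "AE x in lborel. L1 (\<lambda>y. f (x - y) * g y)"
  using lborel_pair.AE_integrable_fst'[OF xy] by simp
 have nxy: "integrable (lborel \<Otimes>\<^sub>M lborel) (\<lambda>(x, y). norm (f (x - y) * g y))"
  using integrable_norm[OF xy] by (simp add: split_beta')
 have "L1_norm (conv f g) \<le> (LINT x|lborel. LINT y|lborel. norm (f (x - y) * g y))"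
  using conv lborel_pair.integrable_fst'[OF nxy] unfolding c
  by (intro integral_mono integral_norm_bound) auto
 also have "\<dots> = (LINT y|lborel. LINT x|lborel. norm (f (x - y) * g y))"
  using lborel_pair.Fubini_integral[OF nxy] by simp
 also have "\<dots> = L1_norm f * L1_norm g"
  by (simp add: norm_mult nf)
 finally show "L1_norm (conv f g) \<le> L1_norm f * L1_norm g" .
 have cxy: "integrable (lborel \<Otimes>\<^sub>M lborel) (\<lambda>(x, y). cis (- (x \<bullet> \<xi>)) * (f (x - y) * g y))"
  by (rule lebesgue_integrable_bound[OF xy]) (auto simp: norm_mult split_beta')
 have "fourier (conv f g) \<xi> = (LINT x|lborel. LINT y|lborel. cis (- (x \<bullet> \<xi>)) * (f (x - y) * g y))"
  using conv unfolding c by (subst fourier_lborel) auto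
 also have "\<dots> = (LINT y|lborel. LINT x|lborel. cis (- (x \<bullet> \<xi>)) * (f (x - y) * g y))"
  using lborel_pair.Fubini_integral[OF cxy] by simp
 also have "\<dots> = (LINT y|lborel. fourier f \<xi> * (cis (- (y \<bullet> \<xi>)) * g y))"
 proof (intro lebesgue_integral_cong refl)
  fix y
  have "(LINT x|lborel. cis (- (x \<bullet> \<xi>)) * (f (x - y) * g y)) = (LINT x|lborel. cis (- (y \<bullet> \<xi>)) * g y * (cis (- ((x - y) \<bullet> \<xi>)) * f (x - y)))"
   by (intro lebesgue_integral_cong) (auto simp: inner_diff_left cis_mult)
  also have "\<dots> = cis (- (y \<bullet> \<xi>)) * g y * (LINT x|lborel. cis (- ((x - y) \<bullet> \<xi>)) * f (x - y))"
   by simp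
  also have "(LINT x|lborel. cis (- ((x - y) \<bullet> \<xi>)) * f (x - y)) = fourier f \<xi>"
   by (subst lborel_integral_translate[of "\<lambda>x. cis (- (x \<bullet> \<xi>)) * f x"]) (auto simp: fourier_lborel)
  finally show "(LINT x|lborel. cis (- (x \<bullet> \<xi>)) * (f (x - y) * g y)) = fourier f \<xi> * (cis (- (y \<bullet> \<xi>)) * g y)"
   by simp
 qed
 also have "\<dots> = fourier f \<xi> * fourier g \<xi>" by (simp add: fourier_lborel)
 finally show "fourier (conv f g) \<xi> = fourier f \<xi> * fourier g \<xi>" .
qed

text \<open>Convexity in disguise: rearranged, it says that x^p lies above its tangent at
  \<open>c\<close>. Young's inequality with exponents p and p / (p - 1) gives it, including the case
  c = 0.\<close>

lemma powr_tangent_le: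
 fixes x c p :: real
 assumes "0 \<le> x" "0 \<le> c" "1 < p"
 shows "p * c powr (p - 1) * x \<le> x powr p + (p - 1) * c powr p"
proof -
 have "x * c powr (p - 1) \<le> x powr p / p + (c powr (p - 1)) powr (p / (p - 1)) / (p / (p - 1))"
  using assms by (intro Youngs_inequality) (auto simp: field_simps)
 also have "(c powr (p - 1)) powr (p / (p - 1)) = c powr p"
  using assms by (simp add: powr_powr)
 finally show ?thesis using assms by (simp add: field_simps)
qed

text \<open>The tangent inequality at c = I / A is integrated against \<open>w\<close>. With this
  \<open>c\<close> the main terms combine to c^p A = I^p / A^(p - 1). The mass of \<open>w\<close>
  enters only in a subtracted term, so it may be replaced by any upper bound
  \<open>A\<close>.\<close>

lemma weighted_jensen_powr:
 fixes w \<phi> :: "'b \<Rightarrow> real"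
 assumes w: "integrable M w" and w\<phi>: "integrable M (\<lambda>x. w x * \<phi> x)"
  and [measurable]: "\<phi> \<in> borel_measurable M"
  and nn: "\<And>x. 0 \<le> w x" "\<And>x. 0 \<le> \<phi> x" and A: "(LINT x|M. w x) \<le> A" "0 < A" and p: "1 < p"
 shows "ennreal ((LINT x|M. w x * \<phi> x) powr p) \<le> ennreal (A powr (p - 1)) * (\<integral>\<^sup>+x. ennreal (w x * \<phi> x powr p) \<partial>M)"
proof (cases "(\<integral>\<^sup>+x. ennreal (w x * \<phi> x powr p) \<partial>M) = \<infinity>")
 case True
 then show ?thesis using A by (simp add: ennreal_mult_top)
next
 case False
 have [measurable]: "w \<in> borel_measurable M" using w by auto
 have i: "integrable M (\<lambda>x. w x * \<phi> x powr p)"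
  using False nn by (intro integrableI_nonneg) (auto simp: less_top)
 define I where "I = (LINT x|M. w x * \<phi> x)"
 define c where "c = I / A"
 have I: "0 \<le> I" unfolding I_def using nn by (intro integral_nonneg_AE) auto
 have c: "0 \<le> c" using I A by (simp add: c_def)
 have "p * c powr (p - 1) * I - (p - 1) * c powr p * A \<le> p * c powr (p - 1) * I - (p - 1) * c powr p * (LINT x|M. w x)"
  using A p by (intro diff_left_mono mult_left_mono) auto
 also have "\<dots> = (LINT x|M. p * c powr (p - 1) * (w x * \<phi> x) - (p - 1) * c powr p * w x)"
  using w w\<phi> by (simp add: I_def)
 also have "\<dots> \<le> (LINT x|M. w x * \<phi> x powr p)"
 proof (rule integral_mono)
  fix x
  have "w x * (p * c powr (p - 1) * \<phi> x) \<le> w x * (\<phi> x powr p + (p - 1) * c powr p)"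
   by (intro mult_left_mono powr_tangent_le nn c p)
  then show "p * c powr (p - 1) * (w x * \<phi> x) - (p - 1) * c powr p * w x \<le> w x * \<phi> x powr p"
   by (simp add: algebra_simps)
 qed (use w w\<phi> i in auto)
 finally have le: "p * c powr (p - 1) * I - (p - 1) * c powr p * A \<le> (LINT x|M. w x * \<phi> x powr p)" .
 have "c powr (p - 1) * I = c powr p * A"
 proof (cases "c = 0")
  case False
  then have "c powr p = c powr (p - 1) * c" using c by (simp add: powr_diff)
  then show ?thesis using A by (simp add: c_def)
 qed (use p in auto)
 then have "p * c powr (p - 1) * I - (p - 1) * c powr p * A = c powr p * A" by (simp add: algebra_simps)
 then have "A powr (p - 1) * (c powr p * A) \<le> A powr (p - 1) * (LINT x|M. w x * \<phi> x powr p)"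
  using le by (intro mult_left_mono) auto
 also have "A powr (p - 1) * (c powr p * A) = I powr p"
  using A I by (simp add: c_def powr_divide powr_diff)
 finally have "ennreal (I powr p) \<le> ennreal (A powr (p - 1)) * ennreal (LINT x|M. w x * \<phi> x powr p)"
  by (subst ennreal_mult'[symmetric]) (auto intro!: ennreal_leI integral_nonneg_AE nn mult_nonneg_nonneg)
 also have "ennreal (LINT x|M. w x * \<phi> x powr p) = (\<integral>\<^sup>+x. ennreal (w x * \<phi> x powr p) \<partial>M)"
  using nn by (intro nn_integral_eq_integral[symmetric] i) auto
 finally show ?thesis unfolding I_def .
qed

lemma weighted_jensen_sum_powr:
 fixes w \<phi> :: "'b \<Rightarrow> real"
 assumes "finite S" "\<And>x. 0 \<le> w x" "\<And>x. 0 \<le> \<phi> x" "(\<Sum>x\<in>S. w x) \<le> A" "0 < A" "1 < p"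
 shows "(\<Sum>x\<in>S. w x * \<phi> x) powr p \<le> A powr (p - 1) * (\<Sum>x\<in>S. w x * \<phi> x powr p)"
proof -
 have "ennreal ((\<Sum>x\<in>S. w x * \<phi> x) powr p) \<le> ennreal (A powr (p - 1)) * (\<Sum>x\<in>S. ennreal (w x * \<phi> x powr p))"
  using weighted_jensen_powr[of "count_space S" w \<phi> A p] assms
  by (simp add: lebesgue_integral_count_space_finite nn_integral_count_space_finite integrable_count_space)
 also have "\<dots> = ennreal (A powr (p - 1) * (\<Sum>x\<in>S. w x * \<phi> x powr p))"
  using assms by (simp add: sum_nonneg ennreal_mult' flip: sum_ennreal)
 finally show ?thesis using assms by (simp add: sum_nonneg)
qed

text \<open>Jensen with the weight |f(x - y)| at almost every x, where the convolution converges
  absolutely, then Tonelli; the factors A^(p - 1) and A combine to A^p.\<close>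

lemma young_convolution:
 fixes f g :: "'a::euclidean_space \<Rightarrow> complex"
 assumes f: "L1 f" and g: "L1 g" and p: "1 < p"
  and A: "L1_norm f \<le> A" "0 < A"
 shows "Lp_integral p (conv f g) \<le>
  ennreal (A powr p) * Lp_integral p g"
proof -
 have [measurable]: "f \<in> Borel" "g \<in> Borel" using f g by auto
 have "AE x in lborel. ennreal (norm (conv f g x) powr p) \<le>
   ennreal (A powr (p - 1)) * (\<integral>\<^sup>+y. ennreal (norm (f (x - y)) * norm (g y) powr p) \<partial>lborel)"
  using AE_integrable_conv[OF f g]
 proof eventually_elim
  case (elim x)
  have fx: "L1 (\<lambda>y. norm (f (x - y)))"
   using f by (intro integrable_norm) (simp add: lborel_integrable_reflect_iff)
  have Ax: "(LINT y|lborel. norm (f (x - y))) \<le> A"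
   using A by (subst lborel_integral_reflect[of "\<lambda>x. norm (f x)"]) auto
  have "norm (conv f g x) \<le> (LINT y|lborel. norm (f (x - y)) * norm (g y))"
   by (subst conv_lborel) (auto simp: norm_mult[symmetric] intro!: integral_norm_bound)
  then have "ennreal (norm (conv f g x) powr p) \<le> ennreal ((LINT y|lborel. norm (f (x - y)) * norm (g y)) powr p)"
   using p by (intro ennreal_leI powr_mono2) auto
  also have "\<dots> \<le> ennreal (A powr (p - 1)) * (\<integral>\<^sup>+y. ennreal (norm (f (x - y)) * norm (g y) powr p) \<partial>lborel)"
   using integrable_norm[OF elim] fx Ax A p by (intro weighted_jensen_powr) (auto simp: norm_mult)
  finally show ?case .
 qed
 then have "Lp_integral p (conv f g) \<le>
   (\<integral>\<^sup>+x. ennreal (A powr (p - 1)) * (\<integral>\<^sup>+y. ennreal (norm (f (x - y)) * norm (g y) powr p) \<partial>lborel) \<partial>lborel)"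
  by (rule nn_integral_mono_AE)
 also have "\<dots> = ennreal (A powr (p - 1)) * (\<integral>\<^sup>+x. (\<integral>\<^sup>+y. ennreal (norm (f (x - y)) * norm (g y) powr p) \<partial>lborel) \<partial>lborel)"
  by (intro nn_integral_cmult) measurable
 also have "(\<integral>\<^sup>+x. (\<integral>\<^sup>+y. ennreal (norm (f (x - y)) * norm (g y) powr p) \<partial>lborel) \<partial>lborel) =
   (\<integral>\<^sup>+y. (\<integral>\<^sup>+x. ennreal (norm (f (x - y)) * norm (g y) powr p) \<partial>lborel) \<partial>lborel)"
  by (intro lborel_pair.Fubini') measurable
 also have "\<dots> = (\<integral>\<^sup>+y. ennreal (L1_norm f) * ennreal (norm (g y) powr p) \<partial>lborel)"
 proof (intro nn_integral_cong)
  fix y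
  have "(\<integral>\<^sup>+x. ennreal (norm (f (x - y)) * norm (g y) powr p) \<partial>lborel) = (\<integral>\<^sup>+x. ennreal (norm (f (x - y))) \<partial>lborel) * ennreal (norm (g y) powr p)"
   by (subst nn_integral_multc[symmetric]) (auto simp: ennreal_mult)
  also have "(\<integral>\<^sup>+x. ennreal (norm (f (x - y))) \<partial>lborel) = (\<integral>\<^sup>+x. ennreal (norm (f x)) \<partial>lborel)"
   by (rule nn_integral_lborel_translate[of "\<lambda>x. ennreal (norm (f x))"]) measurable
  also have "\<dots> = ennreal (L1_norm f)"
   using f by (intro nn_integral_eq_integral) auto
  finally show "(\<integral>\<^sup>+x. ennreal (norm (f (x - y)) * norm (g y) powr p) \<partial>lborel) = ennreal (L1_norm f) * ennreal (norm (g y) powr p)" .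
 qed
 also have "\<dots> = ennreal (L1_norm f) * Lp_integral p g"
  by (intro nn_integral_cmult) measurable
 also have "\<dots> \<le> ennreal A * Lp_integral p g"
  using A by (intro mult_right_mono ennreal_leI) auto
 also have "ennreal (A powr (p - 1)) * (ennreal A * (Lp_integral p g)) =
   ennreal (A powr p) * Lp_integral p g"
  using A by (simp add: mult.assoc[symmetric] ennreal_mult[symmetric] powr_diff)
 finally show ?thesis by (simp add: mult_left_mono)
qed

section \<open>Fourier inversion\<close>

text \<open>Boxes are stable under intersection and generate the Borel sets, so by Dynkin's argument
  all set integrals of \<open>h\<close>, cut off to a large box, vanish. The cut-off makes the
  integrals finite, and exhausting the space by boxes removes it.\<close>

lemma AE_zero_if_box_integrals_zero:
 fixes h :: "'a::euclidean_space \<Rightarrow> complex"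
 assumes i: "\<And>a b. set_integrable lborel (box a b) h"
  and z: "\<And>a b. (LINT x:box a b|lborel. h x) = 0"
 shows "AE x in lborel. h x = 0"
proof -
 have "AE x in lborel. indicator (box (- (real n *\<^sub>R One)) (real n *\<^sub>R One)) x *\<^sub>R h x = 0" for n
 proof (rule sigma_finite_measure.density_zero[OF sigma_finite_lborel])
  let ?B = "box (- (real n *\<^sub>R One)) (real n *\<^sub>R One) :: 'a set"
  show iB: "L1 (\<lambda>x. indicator ?B x *\<^sub>R h x)"
   using i by (simp add: set_integrable_def)
  define g where "g = (\<lambda>x. indicator ?B x *\<^sub>R h x)"
  have ig: "set_integrable lborel A g" if "A \<in> sets borel" for A
   using iB[folded g_def] that unfolding set_integrable_def by (intro integrable_mult_indicator) auto
  fix A :: "'a set" assume "A \<in> sets lborel"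
  then have A: "A \<in> sigma_sets UNIV (range (\<lambda>(a, b). box a b))"
   using borel_eq_box by (metis (no_types, lifting) sets_lborel sets_measure_of subset_UNIV Pow_UNIV)
  have sb: "A \<in> sets borel" if "A \<in> sigma_sets UNIV (range (\<lambda>(a, b). box a b :: 'a set))" for A
   using that by (subst borel_eq_box) simp
  have "Int_stable (range (\<lambda>(a, b). box a b :: 'a set))"
   by (auto simp: Int_stable_def box_Int_box)
  moreover have "range (\<lambda>(a, b). box a b :: 'a set) \<subseteq> Pow UNIV" by simp
  ultimately have "(LINT x:A|lborel. g x) = 0"
   using A
  proof (induction rule: sigma_sets_induct_disjoint)
   case (basic A)
   then obtain a b where "A = box a b" by auto
   moreover have "\<exists>c d. box a b \<inter> ?B = box c d" unfolding box_Int_box by blast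
   then obtain c d where "box a b \<inter> ?B = box c d" by blast
   moreover have "indicator A x *\<^sub>R g x = indicator (A \<inter> ?B) x *\<^sub>R h x" for x
    by (auto simp: g_def indicator_def)
   ultimately show ?case using z[of c d] by (simp add: set_lebesgue_integral_def)
  next
   case empty
   then show ?case by (simp add: set_lebesgue_integral_def)
  next
   case (compl A)
   have "(LINT x:UNIV - A|lborel. g x) = (LINT x:UNIV|lborel. g x) - (LINT x:A|lborel. g x)"
   proof -
    have "(LINT x:A \<union> (UNIV - A)|lborel. g x) = (LINT x:A|lborel. g x) + (LINT x:UNIV - A|lborel. g x)"
     using sb[OF compl(1)] by (intro set_integral_Un ig) auto
    then show ?thesis by simp
   qed
   moreover have "(LINT x:UNIV|lborel. g x) = 0"
    using z by (simp add: set_lebesgue_integral_def g_def)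
   ultimately show ?case using compl by simp
  next
   case (union A)
   have m: "A i \<in> sets borel" for i using union(2) sb by blast
   have "(LINT x:(\<Union>i. A i)|lborel. g x) = (\<Sum>i. (LINT x:(A i)|lborel. g x))"
    using union(1) m by (intro lebesgue_integral_countable_add ig) (auto simp: disjoint_family_on_def)
   then show ?case using union by simp
  qed
  then show "(LINT x:A|lborel. indicator ?B x *\<^sub>R h x) = 0" unfolding g_def .
 qed
 then have "AE x in lborel. \<forall>n. indicator (box (- (real n *\<^sub>R One)) (real n *\<^sub>R One)) x *\<^sub>R h x = 0"
  by (subst AE_all_countable) blast
 then show ?thesis
 proof eventually_elim
  case (elim x)
  have "x \<in> (\<Union>i::nat. box (- (real i *\<^sub>R One)) (real i *\<^sub>R One))" by (simp add: UN_box_eq_UNIV)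
  then obtain n where "x \<in> box (- (real n *\<^sub>R One)) (real n *\<^sub>R One)" by blast
  then show ?case using elim[rule_format, of n] by simp
 qed
qed

lemma inverse_gaussian:
 fixes z :: "'a::euclidean_space"
 assumes e: "0 < (e::real)"
 shows "(LINT \<xi>|lborel. cis (z \<bullet> \<xi>) * exp (- (e * (norm \<xi>)\<^sup>2))) /\<^sub>R (2 * pi) ^ DIM('a) = heat_kernel (of_real e) z"
proof -
 have h1: "(LINT \<xi>|lborel. cis (z \<bullet> \<xi>) * exp (- (e * (norm \<xi>)\<^sup>2))) = (pi / e) powr (DIM('a) / 2) * exp (- ((norm z)\<^sup>2 / (4 * e)))"
  using gaussian_fourier_euclidean(2)[OF e, of "-z"] by (simp add: inner_commute)
 have h2: "(4 * of_real pi * complex_of_real e) powr (- of_nat DIM('a) / 2) = of_real ((4 * pi * e) powr (- real DIM('a) / 2))"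
  using powr_of_real[of "4 * pi * e" "- real DIM('a) / 2"] e by simp
 have h3: "(pi / e) powr (DIM('a) / 2) / (2 * pi) ^ DIM('a) = (4 * pi * e) powr (- real DIM('a) / 2)"
 proof -
  have "(2 * pi) ^ DIM('a) = ((2 * pi)\<^sup>2) powr (DIM('a) / 2)"
  proof -
   have "((2 * pi)\<^sup>2) powr (DIM('a) / 2) = ((2 * pi) powr 2) powr (DIM('a) / 2)" by simp
   also have "\<dots> = (2 * pi) powr DIM('a)" by (subst powr_powr) simp
   finally show ?thesis by (simp add: powr_realpow)
  qed
  then have "(pi / e) powr (DIM('a) / 2) / (2 * pi) ^ DIM('a) = (pi / e) powr (DIM('a) / 2) / ((2 * pi)\<^sup>2) powr (DIM('a) / 2)"
   by (simp only:)
  also have "\<dots> = ((pi / e) / (2 * pi)\<^sup>2) powr (DIM('a) / 2)"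
   by (rule powr_divide[symmetric])
  also have "(pi / e) / (2 * pi)\<^sup>2 = inverse (4 * pi * e)"
   using e by (simp add: field_simps power2_eq_square)
  also have "inverse (4 * pi * e) powr (DIM('a) / 2) = (4 * pi * e) powr (- (DIM('a) / 2))"
  proof -
   have "inverse y powr s = y powr (- s)" if "0 < y" for y s :: real
    using that by (simp add: powr_def ln_inverse)
   note inv = this
   show ?thesis by (rule inv) (use e in simp)
  qed
  also have "- (real DIM('a) / 2) = - real DIM('a) / 2" by (rule minus_divide_left)
  finally show ?thesis .
 qed
 have "complex_of_real (A * E) /\<^sub>R c = of_real (A / c) * of_real E" for A E c :: real
  by (simp add: scaleR_conv_of_real divide_inverse)
 then have "(LINT \<xi>|lborel. cis (z \<bullet> \<xi>) * exp (- (e * (norm \<xi>)\<^sup>2))) /\<^sub>R (2 * pi) ^ DIM('a) =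
   of_real ((pi / e) powr (DIM('a) / 2) / (2 * pi) ^ DIM('a)) * of_real (exp (- ((norm z)\<^sup>2 / (4 * e))))"
  unfolding h1 .
 also have "complex_of_real (exp (- ((norm z)\<^sup>2 / (4 * e)))) = exp (- (of_real ((norm z)\<^sup>2) / (4 * of_real e)))"
  by (simp flip: exp_of_real)
 finally show ?thesis
  unfolding heat_kernel_def h2 h3 .
qed

lemma integrable_pair_mult:
 fixes f g :: "_ \<Rightarrow> complex"
 assumes f: "L1 f" and g: "L1 g"
 shows "integrable (lborel \<Otimes>\<^sub>M lborel) (\<lambda>(x, y). f x * g y)"
proof (rule lborel_pair.Fubini_integrable)
 have [measurable]: "f \<in> Borel" "g \<in> Borel" using f g by auto
 show "(\<lambda>(x, y). f x * g y) \<in> borel_measurable (lborel \<Otimes>\<^sub>M lborel)" by measurable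
qed (use f g in \<open>auto simp: norm_mult\<close>)

text \<open>Regularised inversion: the Gaussian factor makes the double integral absolutely
  convergent, and Fubini rewrites it as a Gaussian mean of \<open>f\<close>.\<close>

lemma gaussian_mean_fourier:
 fixes f :: "'a::euclidean_space \<Rightarrow> complex"
 assumes f: "L1 f" and e: "0 < (e::real)"
 shows "(LINT \<xi>|lborel. cis (x \<bullet> \<xi>) * exp (- (e * (norm \<xi>)\<^sup>2)) * fourier f \<xi>) /\<^sub>R (2 * pi) ^ DIM('a) =
  (LINT y|lborel. f y * heat_kernel (of_real e) (x - y))"
proof -
 have [measurable]: "f \<in> Borel" using f by auto
 let ?G = "\<lambda>\<xi>::'a. complex_of_real (exp (- (e * (norm \<xi>)\<^sup>2)))"
 have G: "L1 ?G" using integrable_gaussian(1)[OF e] by (simp only: complex_of_real_integrable_eq)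
 have i: "integrable (lborel \<Otimes>\<^sub>M lborel) (\<lambda>(\<xi>, y). cis ((x - y) \<bullet> \<xi>) * (?G \<xi> * f y))"
  by (rule lebesgue_integrable_bound[OF integrable_pair_mult[OF G f]]) (auto simp: norm_mult split_beta')
 have "(LINT \<xi>|lborel. cis (x \<bullet> \<xi>) * ?G \<xi> * fourier f \<xi>) = (LINT \<xi>|lborel. LINT y|lborel. cis ((x - y) \<bullet> \<xi>) * (?G \<xi> * f y))"
 proof (intro lebesgue_integral_cong refl)
  fix \<xi>
  have "(LINT y|lborel. cis ((x - y) \<bullet> \<xi>) * (?G \<xi> * f y)) = (LINT y|lborel. cis (x \<bullet> \<xi>) * ?G \<xi> * (cis (- (y \<bullet> \<xi>)) * f y))"
   by (intro lebesgue_integral_cong) (auto simp: inner_diff_left cis_mult)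
  also have "\<dots> = cis (x \<bullet> \<xi>) * ?G \<xi> * fourier f \<xi>" by (simp add: fourier_lborel)
  finally show "cis (x \<bullet> \<xi>) * ?G \<xi> * fourier f \<xi> = (LINT y|lborel. cis ((x - y) \<bullet> \<xi>) * (?G \<xi> * f y))" by simp
 qed
 also have "\<dots> = (LINT y|lborel. LINT \<xi>|lborel. cis ((x - y) \<bullet> \<xi>) * (?G \<xi> * f y))"
  by (rule lborel_pair.Fubini_integral[OF i, symmetric])
 also have "\<dots> = (LINT y|lborel. f y * (LINT \<xi>|lborel. cis ((x - y) \<bullet> \<xi>) * ?G \<xi>))"
  by (intro lebesgue_integral_cong refl) (simp add: mult_ac flip: integral_mult_right_zero)
 finally have "(LINT \<xi>|lborel. cis (x \<bullet> \<xi>) * ?G \<xi> * fourier f \<xi>) /\<^sub>R (2 * pi) ^ DIM('a) =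
   (LINT y|lborel. f y * ((LINT \<xi>|lborel. cis ((x - y) \<bullet> \<xi>) * ?G \<xi>) /\<^sub>R (2 * pi) ^ DIM('a)))"
  by (simp add: scaleR_conv_of_real mult_ac flip: integral_mult_right_zero)
 then show ?thesis unfolding inverse_gaussian[OF e] .
qed

lemma integral_heat_kernel: "0 < Re w \<Longrightarrow> (LINT x|lborel. heat_kernel w (x::'a::euclidean_space)) = 1"
 using fourier_heat_kernel[of w "0::'a"] by (subst (asm) fourier_lborel) auto

lemma heat_kernel_scale:
 assumes e: "0 < e"
 shows "of_real (sqrt e ^ DIM('a)) * heat_kernel (of_real e) (sqrt e *\<^sub>R x) = heat_kernel 1 (x::'a::euclidean_space)"
proof -
 have p: "(4 * of_real pi * complex_of_real e) powr (- of_nat DIM('a) / 2) = of_real ((4 * pi * e) powr (- real DIM('a) / 2))" if "0 < e" for e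
  using powr_of_real[of "4 * pi * e" "- real DIM('a) / 2"] that by simp
 have "sqrt e ^ DIM('a) * (4 * pi * e) powr (- real DIM('a) / 2) = (4 * pi) powr (- real DIM('a) / 2)"
 proof -
  have "sqrt e ^ DIM('a) = e powr (DIM('a) / 2)"
   using e by (simp add: powr_half_sqrt[symmetric] powr_powr flip: powr_realpow)
  then show ?thesis using e by (simp add: powr_mult powr_minus)
 qed
 then have "complex_of_real (sqrt e ^ DIM('a) * (4 * pi * e) powr (- real DIM('a) / 2)) = of_real ((4 * pi) powr (- real DIM('a) / 2))"
  by (simp only:)
 moreover have "of_real ((norm (sqrt e *\<^sub>R x))\<^sup>2) / (4 * complex_of_real e) = of_real ((norm x)\<^sup>2) / (4 * 1)"
  using e by (simp add: power_mult_distrib)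
 moreover have "(4 * of_real pi * 1) powr (- of_nat DIM('a) / 2) = complex_of_real ((4 * pi) powr (- real DIM('a) / 2))"
  using p[of 1] by simp
 ultimately show ?thesis
  unfolding heat_kernel_def p[OF e] by (simp only: mult.assoc[symmetric] of_real_mult[symmetric, where 'a=complex])
qed

text \<open>After rescaling by the square root of \<open>e n\<close> the kernel is fixed and only
  the argument of the indicator moves; off the frontier the indicator is locally constant.\<close>

lemma heat_kernel_indicator_tendsto:
 fixes y :: "'a::euclidean_space"
 assumes [measurable]: "A \<in> sets borel" and y: "y \<notin> frontier A" and e: "\<And>n. 0 < e n" "e \<longlonglongrightarrow> 0"
 shows "(\<lambda>n. LINT x|lborel. indicator A x *\<^sub>R heat_kernel (of_real (e n)) (x - y)) \<longlonglongrightarrow> indicator A y"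
proof -
 have eq: "(LINT x|lborel. indicator A x *\<^sub>R heat_kernel (of_real (e n)) (x - y)) =
   (LINT x|lborel. indicator A (y + sqrt (e n) *\<^sub>R x) *\<^sub>R heat_kernel 1 x)" for n
  using e(1)[of n]
  by (subst lborel_integral_affine[where t=y and c="sqrt (e n)"])
   (auto simp: heat_kernel_scale[OF e(1)[of n], symmetric] scaleR_conv_of_real mult_ac simp flip: integral_mult_right_zero)
 have "(\<lambda>n. LINT x|lborel. indicator A (y + sqrt (e n) *\<^sub>R x) *\<^sub>R heat_kernel 1 x) \<longlonglongrightarrow> (LINT x|lborel. indicator A y *\<^sub>R heat_kernel 1 (x::'a))"
 proof (rule integral_dominated_convergence[where w="\<lambda>x. norm (heat_kernel 1 x)"])
  show "AE x in lborel. (\<lambda>n. indicator A (y + sqrt (e n) *\<^sub>R x) *\<^sub>R heat_kernel 1 x) \<longlonglongrightarrow> indicator A y *\<^sub>R heat_kernel 1 x"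
  proof (rule AE_I2)
   fix x :: 'a
   have "(\<lambda>n. y + sqrt (e n) *\<^sub>R x) \<longlonglongrightarrow> y + sqrt 0 *\<^sub>R x"
    by (intro tendsto_intros e)
   then have lim: "(\<lambda>n. y + sqrt (e n) *\<^sub>R x) \<longlonglongrightarrow> y" by simp
   have "\<forall>\<^sub>F n in sequentially. indicator A (y + sqrt (e n) *\<^sub>R x) = (indicator A y :: real)"
   proof (cases "y \<in> interior A")
    case True
    then have "\<forall>\<^sub>F n in sequentially. y + sqrt (e n) *\<^sub>R x \<in> interior A"
     using lim by (intro topological_tendstoD) auto
    then show ?thesis using True interior_subset[of A] by (auto elim!: eventually_mono simp: indicator_def)
   next
    case False
    then have "y \<in> - closure A" using y by (auto simp: frontier_def)
    then have "\<forall>\<^sub>F n in sequentially. y + sqrt (e n) *\<^sub>R x \<in> - closure A"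
     using lim by (intro topological_tendstoD) auto
    then show ?thesis using \<open>y \<in> - closure A\<close> closure_subset[of A] by (auto elim!: eventually_mono simp: indicator_def)
   qed
   then show "(\<lambda>n. indicator A (y + sqrt (e n) *\<^sub>R x) *\<^sub>R heat_kernel 1 x) \<longlonglongrightarrow> indicator A y *\<^sub>R heat_kernel 1 x"
    by (intro tendsto_eventually) (auto elim!: eventually_mono)
  qed
 qed (use integrable_heat_kernel[of 1] in \<open>auto simp: indicator_def\<close>)
 also have "(LINT x|lborel. indicator A y *\<^sub>R heat_kernel 1 (x::'a)) = indicator A y"
  by (simp add: integral_heat_kernel indicator_def)
 finally show ?thesis unfolding eq .
qed

lemma integral_indicator_heat_kernel_le:
 fixes y :: "'a::euclidean_space"
 assumes e: "0 < e"
 shows "norm (LINT x|lborel. indicator A x *\<^sub>R heat_kernel (of_real e) (x - y)) \<le> 1"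
proof -
 have pos: "0 < Re (complex_of_real e)" using e by simp
 have hy: "L1 (\<lambda>x. norm (heat_kernel (of_real e) (x - y)))"
  using integrable_heat_kernel[OF pos, where 'a='a] lborel_integrable_translate_iff[of "heat_kernel (of_real e)" y]
  by (intro integrable_norm) simp
 have "norm (LINT x|lborel. indicator A x *\<^sub>R heat_kernel (of_real e) (x - y)) \<le> (LINT x|lborel. norm (indicator A x *\<^sub>R heat_kernel (of_real e) (x - y)))"
  by (rule integral_norm_bound)
 also have "\<dots> \<le> (LINT x|lborel. norm (heat_kernel (of_real e) (x - y)))"
  by (rule integral_mono'[OF hy]) (auto simp: indicator_def)
 also have "\<dots> = (LINT x|lborel. norm (heat_kernel (of_real e) (x::'a)))"
  by (rule lborel_integral_translate[of "\<lambda>x. norm (heat_kernel (of_real e) x)"]) measurable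
 also have "\<dots> = 1"
  unfolding integral_norm_heat_kernel[OF pos] using e by simp
 finally show ?thesis .
qed

text \<open>Functions are compared through their integrals over boxes. Those of the regularised
  inverses \<open>J n\<close> tend to the integrals of \<open>I\<close> by dominated convergence,
  and to those of \<open>f\<close> once the Gaussian mean has been moved onto the indicator of the
  box. Pointwise convergence of Gaussian means of \<open>f\<close> never enters.\<close>

theorem fourier_inversion_AE:
 fixes f :: "'a::euclidean_space \<Rightarrow> complex"
 assumes f: "L1 f" and f': "L1 (fourier f)"
 shows "AE x in lborel. inv_fourier (fourier f) x = f x"
proof -
 have [measurable]: "f \<in> Borel" "fourier f \<in> Borel" using f f' by auto
 define I where "I = inv_fourier (fourier f)"
 define e where "e n = inverse (real (Suc n))" for n
 have e: "0 < e n" "e \<longlonglongrightarrow> 0" for n unfolding e_def[abs_def] using LIMSEQ_inverse_real_of_nat by auto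
 define J where "J n x = (LINT \<xi>|lborel. cis (x \<bullet> \<xi>) * exp (- (e n * (norm \<xi>)\<^sup>2)) * fourier f \<xi>) /\<^sub>R (2 * pi) ^ DIM('a)" for n and x :: 'a
 have [measurable]: "J n \<in> Borel" for n
  unfolding J_def by measurable
 have Imeas[measurable]: "I \<in> Borel"
  unfolding I_def by (subst inv_fourier_lborel[THEN ext]) measurable
 have le1: "exp (- (e n * (norm \<xi>)\<^sup>2)) * norm z \<le> norm z" for n and \<xi> :: 'a and z :: complex
  using e(1)[of n] by (intro mult_left_le_one_le) auto
 define N where "N = (LINT \<xi>|lborel. norm (fourier f \<xi>)) / (2 * pi) ^ DIM('a)"
 have NI: "norm (I x) \<le> N" for x
 proof -
  have "norm (LINT \<xi>|lborel. cis (x \<bullet> \<xi>) * fourier f \<xi>) \<le> (LINT \<xi>|lborel. norm (cis (x \<bullet> \<xi>) * fourier f \<xi>))"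
   by (rule integral_norm_bound)
  then show ?thesis unfolding I_def N_def by (subst inv_fourier_lborel) (auto simp: norm_mult divide_right_mono field_simps)
 qed
 have NJ: "norm (J n x) \<le> N" for n x
 proof -
  have "norm (LINT \<xi>|lborel. cis (x \<bullet> \<xi>) * exp (- (e n * (norm \<xi>)\<^sup>2)) * fourier f \<xi>) \<le> (LINT \<xi>|lborel. norm (cis (x \<bullet> \<xi>) * exp (- (e n * (norm \<xi>)\<^sup>2)) * fourier f \<xi>))"
   by (rule integral_norm_bound)
  also have "\<dots> \<le> (LINT \<xi>|lborel. norm (fourier f \<xi>))"
   using f' e(1)[of n] by (intro integral_mono' integrable_norm) (auto simp: norm_mult le1)
  finally show ?thesis unfolding J_def N_def by (auto simp: divide_right_mono field_simps)
 qed
 have JI: "(\<lambda>n. J n x) \<longlonglongrightarrow> I x" for x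
 proof -
  have "(\<lambda>n. LINT \<xi>|lborel. cis (x \<bullet> \<xi>) * exp (- (e n * (norm \<xi>)\<^sup>2)) * fourier f \<xi>) \<longlonglongrightarrow> (LINT \<xi>|lborel. cis (x \<bullet> \<xi>) * fourier f \<xi>)"
  proof (rule integral_dominated_convergence[where w="\<lambda>\<xi>. norm (fourier f \<xi>)"])
   show "AE \<xi> in lborel. (\<lambda>n. cis (x \<bullet> \<xi>) * exp (- (e n * (norm \<xi>)\<^sup>2)) * fourier f \<xi>) \<longlonglongrightarrow> cis (x \<bullet> \<xi>) * fourier f \<xi>"
   proof (rule AE_I2)
    fix \<xi>
    have "(\<lambda>n. cis (x \<bullet> \<xi>) * exp (- (e n * (norm \<xi>)\<^sup>2)) * fourier f \<xi>) \<longlonglongrightarrow> cis (x \<bullet> \<xi>) * exp (- (0 * (norm \<xi>)\<^sup>2)) * fourier f \<xi>"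
     by (intro tendsto_intros tendsto_of_real e)
    then show "(\<lambda>n. cis (x \<bullet> \<xi>) * exp (- (e n * (norm \<xi>)\<^sup>2)) * fourier f \<xi>) \<longlonglongrightarrow> cis (x \<bullet> \<xi>) * fourier f \<xi>" by simp
   qed
  qed (use f' in \<open>auto simp: norm_mult le1\<close>)
  then show ?thesis unfolding J_def I_def by (subst inv_fourier_lborel) (auto intro: tendsto_intros)
 qed
 have fb: "emeasure lborel (box a b) < top" for a b :: 'a
  using emeasure_bounded_finite[OF bounded_box, of a b] by (simp add: infinity_ennreal_def)
 have box: "(LINT x:box a b|lborel. I x) = (LINT x:box a b|lborel. f x)" for a b
 proof (rule LIMSEQ_unique)
  have iB: "L1 (\<lambda>x. indicator (box a b) x * N)"
   by (intro integrable_mult_left) (simp add: integrable_indicator_iff fb)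
  show "(\<lambda>n. LINT x:box a b|lborel. J n x) \<longlonglongrightarrow> (LINT x:box a b|lborel. I x)"
   unfolding set_lebesgue_integral_def
   by (rule integral_dominated_convergence[where w="\<lambda>x. indicator (box a b) x * N"])
    (use iB NJ JI in \<open>auto intro!: tendsto_intros simp: indicator_def\<close>)
  let ?h = "\<lambda>n x y. indicator (box a b) x *\<^sub>R (f y * heat_kernel (of_real (e n)) (x - y))"
  have "(LINT x:box a b|lborel. J n x) = (LINT y|lborel. f y * (LINT x|lborel. indicator (box a b) x *\<^sub>R heat_kernel (of_real (e n)) (x - y)))" for n
  proof -
   have "(LINT x:box a b|lborel. J n x) = (LINT x|lborel. LINT y|lborel. ?h n x y)"
    unfolding set_lebesgue_integral_def J_def gaussian_mean_fourier[OF f e(1)] by simp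
   also have "\<dots> = (LINT y|lborel. LINT x|lborel. ?h n x y)"
   proof (rule lborel_pair.Fubini_integral[symmetric])
    have "L1 (heat_kernel (of_real (e n)) :: 'a \<Rightarrow> complex)"
     using e(1)[of n] by (intro integrable_heat_kernel) auto
    from integrable_conv_pair[OF this f]
    show "integrable (lborel \<Otimes>\<^sub>M lborel) (\<lambda>(x, y). ?h n x y)"
     by (rule lebesgue_integrable_bound) (auto simp: norm_mult indicator_def split_beta')
   qed
   also have "\<dots> = (LINT y|lborel. f y * (LINT x|lborel. indicator (box a b) x *\<^sub>R heat_kernel (of_real (e n)) (x - y)))"
    by (simp add: scaleR_conv_of_real mult.left_commute flip: integral_mult_right_zero)
   finally show ?thesis .
  qed
  moreover have "(\<lambda>n. LINT y|lborel. f y * (LINT x|lborel. indicator (box a b) x *\<^sub>R heat_kernel (of_real (e n)) (x - y))) \<longlonglongrightarrow> (LINT y|lborel. indicator (box a b) y *\<^sub>R f y)"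
  proof (rule integral_dominated_convergence[where w="\<lambda>y. norm (f y)"])
   have "negligible (frontier (box a b))" by (intro negligible_convex_frontier convex_box)
   then have "AE y in lebesgue. y \<notin> frontier (box a b)"
    by (auto simp: negligible_iff_null_sets intro!: AE_not_in)
   then have "AE y in lborel. y \<notin> frontier (box a b)" by (simp add: AE_completion_iff)
   then show "AE y in lborel. (\<lambda>n. f y * (LINT x|lborel. indicator (box a b) x *\<^sub>R heat_kernel (of_real (e n)) (x - y))) \<longlonglongrightarrow> indicator (box a b) y *\<^sub>R f y"
   proof eventually_elim
    case (elim y)
    have "(\<lambda>n. f y * (LINT x|lborel. indicator (box a b) x *\<^sub>R heat_kernel (of_real (e n)) (x - y))) \<longlonglongrightarrow> f y * indicator (box a b) y"
     using elim e by (intro tendsto_intros heat_kernel_indicator_tendsto) auto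
    moreover have "f y * indicator (box a b) y = indicator (box a b) y *\<^sub>R f y"
     by (simp add: indicator_def)
    ultimately show ?case by (simp only:)
   qed
   show "AE y in lborel. norm (f y * (LINT x|lborel. indicator (box a b) x *\<^sub>R heat_kernel (of_real (e n)) (x - y))) \<le> norm (f y)" for n
   proof (rule AE_I2)
    fix y :: 'a
    have "norm (LINT x|lborel. indicator (box a b) x *\<^sub>R heat_kernel (of_real (e n)) (x - y)) \<le> 1"
     by (rule integral_indicator_heat_kernel_le[OF e(1)])
    from mult_left_mono[OF this, of "norm (f y)"]
    show "norm (f y * (LINT x|lborel. indicator (box a b) x *\<^sub>R heat_kernel (of_real (e n)) (x - y))) \<le> norm (f y)"
     unfolding norm_mult by simp
   qed
  qed (use f in auto)
  ultimately show "(\<lambda>n. LINT x:box a b|lborel. J n x) \<longlonglongrightarrow> (LINT x:box a b|lborel. f x)"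
   by (simp add: set_lebesgue_integral_def)
 qed
 have iI: "set_integrable lborel (box a b) I" for a b
  unfolding set_integrable_def
 proof (rule lebesgue_integrable_bound[of _ "\<lambda>x. indicator (box a b) x * N"])
  show "L1 (\<lambda>x. indicator (box a b) x * N)"
   by (intro integrable_mult_left) (simp add: integrable_indicator_iff fb)
  have "\<bar>N\<bar> = N" using NI[of 0] norm_ge_zero[of "I 0"] by linarith
  then show "AE x in lborel. norm (indicator (box a b) x *\<^sub>R I x) \<le> norm (indicator (box a b) x * N)"
   using NI by (auto simp: indicator_def)
 qed measurable
 have fi: "set_integrable lborel (box a b) f" for a b
  using f unfolding set_integrable_def by (intro integrable_mult_indicator) auto
 have "AE x in lborel. I x - f x = 0"
 proof (rule AE_zero_if_box_integrals_zero)
  fix a b :: 'a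
  show "set_integrable lborel (box a b) (\<lambda>x. I x - f x)"
   by (rule set_integral_diff(1)[OF iI fi])
  show "(LINT x:box a b|lborel. I x - f x) = 0"
   using set_integral_diff(2)[OF iI[of a b] fi[of a b]] box[of a b] by simp
 qed
 then show ?thesis unfolding I_def by eventually_elim simp
qed

corollary fourier_injective_AE:
 assumes "L1 f" "L1 g" "\<And>\<xi>. fourier f \<xi> = fourier g \<xi>"
 shows "AE x in lborel. f x = g x"
proof -
 have [measurable]: "f \<in> Borel" "g \<in> Borel" using assms by auto
 have z: "fourier (\<lambda>x. f x - g x) = (\<lambda>_. 0)"
  using assms by (auto simp: fourier_lborel right_diff_distrib fun_eq_iff)
 have "AE x in lborel. inv_fourier (fourier (\<lambda>x. f x - g x)) x = f x - g x"
  by (rule fourier_inversion_AE) (use assms z in auto)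
 then show ?thesis by (auto simp: z inv_fourier_def)
qed

section \<open>Fourier transforms of integrable functions\<close>

text \<open>By \<open>young_convolution\<close> such a symbol acts by convolution with L_p norm at
  most \<open>B\<close>. The closure rules that follow are the calculus in which all symbol
  estimates are made. The symbol is prescribed at every frequency, not just almost
  everywhere.\<close>

definition L1_multiplier :: "real \<Rightarrow> ('a::euclidean_space \<Rightarrow> complex) \<Rightarrow> bool" where
 "L1_multiplier B m \<longleftrightarrow>
  (\<exists>f. L1 f \<and> L1_norm f \<le> B \<and> (\<forall>\<xi>. fourier f \<xi> = m \<xi>))"

lemma L1_multiplierI:
 "L1 f \<Longrightarrow> (L1_norm f) \<le> B \<Longrightarrow> (\<And>\<xi>. fourier f \<xi> = m \<xi>) \<Longrightarrow> L1_multiplier B m"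
 unfolding L1_multiplier_def by blast

lemma L1_multiplierE:
 assumes "L1_multiplier B m"
 obtains f where "L1 f" "L1_norm f \<le> B" "\<And>\<xi>. fourier f \<xi> = m \<xi>"
 using assms unfolding L1_multiplier_def by blast

lemma L1_multiplier_nonneg: "L1_multiplier B m \<Longrightarrow> 0 \<le> B"
 by (erule L1_multiplierE, rule order_trans[rotated], assumption) simp

lemma L1_multiplier_mono: "L1_multiplier B m \<Longrightarrow> B \<le> B' \<Longrightarrow> L1_multiplier B' m"
 unfolding L1_multiplier_def by (meson order_trans)

lemma L1_multiplier_mult:
 assumes "L1_multiplier A m" "L1_multiplier B n"
 shows "L1_multiplier (A * B) (\<lambda>\<xi>. m \<xi> * n \<xi>)"
proof -
 obtain f where f: "L1 f" "L1_norm f \<le> A" "\<And>\<xi>. fourier f \<xi> = m \<xi>"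
  using assms(1) unfolding L1_multiplier_def by blast
 obtain g where g: "L1 g" "L1_norm g \<le> B" "\<And>\<xi>. fourier g \<xi> = n \<xi>"
  using assms(2) unfolding L1_multiplier_def by blast
 have "L1_norm (conv f g) \<le> A * B"
  using L1_multiplier_nonneg[OF assms(1)] L1_multiplier_nonneg[OF assms(2)]
  by (intro norm_conv_L1_le[OF f(1) g(1), THEN order_trans] mult_mono f g) auto
 then show ?thesis
  using f g integrable_conv[OF f(1) g(1)] fourier_conv[OF f(1) g(1)] by (intro L1_multiplierI[of "conv f g"]) auto
qed

lemma L1_multiplier_add:
 assumes "L1_multiplier A m" "L1_multiplier B n"
 shows "L1_multiplier (A + B) (\<lambda>\<xi>. m \<xi> + n \<xi>)"
proof -
 obtain f where f: "L1 f" "L1_norm f \<le> A" "\<And>\<xi>. fourier f \<xi> = m \<xi>"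
  using assms(1) unfolding L1_multiplier_def by blast
 obtain g where g: "L1 g" "L1_norm g \<le> B" "\<And>\<xi>. fourier g \<xi> = n \<xi>"
  using assms(2) unfolding L1_multiplier_def by blast
 have [measurable]: "f \<in> Borel" "g \<in> Borel" using f g by auto
 have "(LINT x|lborel. norm (f x + g x)) \<le> (LINT x|lborel. norm (f x) + norm (g x))"
  using f g by (intro integral_mono) (auto intro: norm_triangle_ineq)
 then have "(LINT x|lborel. norm (f x + g x)) \<le> A + B" using f g by simp
 moreover have "fourier (\<lambda>x. f x + g x) \<xi> = m \<xi> + n \<xi>" for \<xi>
  using f g by (simp add: fourier_lborel distrib_left)
 ultimately show ?thesis using f g by (intro L1_multiplierI) auto
qed

lemma L1_multiplier_cmult:
 assumes "L1_multiplier A m"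
 shows "L1_multiplier (norm c * A) (\<lambda>\<xi>. c * m \<xi>)"
proof -
 obtain f where f: "L1 f" "L1_norm f \<le> A" "\<And>\<xi>. fourier f \<xi> = m \<xi>"
  using assms(1) unfolding L1_multiplier_def by blast
 have [measurable]: "f \<in> Borel" using f by auto
 have "fourier (\<lambda>x. c * f x) \<xi> = c * m \<xi>" for \<xi>
  using f by (simp add: fourier_lborel mult.left_commute)
 then show ?thesis using f by (intro L1_multiplierI[of "\<lambda>x. c * f x"]) (auto simp: norm_mult mult_left_mono)
qed

text \<open>The rescaled kernel has the same L1 norm, so a symbol estimated at unit scale costs the
  same at every dyadic scale and at every time.\<close>

lemma L1_multiplier_dilate:
 fixes m :: "'a::euclidean_space \<Rightarrow> complex"
 assumes "L1_multiplier A m" and c: "0 < c"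
 shows "L1_multiplier A (\<lambda>\<xi>. m (c *\<^sub>R \<xi>))"
proof -
 obtain f where f: "L1 f" "L1_norm f \<le> A" "\<And>\<xi>. fourier f \<xi> = m \<xi>"
  using assms(1) unfolding L1_multiplier_def by blast
 have [measurable]: "f \<in> Borel" using f by auto
 define g where "g x = (1 / c) ^ DIM('a) *\<^sub>R f (0 + (1 / c) *\<^sub>R x)" for x
 have [measurable]: "g \<in> Borel" unfolding g_def by measurable
 have "L1 (\<lambda>x. f (0 + (1 / c) *\<^sub>R x))"
  using c f by (subst lborel_integrable_affine_iff) auto
 then have "L1 g" unfolding g_def by (rule integrable_scaleR_right)
 moreover have "L1_norm g \<le> A"
  using f(2) c by (subst (asm) lborel_integral_affine[where c="1/c" and t=0]) (auto simp: g_def)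
 moreover have "fourier g \<xi> = m (c *\<^sub>R \<xi>)" for \<xi>
 proof -
  have "m (c *\<^sub>R \<xi>) = (LINT x|lborel. cis (- (x \<bullet> (c *\<^sub>R \<xi>))) * f x)"
   by (simp add: f(3)[symmetric] fourier_lborel)
  also have "\<dots> = \<bar>1 / c\<bar> ^ DIM('a) *\<^sub>R (LINT x|lborel. cis (- ((0 + (1 / c) *\<^sub>R x) \<bullet> (c *\<^sub>R \<xi>))) * f (0 + (1 / c) *\<^sub>R x))"
   using c by (intro lborel_integral_affine) auto
  also have "\<dots> = fourier g \<xi>"
   using c by (subst fourier_lborel) (auto simp: g_def)
  finally show ?thesis ..
 qed
 ultimately show ?thesis by (rule L1_multiplierI)
qed

lemma AE_summable_of_integrals:
 fixes f :: "nat \<Rightarrow> 'b \<Rightarrow> 'c::{banach, second_countable_topology}"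
 assumes f: "\<And>i. integrable M (f i)" and s: "summable (\<lambda>i. LINT x|M. norm (f i x))"
 shows "AE x in M. summable (\<lambda>i. norm (f i x))"
proof -
 have [measurable]: "f i \<in> borel_measurable M" for i using f by auto
 have "(\<integral>\<^sup>+x. (\<Sum>i. ennreal (norm (f i x))) \<partial>M) = (\<Sum>i. ennreal (LINT x|M. norm (f i x)))"
 proof (subst nn_integral_suminf)
  have "(\<integral>\<^sup>+x. ennreal (norm (f i x)) \<partial>M) = ennreal (LINT x|M. norm (f i x))" for i
   using f by (intro nn_integral_eq_integral) auto
  then show "(\<Sum>i. \<integral>\<^sup>+x. ennreal (norm (f i x)) \<partial>M) = (\<Sum>i. ennreal (LINT x|M. norm (f i x)))" by simp
 qed measurable
 also have "\<dots> \<noteq> \<infinity>" unfolding infinity_ennreal_def by (rule ennreal_suminf_neq_top[OF s]) simp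
 finally have "AE x in M. (\<Sum>i. ennreal (norm (f i x))) \<noteq> \<infinity>"
  by (intro nn_integral_noteq_infinite) auto
 then show ?thesis by eventually_elim (auto intro: summable_suminf_not_top)
qed

lemma L1_multiplier_suminf:
 fixes m :: "nat \<Rightarrow> 'a::euclidean_space \<Rightarrow> complex"
 assumes m: "\<And>i. L1_multiplier (B i) (m i)" and B: "summable B" and M: "\<And>\<xi>. (\<lambda>i. m i \<xi>) sums M \<xi>"
 shows "L1_multiplier (\<Sum>i. B i) M"
proof -
 have "\<forall>i. \<exists>f. L1 f \<and> L1_norm f \<le> B i \<and> (\<forall>\<xi>. fourier f \<xi> = m i \<xi>)"
  using m unfolding L1_multiplier_def by blast
 then obtain f where f: "\<And>i. L1 (f i)" "\<And>i. (L1_norm (f i)) \<le> B i" "\<And>i \<xi>. fourier (f i) \<xi> = m i \<xi>"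
  by metis
 have [measurable]: "f i \<in> Borel" for i using f(1)[of i] by auto
 have s: "summable (\<lambda>i. L1_norm (f i))"
  by (rule summable_comparison_test'[OF B, of 0]) (use f(2) in \<open>auto simp: integral_nonneg_AE\<close>)
 note ae = AE_summable_of_integrals[OF f(1) s]
 define F where "F x = (\<Sum>i. f i x)" for x
 have F: "L1 F" unfolding F_def by (rule integrable_suminf[OF f(1) ae s])
 have [measurable]: "F \<in> Borel" using F by auto
 have ae': "AE x in lborel. summable (\<lambda>i. norm (norm (f i x)))" using ae by simp
 have s': "summable (\<lambda>i. LINT x|lborel. norm (norm (f i x)))" using s by simp
 have "L1_norm F \<le> (LINT x|lborel. (\<Sum>i. norm (f i x)))"
 proof (rule integral_mono_AE)
  show "AE x in lborel. norm (F x) \<le> (\<Sum>i. norm (f i x))"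
   using ae by eventually_elim (auto simp: F_def intro: summable_norm)
  show "L1 (\<lambda>x. \<Sum>i. norm (f i x))"
   by (rule integrable_suminf[OF integrable_norm[OF f(1)] ae' s'])
 qed (use F in auto)
 also have "\<dots> = (\<Sum>i. L1_norm (f i))"
  by (rule integral_suminf[OF integrable_norm[OF f(1)] ae' s'])
 also have "\<dots> \<le> (\<Sum>i. B i)" using f(2) s B by (intro suminf_le) auto
 finally have "L1_norm F \<le> (\<Sum>i. B i)" .
 moreover have "fourier F \<xi> = M \<xi>" for \<xi>
 proof -
  have "(\<lambda>i. LINT x|lborel. cis (- (x \<bullet> \<xi>)) * f i x) sums (LINT x|lborel. (\<Sum>i. cis (- (x \<bullet> \<xi>)) * f i x))"
   by (rule sums_integral) (use f ae s in \<open>auto simp: norm_mult\<close>)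
  moreover have "(LINT x|lborel. (\<Sum>i. cis (- (x \<bullet> \<xi>)) * f i x)) = fourier F \<xi>"
   unfolding fourier_lborel[OF \<open>F \<in> Borel\<close>]
  proof (rule integral_cong_AE)
   show "AE x in lborel. (\<Sum>i. cis (- (x \<bullet> \<xi>)) * f i x) = cis (- (x \<bullet> \<xi>)) * F x"
    using ae by eventually_elim (auto simp: F_def intro!: suminf_mult summable_norm_cancel)
  qed measurable
  moreover have "(LINT x|lborel. cis (- (x \<bullet> \<xi>)) * f i x) = m i \<xi>" for i
   using f(3)[of i \<xi>] by (simp add: fourier_lborel)
  ultimately show ?thesis using M[of \<xi>] by (simp add: sums_unique2)
 qed
 ultimately show ?thesis using F by (intro L1_multiplierI) auto
qed

text \<open>Fubini together with \<open>integral_norm_heat_kernel\<close>. It is used along the line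
  Re w = 1 for radial cutoffs and along a ray for the Mittag-Leffler symbol.\<close>

lemma
 fixes w \<mu> :: "real \<Rightarrow> complex"
 defines "f \<equiv> \<lambda>x::'a::euclidean_space. LINT \<tau>|lborel. \<mu> \<tau> * heat_kernel (w \<tau>) x"
 assumes [measurable]: "w \<in> Borel" "\<mu> \<in> Borel"
  and pos: "\<And>\<tau>. \<mu> \<tau> \<noteq> 0 \<Longrightarrow> 0 < Re (w \<tau>)"
  and int: "L1 (\<lambda>\<tau>. norm (\<mu> \<tau>) * (norm (w \<tau>) / Re (w \<tau>)) powr (DIM('a) / 2))"
 shows integrable_heat_superposition: "L1 f"
  and norm_heat_superposition_le: "L1_norm f \<le>
   (LINT \<tau>|lborel. norm (\<mu> \<tau>) * (norm (w \<tau>) / Re (w \<tau>)) powr (DIM('a) / 2))"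
  and fourier_heat_superposition: "fourier f \<xi> = (LINT \<tau>|lborel. \<mu> \<tau> * exp (- (w \<tau> * of_real ((norm \<xi>)\<^sup>2))))"
proof -
 have n: "(LINT x|lborel. norm (\<mu> \<tau> * heat_kernel (w \<tau>) (x::'a))) = norm (\<mu> \<tau>) * (norm (w \<tau>) / Re (w \<tau>)) powr (DIM('a) / 2)" for \<tau>
  using pos[of \<tau>] by (cases "\<mu> \<tau> = 0") (auto simp: norm_mult integral_norm_heat_kernel)
 have i: "L1 (\<lambda>x::'a. \<mu> \<tau> * heat_kernel (w \<tau>) x)" for \<tau>
  using pos[of \<tau>] integrable_heat_kernel[of "w \<tau>", where 'a='a] by (cases "\<mu> \<tau> = 0") auto
 have tx: "integrable (lborel \<Otimes>\<^sub>M lborel) (\<lambda>(\<tau>, x::'a). \<mu> \<tau> * heat_kernel (w \<tau>) x)"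
 proof (rule lborel_pair.Fubini_integrable)
  show "L1 (\<lambda>\<tau>. LINT x::'a|lborel. norm (case (\<tau>, x) of (\<tau>, x) \<Rightarrow> \<mu> \<tau> * heat_kernel (w \<tau>) x))"
   using int by (simp only: prod.case n)
  show "AE \<tau> in lborel. L1 (\<lambda>x::'a. case (\<tau>, x) of (\<tau>, x) \<Rightarrow> \<mu> \<tau> * heat_kernel (w \<tau>) x)"
   using i by simp
 qed measurable
 have xt: "integrable (lborel \<Otimes>\<^sub>M lborel) (\<lambda>(x::'a, \<tau>). \<mu> \<tau> * heat_kernel (w \<tau>) x)"
  using lborel_pair.integrable_product_swap[OF tx] by (simp add: split_beta')
 show f: "L1 f"
  using lborel_pair.integrable_fst'[OF xt] unfolding f_def by simp
 have [measurable]: "f \<in> Borel" using f by auto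
 have nxt: "integrable (lborel \<Otimes>\<^sub>M lborel) (\<lambda>(x::'a, \<tau>). norm (\<mu> \<tau> * heat_kernel (w \<tau>) x))"
  using integrable_norm[OF xt] by (simp add: split_beta')
 have "L1_norm f \<le> (LINT x::'a|lborel. LINT \<tau>|lborel. norm (\<mu> \<tau> * heat_kernel (w \<tau>) x))"
  using f lborel_pair.integrable_fst'[OF nxt] unfolding f_def
  by (intro integral_mono integral_norm_bound) auto
 also have "\<dots> = (LINT \<tau>|lborel. LINT x::'a|lborel. norm (\<mu> \<tau> * heat_kernel (w \<tau>) x))"
  using lborel_pair.Fubini_integral[OF nxt] by simp
 finally show "L1_norm f \<le> (LINT \<tau>|lborel. norm (\<mu> \<tau>) * (norm (w \<tau>) / Re (w \<tau>)) powr (DIM('a) / 2))"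
  unfolding n .
 have cxt: "integrable (lborel \<Otimes>\<^sub>M lborel) (\<lambda>(x::'a, \<tau>). cis (- (x \<bullet> \<xi>)) * (\<mu> \<tau> * heat_kernel (w \<tau>) x))"
  by (rule lebesgue_integrable_bound[OF xt]) (auto simp: norm_mult split_beta')
 have "fourier f \<xi> = (LINT x::'a|lborel. LINT \<tau>|lborel. cis (- (x \<bullet> \<xi>)) * (\<mu> \<tau> * heat_kernel (w \<tau>) x))"
  unfolding fourier_lborel[OF \<open>f \<in> Borel\<close>] by (simp add: f_def)
 also have "\<dots> = (LINT \<tau>|lborel. LINT x::'a|lborel. cis (- (x \<bullet> \<xi>)) * (\<mu> \<tau> * heat_kernel (w \<tau>) x))"
  using lborel_pair.Fubini_integral[OF cxt] by simp
 also have "\<dots> = (LINT \<tau>|lborel. \<mu> \<tau> * fourier (heat_kernel (w \<tau>)) \<xi>)"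
  by (simp add: fourier_lborel mult.left_commute)
 also have "\<dots> = (LINT \<tau>|lborel. \<mu> \<tau> * exp (- (w \<tau> * of_real ((norm \<xi>)\<^sup>2))))"
  using pos by (intro lebesgue_integral_cong refl) (metis fourier_heat_kernel mult_zero_left)
 finally show "fourier f \<xi> = (LINT \<tau>|lborel. \<mu> \<tau> * exp (- (w \<tau> * of_real ((norm \<xi>)\<^sup>2))))" .
qed

section \<open>Elementary smooth functions of one variable\<close>

text \<open>A syntactic substitute for smoothness: the class is closed under differentiation
  (\<open>elementary_smooth_derivative\<close>), so integration by parts can be repeated at will.
  \<open>flat\<close> carries every power of 1/x because differentiating exp(-1/x) produces them;
  \<open>power\<close> asks for vanishing to the left of a positive \<open>e\<close>, away from the
  singularity of \<open>powr\<close> at 0.\<close>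

inductive elementary_smooth :: "(real \<Rightarrow> complex) \<Rightarrow> bool" where
 const: "elementary_smooth (\<lambda>_. c)"
| ident: "elementary_smooth of_real"
| exp: "elementary_smooth (\<lambda>x. of_real (exp x))"
| flat: "elementary_smooth (\<lambda>x. if x \<le> 0 then 0 else of_real ((1 / x) ^ n * exp (- (1 / x))))"
| add: "elementary_smooth f \<Longrightarrow> elementary_smooth g \<Longrightarrow> elementary_smooth (\<lambda>x. f x + g x)"
| mult: "elementary_smooth f \<Longrightarrow> elementary_smooth g \<Longrightarrow> elementary_smooth (\<lambda>x. f x * g x)"
| inverse: "elementary_smooth f \<Longrightarrow> (\<And>x. f x \<noteq> 0) \<Longrightarrow> elementary_smooth (\<lambda>x. inverse (f x))"
| affine: "elementary_smooth f \<Longrightarrow> elementary_smooth (\<lambda>x. f (a + b * x))"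
| power: "elementary_smooth f \<Longrightarrow> 0 < e \<Longrightarrow> (\<And>x. x < e \<Longrightarrow> f x = 0) \<Longrightarrow>
  elementary_smooth (\<lambda>x. of_real (x powr s) * f x)"

lemma flat_tendsto_0: "((\<lambda>x::real. (1 / x) ^ n * exp (- (1 / x))) \<longlongrightarrow> 0) (at_right 0)"
proof -
 have "((\<lambda>x. x ^ n / exp x) \<longlongrightarrow> (0::real)) at_top" by (rule tendsto_power_div_exp_0)
 then have "((\<lambda>x::real. (inverse x) ^ n / exp (inverse x)) \<longlongrightarrow> 0) (at_right 0)"
  by (rule filterlim_compose) (rule filterlim_inverse_at_top_right)
 then show ?thesis by (simp add: inverse_eq_divide exp_minus)
qed

lemma has_vector_derivative_flat:
 "((\<lambda>x. if x \<le> 0 then 0 else complex_of_real ((1 / x) ^ n * exp (- (1 / x)))) has_vector_derivative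
  (of_real (- real n) * (if x \<le> 0 then 0 else of_real ((1 / x) ^ (n + 1) * exp (- (1 / x)))) +
   (if x \<le> 0 then 0 else of_real ((1 / x) ^ (n + 2) * exp (- (1 / x)))))) (at x)"
proof -
 define g where "g n x = (if x \<le> 0 then 0 else (1 / x) ^ n * exp (- (1 / x)))" for n and x :: real
 have "(g n has_real_derivative (- real n * g (n + 1) x + g (n + 2) x)) (at x)"
 proof (cases x "0 :: real" rule: linorder_cases)
  case less
  have "((\<lambda>_. 0) has_real_derivative 0) (at x)" by simp
  then have "(g n has_real_derivative 0) (at x)"
   by (rule has_field_derivative_transform_within_open[of _ _ _ "{..<0}"]) (use less in \<open>auto simp: g_def\<close>)
  then show ?thesis using less by (simp add: g_def)
 next
  case greater
  have "((\<lambda>x. (1 / x) ^ n * exp (- (1 / x))) has_real_derivative (- real n * ((1 / x) ^ (n + 1) * exp (- (1 / x))) + (1 / x) ^ (n + 2) * exp (- (1 / x)))) (at x)"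
  proof -
   have d: "((\<lambda>x. 1 / x) has_real_derivative - ((1 / x)\<^sup>2)) (at x)"
    using greater by (auto intro!: derivative_eq_intros simp: field_simps power2_eq_square)
   have "((\<lambda>x. (1 / x) ^ n) has_real_derivative - real n * (1 / x) ^ (n + 1)) (at x)"
    by (rule DERIV_cong[OF DERIV_power[OF d]]) (cases n, simp_all add: power2_eq_square algebra_simps add_divide_distrib diff_divide_distrib)
   moreover have "((\<lambda>x. exp (- (1 / x))) has_real_derivative exp (- (1 / x)) * (1 / x)\<^sup>2) (at x)"
    using greater by (auto intro!: derivative_eq_intros simp: power2_eq_square)
   ultimately have "((\<lambda>x. (1 / x) ^ n * exp (- (1 / x))) has_real_derivative
     (1 / x) ^ n * (exp (- (1 / x)) * (1 / x)\<^sup>2) + - real n * (1 / x) ^ (n + 1) * exp (- (1 / x))) (at x)"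
    by (rule DERIV_mult')
   then show ?thesis by (simp add: power_add power2_eq_square mult_ac)
  qed
  then have "(g n has_real_derivative (- real n * ((1 / x) ^ (n + 1) * exp (- (1 / x))) + (1 / x) ^ (n + 2) * exp (- (1 / x)))) (at x)"
   by (rule has_field_derivative_transform_within_open[of _ _ _ "{0<..}"]) (use greater in \<open>auto simp: g_def\<close>)
  then show ?thesis using greater by (simp add: g_def)
 next
  case equal
  \<comment> \<open>From the right the difference quotient at 0 is the next flat function, with one
    more power of 1/y.\<close>
  have "((\<lambda>y. (g n y - g n 0) / (y - 0)) \<longlongrightarrow> 0) (at 0)"
  proof (rule filterlim_split_at)
   show "((\<lambda>y. (g n y - g n 0) / (y - 0)) \<longlongrightarrow> 0) (at_left 0)"
    by (rule tendsto_eventually) (auto simp: g_def eventually_at_filter)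
   have "\<forall>\<^sub>F y in at_right 0. (1 / y) ^ (n + 1) * exp (- (1 / y)) = (g n y - g n 0) / (y - 0)"
    unfolding eventually_at_filter by (auto simp: g_def)
   then show "((\<lambda>y. (g n y - g n 0) / (y - 0)) \<longlongrightarrow> 0) (at_right 0)"
    by (rule Lim_transform_eventually[OF flat_tendsto_0])
  qed
  then show ?thesis using equal by (simp add: has_field_derivative_iff g_def)
 qed
 then have "((\<lambda>x. complex_of_real (g n x)) has_vector_derivative of_real (- real n * g (n + 1) x + g (n + 2) x)) (at x)"
  by (intro has_vector_derivative_of_real) (simp add: has_real_derivative_iff_has_vector_derivative)
 moreover have "(\<lambda>x. complex_of_real (g n x)) = (\<lambda>x. if x \<le> 0 then 0 else complex_of_real ((1 / x) ^ n * exp (- (1 / x))))"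
  by (auto simp: g_def)
 moreover have "complex_of_real (- real n * g (n + 1) x + g (n + 2) x) = (of_real (- real n) * (if x \<le> 0 then 0 else of_real ((1 / x) ^ (n + 1) * exp (- (1 / x)))) +
   (if x \<le> 0 then 0 else of_real ((1 / x) ^ (n + 2) * exp (- (1 / x)))))"
  by (auto simp: g_def)
 ultimately show ?thesis by (simp only:)
qed

lemma has_vector_derivative_zero_left:
 fixes f :: "real \<Rightarrow> complex"
 assumes "\<And>x. (f has_vector_derivative f' x) (at x)" "\<And>x. x < e \<Longrightarrow> f x = 0" "x < e"
 shows "f' x = 0"
proof -
 have "((\<lambda>_. 0 :: complex) has_vector_derivative 0) (at x)" by simp
 then have "(f has_vector_derivative 0) (at x)"
  by (rule has_vector_derivative_transform_within_open[of _ _ _ "{..<e}"]) (use assms in auto)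
 then show ?thesis using assms(1) vector_derivative_unique_at by blast
qed

lemma elementary_smooth_derivative:
 "elementary_smooth f \<Longrightarrow> \<exists>f'. elementary_smooth f' \<and> (\<forall>x. (f has_vector_derivative f' x) (at x))"
proof (induction rule: elementary_smooth.induct)
 case (const c)
 show ?case by (intro exI[of _ "\<lambda>_. 0"]) (auto intro: elementary_smooth.const)
next
 case ident
 show ?case by (intro exI[of _ "\<lambda>_. 1"]) (auto intro!: elementary_smooth.const derivative_eq_intros has_vector_derivative_of_real)
next
 case exp
 have "((\<lambda>x. complex_of_real (exp x)) has_vector_derivative of_real (exp x)) (at x)" for x
  by (intro has_vector_derivative_of_real) (auto simp: has_real_derivative_iff_has_vector_derivative[symmetric])
 then show ?case by (intro exI[of _ "\<lambda>x. of_real (exp x)"]) (auto intro: elementary_smooth.exp)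
next
 case (flat n)
 have "elementary_smooth (\<lambda>x. of_real (- real n) * (if x \<le> 0 then 0 else of_real ((1 / x) ^ (n + 1) * exp (- (1 / x)))) +
   (if x \<le> 0 then 0 else of_real ((1 / x) ^ (n + 2) * exp (- (1 / x)))))"
  by (rule elementary_smooth.add[OF elementary_smooth.mult[OF elementary_smooth.const elementary_smooth.flat] elementary_smooth.flat])
 then show ?case using has_vector_derivative_flat[of n] by (intro exI conjI allI)
next
 case (add f g)
 then obtain f' g' where "elementary_smooth f'" "elementary_smooth g'" "\<forall>x. (f has_vector_derivative f' x) (at x)" "\<forall>x. (g has_vector_derivative g' x) (at x)"
  by auto
 then show ?case
  by (intro exI[of _ "\<lambda>x. f' x + g' x"]) (auto intro!: elementary_smooth.add derivative_intros)
next
 case (mult f g)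
 then obtain f' g' where "elementary_smooth f'" "elementary_smooth g'" "\<forall>x. (f has_vector_derivative f' x) (at x)" "\<forall>x. (g has_vector_derivative g' x) (at x)"
  by auto
 then show ?case using mult.hyps
  by (intro exI[of _ "\<lambda>x. f x * g' x + f' x * g x"]) (auto intro!: elementary_smooth.add elementary_smooth.mult has_vector_derivative_mult)
next
 case (inverse f)
 then obtain f' where f': "elementary_smooth f'" "\<forall>x. (f has_vector_derivative f' x) (at x)" by auto
 have "((\<lambda>x. inverse (f x)) has_vector_derivative (- 1) * (f' x * (inverse (f x) * inverse (f x)))) (at x)" for x
 proof -
  have "((\<lambda>x. inverse (f x)) has_vector_derivative (f' x * (- (inverse (f x) * inverse (f x))))) (at x)"
  proof (rule field_vector_diff_chain_at[of f _ x inverse, unfolded o_def])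
   show "(f has_vector_derivative f' x) (at x)" using f' by simp
   show "(inverse has_field_derivative - (inverse (f x) * inverse (f x))) (at (f x))"
    using inverse.hyps(2)[of x] by (auto intro!: derivative_eq_intros simp: power2_eq_square)
  qed
  then show ?thesis by simp
 qed
 moreover have "elementary_smooth (\<lambda>x. (- 1) * (f' x * (inverse (f x) * inverse (f x))))"
  using f' inverse.hyps by (intro elementary_smooth.mult elementary_smooth.inverse elementary_smooth.const)
 ultimately show ?case by blast
next
 case (affine f a b)
 then obtain f' where f': "elementary_smooth f'" "\<forall>x. (f has_vector_derivative f' x) (at x)" by auto
 have "((\<lambda>x. f (a + b * x)) has_vector_derivative of_real b * f' (a + b * x)) (at x)" for x
 proof -
  have "((f \<circ> (\<lambda>x. a + b * x)) has_vector_derivative b *\<^sub>R f' (a + b * x)) (at x)"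
   by (rule vector_diff_chain_at) (use f' in \<open>auto intro!: derivative_eq_intros simp: has_real_derivative_iff_has_vector_derivative[symmetric]\<close>)
  then show ?thesis by (simp add: o_def scaleR_conv_of_real)
 qed
 then show ?case using f'
  by (intro exI[of _ "\<lambda>x. of_real b * f' (a + b * x)"])
   (auto intro!: elementary_smooth.mult elementary_smooth.const elementary_smooth.affine[OF f'(1)])
next
 case (power f e s)
 then obtain f' where f': "elementary_smooth f'" "\<forall>x. (f has_vector_derivative f' x) (at x)" by auto
 have z: "f' x = 0" if "x < e" for x
  using has_vector_derivative_zero_left[of f f' e x] f' power.hyps that by auto
 have "((\<lambda>x. complex_of_real (x powr s) * f x) has_vector_derivative of_real s * (of_real (x powr (s - 1)) * f x) + of_real (x powr s) * f' x) (at x)" for x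
 proof (cases "x < e")
  case True
  have "((\<lambda>_. 0 :: complex) has_vector_derivative 0) (at x)" by simp
  then have "((\<lambda>x. complex_of_real (x powr s) * f x) has_vector_derivative 0) (at x)"
   by (rule has_vector_derivative_transform_within_open[of _ _ _ "{..<e}"]) (use True power.hyps in auto)
  then show ?thesis using True z power.hyps by simp
 next
  case False
  then have x: "0 < x" using power.hyps by simp
  have "((\<lambda>x. complex_of_real (x powr s)) has_vector_derivative of_real (s * x powr (s - 1))) (at x)"
   using x by (intro has_vector_derivative_of_real) (auto simp: has_real_derivative_iff_has_vector_derivative[symmetric] intro!: derivative_eq_intros)
  from has_vector_derivative_mult[OF this f'(2)[rule_format, of x]] show ?thesis by (simp add: algebra_simps)
 qed
 moreover have "elementary_smooth (\<lambda>x. of_real s * (of_real (x powr (s - 1)) * f x) + of_real (x powr s) * f' x)"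
  using power.hyps f' z
  by (intro elementary_smooth.add elementary_smooth.mult[OF elementary_smooth.const] elementary_smooth.power[of _ e]) auto
 ultimately show ?case by blast
qed

lemma elementary_smooth_continuous: "elementary_smooth f \<Longrightarrow> continuous_on S f"
 by (meson elementary_smooth_derivative has_vector_derivative_continuous continuous_at_imp_continuous_on)

section \<open>Radial multipliers\<close>

lemma integrable_continuous_compact_support:
 fixes f :: "'a::euclidean_space \<Rightarrow> 'b::euclidean_space"
 assumes "continuous_on UNIV f" "compact S" "\<And>x. x \<notin> S \<Longrightarrow> f x = 0"
 shows "L1 f"
proof -
 have "L1 (\<lambda>x. indicator S x *\<^sub>R f x)"
  using assms by (intro borel_integrable_compact continuous_on_subset[OF assms(1)]) auto
 also have "(\<lambda>x. indicator S x *\<^sub>R f x) = f" using assms(3) by (auto simp: indicator_def)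
 finally show ?thesis .
qed

lemma has_vector_derivative_zero_outside:
 fixes f :: "real \<Rightarrow> complex"
 assumes "\<And>x. (f has_vector_derivative f' x) (at x)" "\<And>x. x \<notin> {a..b} \<Longrightarrow> f x = 0" "x \<notin> {a..b}"
 shows "f' x = 0"
proof -
 have "((\<lambda>_. 0 :: complex) has_vector_derivative 0) (at x)" by simp
 then have "(f has_vector_derivative 0) (at x)"
  by (rule has_vector_derivative_transform_within_open[of _ _ _ "- {a..b}"]) (use assms in auto)
 then show ?thesis using assms(1) vector_derivative_unique_at by blast
qed

lemma fourier_has_vector_derivative:
 fixes h h' :: "real \<Rightarrow> complex"
 assumes d: "\<And>x. (h has_vector_derivative h' x) (at x)" and c: "continuous_on UNIV h'"
  and z: "\<And>x. x \<notin> {a..b} \<Longrightarrow> h x = 0" and ab: "a \<le> b"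
 shows "fourier h' v = \<i> * of_real v * fourier h v"
proof -
 have z': "h' x = 0" if "x \<notin> {a..b}" for x
  using has_vector_derivative_zero_outside[of h h' a b x] d z that by blast
 have ch: "continuous_on UNIV h"
  using d by (meson has_vector_derivative_continuous continuous_at_imp_continuous_on)
 have ih: "L1 h" "L1 h'"
  by (rule integrable_continuous_compact_support[of _ "{a..b}"]; use ch c z z' in auto)+
 have [measurable]: "h \<in> Borel" "h' \<in> Borel" using ih by auto
 define G' where "G' x = cis (- (x * v)) * h' x + (- \<i> * of_real v * cis (- (x * v))) * h x" for x
 have dG: "((\<lambda>x. cis (- (x * v)) * h x) has_vector_derivative G' x) (at x)" for x
 proof -
  have "((\<lambda>z. exp (- (\<i> * of_real v) * z)) has_field_derivative - (\<i> * of_real v) * exp (- (\<i> * of_real v) * of_real x)) (at (of_real x))"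
   by (auto intro!: derivative_eq_intros)
  from has_vector_derivative_real_field[OF this]
  have "((\<lambda>x. cis (- (x * v))) has_vector_derivative - \<i> * of_real v * cis (- (x * v))) (at x)"
   by (simp add: o_def cis_conv_exp mult_ac)
  from has_vector_derivative_mult[OF this d] show ?thesis unfolding G'_def by simp
 qed
 \<comment> \<open>Enlarged by 1 on both sides: \<open>h\<close> is assumed to vanish outside
   \<open>{a..b}\<close>, so the boundary terms drop at the new end points.\<close>
 have "integral\<^sup>L lborel (\<lambda>x. indicator {a - 1 .. b + 1} x *\<^sub>R G' x) = cis (- ((b + 1) * v)) * h (b + 1) - cis (- ((a - 1) * v)) * h (a - 1)"
 proof (rule integral_FTC_atLeastAtMost)
  show "continuous_on {a - 1..b + 1} G'"
   unfolding G'_def by (intro continuous_intros continuous_on_subset[OF c] continuous_on_subset[OF ch]) auto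
 qed (use ab dG in \<open>auto intro: has_vector_derivative_at_within\<close>)
 also have "(\<lambda>x. indicator {a - 1 .. b + 1} x *\<^sub>R G' x) = G'"
  using z z' by (auto simp: indicator_def G'_def fun_eq_iff)
 also have "integral\<^sup>L lborel G' = fourier h' v - \<i> * of_real v * fourier h v"
 proof -
  have G': "G' = (\<lambda>x. cis (- (x \<bullet> v)) * h' x + (- \<i> * of_real v) * (cis (- (x \<bullet> v)) * h x))"
   by (simp add: G'_def fun_eq_iff mult.assoc)
  show ?thesis
   unfolding G' fourier_lborel[OF \<open>h \<in> Borel\<close>] fourier_lborel[OF \<open>h' \<in> Borel\<close>]
   using integrable_cis_mult(2)[OF ih(2), of v] integrable_cis_mult(2)[OF ih(1), of v]
   by (subst lebesgue_integral_add) simp_all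
 qed
 finally show ?thesis using z by simp
qed

lemma elementary_smooth_fourier_decay:
 assumes "elementary_smooth h" "\<And>x. x \<notin> {a..b} \<Longrightarrow> h x = 0" "a \<le> b"
 shows "\<exists>C. \<forall>v. \<bar>v\<bar> ^ n * norm (fourier h v) \<le> C"
 using assms(1,2)
proof (induction n arbitrary: h)
 case 0
 have "L1 h"
  by (rule integrable_continuous_compact_support[of _ "{a..b}"]) (use 0 elementary_smooth_continuous in auto)
 from norm_fourier_le[OF this] show ?case
  by (intro exI[of _ "LINT x|lborel. norm (h x)"]) simp
next
 case (Suc n)
 obtain h' where h': "elementary_smooth h'" "\<And>x. (h has_vector_derivative h' x) (at x)"
  using elementary_smooth_derivative[OF Suc.prems(1)] by blast
 have "h' x = 0" if "x \<notin> {a..b}" for x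
  using has_vector_derivative_zero_outside[of h h' a b x] h' Suc.prems that by blast
 then obtain C where C: "\<And>v. \<bar>v\<bar> ^ n * norm (fourier h' v) \<le> C" using Suc.IH[OF h'(1)] by auto
 have "fourier h' v = \<i> * of_real v * fourier h v" for v
  by (rule fourier_has_vector_derivative[OF h'(2) elementary_smooth_continuous[OF h'(1)] Suc.prems(2) assms(3)])
 then have "\<bar>v\<bar> ^ Suc n * norm (fourier h v) = \<bar>v\<bar> ^ n * norm (fourier h' v)" for v
  by (simp add: norm_mult)
 with C have "\<bar>v\<bar> ^ Suc n * norm (fourier h v) \<le> C" for v by (simp only:)
 then show ?case by blast
qed

lemma continuous_AE_eq:
 fixes f g :: "'a::euclidean_space \<Rightarrow> complex"
 assumes "continuous_on UNIV f" "continuous_on UNIV g" "AE x in lborel. f x = g x"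
 shows "f x = g x"
proof (rule ccontr)
 assume "f x \<noteq> g x"
 moreover have o: "open {x. f x \<noteq> g x}" using assms by (intro open_Collect_neq) auto
 ultimately have "\<not> negligible {x. f x \<noteq> g x}" using open_not_negligible by blast
 moreover have "AE x in lebesgue. x \<notin> {x. f x \<noteq> g x}" using assms(3) by (simp add: AE_completion)
 then have "{x. f x \<noteq> g x} \<in> null_sets lebesgue"
  using o by (subst AE_iff_null_sets) auto
 ultimately show False by (simp add: negligible_iff_null_sets)
qed

lemma continuous_on_inv_fourier:
 fixes m :: "'a::euclidean_space \<Rightarrow> complex"
 assumes "L1 m"
 shows "continuous_on UNIV (inv_fourier m)"
proof -
 have "inv_fourier m = (\<lambda>x. fourier m (- x) /\<^sub>R (2 * pi) ^ DIM('a))"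
  using assms by (auto simp: inv_fourier_lborel fourier_lborel inner_commute)
 then show ?thesis
  by (auto intro!: continuous_intros continuous_on_compose2[OF continuous_on_fourier[OF assms]])
qed

lemma fourier_inversion_continuous:
 assumes "L1 f" "L1 (fourier f)" "continuous_on UNIV f"
 shows "inv_fourier (fourier f) x = f x"
 by (rule continuous_AE_eq[OF continuous_on_inv_fourier[OF assms(2)] assms(3) fourier_inversion_AE[OF assms(1,2)]])

lemma elementary_smooth_fourier_weighted_integrable:
 assumes h: "elementary_smooth h" "\<And>x. x \<notin> {a..b} \<Longrightarrow> h x = 0" "a \<le> b"
 shows "L1 (\<lambda>v. norm (fourier h v) * (1 + \<bar>v\<bar>) ^ n)"
proof -
 have ih: "L1 h"
  by (rule integrable_continuous_compact_support[of _ "{a..b}"]) (use h elementary_smooth_continuous in auto)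
 have [measurable]: "fourier h \<in> Borel" by (rule borel_measurable_fourier[OF ih])
 obtain C0 where C0: "\<And>v. norm (fourier h v) \<le> C0"
  using elementary_smooth_fourier_decay[OF h, of 0] by auto
 \<comment> \<open>Two orders more than the weight, to leave the integrable majorant 1 / (1 +
   v^2).\<close>
 obtain C1 where C1: "\<And>v. \<bar>v\<bar> ^ (n + 2) * norm (fourier h v) \<le> C1"
  using elementary_smooth_fourier_decay[OF h, of "n + 2"] by auto
 have C: "0 \<le> C0" "0 \<le> C1" using order_trans[OF norm_ge_zero C0[of 0]] C1[of 0] by auto
 define C where "C = 2 ^ (n + 2) * (C0 + C1)"
 have b: "norm (fourier h v) * (1 + \<bar>v\<bar>) ^ n \<le> C * inverse (1 + v\<^sup>2)" for v
 proof -
  have "(1 + \<bar>v\<bar>) ^ (n + 2) * norm (fourier h v) \<le> C"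
  proof (cases "\<bar>v\<bar> \<le> 1")
   case True
   have "(1 + \<bar>v\<bar>) ^ (n + 2) * norm (fourier h v) \<le> 2 ^ (n + 2) * C0"
    using True C0 by (intro mult_mono power_mono) auto
   also have "\<dots> \<le> C" using C unfolding C_def by (intro mult_left_mono) auto
   finally show ?thesis .
  next
   case False
   have "(1 + \<bar>v\<bar>) ^ (n + 2) * norm (fourier h v) \<le> (2 * \<bar>v\<bar>) ^ (n + 2) * norm (fourier h v)"
    using False by (intro mult_right_mono power_mono) auto
   also have "\<dots> = 2 ^ (n + 2) * (\<bar>v\<bar> ^ (n + 2) * norm (fourier h v))" by (simp only: power_mult_distrib mult.assoc)
   also have "\<dots> \<le> 2 ^ (n + 2) * C1" by (intro mult_left_mono C1) auto
   also have "\<dots> \<le> C" using C unfolding C_def by (intro mult_left_mono) auto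
   finally show ?thesis .
  qed
  moreover have "norm (fourier h v) * (1 + \<bar>v\<bar>) ^ n * (1 + v\<^sup>2) \<le> norm (fourier h v) * (1 + \<bar>v\<bar>) ^ n * (1 + \<bar>v\<bar>)\<^sup>2"
   by (intro mult_left_mono) (auto simp: power2_eq_square algebra_simps)
  moreover have "norm (fourier h v) * (1 + \<bar>v\<bar>) ^ n * (1 + \<bar>v\<bar>)\<^sup>2 = (1 + \<bar>v\<bar>) ^ (n + 2) * norm (fourier h v)"
   by (simp add: power_add power2_eq_square mult_ac)
  ultimately have "norm (fourier h v) * (1 + \<bar>v\<bar>) ^ n * (1 + v\<^sup>2) \<le> C" by linarith
  moreover have "0 < 1 + v\<^sup>2" by (simp add: add_pos_nonneg)
  ultimately show ?thesis by (simp add: field_simps)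
 qed
 have "L1 (\<lambda>v::real. inverse (1 + v\<^sup>2))"
  using integrable_inverse_1_plus_square by (simp add: set_integrable_def einterval_def)
 then have "L1 (\<lambda>v. C * inverse (1 + v\<^sup>2))" by (rule integrable_mult_right)
 then show ?thesis
 proof (rule lebesgue_integrable_bound)
  have "norm (norm (fourier h v) * (1 + \<bar>v\<bar>) ^ n) \<le> norm (C * inverse (1 + v\<^sup>2))" for v
  proof -
   have "norm (norm (fourier h v) * (1 + \<bar>v\<bar>) ^ n) = norm (fourier h v) * (1 + \<bar>v\<bar>) ^ n" by simp
   then show ?thesis using b[of v] abs_ge_self[of "C * inverse (1 + v\<^sup>2)"] by simp
  qed
  then show "AE v in lborel. norm (norm (fourier h v) * (1 + \<bar>v\<bar>) ^ n) \<le> norm (C * inverse (1 + v\<^sup>2))" by simp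
 qed measurable
qed

text \<open>One-dimensional Fourier inversion of H(r) = e^r h(r) writes h(r) as an integral of
  exp(-(1 - i v) r) against the transform of \<open>H\<close> divided by 2 pi. At r = |\<xi>|^2 this
  is a superposition of heat kernels at times 1 - i v. Their L1 norms grow polynomially in v, while
  the transform of \<open>H\<close> decays faster than any power. The factor e^r moves the times
  into the right half-plane.\<close>

lemma radial_multiplier:
 assumes h: "elementary_smooth h" "\<And>x. x \<notin> {a..b} \<Longrightarrow> h x = 0"
 shows "\<exists>B. L1_multiplier B (\<lambda>\<xi>::'a::euclidean_space. h ((norm \<xi>)\<^sup>2))"
proof (cases "a \<le> b")
 case False
 then have "h x = 0" for x using h(2)[of x] by auto
 then show ?thesis by (intro exI[of _ 0] L1_multiplierI[of "\<lambda>_. 0"]) (auto simp: fourier_def)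
next
 case ab: True
 define H where "H x = of_real (exp x) * h x" for x
 have H: "elementary_smooth H" "\<And>x. x \<notin> {a..b} \<Longrightarrow> H x = 0"
  unfolding H_def using h by (auto intro: elementary_smooth.mult[OF elementary_smooth.exp])
 have iH: "L1 H"
  by (rule integrable_continuous_compact_support[of _ "{a..b}"]) (use H elementary_smooth_continuous in auto)
 have [measurable]: "fourier H \<in> Borel" by (rule borel_measurable_fourier[OF iH])
 note w = elementary_smooth_fourier_weighted_integrable[OF H ab]
 have iFH: "L1 (fourier H)" using w[of 0] by (simp add: integrable_norm_iff)
 define \<mu> where "\<mu> v = fourier H v / of_real (2 * pi)" for v
 define w where "w v = 1 - \<i> * of_real v" for v
 have [measurable]: "\<mu> \<in> Borel" "w \<in> Borel" unfolding \<mu>_def w_def by measurable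
 have Rew: "Re (w v) = 1" for v by (simp add: w_def)
 have nw: "norm (w v) \<le> 1 + \<bar>v\<bar>" for v
  unfolding w_def by (rule order_trans[OF norm_triangle_ineq4]) (simp add: norm_mult)
 have int: "L1 (\<lambda>v. norm (\<mu> v) * (norm (w v) / Re (w v)) powr (DIM('a) / 2))"
 proof (rule lebesgue_integrable_bound)
  show "L1 (\<lambda>v. norm (fourier H v) * (1 + \<bar>v\<bar>) ^ DIM('a))" by (rule w)
  show "AE v in lborel. norm (norm (\<mu> v) * (norm (w v) / Re (w v)) powr (DIM('a) / 2)) \<le> norm (norm (fourier H v) * (1 + \<bar>v\<bar>) ^ DIM('a))"
  proof (rule AE_I2)
   fix v
   have "(norm (w v) / Re (w v)) powr (DIM('a) / 2) \<le> (1 + \<bar>v\<bar>) powr (DIM('a) / 2)"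
    using nw by (intro powr_mono2) (auto simp: Rew)
   also have "\<dots> \<le> (1 + \<bar>v\<bar>) powr DIM('a)" by (intro powr_mono) auto
   also have "\<dots> = (1 + \<bar>v\<bar>) ^ DIM('a)" by (simp add: powr_realpow)
   finally have "(norm (w v) / Re (w v)) powr (DIM('a) / 2) \<le> (1 + \<bar>v\<bar>) ^ DIM('a)" .
   moreover have "norm (\<mu> v) \<le> norm (fourier H v)"
    using pi_gt3 by (auto simp: \<mu>_def norm_divide divide_le_eq mult_le_cancel_left1)
   ultimately show "norm (norm (\<mu> v) * (norm (w v) / Re (w v)) powr (DIM('a) / 2)) \<le> norm (norm (fourier H v) * (1 + \<bar>v\<bar>) ^ DIM('a))"
    by (auto simp: abs_mult intro!: mult_mono)
  qed
 qed measurable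
 have eq: "(LINT v|lborel. \<mu> v * exp (- (w v * of_real ((norm \<xi>)\<^sup>2)))) = h ((norm \<xi>)\<^sup>2)" for \<xi> :: 'a
 proof -
  define r where "r = (norm \<xi>)\<^sup>2"
  have "H r = (LINT v|lborel. cis (r * v) * fourier H v) / of_real (2 * pi)"
  proof -
   have "H r = inv_fourier (fourier H) r"
    by (rule fourier_inversion_continuous[OF iH iFH elementary_smooth_continuous[OF H(1)], symmetric])
   also have "\<dots> = (LINT v|lborel. cis (r * v) * fourier H v) /\<^sub>R (2 * pi)"
    by (subst inv_fourier_lborel) simp_all
   finally show ?thesis by (simp only: scaleR_conv_of_real divide_inverse mult.commute of_real_inverse)
  qed
  then have "h r = of_real (exp (- r)) * ((LINT v|lborel. cis (r * v) * fourier H v) / of_real (2 * pi))"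
   unfolding H_def by (simp add: exp_minus field_simps)
  also have "\<dots> = (LINT v|lborel. of_real (exp (- r)) * (cis (r * v) * fourier H v) / of_real (2 * pi))"
   by simp
  also have "\<dots> = (LINT v|lborel. \<mu> v * exp (- (w v * of_real r)))"
  proof (intro lebesgue_integral_cong refl)
   fix v
   have "exp (- (w v * of_real r)) = exp (of_real (- r)) * exp (\<i> * of_real (r * v))"
    by (simp add: w_def algebra_simps flip: exp_add)
   then show "of_real (exp (- r)) * (cis (r * v) * fourier H v) / of_real (2 * pi) = \<mu> v * exp (- (w v * of_real r))"
    by (simp only: \<mu>_def cis_conv_exp exp_of_real) simp
  qed
  finally show ?thesis unfolding r_def ..
 qed
 have pos: "\<mu> v \<noteq> 0 \<Longrightarrow> 0 < Re (w v)" for v by (simp add: Rew)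
 have m: "w \<in> Borel" "\<mu> \<in> Borel" by measurable
 have "L1_multiplier (LINT v|lborel. norm (\<mu> v) * (norm (w v) / Re (w v)) powr (DIM('a) / 2)) (\<lambda>\<xi>::'a. h ((norm \<xi>)\<^sup>2))"
 proof (rule L1_multiplierI)
  show "L1 (\<lambda>x::'a. LINT v|lborel. \<mu> v * heat_kernel (w v) x)"
   by (rule integrable_heat_superposition[OF m _ int]) (rule pos)
  show "(LINT x::'a|lborel. norm (LINT v|lborel. \<mu> v * heat_kernel (w v) x)) \<le> (LINT v|lborel. norm (\<mu> v) * (norm (w v) / Re (w v)) powr (DIM('a) / 2))"
   by (rule norm_heat_superposition_le[OF m _ int]) (rule pos)
  show "fourier (\<lambda>x::'a. LINT v|lborel. \<mu> v * heat_kernel (w v) x) \<xi> = h ((norm \<xi>)\<^sup>2)" for \<xi>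
   unfolding eq[symmetric] by (rule fourier_heat_superposition[OF m _ int]) (rule pos)
 qed
 then show ?thesis by blast
qed

section \<open>Smooth cutoffs and homogeneous symbols\<close>

definition smooth_step :: "real \<Rightarrow> complex" where
 "smooth_step x = (if x \<le> 0 then 0 else of_real (exp (- (1 / x)))) *
  inverse ((if x \<le> 0 then 0 else of_real (exp (- (1 / x)))) + (if 1 - x \<le> 0 then 0 else of_real (exp (- (1 / (1 - x))))))"

lemma elementary_smooth_step: "elementary_smooth smooth_step"
proof -
 define f :: "real \<Rightarrow> complex" where "f x = (if x \<le> 0 then 0 else of_real ((1 / x) ^ 0 * exp (- (1 / x))))" for x
 have f: "elementary_smooth f" unfolding f_def by (rule elementary_smooth.flat)
 have nz: "f x + f (1 + (- 1) * x) \<noteq> 0" for x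
  by (auto simp: f_def simp del: of_real_exp simp flip: of_real_add)
   (use add_pos_pos[of "exp (- (1 / x))" "exp (- (1 / (1 - x)))"] in auto)
 have "elementary_smooth (\<lambda>x. f x * inverse (f x + f (1 + (- 1) * x)))"
  by (intro elementary_smooth.mult elementary_smooth.inverse elementary_smooth.add f elementary_smooth.affine[OF f] nz)
 moreover have "smooth_step = (\<lambda>x. f x * inverse (f x + f (1 + (- 1) * x)))"
  by (auto simp: smooth_step_def f_def fun_eq_iff)
 ultimately show ?thesis by simp
qed

lemma smooth_step_eq_0: "x \<le> 0 \<Longrightarrow> smooth_step x = 0"
 by (simp add: smooth_step_def)

lemma smooth_step_eq_1: "1 \<le> x \<Longrightarrow> smooth_step x = 1"
 by (simp add: smooth_step_def)

text \<open>The argument stands for |\<xi>|^2. The first factor is 1 for r >= 0 and gives compact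
  support on the whole line; the second keeps the value 1 up to |\<xi>| = 2.\<close>

definition ball_cutoff :: "real \<Rightarrow> complex" where
 "ball_cutoff r = smooth_step (1 + 1 * r) * smooth_step (5 + (- 1) * r)"

text \<open>In terms of r = |\<xi>|^2, equal to 1 for 1/2 <= |\<xi>| <= 2, which is where the dyadic
  symbols of positive index live after rescaling.\<close>

definition annulus_cutoff :: "real \<Rightarrow> complex" where
 "annulus_cutoff r = smooth_step (- 1 + 8 * r) * smooth_step (5 + (- 1) * r)"

lemma elementary_smooth_cutoffs: "elementary_smooth ball_cutoff" "elementary_smooth annulus_cutoff"
 unfolding ball_cutoff_def[abs_def] annulus_cutoff_def[abs_def]
 by (intro elementary_smooth.mult elementary_smooth.affine[OF elementary_smooth_step])+

lemma ball_cutoff_eq: "0 \<le> r \<Longrightarrow> r \<le> 4 \<Longrightarrow> ball_cutoff r = 1" "r \<notin> {- 1..5} \<Longrightarrow> ball_cutoff r = 0"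
 "5 \<le> r \<Longrightarrow> ball_cutoff r = 0"
 by (auto simp: ball_cutoff_def smooth_step_eq_0 smooth_step_eq_1)

lemma annulus_cutoff_eq: "1/4 \<le> r \<Longrightarrow> r \<le> 4 \<Longrightarrow> annulus_cutoff r = 1" "r \<notin> {1/8..5} \<Longrightarrow> annulus_cutoff r = 0"
 by (auto simp: annulus_cutoff_def smooth_step_eq_0 smooth_step_eq_1)

lemma annulus_power_multiplier:
 "\<exists>B. L1_multiplier B (\<lambda>\<xi>::'a::euclidean_space. of_real ((norm \<xi>)\<^sup>2 powr s) * annulus_cutoff ((norm \<xi>)\<^sup>2))"
proof (rule radial_multiplier)
 show "elementary_smooth (\<lambda>r. of_real (r powr s) * annulus_cutoff r)"
  by (rule elementary_smooth.power[of _ "1/8"]) (auto intro: elementary_smooth_cutoffs annulus_cutoff_eq)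
 show "of_real (r powr s) * annulus_cutoff r = 0" if "r \<notin> {1/8..5}" for r
  using that by (simp add: annulus_cutoff_eq)
qed

text \<open>|\<xi>|^a is in general not smooth at the origin, so the ball is cut into dyadic annuli
  by telescoping the cutoff. The i-th piece is a dilate of the first one times 2^(-a i), and the
  geometric series sums the kernels. The origin is excluded because \<open>0 powr 0 = 0\<close>
  differs from the value of the continuous symbol when a = 0.\<close>

lemma ball_power_multiplier:
 assumes a: "0 \<le> a"
 shows "\<exists>B m. L1_multiplier B m \<and> (\<forall>\<xi>::'a::euclidean_space. \<xi> \<noteq> 0 \<longrightarrow> m \<xi> = of_real (norm \<xi> powr a) * ball_cutoff ((norm \<xi>)\<^sup>2))"
proof (cases "a = 0")
 case True
 obtain B where "L1_multiplier B (\<lambda>\<xi>::'a. ball_cutoff ((norm \<xi>)\<^sup>2))"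
  using radial_multiplier[OF elementary_smooth_cutoffs(1) ball_cutoff_eq(2)] by blast
 then show ?thesis using True by auto
next
 case False
 \<comment> \<open>For 0 <= r <= 1 both cutoffs are 1 and cancel; the last factor extends the zero
   to negative r, as the rule \<open>power\<close> of \<open>elementary_smooth\<close>
   requires.\<close>
 define \<psi> where "\<psi> r = (ball_cutoff r + (- 1) * ball_cutoff (0 + 4 * r)) * smooth_step (- 1 + 2 * r)" for r
 have \<psi>: "\<psi> r = ball_cutoff r - ball_cutoff (4 * r)" if "0 \<le> r" for r
  using that by (cases "r \<le> 1") (auto simp: \<psi>_def ball_cutoff_eq smooth_step_eq_1)
 have "\<exists>B. L1_multiplier B (\<lambda>\<xi>::'a. of_real ((norm \<xi>)\<^sup>2 powr (a / 2)) * \<psi> ((norm \<xi>)\<^sup>2))"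
 proof (rule radial_multiplier)
  have "elementary_smooth \<psi>"
   unfolding \<psi>_def by (intro elementary_smooth.mult elementary_smooth.add elementary_smooth.const elementary_smooth_cutoffs
     elementary_smooth.affine[OF elementary_smooth_cutoffs(1)] elementary_smooth.affine[OF elementary_smooth_step])
  then show "elementary_smooth (\<lambda>r. of_real (r powr (a / 2)) * \<psi> r)"
   by (rule elementary_smooth.power[of _ "1/2"]) (auto simp: \<psi>_def smooth_step_eq_0)
  show "of_real (r powr (a / 2)) * \<psi> r = 0" if "r \<notin> {1/2..5}" for r
  proof (cases "r < 1/2")
   case True
   then show ?thesis by (simp add: \<psi>_def smooth_step_eq_0)
  next
   case False
   then show ?thesis using that by (simp add: \<psi> ball_cutoff_eq)
  qed
 qed
 then obtain B where B: "L1_multiplier B (\<lambda>\<xi>::'a. of_real ((norm \<xi>)\<^sup>2 powr (a / 2)) * \<psi> ((norm \<xi>)\<^sup>2))" by blast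
 have pw: "(norm \<xi>)\<^sup>2 powr (a / 2) = norm \<xi> powr a" for \<xi> :: 'a
  by (cases "\<xi> = 0") (use False in \<open>auto simp: powr_powr simp flip: powr_numeral\<close>)
 define m where "m i \<xi> = of_real (norm \<xi> powr a) * (ball_cutoff (4 ^ i * (norm \<xi>)\<^sup>2) - ball_cutoff (4 ^ Suc i * (norm \<xi>)\<^sup>2))" for i and \<xi> :: 'a
 have mL: "L1_multiplier ((2 powr (- a)) ^ i * B) (m i)" for i
 proof -
  have "L1_multiplier (norm (of_real ((2 powr (- a)) ^ i) :: complex) * B) (\<lambda>\<xi>::'a. of_real ((2 powr (- a)) ^ i) * (of_real ((norm (2 ^ i *\<^sub>R \<xi>))\<^sup>2 powr (a / 2)) * \<psi> ((norm (2 ^ i *\<^sub>R \<xi>))\<^sup>2)))"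
   by (intro L1_multiplier_cmult L1_multiplier_dilate[where m="\<lambda>\<xi>. of_real ((norm \<xi>)\<^sup>2 powr (a / 2)) * \<psi> ((norm \<xi>)\<^sup>2)"]) (use B in auto)
  moreover have "of_real ((2 powr (- a)) ^ i) * (of_real ((norm (2 ^ i *\<^sub>R \<xi>))\<^sup>2 powr (a / 2)) * \<psi> ((norm (2 ^ i *\<^sub>R \<xi>))\<^sup>2)) = m i \<xi>" for \<xi> :: 'a
  proof -
   have e1: "(norm (2 ^ i *\<^sub>R \<xi>))\<^sup>2 = 4 ^ i * (norm \<xi>)\<^sup>2"
    by (simp add: power_mult_distrib power2_eq_square flip: power_mult_distrib)
   have "(2 powr (- a)) ^ i * norm (2 ^ i *\<^sub>R \<xi>) powr a = norm \<xi> powr a"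
   proof -
    have "norm (2 ^ i *\<^sub>R \<xi>) powr a = (2 ^ i) powr a * norm \<xi> powr a" by (simp add: powr_mult)
    moreover have "(2 ^ i :: real) powr a = (2 powr a) ^ i"
     by (simp add: powr_realpow[symmetric] powr_powr mult.commute)
    ultimately show ?thesis by (simp add: powr_minus power_inverse mult.assoc[symmetric])
   qed
   then have e2: "complex_of_real ((2 powr (- a)) ^ i) * of_real (norm (2 ^ i *\<^sub>R \<xi>) powr a) = of_real (norm \<xi> powr a)"
    by (simp only: of_real_mult[symmetric])
   show ?thesis unfolding pw mult.assoc[symmetric] e2 unfolding e1 by (simp add: m_def \<psi> mult.assoc)
  qed
  ultimately show ?thesis by (simp add: norm_power)
 qed
 have small: "2 powr (- a) < 1" using False a powr_less_mono[of "- a" 0 2] by simp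
 have "L1_multiplier (\<Sum>i. (2 powr (- a)) ^ i * B) (\<lambda>\<xi>::'a. if \<xi> = 0 then 0 else of_real (norm \<xi> powr a) * ball_cutoff ((norm \<xi>)\<^sup>2))"
 proof (rule L1_multiplier_suminf[OF mL])
  show "summable (\<lambda>i. (2 powr (- a)) ^ i * B)" using small by (intro summable_mult2 summable_geometric) auto
  fix \<xi> :: 'a
  show "(\<lambda>i. m i \<xi>) sums (if \<xi> = 0 then 0 else of_real (norm \<xi> powr a) * ball_cutoff ((norm \<xi>)\<^sup>2))"
  proof (cases "\<xi> = 0")
   case False
   have "(\<lambda>n. ball_cutoff (4 ^ n * (norm \<xi>)\<^sup>2)) \<longlonglongrightarrow> 0"
   proof (rule tendsto_eventually)
    obtain N where N: "5 / (norm \<xi>)\<^sup>2 < 4 ^ N" using real_arch_pow[of 4 "5 / (norm \<xi>)\<^sup>2"] by auto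
    have "ball_cutoff (4 ^ n * (norm \<xi>)\<^sup>2) = 0" if "N \<le> n" for n
    proof (rule ball_cutoff_eq(3))
     have "(4::real) ^ N \<le> 4 ^ n" using that by (intro power_increasing) auto
     with N have "5 / (norm \<xi>)\<^sup>2 \<le> 4 ^ n" by linarith
     then show "5 \<le> 4 ^ n * (norm \<xi>)\<^sup>2" using False by (simp add: divide_le_eq)
    qed
    then show "\<forall>\<^sub>F n in sequentially. ball_cutoff (4 ^ n * (norm \<xi>)\<^sup>2) = 0"
     using eventually_sequentially by blast
   qed
   from telescope_sums'[OF this] have "(\<lambda>i. ball_cutoff (4 ^ i * (norm \<xi>)\<^sup>2) - ball_cutoff (4 ^ Suc i * (norm \<xi>)\<^sup>2)) sums (ball_cutoff ((norm \<xi>)\<^sup>2))"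
    by simp
   then show ?thesis using False unfolding m_def by (simp only: if_False) (rule sums_mult)
  qed (use False in \<open>simp add: m_def\<close>)
 qed
 then show ?thesis by (intro exI conjI) auto
qed

section \<open>Hankel's formula\<close>

text \<open>
 By reflection symmetry only the upper half of Hankel's contour is needed: for an integrand that is
 real on the positive axis, the full contour integral is \<open>2 \<i>\<close> times the imaginary part of the
 integral over the half. The half contour is the ray from \<open>R\<close> in the direction \<open>cis \<theta>\<close>.
\<close>

definition ray :: "real \<Rightarrow> real \<Rightarrow> real \<Rightarrow> complex" where
 "ray \<theta> R x = of_real R + cis \<theta> * of_real x"

definition ray_integral :: "real \<Rightarrow> real \<Rightarrow> (complex \<Rightarrow> complex) \<Rightarrow> complex" where
 "ray_integral \<theta> R f = (LINT x|lborel. indicator {0..} x *\<^sub>R (cis \<theta> * f (ray \<theta> R x)))"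

lemma borel_measurable_ray [measurable]: "ray \<theta> R \<in> Borel"
 unfolding ray_def by measurable

lemma ray_simps: "Re (ray \<theta> R x) = R + x * cos \<theta>" "Im (ray \<theta> R x) = x * sin \<theta>"
 by (simp_all add: ray_def)

lemma norm_ray_le: "0 \<le> R \<Longrightarrow> 0 \<le> x \<Longrightarrow> norm (ray \<theta> R x) \<le> R + x"
 unfolding ray_def by (rule order_trans[OF norm_triangle_ineq]) (simp add: norm_mult)

text \<open>\<open>R * sin \<theta>\<close> is the distance from 0 to the line carrying the ray; the
  identity measures the position along that line from the foot of the perpendicular.\<close>

lemma norm_ray_ge:
 assumes "0 \<le> R" "0 \<le> x" "0 \<le> sin \<theta>"
 shows "R * sin \<theta> \<le> norm (ray \<theta> R x)" "x * sin \<theta> \<le> norm (ray \<theta> R x)"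
proof -
 have "(R + x * cos \<theta>)\<^sup>2 + (x * sin \<theta>)\<^sup>2 = (R * sin \<theta>)\<^sup>2 + (R * cos \<theta> + x)\<^sup>2"
  using sin_cos_squared_add[of \<theta>] by algebra
 then have "(R * sin \<theta>)\<^sup>2 \<le> (norm (ray \<theta> R x))\<^sup>2"
  by (simp add: cmod_power2 ray_simps)
 moreover have "(x * sin \<theta>)\<^sup>2 \<le> (norm (ray \<theta> R x))\<^sup>2"
  by (simp add: cmod_power2 ray_simps)
 ultimately show "R * sin \<theta> \<le> norm (ray \<theta> R x)" "x * sin \<theta> \<le> norm (ray \<theta> R x)"
  by (auto intro: power2_le_imp_le)
qed

lemma half_plane_Arg:
 assumes "0 < Im (z * cis \<eta>)" "0 < \<eta>" "\<eta> < pi"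
 shows "z \<noteq> 0" "- \<eta> < Arg z" "Arg z < pi - \<eta>"
proof -
 show z: "z \<noteq> 0" using assms by auto
 have "z = of_real (norm z) * cis (Arg z)" using Arg_eq[OF z] by (simp add: cis_conv_exp)
 then have "z * cis \<eta> = of_real (norm z) * cis (Arg z + \<eta>)" by (metis cis_mult mult.assoc)
 then have "Im (z * cis \<eta>) = norm z * sin (Arg z + \<eta>)" by simp
 then have s: "0 < sin (Arg z + \<eta>)" using assms z by (simp add: zero_less_mult_iff)
 have b: "- pi < Arg z" "Arg z \<le> pi" using mpi_less_Arg Arg_le_pi by auto
 have "0 < Arg z + \<eta>"
 proof (rule ccontr)
  assume "\<not> 0 < Arg z + \<eta>"
  then have "sin (- (Arg z + \<eta>)) \<ge> 0" using b assms by (intro sin_ge_zero) auto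
  then show False using s by (simp only: sin_minus)
 qed
 moreover have "Arg z + \<eta> < pi"
 proof (rule ccontr)
  assume "\<not> Arg z + \<eta> < pi"
  then have "sin (Arg z + \<eta> - pi) \<ge> 0" using b assms by (intro sin_ge_zero) auto
  then show False using s by (simp add: sin_diff)
 qed
 ultimately show "- \<eta> < Arg z" "Arg z < pi - \<eta>" by auto
qed

text \<open>These rotated half-planes are the domains of all contour shifts: they are convex, so
  primitives exist, and they contain every ray of direction \<theta> that starts on the positive
  axis.\<close>

lemma ray_in_half_plane:
 assumes "0 < R" "0 \<le> x" "0 < \<eta>" "0 \<le> \<theta>" "\<theta> + \<eta> < pi"
 shows "0 < Im (ray \<theta> R x * cis \<eta>)"
proof -
 have "ray \<theta> R x * cis \<eta> = of_real R * cis \<eta> + of_real x * cis (\<theta> + \<eta>)"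
  by (simp add: ray_def cis_mult[symmetric] algebra_simps)
 then have "Im (ray \<theta> R x * cis \<eta>) = R * sin \<eta> + x * sin (\<theta> + \<eta>)" by simp
 moreover have "0 < sin \<eta>" "0 < sin (\<theta> + \<eta>)" using assms by (auto intro!: sin_gt_zero)
 ultimately show ?thesis using assms by (simp add: add_pos_nonneg)
qed

lemma convex_open_half_plane: "convex {z. 0 < Im (z * cis \<eta>)}" "open {z. 0 < Im (z * cis \<eta>)}"
proof -
 have eq: "{z. 0 < Im (z * cis \<eta>)} = {z. inner (Complex (sin \<eta>) (cos \<eta>)) z > 0}"
  by (auto simp: inner_complex_def algebra_simps)
 show "convex {z. 0 < Im (z * cis \<eta>)}" unfolding eq by (rule convex_halfspace_gt)
 show "open {z. 0 < Im (z * cis \<eta>)}" unfolding eq by (rule open_halfspace_gt)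
qed

text \<open>With a primitive \<open>F\<close>, each ray integral is the limit of \<open>F\<close>
  along the ray minus \<open>F\<close> at the base. The far ends of the two rays merge by the decay
  of \<open>f\<close>, and between the bases \<open>F\<close> changes by an integral of
  \<open>f\<close> over a real interval, where \<open>f\<close> is real. Hence the imaginary parts
  agree.\<close>

lemma ray_integral_shift:
 assumes D: "convex D" "open D" and f: "f holomorphic_on D"
  and ray: "\<And>R x. 0 < R \<Longrightarrow> 0 \<le> x \<Longrightarrow> ray \<theta> R x \<in> D"
  and real: "\<And>R. 0 < R \<Longrightarrow> Im (f (of_real R)) = 0"
  and int: "\<And>R. 0 < R \<Longrightarrow> L1 (\<lambda>x. indicator {0..} x *\<^sub>R (cis \<theta> * f (ray \<theta> R x)))"
  and decay: "\<And>R x. min R1 R2 \<le> R \<Longrightarrow> R \<le> max R1 R2 \<Longrightarrow> 0 \<le> x \<Longrightarrow> norm (f (ray \<theta> R x)) \<le> B x"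
  and B: "(B \<longlongrightarrow> 0) at_top" and R: "0 < R1" "0 < R2"
 shows "Im (ray_integral \<theta> R1 f) = Im (ray_integral \<theta> R2 f)"
proof -
 obtain F where "\<And>z. z \<in> D \<Longrightarrow> (F has_field_derivative f z) (at z within D)"
  using holomorphic_convex_primitive'[OF D f] by blast
 then have F: "(F has_field_derivative f z) (at z)" if "z \<in> D" for z
  using at_within_open[OF that D(2)] that by metis
 have Rin: "of_real R \<in> D" if "0 < R" for R using ray[OF that, of 0] by (simp add: ray_def)
 have lim: "(\<lambda>n::nat. F (ray \<theta> R (real n)) - F (of_real R)) \<longlonglongrightarrow> ray_integral \<theta> R f" if R: "0 < R" for R
 proof -
  have "(LINT x|lborel. indicator {0..real n} x *\<^sub>R (cis \<theta> * f (ray \<theta> R x))) = F (ray \<theta> R (real n)) - F (ray \<theta> R 0)" for n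
  proof (rule integral_FTC_atLeastAtMost)
   fix x :: real assume x: "0 \<le> x" "x \<le> real n"
   have "((\<lambda>x. F (ray \<theta> R x)) has_vector_derivative (cis \<theta> * f (ray \<theta> R x))) (at x within {0..real n})"
   proof (rule field_vector_diff_chain_within[of "ray \<theta> R" _ x "{0..real n}" F, unfolded o_def])
    show "(ray \<theta> R has_vector_derivative cis \<theta>) (at x within {0..real n})"
     unfolding ray_def[abs_def] by (auto intro!: derivative_eq_intros)
    show "(F has_field_derivative f (ray \<theta> R x)) (at (ray \<theta> R x) within ray \<theta> R ` {0..real n})"
     using F[OF ray[OF R x(1)]] by (rule has_field_derivative_at_within)
   qed
   then show "((\<lambda>x. F (ray \<theta> R x)) has_vector_derivative (cis \<theta> * f (ray \<theta> R x))) (at x within {0..real n})" .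
  next
   have "continuous_on {0..real n} (ray \<theta> R)" unfolding ray_def[abs_def] by (intro continuous_intros)
   moreover have "ray \<theta> R ` {0..real n} \<subseteq> D" using ray R by auto
   ultimately show "continuous_on {0..real n} (\<lambda>x. cis \<theta> * f (ray \<theta> R x))"
    using holomorphic_on_imp_continuous_on[OF f] by (intro continuous_intros) (auto intro: continuous_on_compose2)
  qed auto
  moreover have "(\<lambda>n. LINT x|lborel. indicator {0..real n} x *\<^sub>R (cis \<theta> * f (ray \<theta> R x))) \<longlonglongrightarrow> ray_integral \<theta> R f"
   unfolding ray_integral_def
  proof (rule integral_dominated_convergence[where w="\<lambda>x. norm (indicator {0..} x *\<^sub>R (cis \<theta> * f (ray \<theta> R x)))"])
   have m: "(\<lambda>x. indicator {0..} x *\<^sub>R (cis \<theta> * f (ray \<theta> R x))) \<in> borel_measurable lborel" using int[OF R] by auto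
   then show "(\<lambda>x. indicator {0..} x *\<^sub>R (cis \<theta> * f (ray \<theta> R x))) \<in> borel_measurable lborel" .
   have e: "(\<lambda>x. indicator {0..real n} x *\<^sub>R (cis \<theta> * f (ray \<theta> R x))) = (\<lambda>x. indicator {..real n} x *\<^sub>R (indicator {0..} x *\<^sub>R (cis \<theta> * f (ray \<theta> R x))))" for n
    by (auto simp: indicator_def)
   show "(\<lambda>x. indicator {0..real n} x *\<^sub>R (cis \<theta> * f (ray \<theta> R x))) \<in> borel_measurable lborel" for n
    unfolding e by (intro borel_measurable_scaleR borel_measurable_indicator m) simp
   show "AE x in lborel. (\<lambda>n. indicator {0..real n} x *\<^sub>R (cis \<theta> * f (ray \<theta> R x))) \<longlonglongrightarrow> indicator {0..} x *\<^sub>R (cis \<theta> * f (ray \<theta> R x))"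
   proof (rule AE_I2, rule tendsto_eventually)
    fix x :: real
    obtain N :: nat where "x \<le> real N" using real_arch_simple by blast
    then show "\<forall>\<^sub>F n in sequentially. indicator {0..real n} x *\<^sub>R (cis \<theta> * f (ray \<theta> R x)) = indicator {0..} x *\<^sub>R (cis \<theta> * f (ray \<theta> R x))"
     by (intro eventually_sequentiallyI[of N]) (auto simp: indicator_def)
   qed
  next
   show "L1 (\<lambda>x. norm (indicator {0..} x *\<^sub>R (cis \<theta> * f (ray \<theta> R x))))"
    by (rule integrable_norm[OF int[OF R]])
  qed (auto simp: indicator_def)
  ultimately show ?thesis by (simp add: ray_def)
 qed
 have const: "Im (F (of_real R1)) = Im (F (of_real R2))"
 proof -
  have "((\<lambda>R. Im (F (of_real R))) has_field_derivative 0) (at R within {0<..})" if "R \<in> {0<..}" for R :: real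
  proof -
   have "((\<lambda>R. F (of_real R)) has_vector_derivative f (of_real R)) (at R)"
    using has_vector_derivative_real_field[OF F[OF Rin[of R]]] that by simp
   then have "((\<lambda>R. Im (F (of_real R))) has_vector_derivative Im (f (of_real R))) (at R)"
    by (rule bounded_linear.has_vector_derivative[OF bounded_linear_Im])
   then show ?thesis
    using real[of R] that by (auto simp: has_real_derivative_iff_has_vector_derivative intro: has_vector_derivative_at_within)
  qed
  then obtain c where "\<forall>R\<in>{0<..}. Im (F (of_real R)) = c"
   using has_field_derivative_zero_constant[of "{0<..}" "\<lambda>R::real. Im (F (of_real R))"] by auto
  then show ?thesis using R by simp
 qed
 \<comment> \<open>The mean value inequality on the segment joining the points of the two rays with
   the same parameter; every point of it lies on an intermediate ray.\<close>
 have close: "norm (F (ray \<theta> R1 x) - F (ray \<theta> R2 x)) \<le> B x * \<bar>R1 - R2\<bar>" if x: "0 \<le> x" for x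
 proof -
  let ?S = "closed_segment (ray \<theta> R1 x) (ray \<theta> R2 x)"
  have S: "\<exists>R. z = ray \<theta> R x \<and> min R1 R2 \<le> R \<and> R \<le> max R1 R2" if "z \<in> ?S" for z
  proof -
   obtain u where u: "0 \<le> u" "u \<le> 1" "z = (1 - u) *\<^sub>R ray \<theta> R1 x + u *\<^sub>R ray \<theta> R2 x"
    using \<open>z \<in> ?S\<close> by (auto simp: closed_segment_def)
   have "z = ray \<theta> ((1 - u) * R1 + u * R2) x"
    using u(3) by (simp add: ray_def scaleR_conv_of_real algebra_simps)
   moreover have "(1 - u) * R1 + u * R2 \<in> closed_segment R1 R2"
    using u by (auto simp: closed_segment_def intro!: exI[of _ u])
   ultimately show ?thesis by (auto simp: closed_segment_eq_real_ivl min_def max_def split: if_splits)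
  qed
  have "norm (F (ray \<theta> R1 x) - F (ray \<theta> R2 x)) \<le> B x * norm (ray \<theta> R1 x - ray \<theta> R2 x)"
  proof (rule field_differentiable_bound[where S="?S" and f'=f])
   fix z assume "z \<in> ?S"
   then obtain Q where Q: "z = ray \<theta> Q x" "min R1 R2 \<le> Q" "Q \<le> max R1 R2" using S by blast
   then have "0 < Q" using R by (auto simp: min_def split: if_splits)
   then show "(F has_field_derivative f z) (at z within ?S)"
    using F[OF ray[OF _ x]] Q by (auto intro: has_field_derivative_at_within)
   show "norm (f z) \<le> B x" using decay[OF Q(2,3) x] Q by simp
  qed auto
  also have "norm (ray \<theta> R1 x - ray \<theta> R2 x) = \<bar>R1 - R2\<bar>" by (simp add: ray_def flip: of_real_diff)
  finally show ?thesis .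
 qed
 have "(\<lambda>n::nat. F (ray \<theta> R1 (real n)) - F (ray \<theta> R2 (real n))) \<longlonglongrightarrow> 0"
 proof (rule Lim_null_comparison)
  show "\<forall>\<^sub>F n in sequentially. norm (F (ray \<theta> R1 (real n)) - F (ray \<theta> R2 (real n))) \<le> B (real n) * \<bar>R1 - R2\<bar>"
   using close by simp
  show "(\<lambda>n. B (real n) * \<bar>R1 - R2\<bar>) \<longlonglongrightarrow> 0"
   by (intro tendsto_mult_left_zero filterlim_compose[OF B filterlim_real_sequentially])
 qed
 from tendsto_diff[OF this tendsto_const[of "F (of_real R1) - F (of_real R2)"]]
 have "(\<lambda>n::nat. (F (ray \<theta> R1 (real n)) - F (of_real R1)) - (F (ray \<theta> R2 (real n)) - F (of_real R2))) \<longlonglongrightarrow> 0 - (F (of_real R1) - F (of_real R2))"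
  by (simp add: algebra_simps)
 then have "ray_integral \<theta> R1 f - ray_integral \<theta> R2 f = 0 - (F (of_real R1) - F (of_real R2))"
  using tendsto_diff[OF lim[OF R(1)] lim[OF R(2)]] LIMSEQ_unique by blast
 then have "Im (ray_integral \<theta> R1 f - ray_integral \<theta> R2 f) = 0" using const by simp
 then show ?thesis by simp
qed

text \<open>The inequality ln z <= z - 1 at z = e t / y, exponentiated.\<close>

lemma powr_le_exp:
 fixes t y e :: real
 assumes "0 < t" "0 < y" "0 < e"
 shows "t powr y \<le> (y / e) powr y * exp (e * t)"
proof -
 have "ln (e * t / y) \<le> e * t / y - 1" using assms by (intro ln_le_minus_one) auto
 then have "y * ln (e * t / y) \<le> e * t" using assms by (simp add: field_simps)
 then have "exp (y * ln (e * t / y)) \<le> exp (e * t)" by simp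
 then have "(e * t / y) powr y \<le> exp (e * t)" using assms by (simp add: powr_def)
 then have "(y / e) powr y * (e * t / y) powr y \<le> (y / e) powr y * exp (e * t)" by (intro mult_left_mono) auto
 moreover have "(y / e) powr y * (e * t / y) powr y = t powr y"
  using assms by (subst powr_mult[symmetric]) auto
 ultimately show ?thesis by simp
qed

text \<open>The ray enters the left half-plane, where exp decays along it, and stays off the cut of
  \<open>Ln\<close>.\<close>

locale hankel_contour =
 fixes \<theta> :: real
 assumes \<theta>: "pi / 2 < \<theta>" "\<theta> < pi"
begin

lemma cos_neg: "cos \<theta> < 0" and sin_pos: "0 < sin \<theta>"
proof -
 have "0 < cos (pi - \<theta>)" using \<theta> by (intro cos_gt_zero_pi) auto
 then show "cos \<theta> < 0" by (simp add: cos_diff)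
 show "0 < sin \<theta>" using \<theta> pi_gt3 by (intro sin_gt_zero) auto
qed

lemma ray_nonzero: "0 < R \<Longrightarrow> 0 \<le> x \<Longrightarrow> 0 < norm (ray \<theta> R x)"
 using norm_ray_ge(1)[of R x \<theta>] sin_pos mult_pos_pos[of R "sin \<theta>"] by linarith

lemma ray_notin_nonpos: "0 < R \<Longrightarrow> 0 \<le> x \<Longrightarrow> ray \<theta> R x \<notin> \<real>\<^sub>\<le>\<^sub>0"
 using sin_pos by (auto simp: complex_nonpos_Reals_iff ray_simps zero_less_mult_iff)

lemma norm_ray_powr_le:
 assumes "0 < R0" "R0 \<le> R1" "0 < e"
 shows "\<exists>K\<ge>0. \<forall>R x. R0 \<le> R \<longrightarrow> R \<le> R1 \<longrightarrow> 0 \<le> x \<longrightarrow> norm (ray \<theta> R x) powr y \<le> K * exp (e * x)"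
proof (cases "0 < y")
 case True
 have "norm (ray \<theta> R x) powr y \<le> (y / e) powr y * exp (e * R1) * exp (e * x)" if "R0 \<le> R" "R \<le> R1" "0 \<le> x" for R x
 proof -
  have "norm (ray \<theta> R x) powr y \<le> (R + x) powr y"
   using norm_ray_le[of R x \<theta>] that assms True by (intro powr_mono2) auto
  also have "\<dots> \<le> (y / e) powr y * exp (e * (R + x))"
   using that assms True by (intro powr_le_exp) auto
  also have "\<dots> \<le> (y / e) powr y * exp (e * (R1 + x))"
   using that assms by (intro mult_left_mono) auto
  finally show ?thesis by (simp add: ring_distribs exp_add mult_ac)
 qed
 then show ?thesis by (intro exI[of _ "(y / e) powr y * exp (e * R1)"]) auto
next
 case False
 have "norm (ray \<theta> R x) powr y \<le> (R0 * sin \<theta>) powr y * exp (e * x)" if "R0 \<le> R" "R \<le> R1" "0 \<le> x" for R x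
 proof -
  have "R0 * sin \<theta> \<le> R * sin \<theta>" using that sin_pos by simp
  also have "\<dots> \<le> norm (ray \<theta> R x)" using norm_ray_ge(1)[of R x \<theta>] sin_pos that assms by simp
  finally have "norm (ray \<theta> R x) powr y \<le> (R0 * sin \<theta>) powr y"
   using False sin_pos assms by (intro powr_mono2') auto
  also have "\<dots> \<le> (R0 * sin \<theta>) powr y * exp (e * x)"
   using that assms by (simp add: mult_le_cancel_left1)
  finally show ?thesis .
 qed
 then show ?thesis by (intro exI[of _ "(R0 * sin \<theta>) powr y"]) auto
qed

text \<open>Half of the decay rate of exp is spent on absorbing the power. Uniformity over a compact
  range of \<open>R\<close> is what the shift of contours uses.\<close>

lemma norm_exp_powr_ray_le:
 assumes "0 < R0" "R0 \<le> R1"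
 shows "\<exists>K\<ge>0. \<forall>R x. R0 \<le> R \<longrightarrow> R \<le> R1 \<longrightarrow> 0 \<le> x \<longrightarrow>
  norm (exp (ray \<theta> R x)) * norm (ray \<theta> R x) powr y \<le> K * exp (cos \<theta> / 2 * x)"
proof -
 obtain K where K: "K \<ge> 0" "\<And>R x. R0 \<le> R \<Longrightarrow> R \<le> R1 \<Longrightarrow> 0 \<le> x \<Longrightarrow> norm (ray \<theta> R x) powr y \<le> K * exp (- cos \<theta> / 2 * x)"
  using norm_ray_powr_le[OF assms, of "- cos \<theta> / 2" y] cos_neg by auto
 have "norm (exp (ray \<theta> R x)) * norm (ray \<theta> R x) powr y \<le> (exp R1 * K) * exp (cos \<theta> / 2 * x)" if "R0 \<le> R" "R \<le> R1" "0 \<le> x" for R x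
 proof -
  have "norm (exp (ray \<theta> R x)) * norm (ray \<theta> R x) powr y \<le> exp (R1 + x * cos \<theta>) * (K * exp (- cos \<theta> / 2 * x))"
   using that K by (intro mult_mono) (auto simp: ray_simps)
  also have "\<dots> = (exp R1 * K) * (exp (x * cos \<theta>) * exp (- cos \<theta> / 2 * x))" by (simp add: exp_add mult_ac)
  also have "exp (x * cos \<theta>) * exp (- cos \<theta> / 2 * x) = exp (cos \<theta> / 2 * x)"
   by (simp add: field_simps flip: exp_add)
  finally show ?thesis .
 qed
 then show ?thesis using K(1) by (intro exI[of _ "exp R1 * K"]) auto
qed

lemma integrable_exp_ray: "L1 (\<lambda>x. indicator {0..} x * exp (cos \<theta> / 2 * x))"
proof -
 have "L1 (\<lambda>x. indicator {0<..} x * (x powr (1 - 1) * exp (- (- cos \<theta> / 2 * x))))"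
  using has_bochner_integral_Gamma_real[of 1 "- cos \<theta> / 2"] cos_neg by (auto simp: has_bochner_integral_iff)
 then show ?thesis
  by (rule integrable_cong_AE_imp) (auto simp: indicator_def intro!: AE_I[of _ _ "{0}"])
qed

lemma exp_ray_tendsto_0: "((\<lambda>x. K * exp (cos \<theta> / 2 * x)) \<longlongrightarrow> 0) at_top"
proof -
 have "LIM x at_top. cos \<theta> / 2 * x :> at_bot"
  using cos_neg by (intro filterlim_tendsto_neg_mult_at_bot[OF tendsto_const]) (auto simp: filterlim_ident)
 then have "((\<lambda>x. exp (cos \<theta> / 2 * x)) \<longlongrightarrow> 0) at_top"
  by (rule filterlim_compose[OF exp_at_bot])
 then show ?thesis by (intro tendsto_mult_right_zero)
qed

lemma integrable_exp_powr_ray: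
 assumes R: "0 < R"
 shows "L1 (\<lambda>x. indicator {0..} x * (norm (exp (ray \<theta> R x)) * norm (ray \<theta> R x) powr y))"
proof -
 obtain K where K: "K \<ge> 0" "\<And>Q x. R \<le> Q \<Longrightarrow> Q \<le> R \<Longrightarrow> 0 \<le> x \<Longrightarrow> norm (exp (ray \<theta> Q x)) * norm (ray \<theta> Q x) powr y \<le> K * exp (cos \<theta> / 2 * x)"
  using norm_exp_powr_ray_le[of R R y] R by auto
 have "L1 (\<lambda>x. K * (indicator {0..} x * exp (cos \<theta> / 2 * x)))"
  using integrable_exp_ray by (rule integrable_mult_right)
 then show ?thesis
  by (rule lebesgue_integrable_bound) (use K in \<open>auto simp: indicator_def abs_mult\<close>)
qed

lemma norm_powr_real_exponent: "norm (z powr of_real y) = norm z powr y" for z :: complex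
 by (simp add: norm_powr_real_powr')

lemma integrable_ray_exp_powr:
 assumes R: "0 < R"
 shows "L1 (\<lambda>x. indicator {0..} x *\<^sub>R (cis \<theta> * (exp (ray \<theta> R x) * ray \<theta> R x powr of_real y)))"
proof (rule lebesgue_integrable_bound[OF integrable_exp_powr_ray[OF R, of y]])
 show "(\<lambda>x. indicator {0..} x *\<^sub>R (cis \<theta> * (exp (ray \<theta> R x) * ray \<theta> R x powr of_real y))) \<in> borel_measurable lborel"
  unfolding powr_def by measurable
qed (auto simp: norm_mult norm_powr_real_exponent indicator_def)

definition hankel :: "real \<Rightarrow> real \<Rightarrow> real" where
 "hankel R s = Im (ray_integral \<theta> R (\<lambda>z. exp z * z powr of_real (- s))) / pi"

lemma hankel_shift:
 assumes "0 < R1" "0 < R2"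
 shows "hankel R1 s = hankel R2 s"
proof -
 define \<eta> where "\<eta> = (pi - \<theta>) / 2"
 have \<eta>: "0 < \<eta>" "\<theta> + \<eta> < pi" "\<eta> < pi" using \<theta> by (auto simp: \<eta>_def field_simps)
 have "\<exists>K\<ge>0. \<forall>R x. min R1 R2 \<le> R \<longrightarrow> R \<le> max R1 R2 \<longrightarrow> 0 \<le> x \<longrightarrow>
   norm (exp (ray \<theta> R x)) * norm (ray \<theta> R x) powr (- s) \<le> K * exp (cos \<theta> / 2 * x)"
  using assms by (intro norm_exp_powr_ray_le) auto
 then obtain K where K: "\<And>R x. min R1 R2 \<le> R \<Longrightarrow> R \<le> max R1 R2 \<Longrightarrow> 0 \<le> x \<Longrightarrow>
   norm (exp (ray \<theta> R x)) * norm (ray \<theta> R x) powr (- s) \<le> K * exp (cos \<theta> / 2 * x)"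
  by blast
 have "Im (ray_integral \<theta> R1 (\<lambda>z. exp z * z powr of_real (- s))) = Im (ray_integral \<theta> R2 (\<lambda>z. exp z * z powr of_real (- s)))"
 proof (rule ray_integral_shift[OF convex_open_half_plane[of \<eta>] _ _ _ _ _ exp_ray_tendsto_0[of K] assms])
  have "z \<notin> \<real>\<^sub>\<le>\<^sub>0" if "0 < Im (z * cis \<eta>)" for z
  proof
   assume "z \<in> \<real>\<^sub>\<le>\<^sub>0"
   then have "Im z = 0" "Re z \<le> 0" by (auto simp: complex_nonpos_Reals_iff)
   with that have "0 < Re z * sin \<eta>" "Re z \<le> 0" by auto
   moreover have "0 < sin \<eta>" using \<eta> by (intro sin_gt_zero) auto
   ultimately show False by (simp add: zero_less_mult_iff)
  qed
  then show "(\<lambda>z. exp z * z powr of_real (- s)) holomorphic_on {z. 0 < Im (z * cis \<eta>)}"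
   by (intro holomorphic_intros) auto
  show "ray \<theta> R x \<in> {z. 0 < Im (z * cis \<eta>)}" if "0 < R" "0 \<le> x" for R x
   using ray_in_half_plane[of R x \<eta> \<theta>] that \<eta> \<theta> pi_gt_zero by auto
  show "Im (exp (of_real R) * of_real R powr of_real (- s)) = 0" if "0 < R" for R
  proof -
   have "exp (of_real R) * complex_of_real R powr of_real (- s) = of_real (exp R * R powr (- s))"
    using that powr_of_real[of R "- s"] by (simp add: exp_of_real)
   then show ?thesis by (metis Im_complex_of_real)
  qed
  show "L1 (\<lambda>x. indicator {0..} x *\<^sub>R (cis \<theta> * (exp (ray \<theta> R x) * ray \<theta> R x powr of_real (- s))))" if "0 < R" for R
   by (rule integrable_ray_exp_powr[OF that])
  show "norm (exp (ray \<theta> R x) * ray \<theta> R x powr of_real (- s)) \<le> K * exp (cos \<theta> / 2 * x)"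
   if "min R1 R2 \<le> R" "R \<le> max R1 R2" "0 \<le> x" for R x
   unfolding norm_mult norm_powr_real_exponent by (rule K[OF that])
 qed
 then show ?thesis by (simp add: hankel_def)
qed

text \<open>For s < 1 the singularity of z^(-s) at 0 is integrable, so the base of the ray may move
  to 0. The limit is a Gamma integral with complex parameter -cis \<theta>, and Euler's reflection
  formula turns Gamma(1 - s) sin(pi s) / pi into the reciprocal Gamma function.\<close>

lemma hankel_between_0_1:
 assumes s: "0 < s" "s < 1" and R: "0 < R"
 shows "hankel R s = rGamma s"
proof -
 define r where "r n = inverse (real (Suc n))" for n
 have r: "0 < r n" "r n \<le> 1" "r \<longlonglongrightarrow> 0" for n
  unfolding r_def[abs_def] using LIMSEQ_inverse_real_of_nat by (auto simp: field_simps)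
 let ?g = "\<lambda>R x. indicator {0<..} x *\<^sub>R (cis \<theta> * (exp (ray \<theta> R x) * ray \<theta> R x powr of_real (- s)))"
 have "(\<lambda>n. LINT x|lborel. ?g (r n) x) \<longlonglongrightarrow> (LINT x|lborel. ?g 0 x)"
 proof (rule integral_dominated_convergence[where w="\<lambda>x. exp 1 * sin \<theta> powr (- s) * (indicator {0<..} x * (x powr (1 - s - 1) * exp (- (- cos \<theta> * x))))"])
  show "?g 0 \<in> borel_measurable lborel" "?g (r n) \<in> borel_measurable lborel" for n
   unfolding powr_def by measurable
  show "L1 (\<lambda>x. exp 1 * sin \<theta> powr (- s) * (indicator {0<..} x * (x powr (1 - s - 1) * exp (- (- cos \<theta> * x)))))"
   using has_bochner_integral_Gamma_real[of "1 - s" "- cos \<theta>"] cos_neg s by (auto simp: has_bochner_integral_iff)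
  show "AE x in lborel. (\<lambda>n. ?g (r n) x) \<longlonglongrightarrow> ?g 0 x"
  proof (rule AE_I2)
   fix x :: real
   show "(\<lambda>n. ?g (r n) x) \<longlonglongrightarrow> ?g 0 x"
   proof (cases "0 < x")
    case True
    have l: "(\<lambda>n. ray \<theta> (r n) x) \<longlonglongrightarrow> ray \<theta> 0 x"
     unfolding ray_def by (intro tendsto_intros tendsto_of_real r)
    have "ray \<theta> 0 x \<notin> \<real>\<^sub>\<le>\<^sub>0"
     using True sin_pos by (auto simp: complex_nonpos_Reals_iff ray_simps)
    then show ?thesis using l by (intro tendsto_intros) auto
   qed (simp add: indicator_def)
  qed
  fix n
  show "AE x in lborel. norm (?g (r n) x) \<le> exp 1 * sin \<theta> powr (- s) * (indicator {0<..} x * (x powr (1 - s - 1) * exp (- (- cos \<theta> * x))))"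
  proof (rule AE_I2)
   fix x :: real
   show "norm (?g (r n) x) \<le> exp 1 * sin \<theta> powr (- s) * (indicator {0<..} x * (x powr (1 - s - 1) * exp (- (- cos \<theta> * x))))"
   proof (cases "0 < x")
    case True
    have "norm (ray \<theta> (r n) x) powr (- s) \<le> (x * sin \<theta>) powr (- s)"
     using norm_ray_ge(2)[of "r n" x \<theta>] True sin_pos r(1)[of n] s by (intro powr_mono2') auto
    moreover have "exp (r n + x * cos \<theta>) \<le> exp 1 * exp (x * cos \<theta>)"
     using r(2)[of n] by (simp add: exp_add)
    ultimately have "exp (r n + x * cos \<theta>) * norm (ray \<theta> (r n) x) powr (- s) \<le> (exp 1 * exp (x * cos \<theta>)) * (x * sin \<theta>) powr (- s)"
     by (intro mult_mono) auto
    then show ?thesis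
     using True sin_pos by (simp add: norm_mult norm_powr_real_exponent del: of_real_minus) (simp add: ray_simps powr_mult mult_ac)
   qed (simp add: indicator_def)
  qed
 qed
 moreover have eqn: "(LINT x|lborel. ?g (r n) x) = ray_integral \<theta> (r n) (\<lambda>z. exp z * z powr of_real (- s))" for n
  unfolding ray_integral_def
 proof (rule integral_cong_AE)
  show "AE x in lborel. ?g (r n) x = indicator {0..} x *\<^sub>R (cis \<theta> * (exp (ray \<theta> (r n) x) * ray \<theta> (r n) x powr of_real (- s)))"
   by (rule AE_I[of _ _ "{0}"]) (auto simp: indicator_def)
 qed (unfold powr_def, measurable)
 ultimately have "(\<lambda>n. Im (ray_integral \<theta> (r n) (\<lambda>z. exp z * z powr of_real (- s))) / pi) \<longlonglongrightarrow> Im (LINT x|lborel. ?g 0 x) / pi"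
  by (intro tendsto_intros) simp_all
 moreover have "(\<lambda>n. Im (ray_integral \<theta> (r n) (\<lambda>z. exp z * z powr of_real (- s))) / pi) = (\<lambda>n. hankel R s)"
  using hankel_shift[OF r(1) R] by (simp add: hankel_def)
 ultimately have "(\<lambda>n::nat. hankel R s) \<longlonglongrightarrow> Im (LINT x|lborel. ?g 0 x) / pi"
  by (simp only:)
 from LIMSEQ_unique[OF tendsto_const this] have h: "hankel R s = Im (LINT x|lborel. ?g 0 x) / pi" .
 \<comment> \<open>The representative with argument in (-pi/2, 0), as the principal power
   requires.\<close>
 have neg: "- cis \<theta> = cis (\<theta> - pi)" by (simp add: cis_divide[symmetric])
 have g0: "?g 0 x = cis (\<theta> * (1 - s)) * (indicator {0<..} x *\<^sub>R (of_real (x powr (1 - s - 1)) * exp (- (- cis \<theta> * of_real x))))" for x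
 proof (cases "0 < x")
  case True
  have "Ln (ray \<theta> 0 x) = of_real (ln x) + Ln (cis \<theta>)"
  proof -
   have "ray \<theta> 0 x = of_real x * cis \<theta>" by (simp add: ray_def mult.commute)
   then show ?thesis using True by (simp add: Ln_times_of_real Ln_of_real)
  qed
  also have "Ln (cis \<theta>) = \<theta> * \<i>" using \<theta> pi_gt_zero by (intro Ln_cis) auto
  finally have "ray \<theta> 0 x powr of_real (- s) = exp (of_real (- s * ln x)) * cis (- s * \<theta>)"
   using ray_notin_nonpos[of _ x] True by (auto simp: powr_def ray_def cis_conv_exp algebra_simps simp flip: exp_add)
  also have "exp (of_real (- s * ln x)) = complex_of_real (x powr (1 - s - 1))"
   using True by (simp add: powr_def exp_of_real[symmetric])
  finally have p: "ray \<theta> 0 x powr of_real (- s) = of_real (x powr (1 - s - 1)) * cis (- s * \<theta>)" .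
  have "cis \<theta> * cis (- s * \<theta>) = cis (\<theta> * (1 - s))" by (simp add: cis_mult algebra_simps)
  then show ?thesis using True unfolding p by (simp add: ray_def mult_ac)
 qed (simp add: indicator_def)
 have "(LINT x|lborel. ?g 0 x) = cis (\<theta> * (1 - s)) * (LINT x|lborel. indicator {0<..} x *\<^sub>R (of_real (x powr (1 - s - 1)) * exp (- (- cis \<theta> * of_real x))))"
  unfolding g0 by (rule integral_mult_right_zero)
 also have "(LINT x|lborel. indicator {0<..} x *\<^sub>R (of_real (x powr (1 - s - 1)) * exp (- (- cis \<theta> * of_real x)))) =
   of_real (Gamma (1 - s)) * (- cis \<theta>) powr (- of_real (1 - s))"
  by (rule Gamma_integral_complex_scale(2)) (use s cos_neg in auto)
 also have "(- cis \<theta>) powr (- of_real (1 - s)) = cis (- (1 - s) * (\<theta> - pi))"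
 proof -
  have L: "Ln (- cis \<theta>) = (\<theta> - pi) * \<i>" unfolding neg using \<theta> by (intro Ln_cis) auto
  have "(- cis \<theta>) powr (- of_real (1 - s)) = exp (- of_real (1 - s) * Ln (- cis \<theta>))"
   by (simp add: powr_def)
  also have "\<dots> = cis (- (1 - s) * (\<theta> - pi))"
   unfolding L by (simp add: cis_conv_exp mult_ac)
  finally show ?thesis .
 qed
 also have "cis (\<theta> * (1 - s)) * (of_real (Gamma (1 - s)) * cis (- (1 - s) * (\<theta> - pi))) = of_real (Gamma (1 - s)) * cis (pi * (1 - s))"
 proof -
  have "cis (\<theta> * (1 - s)) * cis (- (1 - s) * (\<theta> - pi)) = cis (pi * (1 - s))" by (simp add: cis_mult algebra_simps)
  then show ?thesis by (simp add: mult.left_commute)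
 qed
 finally have "hankel R s = Gamma (1 - s) * sin (pi * (1 - s)) / pi" unfolding h by simp
 also have "sin (pi * (1 - s)) = sin (pi * s)" by (simp add: algebra_simps sin_diff)
 also have "Gamma (1 - s) * sin (pi * s) / pi = rGamma s"
 proof -
  have "complex_of_real (rGamma s * rGamma (1 - s)) = complex_of_real (sin (pi * s) / pi)"
  proof -
   have "sin (complex_of_real pi * of_real s) = of_real (sin (pi * s))" by (metis of_real_mult sin_of_real)
   then show ?thesis
    using rGamma_reflection_complex[of "of_real s"] by (simp add: rGamma_complex_of_real[symmetric])
  qed
  then have "rGamma s * rGamma (1 - s) = sin (pi * s) / pi" unfolding of_real_eq_iff .
  moreover have "rGamma (1 - s) = 1 / Gamma (1 - s)" "Gamma (1 - s) \<noteq> 0"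
  proof -
   have "0 < Gamma (1 - s)" using s by (intro Gamma_real_pos) simp
   then show "rGamma (1 - s) = 1 / Gamma (1 - s)" "Gamma (1 - s) \<noteq> 0"
    by (auto simp: rGamma_inverse_Gamma inverse_eq_divide)
  qed
  ultimately show ?thesis by (simp add: field_simps)
 qed
 finally show ?thesis .
qed

text \<open>The derivative of exp z z^(-s) is integrated along the ray. The contribution of the far
  end vanishes, and that of the base is real, hence invisible to the imaginary part.\<close>

lemma hankel_rec:
 assumes R: "0 < R"
 shows "hankel R s = s * hankel R (s + 1)"
proof -
 let ?G = "\<lambda>x. exp (ray \<theta> R x) * ray \<theta> R x powr of_real (- s)"
 let ?a = "\<lambda>x. cis \<theta> * (exp (ray \<theta> R x) * ray \<theta> R x powr of_real (- s))"
 let ?b = "\<lambda>x. cis \<theta> * (exp (ray \<theta> R x) * ray \<theta> R x powr of_real (- (s + 1)))"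
 have FTC: "(LINT x|lborel. indicator {0..real n} x *\<^sub>R (?a x - of_real s * ?b x)) = ?G (real n) - ?G 0" for n
 proof (rule integral_FTC_atLeastAtMost)
  fix x :: real assume x: "0 \<le> x" "x \<le> real n"
  have "((\<lambda>z. exp z * z powr of_real (- s)) has_field_derivative (exp (ray \<theta> R x) * ray \<theta> R x powr of_real (- s) - of_real s * (exp (ray \<theta> R x) * ray \<theta> R x powr of_real (- (s + 1))))) (at (ray \<theta> R x) within ray \<theta> R ` {0..real n})"
  proof -
   have ex: "complex_of_real (- (s + 1)) = of_real (- s) - 1" by simp
   have "((\<lambda>z. exp z * z powr a) has_field_derivative (exp w * w powr a + a * (exp w * w powr (a - 1)))) (at w within S)"
    if "w \<notin> \<real>\<^sub>\<le>\<^sub>0" for a w :: complex and S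
    using that by (auto intro!: derivative_eq_intros simp: algebra_simps)
   from this[OF ray_notin_nonpos[OF R x(1)], of "of_real (- s)"] show ?thesis unfolding ex by simp
  qed
  moreover have "(ray \<theta> R has_vector_derivative cis \<theta>) (at x within {0..real n})"
   unfolding ray_def[abs_def] by (auto intro!: derivative_eq_intros)
  ultimately have "(?G has_vector_derivative (cis \<theta> * (exp (ray \<theta> R x) * ray \<theta> R x powr of_real (- s) - of_real s * (exp (ray \<theta> R x) * ray \<theta> R x powr of_real (- (s + 1)))))) (at x within {0..real n})"
   by (rule field_vector_diff_chain_within[of "ray \<theta> R" _ _ _ "\<lambda>z. exp z * z powr of_real (- s)", unfolded o_def, rotated])
  moreover have "c * (A - t * B) = c * A - t * (c * B)" for c A t B :: complex
   by (simp add: algebra_simps)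
  ultimately show "(?G has_vector_derivative (?a x - of_real s * ?b x)) (at x within {0..real n})"
   by metis
 next
  have "continuous_on {0..real n} (ray \<theta> R)" unfolding ray_def[abs_def] by (intro continuous_intros)
  moreover have "ray \<theta> R ` {0..real n} \<subseteq> - \<real>\<^sub>\<le>\<^sub>0" using ray_notin_nonpos[OF R] by auto
  moreover have "continuous_on (- \<real>\<^sub>\<le>\<^sub>0) (\<lambda>z::complex. exp z * z powr a)" for a
   by (intro holomorphic_on_imp_continuous_on holomorphic_intros) auto
  ultimately have c: "continuous_on {0..real n} (\<lambda>x. exp (ray \<theta> R x) * ray \<theta> R x powr a)" for a
   using continuous_on_compose2 by blast
  show "continuous_on {0..real n} (\<lambda>x. ?a x - of_real s * ?b x)"
   by (intro continuous_on_diff continuous_on_mult[OF continuous_on_const] c)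
 qed auto
 have ia: "L1 (\<lambda>x. indicator {0..} x *\<^sub>R ?a x)" "L1 (\<lambda>x. indicator {0..} x *\<^sub>R ?b x)"
  by (rule integrable_ray_exp_powr[OF R])+
 have iab: "L1 (\<lambda>x. indicator {0..} x *\<^sub>R (?a x - of_real s * ?b x))"
 proof -
  have "L1 (\<lambda>x. indicator {0..} x *\<^sub>R ?a x - of_real s * (indicator {0..} x *\<^sub>R ?b x))"
   using ia by (intro lebesgue_integrable_diff integrable_mult_right) auto
  then show ?thesis by (simp add: scaleR_diff_right)
 qed
 have lim1: "(\<lambda>n. LINT x|lborel. indicator {0..real n} x *\<^sub>R (?a x - of_real s * ?b x)) \<longlonglongrightarrow> (LINT x|lborel. indicator {0..} x *\<^sub>R (?a x - of_real s * ?b x))"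
 proof (rule integral_dominated_convergence[where w="\<lambda>x. norm (indicator {0..} x *\<^sub>R (?a x - of_real s * ?b x))"])
  show "(\<lambda>x. indicator {0..} x *\<^sub>R (?a x - of_real s * ?b x)) \<in> borel_measurable lborel" using iab by auto
  show "(\<lambda>x. indicator {0..real n} x *\<^sub>R (?a x - of_real s * ?b x)) \<in> borel_measurable lborel" for n
   unfolding powr_def by measurable
  show "AE x in lborel. (\<lambda>n. indicator {0..real n} x *\<^sub>R (?a x - of_real s * ?b x)) \<longlonglongrightarrow> indicator {0..} x *\<^sub>R (?a x - of_real s * ?b x)"
  proof (rule AE_I2, rule tendsto_eventually)
   fix x :: real
   obtain N :: nat where "x \<le> real N" using real_arch_simple by blast
   then show "\<forall>\<^sub>F n in sequentially. indicator {0..real n} x *\<^sub>R (?a x - of_real s * ?b x) = indicator {0..} x *\<^sub>R (?a x - of_real s * ?b x)"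
    by (intro eventually_sequentiallyI[of N]) (auto simp: indicator_def)
  qed
 next
  show "L1 (\<lambda>x. norm (indicator {0..} x *\<^sub>R (?a x - of_real s * ?b x)))"
   by (rule integrable_norm[OF iab])
 qed (auto simp: indicator_def)
 obtain K where K: "\<And>Q x. R \<le> Q \<Longrightarrow> Q \<le> R \<Longrightarrow> 0 \<le> x \<Longrightarrow> norm (exp (ray \<theta> Q x)) * norm (ray \<theta> Q x) powr (- s) \<le> K * exp (cos \<theta> / 2 * x)"
  using norm_exp_powr_ray_le[of R R "- s"] R by auto
 have lim2: "(\<lambda>n. ?G (real n) - ?G 0) \<longlonglongrightarrow> 0 - ?G 0"
 proof (rule tendsto_diff[OF Lim_null_comparison tendsto_const])
  show "\<forall>\<^sub>F n in sequentially. norm (?G (real n)) \<le> K * exp (cos \<theta> / 2 * real n)"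
   unfolding norm_mult norm_powr_real_exponent using K by simp
  show "(\<lambda>n. K * exp (cos \<theta> / 2 * real n)) \<longlonglongrightarrow> 0"
   by (rule filterlim_compose[OF exp_ray_tendsto_0 filterlim_real_sequentially])
 qed
 have "(LINT x|lborel. indicator {0..} x *\<^sub>R (?a x - of_real s * ?b x)) = 0 - ?G 0"
  using LIMSEQ_unique[OF lim1] lim2 unfolding FTC by blast
 moreover have "(LINT x|lborel. indicator {0..} x *\<^sub>R (?a x - of_real s * ?b x)) =
   (LINT x|lborel. indicator {0..} x *\<^sub>R ?a x - of_real s * (indicator {0..} x *\<^sub>R ?b x))"
  by (simp add: scaleR_diff_right)
 moreover have "\<dots> = ray_integral \<theta> R (\<lambda>z. exp z * z powr of_real (- s)) - of_real s * ray_integral \<theta> R (\<lambda>z. exp z * z powr of_real (- (s + 1)))"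
  unfolding ray_integral_def
  by (subst lebesgue_integral_diff[OF ia(1) integrable_mult_right[OF ia(2)]]) (simp only: integral_mult_right_zero)
 moreover have "?G 0 = of_real (exp R * R powr (- s))"
  using R powr_of_real[of R "- s"] by (simp add: ray_def exp_of_real)
 ultimately have "ray_integral \<theta> R (\<lambda>z. exp z * z powr of_real (- s)) - of_real s * ray_integral \<theta> R (\<lambda>z. exp z * z powr of_real (- (s + 1))) = of_real (- (exp R * R powr (- s)))"
  by simp
 then have "Im (ray_integral \<theta> R (\<lambda>z. exp z * z powr of_real (- s)) - of_real s * ray_integral \<theta> R (\<lambda>z. exp z * z powr of_real (- (s + 1)))) = 0"
  by (metis Im_complex_of_real)
 then show ?thesis by (simp add: hankel_def field_simps del: of_real_minus of_real_add)
qed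

text \<open>The limit of the case s < 1. Starting the ray at Q = 1 / sin \<theta> keeps it outside
  the open unit disc, so |z^(-s)| <= 1 for all s in (0, 1] and one majorant serves the whole
  sequence.\<close>

lemma hankel_1:
 assumes R: "0 < R"
 shows "hankel R 1 = rGamma 1"
proof -
 define Q where "Q = 1 / sin \<theta>"
 have Q: "0 < Q" using sin_pos by (simp add: Q_def)
 have ge1: "1 \<le> norm (ray \<theta> Q x)" if "0 \<le> x" for x
  using norm_ray_ge(1)[of Q x \<theta>] that Q sin_pos by (simp add: Q_def)
 define s where "s n = 1 - inverse (real (Suc (Suc n)))" for n
 have s: "0 < s n" "s n < 1" "s \<longlonglongrightarrow> 1" for n
 proof -
  show "0 < s n" "s n < 1" by (auto simp: s_def field_simps)
  have "(\<lambda>n. 1 - inverse (real (Suc (Suc n)))) \<longlonglongrightarrow> 1 - 0"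
   by (intro tendsto_intros LIMSEQ_Suc[OF LIMSEQ_inverse_real_of_nat])
  then show "s \<longlonglongrightarrow> 1" unfolding s_def[abs_def] by simp
 qed
 have "(\<lambda>n. ray_integral \<theta> Q (\<lambda>z. exp z * z powr of_real (- s n))) \<longlonglongrightarrow> ray_integral \<theta> Q (\<lambda>z. exp z * z powr of_real (- 1))"
  unfolding ray_integral_def
 proof (rule integral_dominated_convergence[where w="\<lambda>x. indicator {0..} x * (norm (exp (ray \<theta> Q x)) * norm (ray \<theta> Q x) powr 0)"])
  show "L1 (\<lambda>x. indicator {0..} x * (norm (exp (ray \<theta> Q x)) * norm (ray \<theta> Q x) powr 0))"
   by (rule integrable_exp_powr_ray[OF Q])
  show "(\<lambda>x. indicator {0..} x *\<^sub>R (cis \<theta> * (exp (ray \<theta> Q x) * ray \<theta> Q x powr of_real (- 1)))) \<in> borel_measurable lborel"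
   "(\<lambda>x. indicator {0..} x *\<^sub>R (cis \<theta> * (exp (ray \<theta> Q x) * ray \<theta> Q x powr of_real (- s n)))) \<in> borel_measurable lborel" for n
   unfolding powr_def by measurable
  show "AE x in lborel. (\<lambda>n. indicator {0..} x *\<^sub>R (cis \<theta> * (exp (ray \<theta> Q x) * ray \<theta> Q x powr of_real (- s n)))) \<longlonglongrightarrow> indicator {0..} x *\<^sub>R (cis \<theta> * (exp (ray \<theta> Q x) * ray \<theta> Q x powr of_real (- 1)))"
  proof (rule AE_I2)
   fix x :: real
   show "(\<lambda>n. indicator {0..} x *\<^sub>R (cis \<theta> * (exp (ray \<theta> Q x) * ray \<theta> Q x powr of_real (- s n)))) \<longlonglongrightarrow> indicator {0..} x *\<^sub>R (cis \<theta> * (exp (ray \<theta> Q x) * ray \<theta> Q x powr of_real (- 1)))"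
   proof (cases "0 \<le> x")
    case True
    have "(\<lambda>n. exp (of_real (- s n) * Ln (ray \<theta> Q x))) \<longlonglongrightarrow> exp (of_real (- 1) * Ln (ray \<theta> Q x))"
     by (intro tendsto_intros tendsto_of_real s)
    then have "(\<lambda>n. ray \<theta> Q x powr of_real (- s n)) \<longlonglongrightarrow> ray \<theta> Q x powr of_real (- 1)"
     using ray_nonzero[OF Q True] by (simp add: powr_def)
    then show ?thesis by (intro tendsto_scaleR tendsto_mult tendsto_const)
   qed (simp add: indicator_def)
  qed
  show "AE x in lborel. norm (indicator {0..} x *\<^sub>R (cis \<theta> * (exp (ray \<theta> Q x) * ray \<theta> Q x powr of_real (- s n)))) \<le> indicator {0..} x * (norm (exp (ray \<theta> Q x)) * norm (ray \<theta> Q x) powr 0)" for n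
  proof (rule AE_I2)
   fix x :: real
   show "norm (indicator {0..} x *\<^sub>R (cis \<theta> * (exp (ray \<theta> Q x) * ray \<theta> Q x powr of_real (- s n)))) \<le> indicator {0..} x * (norm (exp (ray \<theta> Q x)) * norm (ray \<theta> Q x) powr 0)"
   proof (cases "0 \<le> x")
    case True
    have "norm (ray \<theta> Q x) powr (- s n) \<le> norm (ray \<theta> Q x) powr 0"
     using ge1[OF True] s(1)[of n] by (intro powr_mono) auto
    then show ?thesis using True unfolding norm_scaleR norm_mult norm_powr_real_exponent by (simp add: mult_left_mono)
   qed (simp add: indicator_def)
  qed
 qed
 then have "(\<lambda>n. hankel Q (s n)) \<longlonglongrightarrow> hankel Q 1"
  unfolding hankel_def by (intro tendsto_intros) simp_all
 then have "(\<lambda>n. rGamma (s n)) \<longlonglongrightarrow> hankel Q 1" using hankel_between_0_1[OF s(1,2) Q] by simp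
 moreover have "(\<lambda>n. rGamma (s n)) \<longlonglongrightarrow> rGamma 1"
  by (rule isCont_tendsto_compose[OF _ s(3)])
   (metis continuous_on_eq_continuous_at continuous_on_rGamma open_UNIV UNIV_I)
 ultimately have "hankel Q 1 = rGamma 1" by (rule LIMSEQ_unique)
 then show ?thesis using hankel_shift[OF R Q] by simp
qed

text \<open>Both sides obey the same recurrence, so agreement on (0, 1] spreads to all real s:
  upwards the recurrence is divided by s + n > 0, downwards it is applied as it stands.\<close>

theorem hankel_eq_rGamma:
 assumes R: "0 < R"
 shows "hankel R s = rGamma s"
proof -
 have base: "hankel R s = rGamma s" if "0 < s" "s \<le> 1" for s
  using hankel_between_0_1[OF that(1) _ R] hankel_1[OF R] that by (cases "s = 1") auto
 have up: "hankel R (s + real n) = rGamma (s + real n)" if "0 < s" "s \<le> 1" for s n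
 proof (induction n)
  case (Suc n)
  have "(s + real n) * hankel R (s + real n + 1) = (s + real n) * rGamma (s + real n + 1)"
   using Suc hankel_rec[OF R, of "s + real n"] rGamma_plus1[of "s + real n"] by simp
  then show ?case using that by (simp add: add_ac)
 qed (use base that in auto)
 have down: "hankel R (s - real n) = rGamma (s - real n)" if "0 < s" "s \<le> 1" for s n
 proof (induction n)
  case (Suc n)
  have "hankel R (s - real (Suc n)) = (s - real (Suc n)) * rGamma (s - real (Suc n) + 1)"
   using hankel_rec[OF R, of "s - real (Suc n)"] Suc by simp
  then show ?case using rGamma_plus1[of "s - real (Suc n)"] by simp
 qed (use base that in auto)
 define t where "t = s - real_of_int (\<lceil>s\<rceil> - 1)"
 have t: "0 < t" "t \<le> 1" unfolding t_def by linarith+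
 show ?thesis
 proof (cases "0 \<le> \<lceil>s\<rceil> - 1")
  case True
  then have "s = t + real (nat (\<lceil>s\<rceil> - 1))" by (simp add: t_def)
  then show ?thesis using up[OF t, of "nat (\<lceil>s\<rceil> - 1)"] by simp
 next
  case False
  then have "s = t - real (nat (1 - \<lceil>s\<rceil>))" by (simp add: t_def)
  then show ?thesis using down[OF t, of "nat (1 - \<lceil>s\<rceil>)"] by simp
 qed
qed

end

section \<open>The Mittag-Leffler function\<close>

definition mittag_leffler :: "real \<Rightarrow> real \<Rightarrow> real \<Rightarrow> real" where
 "mittag_leffler a b z = (\<Sum>k. rGamma (a * real k + b) * z ^ k)"

context hankel_contour
begin

text \<open>A contour at distance at least \<open>X\<close> from 0 bounds z^(-s) by X^(-s). As
  \<open>X\<close> is free, 1/Gamma decays faster than any exponential, which makes the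
  Mittag-Leffler series converge everywhere.\<close>

lemma norm_rGamma_le:
 fixes X :: real
 assumes X: "0 < X"
 shows "\<exists>C. \<forall>s\<ge>0. \<bar>rGamma s\<bar> \<le> C * X powr (- s)"
proof -
 define R where "R = X / sin \<theta>"
 have R: "0 < R" using X sin_pos by (simp add: R_def)
 define C where "C = (LINT x|lborel. indicator {0..} x * (norm (exp (ray \<theta> R x)) * norm (ray \<theta> R x) powr 0)) / pi"
 have "\<bar>rGamma s\<bar> \<le> C * X powr (- s)" if s: "0 \<le> s" for s
 proof -
  have "\<bar>rGamma s\<bar> = \<bar>Im (ray_integral \<theta> R (\<lambda>z. exp z * z powr of_real (- s)))\<bar> / pi"
   unfolding hankel_eq_rGamma[OF R, symmetric] hankel_def by simp
  also have "\<dots> \<le> norm (ray_integral \<theta> R (\<lambda>z. exp z * z powr of_real (- s))) / pi"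
   by (intro divide_right_mono abs_Im_le_cmod) simp
  also have "norm (ray_integral \<theta> R (\<lambda>z. exp z * z powr of_real (- s))) \<le>
    (LINT x|lborel. norm (indicator {0..} x *\<^sub>R (cis \<theta> * (exp (ray \<theta> R x) * ray \<theta> R x powr of_real (- s)))))"
   unfolding ray_integral_def by (rule integral_norm_bound)
  also have "\<dots> \<le> (LINT x|lborel. X powr (- s) * (indicator {0..} x * (norm (exp (ray \<theta> R x)) * norm (ray \<theta> R x) powr 0)))"
  proof (intro integral_mono integrable_norm integrable_ray_exp_powr[OF R] integrable_mult_right integrable_exp_powr_ray[OF R])
   fix x :: real
   show "norm (indicator {0..} x *\<^sub>R (cis \<theta> * (exp (ray \<theta> R x) * ray \<theta> R x powr of_real (- s)))) \<le>
     X powr (- s) * (indicator {0..} x * (norm (exp (ray \<theta> R x)) * norm (ray \<theta> R x) powr 0))"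
   proof (cases "0 \<le> x")
    case True
    have "X \<le> norm (ray \<theta> R x)"
     using norm_ray_ge(1)[of R x \<theta>] True R sin_pos by (simp add: R_def)
    then have "norm (ray \<theta> R x) powr (- s) \<le> X powr (- s)"
     using s X by (intro powr_mono2') auto
    then have "norm (exp (ray \<theta> R x)) * norm (ray \<theta> R x) powr (- s) \<le> norm (exp (ray \<theta> R x)) * X powr (- s)"
     by (intro mult_left_mono) auto
    moreover have "norm (ray \<theta> R x) powr 0 = 1" using ray_nonzero[OF R True] by simp
    ultimately show ?thesis using True unfolding norm_scaleR norm_mult norm_powr_real_exponent by (simp add: mult.commute)
   qed (simp add: indicator_def)
  qed
  also have "\<dots> / pi = C * X powr (- s)" by (simp add: C_def)
  finally show ?thesis by (simp add: divide_right_mono)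
 qed
 then show ?thesis by blast
qed

end

text \<open>For 0 < a < 2 the angle pi / a exceeds pi / 2, so a direction strictly between them
  exists. Along such a contour z^a stays off the negative axis.\<close>

lemma ex_hankel_contour:
 assumes "a < 2"
 obtains \<theta> where "hankel_contour \<theta>" "a * \<theta> < pi"
proof (cases "0 < a")
 case True
 define m where "m = min pi (pi / a)"
 define \<theta> where "\<theta> = (pi / 2 + m) / 2"
 have m: "pi / 2 < m" "m \<le> pi" "m \<le> pi / a" using assms True pi_gt_zero by (auto simp: m_def field_simps)
 then have t: "pi / 2 < \<theta>" "\<theta> < m" by (auto simp: \<theta>_def)
 have "a * \<theta> < a * (pi / a)" using t m True by (intro mult_strict_left_mono) auto
 then have "hankel_contour \<theta>" "a * \<theta> < pi" using True t m by (auto simp: hankel_contour_def)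
 then show ?thesis by (rule that)
next
 case False
 have "hankel_contour (3 * pi / 4)" using pi_gt_zero by (simp add: hankel_contour_def)
 moreover have "a * (3 * pi / 4) < pi"
  using False pi_gt_zero by (smt (verit) divide_pos_pos mult_nonneg_nonneg mult_nonpos_nonneg)
 ultimately show ?thesis by (rule that)
qed

lemma summable_mittag_leffler:
 assumes a: "0 < a"
 shows "summable (\<lambda>k. norm (rGamma (a * real k + b) * z ^ k))"
proof -
 interpret hankel_contour "3 * pi / 4" using pi_gt_zero by unfold_locales auto
 \<comment> \<open>So that X^a = 2 (|z| + 1), which bounds the terms of the series by a multiple of
   2^(-k).\<close>
 define X where "X = (2 * (\<bar>z\<bar> + 1)) powr (1 / a)"
 have X: "0 < X" "X powr a = 2 * (\<bar>z\<bar> + 1)" using a by (auto simp: X_def powr_powr)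
 obtain C where C: "\<And>s. 0 \<le> s \<Longrightarrow> \<bar>rGamma s\<bar> \<le> C * X powr (- s)"
  using norm_rGamma_le[OF X(1)] by blast
 have C0: "0 \<le> C" using C[of 0] X by (auto intro: order_trans[OF abs_ge_zero])
 obtain N :: nat where N: "- b / a \<le> real N" using real_arch_simple by blast
 show ?thesis
 proof (rule summable_comparison_test')
  show "summable (\<lambda>k. C * X powr (- b) * (1 / 2) ^ k)" by (intro summable_mult summable_geometric) auto
  fix k assume k: "N \<le> k"
  have "- b / a \<le> real k" using N k by linarith
  then have "0 \<le> a * real k + b" using a by (simp add: field_simps)
  from mult_right_mono[OF C[OF this], of "\<bar>z\<bar> ^ k"]
  have "norm (rGamma (a * real k + b) * z ^ k) \<le> C * X powr (- (a * real k + b)) * \<bar>z\<bar> ^ k"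
   by (simp only: real_norm_def abs_mult power_abs zero_le_power abs_ge_zero)
  also have "X powr (- (a * real k + b)) = X powr (- b) * (1 / (2 * (\<bar>z\<bar> + 1))) ^ k"
  proof -
   have "X powr (- (a * real k + b)) = X powr (- b) * (X powr a) powr (- real k)"
    by (simp add: powr_powr powr_add[symmetric] algebra_simps)
   also have "(X powr a) powr (- real k) = (1 / (2 * (\<bar>z\<bar> + 1))) ^ k"
    unfolding X(2) by (simp add: powr_minus powr_realpow power_divide inverse_eq_divide)
   finally show ?thesis .
  qed
  also have "C * (X powr (- b) * (1 / (2 * (\<bar>z\<bar> + 1))) ^ k) * \<bar>z\<bar> ^ k = C * X powr (- b) * (\<bar>z\<bar> / (2 * (\<bar>z\<bar> + 1))) ^ k"
   by (simp add: power_divide)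
  also have "\<dots> \<le> C * X powr (- b) * (1 / 2) ^ k"
   using C0 by (intro mult_left_mono power_mono) (auto simp: field_simps)
  finally show "norm (norm (rGamma (a * real k + b) * z ^ k)) \<le> C * X powr (- b) * (1 / 2) ^ k" by simp
 qed
qed

lemma sums_mittag_leffler:
 "0 < a \<Longrightarrow> (\<lambda>k. rGamma (a * real k + b) * z ^ k) sums mittag_leffler a b z"
 unfolding mittag_leffler_def by (intro summable_sums summable_norm_cancel[OF summable_mittag_leffler])

text \<open>
 Multiplying by \<open>r\<close> shifts the second index down; this converts boundedness of the multiplier with
 index \<open>b - a\<close> into decay of the one with index \<open>b\<close>.
\<close>

lemma mittag_leffler_shift:
 assumes "0 < a"
 shows "r * mittag_leffler a b (- r) = rGamma (b - a) - mittag_leffler a (b - a) (- r)"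
proof -
 have "(\<lambda>k. rGamma (a * real (Suc k) + (b - a)) * (- r) ^ Suc k) sums (- r * mittag_leffler a b (- r))"
  using sums_mult[OF sums_mittag_leffler[OF assms, of b "- r"], of "- r"] by (simp add: algebra_simps)
 then have "(\<lambda>k. rGamma (a * real k + (b - a)) * (- r) ^ k) sums (- r * mittag_leffler a b (- r) + rGamma (b - a))"
  by (subst (asm) sums_Suc_iff) simp
 then have "mittag_leffler a (b - a) (- r) = - r * mittag_leffler a b (- r) + rGamma (b - a)"
  using sums_mittag_leffler[OF assms] sums_unique2 by blast
 then show ?thesis by simp
qed

locale mittag_leffler_contour = hankel_contour +
 fixes a :: real
 assumes a: "0 < a" "a < 2" and a\<theta>: "a * \<theta> < pi"
begin

text \<open>Half of the largest argument of z^a on the contour. Rotation by -\<psi> carries the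
  sector of these arguments to one that is symmetric about the positive axis and lies in the right
  half-plane.\<close>

definition \<psi> :: real where "\<psi> = a * \<theta> / 2"

lemma \<psi>: "0 < \<psi>" "\<psi> < pi / 2"
proof -
 show "0 < \<psi>" unfolding \<psi>_def using a \<theta> pi_gt_zero by (intro divide_pos_pos mult_pos_pos) linarith+
 show "\<psi> < pi / 2" using a\<theta> by (simp add: \<psi>_def)
qed

lemma cos_\<psi>: "0 < cos \<psi>" using \<psi> by (intro cos_gt_zero) auto

lemma ray_powr_eq:
 assumes "0 < R" "0 \<le> x"
 shows "ray \<theta> R x powr of_real y = of_real (norm (ray \<theta> R x) powr y) * cis (y * Arg (ray \<theta> R x))"
proof -
 have nz: "ray \<theta> R x \<noteq> 0" using ray_nonzero[OF assms] by auto
 have "Ln (ray \<theta> R x) = of_real (ln (norm (ray \<theta> R x))) + \<i> * of_real (Arg (ray \<theta> R x))"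
  using nz by (simp add: Arg_eq_Im_Ln complex_eq_iff)
 then show ?thesis using nz
  by (simp add: powr_def cis_conv_exp exp_of_real[symmetric] algebra_simps flip: exp_add)
qed

lemma Arg_ray:
 assumes "0 < R" "0 \<le> x"
 shows "0 \<le> Arg (ray \<theta> R x)" "Arg (ray \<theta> R x) \<le> \<theta>"
proof -
 have nz: "ray \<theta> R x \<noteq> 0" using ray_nonzero[OF assms] by auto
 show "0 \<le> Arg (ray \<theta> R x)"
  using Im_Ln_pos_le[OF nz] assms sin_pos by (simp add: Arg_eq_Im_Ln[OF nz] ray_simps)
 show "Arg (ray \<theta> R x) \<le> \<theta>"
 proof (rule field_le_epsilon)
  fix e :: real assume e: "0 < e"
  define \<eta> where "\<eta> = max (pi - \<theta> - e) ((pi - \<theta>) / 2)"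
  have \<eta>: "0 < \<eta>" "\<eta> < pi - \<theta>" "\<eta> < pi" using e \<theta> pi_gt_zero by (auto simp: \<eta>_def less_max_iff_disj)
  have "0 < Im (ray \<theta> R x * cis \<eta>)" using ray_in_half_plane[of R x \<eta> \<theta>] assms \<eta> \<theta> pi_gt_zero by auto
  from half_plane_Arg(3)[OF this] \<eta> have "Arg (ray \<theta> R x) < pi - \<eta>" by simp
  then show "Arg (ray \<theta> R x) \<le> \<theta> + e" by (auto simp: \<eta>_def)
 qed
qed

lemma Re_rotated_ray_powr:
 assumes "0 < R" "0 \<le> x"
 shows "norm (ray \<theta> R x) powr a * cos \<psi> \<le> Re (cis (- \<psi>) * ray \<theta> R x powr of_real a)"
proof -
 define t where "t = a * Arg (ray \<theta> R x) - \<psi>"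
 have "0 \<le> a * Arg (ray \<theta> R x)" "a * Arg (ray \<theta> R x) \<le> a * \<theta>"
  using Arg_ray[OF assms] a by auto
 then have "\<bar>t\<bar> \<le> \<psi>" unfolding t_def \<psi>_def abs_le_iff by linarith
 then have "cos \<psi> \<le> cos \<bar>t\<bar>" using \<psi> pi_gt_zero by (subst cos_mono_le_eq) auto
 then have "cos \<psi> \<le> cos t" by simp
 moreover have "Re (cis (- \<psi>) * ray \<theta> R x powr of_real a) = norm (ray \<theta> R x) powr a * cos t"
 proof -
  have "cis (- \<psi>) * ray \<theta> R x powr of_real a = of_real (norm (ray \<theta> R x) powr a) * cis t"
  proof -
   have "cis (- \<psi>) * (of_real A * cis y) = of_real A * cis (y - \<psi>)" for A y :: real
    using cis_mult[of "- \<psi>" y] by (simp add: mult.left_commute)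
   then show ?thesis unfolding ray_powr_eq[OF assms] t_def .
  qed
  then show ?thesis by simp
 qed
 ultimately show ?thesis by (simp add: mult_left_mono)
qed

text \<open>After the rotation both summands have non-negative real part, so they cannot cancel, and
  the lower bound is uniform in \<open>r\<close>.\<close>

lemma norm_ray_powr_add_ge:
 assumes "0 < R" "0 \<le> x" "0 \<le> r"
 shows "norm (ray \<theta> R x) powr a * cos \<psi> \<le> norm (ray \<theta> R x powr of_real a + of_real r)"
proof -
 have "norm (ray \<theta> R x) powr a * cos \<psi> \<le> Re (cis (- \<psi>) * (ray \<theta> R x powr of_real a + of_real r))"
  using Re_rotated_ray_powr[OF assms(1,2)] mult_nonneg_nonneg[OF less_imp_le[OF cos_\<psi>] assms(3)]
  by (simp add: ring_distribs)
 also have "\<dots> \<le> norm (cis (- \<psi>) * (ray \<theta> R x powr of_real a + of_real r))" by (rule complex_Re_le_cmod)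
 finally show ?thesis by (simp add: norm_mult)
qed

text \<open>When r is smaller than |z|^a on the whole ray, 1 / (z^a + r) is a geometric series in -r
  z^(-a) up to the factor z^(-a), and each term is Hankel's integral for one coefficient of the
  Mittag-Leffler series.\<close>

lemma mittag_leffler_contour_large:
 assumes R: "0 < R" and r: "0 \<le> r" "r < (R * sin \<theta>) powr a"
 shows "mittag_leffler a b (- r) =
  Im (ray_integral \<theta> R (\<lambda>z. exp z * z powr of_real (a - b) / (z powr of_real a + of_real r))) / pi"
proof -
 define X where "X = (R * sin \<theta>) powr (- a)"
 have X: "0 < X" "r * X < 1"
  using r R sin_pos by (auto simp: X_def powr_minus divide_less_eq field_simps)
 define f where "f k x = indicator {0..} x *\<^sub>R (cis \<theta> * ((- of_real r) ^ k * (exp (ray \<theta> R x) * ray \<theta> R x powr of_real (- (a * real k + b)))))" for k :: nat and x :: real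
 define g where "g x = indicator {0..} x * (norm (exp (ray \<theta> R x)) * norm (ray \<theta> R x) powr (- b))" for x
 have g: "L1 g" unfolding g_def by (rule integrable_exp_powr_ray[OF R])
 have nX: "norm (ray \<theta> R x) powr (- a) \<le> X" if "0 \<le> x" for x
  unfolding X_def using norm_ray_ge(1)[of R x \<theta>] that R sin_pos a by (intro powr_mono2') auto
 have feq: "f k x = (- of_real r) ^ k * (indicator {0..} x *\<^sub>R (cis \<theta> * (exp (ray \<theta> R x) * ray \<theta> R x powr of_real (- (a * real k + b)))))" for k x
  by (simp add: f_def mult.left_commute)
 have fi: "L1 (f k)" for k
  unfolding feq by (intro integrable_mult_right integrable_ray_exp_powr[OF R])
 have fint: "(LINT x|lborel. f k x) = (- of_real r) ^ k * ray_integral \<theta> R (\<lambda>z. exp z * z powr of_real (- (a * real k + b)))" for k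
  unfolding feq ray_integral_def by (rule integral_mult_right_zero)
 have fb: "norm (f k x) \<le> (r * X) ^ k * g x" for k x
 proof (cases "0 \<le> x")
  case True
  have nz: "norm (ray \<theta> R x) \<noteq> 0" using ray_nonzero[OF R True] by simp
  have "norm (ray \<theta> R x) powr (- (a * real k + b)) = (norm (ray \<theta> R x) powr (- a)) ^ k * norm (ray \<theta> R x) powr (- b)"
   using nz by (simp add: powr_realpow[symmetric] powr_powr powr_add[symmetric])
  also have "\<dots> \<le> X ^ k * norm (ray \<theta> R x) powr (- b)"
   by (intro mult_right_mono power_mono nX True) auto
  finally have "r ^ k * (norm (exp (ray \<theta> R x)) * norm (ray \<theta> R x) powr (- (a * real k + b))) \<le> r ^ k * (norm (exp (ray \<theta> R x)) * (X ^ k * norm (ray \<theta> R x) powr (- b)))"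
   using r by (intro mult_left_mono) auto
  moreover have "norm (f k x) = r ^ k * (norm (exp (ray \<theta> R x)) * norm (ray \<theta> R x) powr (- (a * real k + b)))"
   unfolding f_def norm_scaleR norm_mult norm_powr_real_exponent norm_power using True r by simp
  ultimately show ?thesis using True by (simp add: g_def power_mult_distrib mult_ac)
 qed (simp add: f_def g_def)
 have gnn: "0 \<le> g x" for x by (simp add: g_def)
 have sg: "summable (\<lambda>k. (r * X) ^ k)" using X r by (intro summable_geometric) auto
 have "(\<lambda>k. LINT x|lborel. f k x) sums (LINT x|lborel. (\<Sum>k. f k x))"
 proof (rule sums_integral[OF fi])
  show "AE x in lborel. summable (\<lambda>k. norm (f k x))"
   using fb by (intro AE_I2 summable_comparison_test'[OF summable_mult2[OF sg]]) auto
  show "summable (\<lambda>k. L1_norm (f k))"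
  proof (rule summable_comparison_test'[OF summable_mult2[OF sg, of "LINT x|lborel. g x"]])
   fix k :: nat
   have "L1_norm (f k) \<le> (LINT x|lborel. (r * X) ^ k * g x)"
    using fb by (intro integral_mono integrable_norm fi integrable_mult_right g)
   then show "norm (L1_norm (f k)) \<le> (r * X) ^ k * (LINT x|lborel. g x)"
    by (simp add: integral_nonneg_AE)
  qed
 qed
 moreover have "(\<Sum>k. f k x) = indicator {0..} x *\<^sub>R (cis \<theta> * (exp (ray \<theta> R x) * ray \<theta> R x powr of_real (a - b) / (ray \<theta> R x powr of_real a + of_real r)))" for x
 proof (cases "0 \<le> x")
  case True
  define z where "z = ray \<theta> R x"
  have nz: "z \<noteq> 0" using ray_nonzero[OF R True] by (auto simp: z_def)
  define q where "q = - of_real r * z powr of_real (- a)"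
  have "norm q = r * norm z powr (- a)" unfolding q_def norm_mult norm_powr_real_exponent using r by simp
  also have "\<dots> \<le> r * X" unfolding z_def using nX[OF True] r by (intro mult_left_mono) auto
  finally have q: "norm q < 1" using X by simp
  have "(\<lambda>k. q ^ k) sums (1 / (1 - q))" by (rule geometric_sums[OF q])
  then have "(\<lambda>k. cis \<theta> * (exp z * z powr of_real (- b)) * q ^ k) sums (cis \<theta> * (exp z * z powr of_real (- b)) * (1 / (1 - q)))"
   by (rule sums_mult)
  moreover have "cis \<theta> * (exp z * z powr of_real (- b)) * q ^ k = f k x" for k
  proof -
   have "z powr of_real (- (a * real k + b)) = z powr of_real (- b) * (z powr of_real (- a)) ^ k"
    using nz by (simp add: powr_def exp_add[symmetric] exp_of_nat_mult[symmetric] algebra_simps)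
   moreover have "q ^ k = (- of_real r) ^ k * (z powr of_real (- a)) ^ k"
    unfolding q_def by (rule power_mult_distrib)
   moreover have "c * (E * Z) * (N * W) = c * (N * (E * (Z * W)))" for c E Z N W :: complex
    by (simp add: mult_ac)
   ultimately show ?thesis using True unfolding f_def z_def[symmetric] by simp
  qed
  moreover have "z powr of_real (- b) * (1 / (1 - q)) = z powr of_real (a - b) / (z powr of_real a + of_real r)"
  proof -
   have p: "z powr of_real (- b) * z powr of_real a = z powr of_real (a - b)" "z powr of_real (- a) * z powr of_real a = 1"
    using nz by (simp_all add: powr_add[symmetric])
   then have "(1 - q) * z powr of_real a = z powr of_real a + of_real r" by (simp add: q_def ring_distribs mult.assoc del: of_real_minus)
   moreover have "z powr of_real a \<noteq> 0" using nz by simp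
   ultimately have "z powr of_real (a - b) / (z powr of_real a + of_real r) = (z powr of_real (- b) * z powr of_real a) / ((1 - q) * z powr of_real a)"
    using p by simp
   then show ?thesis using \<open>z powr of_real a \<noteq> 0\<close> by simp
  qed
  ultimately have "(\<lambda>k. f k x) sums (cis \<theta> * (exp z * (z powr of_real (a - b) / (z powr of_real a + of_real r))))"
   by (simp only: mult.assoc)
  then show ?thesis using True by (simp add: sums_iff z_def)
 qed (simp add: f_def)
 ultimately have "(\<lambda>k. (- of_real r) ^ k * ray_integral \<theta> R (\<lambda>z. exp z * z powr of_real (- (a * real k + b)))) sums
   ray_integral \<theta> R (\<lambda>z. exp z * z powr of_real (a - b) / (z powr of_real a + of_real r))"
  unfolding fint by (simp add: ray_integral_def)
 then have "(\<lambda>k. Im ((- of_real r) ^ k * ray_integral \<theta> R (\<lambda>z. exp z * z powr of_real (- (a * real k + b)))) / pi) sums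
   (Im (ray_integral \<theta> R (\<lambda>z. exp z * z powr of_real (a - b) / (z powr of_real a + of_real r))) / pi)"
  by (intro sums_divide bounded_linear.sums[OF bounded_linear_Im])
 moreover have "Im ((- of_real r) ^ k * ray_integral \<theta> R (\<lambda>z. exp z * z powr of_real (- (a * real k + b)))) / pi = rGamma (a * real k + b) * (- r) ^ k" for k
 proof -
  have "(- complex_of_real r) ^ k = of_real ((- r) ^ k)" by simp
  then have "Im ((- of_real r) ^ k * ray_integral \<theta> R (\<lambda>z. exp z * z powr of_real (- (a * real k + b)))) = (- r) ^ k * Im (ray_integral \<theta> R (\<lambda>z. exp z * z powr of_real (- (a * real k + b))))"
   by (simp only: times_complex.sel Re_complex_of_real Im_complex_of_real mult_zero_left add_0_right)
  then have "Im ((- of_real r) ^ k * ray_integral \<theta> R (\<lambda>z. exp z * z powr of_real (- (a * real k + b)))) / pi =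
    (- r) ^ k * (Im (ray_integral \<theta> R (\<lambda>z. exp z * z powr of_real (- (a * real k + b)))) / pi)"
   by (simp only: times_divide_eq_right)
  also have "Im (ray_integral \<theta> R (\<lambda>z. exp z * z powr of_real (- (a * real k + b)))) / pi = rGamma (a * real k + b)"
   using hankel_eq_rGamma[OF R, of "a * real k + b"] unfolding hankel_def .
  finally show ?thesis by (simp only: mult.commute)
 qed
 ultimately show ?thesis using sums_mittag_leffler[OF a(1), of b "- r"] by (simp add: sums_unique2)
qed

lemma norm_mittag_leffler_integrand_le:
 assumes "0 < R" "0 \<le> x" "0 \<le> r"
 shows "norm (exp (ray \<theta> R x) * ray \<theta> R x powr of_real (a - b) / (ray \<theta> R x powr of_real a + of_real r)) \<le>
  norm (exp (ray \<theta> R x)) * norm (ray \<theta> R x) powr (- b) / cos \<psi>"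
proof -
 have p: "0 < norm (ray \<theta> R x) powr a * cos \<psi>" using ray_nonzero[OF assms(1,2)] cos_\<psi> by simp
 have "norm (exp (ray \<theta> R x) * ray \<theta> R x powr of_real (a - b) / (ray \<theta> R x powr of_real a + of_real r)) =
   norm (exp (ray \<theta> R x)) * norm (ray \<theta> R x) powr (a - b) / norm (ray \<theta> R x powr of_real a + of_real r)"
  unfolding norm_divide norm_mult norm_powr_real_exponent ..
 also have "\<dots> \<le> norm (exp (ray \<theta> R x)) * norm (ray \<theta> R x) powr (a - b) / (norm (ray \<theta> R x) powr a * cos \<psi>)"
 proof (rule divide_left_mono)
  show ge: "norm (ray \<theta> R x) powr a * cos \<psi> \<le> norm (ray \<theta> R x powr of_real a + of_real r)"
   by (rule norm_ray_powr_add_ge[OF assms])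
  show "0 < norm (ray \<theta> R x powr of_real a + of_real r) * (norm (ray \<theta> R x) powr a * cos \<psi>)"
   by (rule mult_pos_pos[OF less_le_trans[OF p ge] p])
 qed simp
 also have "\<dots> = norm (exp (ray \<theta> R x)) * norm (ray \<theta> R x) powr (- b) / cos \<psi>"
  using ray_nonzero[OF assms(1,2)] by (simp add: powr_diff powr_minus divide_simps)
 finally show ?thesis .
qed

text \<open>For given \<open>r\<close> the geometric expansion is valid on the ray from
  \<open>Q\<close>, far enough out; the contour is then shifted to \<open>R\<close> without meeting
  a zero of z^a + r.\<close>

lemma mittag_leffler_contour_eq:
 assumes R: "0 < R" and r: "0 \<le> r"
 shows "mittag_leffler a b (- r) =
  Im (ray_integral \<theta> R (\<lambda>z. exp z * z powr of_real (a - b) / (z powr of_real a + of_real r))) / pi"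
proof -
 let ?f = "\<lambda>z. exp z * z powr of_real (a - b) / (z powr of_real a + of_real r)"
 define Q where "Q = (r + 1) powr (1 / a) / sin \<theta>"
 have Q: "0 < Q" "r < (Q * sin \<theta>) powr a" using r sin_pos a by (auto simp: Q_def powr_powr)
 \<comment> \<open>The half-plane of the shift consists of arguments between -\<eta> = \<theta>' -
   pi and \<theta>'. Since a \<theta>' <= pi and a \<eta> < pi, z^a avoids the negative axis on this
   open half-plane.\<close>
 define \<theta>' where "\<theta>' = min ((\<theta> + pi) / 2) (pi / a)"
 define \<eta> where "\<eta> = pi - \<theta>'"
 have t': "\<theta> < \<theta>'" "\<theta>' < pi" "a * \<theta>' \<le> pi"
 proof -
  show "\<theta> < \<theta>'" using \<theta> a\<theta> a by (simp add: \<theta>'_def field_simps)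
  have "\<theta>' \<le> (\<theta> + pi) / 2" "\<theta>' \<le> pi / a"
   unfolding \<theta>'_def by (rule min.cobounded1, rule min.cobounded2)
  moreover from this(2) have "a * \<theta>' \<le> a * (pi / a)" using a by (intro mult_left_mono) auto
  ultimately show "\<theta>' < pi" "a * \<theta>' \<le> pi" using \<theta> a by auto
 qed
 have \<eta>: "0 < \<eta>" "\<theta> + \<eta> < pi" "\<eta> < pi" "a * \<eta> < pi" "a * (pi - \<eta>) \<le> pi"
 proof -
  show "0 < \<eta>" "\<theta> + \<eta> < pi" "\<eta> < pi" "a * (pi - \<eta>) \<le> pi" using t' \<theta> pi_gt_zero by (auto simp: \<eta>_def)
  have "a * \<eta> < 2 * \<eta>" using a t' by (intro mult_strict_right_mono) (auto simp: \<eta>_def)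
  also have "\<dots> \<le> pi" using t' \<theta> by (simp add: \<eta>_def)
  finally show "a * \<eta> < pi" .
 qed
 obtain K where K: "\<And>P x. min R Q \<le> P \<Longrightarrow> P \<le> max R Q \<Longrightarrow> 0 \<le> x \<Longrightarrow>
   norm (exp (ray \<theta> P x)) * norm (ray \<theta> P x) powr (- b) \<le> K * exp (cos \<theta> / 2 * x)"
 proof -
  have "\<exists>K\<ge>0. \<forall>P x. min R Q \<le> P \<longrightarrow> P \<le> max R Q \<longrightarrow> 0 \<le> x \<longrightarrow>
    norm (exp (ray \<theta> P x)) * norm (ray \<theta> P x) powr (- b) \<le> K * exp (cos \<theta> / 2 * x)"
   using R Q by (intro norm_exp_powr_ray_le) auto
  then show ?thesis using that by blast
 qed
 have np: "z \<notin> \<real>\<^sub>\<le>\<^sub>0" "z powr of_real a + of_real r \<noteq> 0" if z: "0 < Im (z * cis \<eta>)" for z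
 proof -
  note A = half_plane_Arg[OF z \<eta>(1,3)]
  have "Arg z \<noteq> pi" using A(3) \<eta>(1) by simp
  then show "z \<notin> \<real>\<^sub>\<le>\<^sub>0" using A(1) by (auto simp: complex_nonpos_Reals_iff Arg_eq_pi complex_eq_iff)
  define t where "t = a * Arg z"
  have "a * (- \<eta>) < t" "t < a * (pi - \<eta>)" unfolding t_def
   by (rule mult_strict_left_mono[OF A(2) a(1)], rule mult_strict_left_mono[OF A(3) a(1)])
  then have t: "- pi < t" "t < pi" using \<eta>(4,5) by auto
  have "Ln z = of_real (ln (norm z)) + \<i> * of_real (Arg z)"
   using A(1) by (simp add: Arg_eq_Im_Ln complex_eq_iff)
  then have e: "z powr of_real a = of_real (norm z powr a) * cis t" using A(1)
   by (simp add: powr_def cis_conv_exp exp_of_real[symmetric] t_def algebra_simps flip: exp_add)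
  show "z powr of_real a + of_real r \<noteq> 0"
  proof
   assume 0: "z powr of_real a + of_real r = 0"
   have pos: "0 < norm z powr a" using A(1) by simp
   have "norm z powr a * sin t = 0" using arg_cong[OF 0, of Im] unfolding e by simp
   then have "sin t = 0" using pos by simp
   then have "t = 0" using t sin_gt_zero[of t] sin_gt_zero[of "- t"] by (cases "0 < t"; cases "t < 0") auto
   then show False using arg_cong[OF 0, of Re] pos r unfolding e by simp
  qed
 qed
 have "Im (ray_integral \<theta> R ?f) = Im (ray_integral \<theta> Q ?f)"
 proof (rule ray_integral_shift[OF convex_open_half_plane[of \<eta>] _ _ _ _ _ exp_ray_tendsto_0[of "K / cos \<psi>"] R Q(1)])
  show "?f holomorphic_on {z. 0 < Im (z * cis \<eta>)}"
   using np by (intro holomorphic_intros) auto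
  show "ray \<theta> P x \<in> {z. 0 < Im (z * cis \<eta>)}" if "0 < P" "0 \<le> x" for P x
   using ray_in_half_plane[of P x \<eta> \<theta>] that \<eta> \<theta> pi_gt_zero by auto
  show "Im (?f (of_real P)) = 0" if "0 < P" for P
  proof -
   have "?f (complex_of_real P) = of_real (exp P * P powr (a - b) / (P powr a + r))"
    using that powr_of_real[of P "a - b"] powr_of_real[of P a] by (simp add: exp_of_real)
   then show ?thesis by (metis Im_complex_of_real)
  qed
  show "L1 (\<lambda>x. indicator {0..} x *\<^sub>R (cis \<theta> * ?f (ray \<theta> P x)))" if P: "0 < P" for P
  proof (rule lebesgue_integrable_bound)
   show "L1 (\<lambda>x. (1 / cos \<psi>) * (indicator {0..} x * (norm (exp (ray \<theta> P x)) * norm (ray \<theta> P x) powr (- b))))"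
    by (intro integrable_mult_right integrable_exp_powr_ray[OF P])
   show "(\<lambda>x. indicator {0..} x *\<^sub>R (cis \<theta> * ?f (ray \<theta> P x))) \<in> borel_measurable lborel"
    unfolding powr_def by measurable
   show "AE x in lborel. norm (indicator {0..} x *\<^sub>R (cis \<theta> * ?f (ray \<theta> P x))) \<le> norm ((1 / cos \<psi>) * (indicator {0..} x * (norm (exp (ray \<theta> P x)) * norm (ray \<theta> P x) powr (- b))))"
   proof (rule AE_I2)
    fix x :: real
    show "norm (indicator {0..} x *\<^sub>R (cis \<theta> * ?f (ray \<theta> P x))) \<le> norm ((1 / cos \<psi>) * (indicator {0..} x * (norm (exp (ray \<theta> P x)) * norm (ray \<theta> P x) powr (- b))))"
    proof (cases "0 \<le> x")
     case True
     have "norm (indicator {0..} x *\<^sub>R (cis \<theta> * ?f (ray \<theta> P x))) = norm (?f (ray \<theta> P x))"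
      unfolding norm_scaleR norm_mult[of "cis \<theta>"] using True by simp
     also have "\<dots> \<le> norm (exp (ray \<theta> P x)) * norm (ray \<theta> P x) powr (- b) / cos \<psi>"
      by (rule norm_mittag_leffler_integrand_le[OF P True r])
     finally show ?thesis using True cos_\<psi> by simp
    qed simp
   qed
  qed
  show "norm (?f (ray \<theta> P x)) \<le> K / cos \<psi> * exp (cos \<theta> / 2 * x)" if "min R Q \<le> P" "P \<le> max R Q" "0 \<le> x" for P x
  proof -
   have P: "0 < P" using that R Q by auto
   have "norm (?f (ray \<theta> P x)) \<le> norm (exp (ray \<theta> P x)) * norm (ray \<theta> P x) powr (- b) / cos \<psi>"
    by (rule norm_mittag_leffler_integrand_le[OF P that(3) r])
   also have "\<dots> \<le> K * exp (cos \<theta> / 2 * x) / cos \<psi>"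
    using cos_\<psi> K[OF that] by (intro divide_right_mono) auto
   finally show ?thesis by simp
  qed
 qed
 then show ?thesis using mittag_leffler_contour_large[OF Q(1) r Q(2)] by simp
qed

lemma exp_integral:
 assumes "0 < Re c"
 shows "L1 (\<lambda>t. indicator {0<..} t *\<^sub>R exp (- (c * of_real t)))"
  and "(LINT t|lborel. indicator {0<..} t *\<^sub>R exp (- (c * of_real t))) = 1 / c"
proof -
 have e: "(\<lambda>t. indicator {0<..} t *\<^sub>R exp (- (c * of_real t))) = (\<lambda>t. indicator {0<..} t *\<^sub>R (of_real (t powr (1 - 1)) * exp (- (c * of_real t))))"
  by (auto simp: indicator_def)
 show "L1 (\<lambda>t. indicator {0<..} t *\<^sub>R exp (- (c * of_real t)))"
  unfolding e using assms by (intro Gamma_integral_complex_scale) auto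
 have "(LINT t|lborel. indicator {0<..} t *\<^sub>R exp (- (c * of_real t))) = of_real (Gamma 1) * c powr (- of_real 1)"
  unfolding e using assms by (intro Gamma_integral_complex_scale) auto
 also have "\<dots> = 1 / c" using assms by (auto simp: powr_minus inverse_eq_divide)
 finally show "(LINT t|lborel. indicator {0<..} t *\<^sub>R exp (- (c * of_real t))) = 1 / c" .
qed

text \<open>The ray from \<open>R0\<close> stays outside the open unit disc, so |z|^a >= 1 on it and
  the density below decays like exp(-\<tau> cos \<psi>).\<close>

definition R0 :: real where "R0 = 1 / sin \<theta>"

lemma R0_pos: "0 < R0" using sin_pos by (simp add: R0_def)

lemma one_le_norm_ray: "0 \<le> x \<Longrightarrow> 1 \<le> norm (ray \<theta> R0 x)"
 using norm_ray_ge(1)[of R0 x \<theta>] sin_pos by (simp add: R0_def)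

text \<open>Obtained by writing 1 / (z^a + r) as cis(-\<psi>) times the integral of
  exp(-cis(-\<psi>) \<tau> (z^a + r)) over \<tau> > 0 and integrating over z first. It is the weight
  of exp(-w r) at w = cis(-\<psi>) \<tau>, which for r = |\<xi>|^2 is the symbol of a heat kernel at
  complex time w.\<close>

definition heat_density :: "real \<Rightarrow> real \<Rightarrow> complex" where
 "heat_density b \<tau> = indicator {0<..} \<tau> *\<^sub>R (cis (- \<psi>) / of_real pi *
  ray_integral \<theta> R0 (\<lambda>z. exp z * z powr of_real (a - b) * exp (- (cis (- \<psi>) * of_real \<tau> * z powr of_real a))))"

lemma norm_exp_rotated_ray_le:
 assumes "0 \<le> x" "0 \<le> \<tau>" "0 \<le> r"
 shows "norm (exp (- (cis (- \<psi>) * of_real \<tau> * (ray \<theta> R0 x powr of_real a + of_real r)))) \<le> exp (- (cos \<psi> * \<tau>))"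
proof -
 have "cos \<psi> \<le> norm (ray \<theta> R0 x) powr a * cos \<psi>"
  using one_le_norm_ray[OF assms(1)] a cos_\<psi> by (simp add: ge_one_powr_ge_zero mult_le_cancel_right1)
 also have "\<dots> \<le> Re (cis (- \<psi>) * ray \<theta> R0 x powr of_real a)"
  by (rule Re_rotated_ray_powr[OF R0_pos assms(1)])
 finally have "cos \<psi> \<le> Re (cis (- \<psi>) * ray \<theta> R0 x powr of_real a)" .
 moreover have "0 \<le> cos \<psi> * r" using cos_\<psi> assms by simp
 ultimately have "cos \<psi> \<le> Re (cis (- \<psi>) * (ray \<theta> R0 x powr of_real a + of_real r))"
  by (simp add: ring_distribs)
 then have "cos \<psi> * \<tau> \<le> Re (cis (- \<psi>) * (ray \<theta> R0 x powr of_real a + of_real r)) * \<tau>"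
  using assms by (intro mult_right_mono)
 also have "\<dots> = Re (cis (- \<psi>) * of_real \<tau> * (ray \<theta> R0 x powr of_real a + of_real r))"
  by (simp add: algebra_simps)
 finally show ?thesis unfolding norm_exp_eq_Re by simp
qed

lemma borel_measurable_heat_density [measurable]: "heat_density b \<in> Borel"
 unfolding heat_density_def ray_integral_def powr_def by measurable

lemma norm_heat_density_le: "\<exists>C\<ge>0. \<forall>\<tau>. norm (heat_density b \<tau>) \<le> C * (indicator {0<..} \<tau> * exp (- (cos \<psi> * \<tau>)))"
proof -
 define g where "g x = indicator {0..} x * (norm (exp (ray \<theta> R0 x)) * norm (ray \<theta> R0 x) powr (a - b))" for x
 have g: "L1 g" unfolding g_def by (rule integrable_exp_powr_ray[OF R0_pos])
 have "norm (heat_density b \<tau>) \<le> (LINT x|lborel. g x) / pi * (indicator {0<..} \<tau> * exp (- (cos \<psi> * \<tau>)))" for \<tau>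
 proof (cases "0 < \<tau>")
  case True
  have "norm (ray_integral \<theta> R0 (\<lambda>z. exp z * z powr of_real (a - b) * exp (- (cis (- \<psi>) * of_real \<tau> * z powr of_real a)))) \<le>
   (LINT x|lborel. exp (- (cos \<psi> * \<tau>)) * g x)"
   unfolding ray_integral_def
  proof (rule order_trans[OF integral_norm_bound integral_mono'])
   have le: "norm (indicator {0..} x *\<^sub>R (cis \<theta> * (exp (ray \<theta> R0 x) * ray \<theta> R0 x powr of_real (a - b) * exp (- (cis (- \<psi>) * of_real \<tau> * ray \<theta> R0 x powr of_real a))))) \<le> exp (- (cos \<psi> * \<tau>)) * g x" for x
   proof (cases "0 \<le> x")
    case x: True
    have "norm (indicator {0..} x *\<^sub>R (cis \<theta> * (exp (ray \<theta> R0 x) * ray \<theta> R0 x powr of_real (a - b) * exp (- (cis (- \<psi>) * of_real \<tau> * ray \<theta> R0 x powr of_real a))))) =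
     g x * norm (exp (- (cis (- \<psi>) * of_real \<tau> * ray \<theta> R0 x powr of_real a)))"
     unfolding norm_scaleR norm_mult norm_powr_real_exponent using x by (simp add: g_def)
    also have "\<dots> \<le> g x * exp (- (cos \<psi> * \<tau>))"
     using norm_exp_rotated_ray_le[OF x, of \<tau> 0] True by (intro mult_left_mono) (auto simp: g_def)
    finally show ?thesis by (simp add: mult.commute)
   qed (simp add: g_def)
   then show "norm (indicator {0..} x *\<^sub>R (cis \<theta> * (exp (ray \<theta> R0 x) * ray \<theta> R0 x powr of_real (a - b) * exp (- (cis (- \<psi>) * of_real \<tau> * ray \<theta> R0 x powr of_real a))))) \<le> exp (- (cos \<psi> * \<tau>)) * g x" for x .
   show "L1 (\<lambda>x. exp (- (cos \<psi> * \<tau>)) * g x)" using g by (rule integrable_mult_right)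
   show "0 \<le> exp (- (cos \<psi> * \<tau>)) * g x" for x by (simp add: g_def)
  qed
  then show ?thesis using True by (simp add: heat_density_def norm_mult norm_divide divide_right_mono mult.commute)
 qed (simp add: heat_density_def)
 moreover have "0 \<le> (LINT x|lborel. g x) / pi" by (intro divide_nonneg_pos integral_nonneg_AE) (auto simp: g_def)
 ultimately show ?thesis by blast
qed

lemma mittag_leffler_heat_density:
 assumes r: "0 \<le> r"
 shows "mittag_leffler a b (- r) = Im (LINT \<tau>|lborel. heat_density b \<tau> * exp (- (cis (- \<psi>) * of_real \<tau> * of_real r)))"
proof -
 define G where "G x = indicator {0..} x *\<^sub>R (cis \<theta> * (exp (ray \<theta> R0 x) * ray \<theta> R0 x powr of_real (a - b)))" for x
 define E where "E x \<tau> = indicator {0<..} \<tau> *\<^sub>R exp (- (cis (- \<psi>) * of_real \<tau> * (ray \<theta> R0 x powr of_real a + of_real r)))" for x \<tau>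
 have G: "L1 G" unfolding G_def by (rule integrable_ray_exp_powr[OF R0_pos])
 have [measurable]: "G \<in> Borel" using G by auto
 have E_meas[measurable]: "(\<lambda>(x, \<tau>). E x \<tau>) \<in> borel_measurable (lborel \<Otimes>\<^sub>M lborel)"
  unfolding E_def powr_def by measurable
 define e where "e \<tau> = indicator {0<..} \<tau> *\<^sub>R exp (- (of_real (cos \<psi>) * complex_of_real \<tau>))" for \<tau>
 have e: "L1 e" unfolding e_def using cos_\<psi> by (intro exp_integral) auto
 have GE: "norm (G x * E x \<tau>) \<le> norm (G x * e \<tau>)" for x \<tau>
  using norm_exp_rotated_ray_le[of x \<tau> r] r
  by (auto simp: G_def E_def e_def norm_mult norm_exp_eq_Re indicator_def intro!: mult_left_mono simp del: of_real_diff)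
 have xt: "integrable (lborel \<Otimes>\<^sub>M lborel) (\<lambda>(x, \<tau>). G x * E x \<tau>)"
  by (rule lebesgue_integrable_bound[OF integrable_pair_mult[OF G e]]) (use GE in \<open>auto simp: split_beta'\<close>)
 have inner: "(LINT \<tau>|lborel. E x \<tau>) = cis \<psi> / (ray \<theta> R0 x powr of_real a + of_real r)" if x: "0 \<le> x" for x
 proof -
  define c where "c = cis (- \<psi>) * (ray \<theta> R0 x powr of_real a + of_real r)"
  have "0 < norm (ray \<theta> R0 x) powr a * cos \<psi>" using ray_nonzero[OF R0_pos x] cos_\<psi> by simp
  also have "\<dots> \<le> Re c"
   using Re_rotated_ray_powr[OF R0_pos x] mult_nonneg_nonneg[OF less_imp_le[OF cos_\<psi>] r] by (simp add: c_def ring_distribs)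
  finally have c: "0 < Re c" .
  have "(LINT \<tau>|lborel. E x \<tau>) = 1 / c"
  proof -
   have "cis (- \<psi>) * of_real \<tau> * (ray \<theta> R0 x powr of_real a + of_real r) = c * of_real \<tau>" for \<tau>
    by (simp add: c_def)
   then show ?thesis using exp_integral(2)[OF c] unfolding E_def by (simp only:)
  qed
  also have "\<dots> = cis \<psi> / (ray \<theta> R0 x powr of_real a + of_real r)"
  proof -
   have "inverse (cis (- \<psi>)) = cis \<psi>" by (simp add: cis_inverse)
   then show ?thesis unfolding c_def by (simp add: divide_inverse)
  qed
  finally show ?thesis .
 qed
 have "ray_integral \<theta> R0 (\<lambda>z. exp z * z powr of_real (a - b) / (z powr of_real a + of_real r)) =
   (LINT x|lborel. cis (- \<psi>) * (LINT \<tau>|lborel. G x * E x \<tau>))"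
  unfolding ray_integral_def
 proof (intro lebesgue_integral_cong refl)
  fix x :: real
  show "indicator {0..} x *\<^sub>R (cis \<theta> * (exp (ray \<theta> R0 x) * ray \<theta> R0 x powr of_real (a - b) / (ray \<theta> R0 x powr of_real a + of_real r))) =
    cis (- \<psi>) * (LINT \<tau>|lborel. G x * E x \<tau>)"
  proof (cases "0 \<le> x")
   case True
   have "cis (- \<psi>) * (LINT \<tau>|lborel. G x * E x \<tau>) = cis (- \<psi>) * (G x * (cis \<psi> / (ray \<theta> R0 x powr of_real a + of_real r)))"
    unfolding inner[OF True, symmetric] by simp
   also have "\<dots> = (cis (- \<psi>) * cis \<psi>) * (G x / (ray \<theta> R0 x powr of_real a + of_real r))" by simp
   also have "cis (- \<psi>) * cis \<psi> = 1" by (simp add: cis_mult)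
   finally show ?thesis using True by (simp add: G_def)
  qed (simp add: G_def)
 qed
 also have "\<dots> = cis (- \<psi>) * (LINT x|lborel. LINT \<tau>|lborel. G x * E x \<tau>)" by simp
 also have "(LINT x|lborel. LINT \<tau>|lborel. G x * E x \<tau>) = (LINT \<tau>|lborel. LINT x|lborel. G x * E x \<tau>)"
  by (rule lborel_pair.Fubini_integral[OF xt, symmetric])
 also have "cis (- \<psi>) * \<dots> = of_real pi * (LINT \<tau>|lborel. heat_density b \<tau> * exp (- (cis (- \<psi>) * of_real \<tau> * of_real r)))"
 proof -
  have "cis (- \<psi>) / of_real pi * (LINT x|lborel. G x * E x \<tau>) = heat_density b \<tau> * exp (- (cis (- \<psi>) * of_real \<tau> * of_real r))" for \<tau>
  proof -
   have "G x * E x \<tau> = indicator {0<..} \<tau> *\<^sub>R exp (- (cis (- \<psi>) * of_real \<tau> * of_real r)) *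
     (indicator {0..} x *\<^sub>R (cis \<theta> * (exp (ray \<theta> R0 x) * ray \<theta> R0 x powr of_real (a - b) * exp (- (cis (- \<psi>) * of_real \<tau> * ray \<theta> R0 x powr of_real a)))))" for x
   proof -
    have "exp (- (c * (A + B))) = exp (- (c * B)) * exp (- (c * A))" for c A B :: complex
     by (simp add: algebra_simps flip: exp_add)
    then have E: "E x \<tau> = indicator {0<..} \<tau> *\<^sub>R (exp (- (cis (- \<psi>) * of_real \<tau> * of_real r)) * exp (- (cis (- \<psi>) * of_real \<tau> * ray \<theta> R0 x powr of_real a)))"
     unfolding E_def by (simp only:)
    have "(i *\<^sub>R (c * u)) * (j *\<^sub>R (v * w)) = j *\<^sub>R v * (i *\<^sub>R (c * (u * w)))" for i j and c u v w :: complex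
     by (simp add: mult_ac)
    then show ?thesis unfolding E G_def .
   qed
   then have "(LINT x|lborel. G x * E x \<tau>) = indicator {0<..} \<tau> *\<^sub>R exp (- (cis (- \<psi>) * of_real \<tau> * of_real r)) *
     ray_integral \<theta> R0 (\<lambda>z. exp z * z powr of_real (a - b) * exp (- (cis (- \<psi>) * of_real \<tau> * z powr of_real a)))"
    unfolding ray_integral_def by (simp only: integral_mult_right_zero)
   then show ?thesis by (simp add: heat_density_def scaleR_conv_of_real mult_ac)
  qed
  then have "(LINT \<tau>|lborel. heat_density b \<tau> * exp (- (cis (- \<psi>) * of_real \<tau> * of_real r))) = cis (- \<psi>) / of_real pi * (LINT \<tau>|lborel. LINT x|lborel. G x * E x \<tau>)"
   by (simp only: integral_mult_right_zero[symmetric])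
  then show ?thesis by simp
 qed
 finally have "ray_integral \<theta> R0 (\<lambda>z. exp z * z powr of_real (a - b) / (z powr of_real a + of_real r)) =
   of_real pi * (LINT \<tau>|lborel. heat_density b \<tau> * exp (- (cis (- \<psi>) * of_real \<tau> * of_real r)))" .
 then show ?thesis using mittag_leffler_contour_eq[OF R0_pos r, of b] by simp
qed

end

text \<open>Conjugating \<open>F\<close> conjugates its transform and reflects the frequency. For an
  even transform the reflection disappears, so taking imaginary parts commutes with the Fourier
  transform; the contour formula provides an imaginary part only.\<close>

lemma fourier_of_real_Im:
 fixes F :: "'a::euclidean_space \<Rightarrow> complex"
 assumes F: "L1 F" and even: "fourier F (- \<xi>) = fourier F \<xi>"
 shows "L1 (\<lambda>x. complex_of_real (Im (F x)))"
  and "fourier (\<lambda>x. of_real (Im (F x))) \<xi> = of_real (Im (fourier F \<xi>))"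
proof -
 have [measurable]: "F \<in> Borel" using F by auto
 show i: "L1 (\<lambda>x. complex_of_real (Im (F x)))"
  using integrable_Im[OF F] by (simp only: complex_of_real_integrable_eq)
 have e: "complex_of_real (Im z) = (z - cnj z) / (2 * \<i>)" for z by (simp add: complex_eq_iff)
 have iC: "L1 (\<lambda>x. cnj (F x))" using F by simp
 have [measurable]: "(\<lambda>x. cnj (F x)) \<in> Borel"
  unfolding measurable_lborel2[symmetric] by (rule borel_measurable_integrable[OF iC])
 have c: "fourier (\<lambda>x. cnj (F x)) \<xi> = cnj (fourier F (- \<xi>))"
 proof -
  have "fourier (\<lambda>x. cnj (F x)) \<xi> = (LINT x|lborel. cnj (cis (x \<bullet> \<xi>) * F x))"
   by (subst fourier_lborel) (auto simp: cis_cnj)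
  also have "\<dots> = cnj (LINT x|lborel. cis (x \<bullet> \<xi>) * F x)" by (rule lebesgue_integral_cnj)
  finally show ?thesis by (simp add: fourier_lborel)
 qed
 have "fourier (\<lambda>x. of_real (Im (F x))) \<xi> = (fourier F \<xi> - fourier (\<lambda>x. cnj (F x)) \<xi>) / (2 * \<i>)"
 proof -
  have "fourier (\<lambda>x. of_real (Im (F x))) \<xi> = (LINT x|lborel. cis (- (x \<bullet> \<xi>)) * of_real (Im (F x)))"
   by (rule fourier_lborel) measurable
  also have "\<dots> = (LINT x|lborel. (cis (- (x \<bullet> \<xi>)) * F x - cis (- (x \<bullet> \<xi>)) * cnj (F x)) / (2 * \<i>))"
   by (simp only: e times_divide_eq_right right_diff_distrib)
  also have "\<dots> = ((LINT x|lborel. cis (- (x \<bullet> \<xi>)) * F x) - (LINT x|lborel. cis (- (x \<bullet> \<xi>)) * cnj (F x))) / (2 * \<i>)"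
   by (subst integral_divide_zero, subst lebesgue_integral_diff) (use integrable_cis_mult(2)[OF F, of \<xi>] integrable_cis_mult(2)[OF iC, of \<xi>] in auto)
  finally show ?thesis by (simp only: fourier_lborel[OF \<open>F \<in> Borel\<close>] fourier_lborel[OF \<open>(\<lambda>x. cnj (F x)) \<in> Borel\<close>])
 qed
 then show "fourier (\<lambda>x. of_real (Im (F x))) \<xi> = of_real (Im (fourier F \<xi>))"
  unfolding c even e .
qed

context mittag_leffler_contour
begin

text \<open>Away from the origin the blow-up \<tau>^(-d/2) at small times is beaten by exp(-e /
  \<tau>), uniformly in \<tau>.\<close>

lemma norm_heat_kernel_rotated_le:
 fixes \<rho> :: real
 assumes "0 < \<rho>"
 shows "\<exists>K\<ge>0. \<forall>\<tau>>0. \<forall>x::'a::euclidean_space. \<rho> \<le> norm x \<longrightarrow> norm (heat_kernel (cis (- \<psi>) * of_real \<tau>) x) \<le> K"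
proof -
 define e where "e = cos \<psi> * \<rho>\<^sup>2 / 4"
 have e: "0 < e" using assms cos_\<psi> by (simp add: e_def)
 define y where "y = real DIM('a) / 2"
 have y: "0 < y" by (simp add: y_def)
 define K where "K = (4 * pi) powr (- y) * (y / e) powr y"
 have "norm (heat_kernel (cis (- \<psi>) * of_real \<tau>) x) \<le> K" if \<tau>: "0 < \<tau>" and x: "\<rho> \<le> norm x" for \<tau> and x :: 'a
 proof -
  have nw: "norm (cis (- \<psi>) * complex_of_real \<tau>) = \<tau>" "Re (cis (- \<psi>) * complex_of_real \<tau>) = cos \<psi> * \<tau>"
   using \<tau> by (simp_all add: norm_mult)
  have "norm (heat_kernel (cis (- \<psi>) * of_real \<tau>) x) = (4 * pi * \<tau>) powr (- y) * exp (- (cos \<psi> * \<tau> / (4 * \<tau>\<^sup>2) * (norm x)\<^sup>2))"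
   unfolding norm_heat_kernel nw y_def by simp
  also have "\<dots> \<le> (4 * pi * \<tau>) powr (- y) * exp (- (e * (1 / \<tau>)))"
  proof (intro mult_left_mono)
   have "\<rho>\<^sup>2 \<le> (norm x)\<^sup>2" using x assms by (intro power_mono) auto
   then have "cos \<psi> / (4 * \<tau>) * \<rho>\<^sup>2 \<le> cos \<psi> / (4 * \<tau>) * (norm x)\<^sup>2"
    using cos_\<psi> \<tau> by (intro mult_left_mono) auto
   then show "exp (- (cos \<psi> * \<tau> / (4 * \<tau>\<^sup>2) * (norm x)\<^sup>2)) \<le> exp (- (e * (1 / \<tau>)))"
    using \<tau> by (simp add: e_def power2_eq_square)
  qed auto
  also have "(4 * pi * \<tau>) powr (- y) = (4 * pi) powr (- y) * (1 / \<tau>) powr y"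
   using \<tau> by (simp add: powr_mult powr_minus powr_divide inverse_eq_divide)
  also have "(4 * pi) powr (- y) * (1 / \<tau>) powr y * exp (- (e * (1 / \<tau>))) \<le>
    (4 * pi) powr (- y) * ((y / e) powr y * exp (e * (1 / \<tau>))) * exp (- (e * (1 / \<tau>)))"
   using \<tau> y e by (intro mult_right_mono mult_left_mono powr_le_exp) auto
  also have "\<dots> = K" by (simp add: K_def exp_minus)
  finally show ?thesis .
 qed
 moreover have "0 \<le> K" by (simp add: K_def)
 ultimately show ?thesis by blast
qed

text \<open>Superposition of heat kernels along the ray of direction -\<psi>. Continuity off the
  origin is recorded for the Riemann--Liouville derivative, which is taken at fixed x \<noteq> 0
  with this kernel rescaled in time.\<close>

lemma ex_mittag_leffler_kernel:
 "\<exists>f :: 'a::euclidean_space \<Rightarrow> complex. L1 f \<and> continuous_on (- {0}) f \<and>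
  (\<forall>\<xi>. fourier f \<xi> = of_real (mittag_leffler a b (- ((norm \<xi>)\<^sup>2))))"
proof -
 define w where "w \<tau> = cis (- \<psi>) * complex_of_real \<tau>" for \<tau>
 have [measurable]: "w \<in> Borel" unfolding w_def by measurable
 have wm: "w \<in> Borel" "heat_density b \<in> Borel" by measurable
 obtain C where C: "0 \<le> C" "\<And>\<tau>. norm (heat_density b \<tau>) \<le> C * (indicator {0<..} \<tau> * exp (- (cos \<psi> * \<tau>)))"
  using norm_heat_density_le by blast
 have pos: "0 < Re (w \<tau>)" if "heat_density b \<tau> \<noteq> 0" for \<tau>
  using that cos_\<psi> by (auto simp: heat_density_def w_def indicator_def split: if_splits)
 have ie: "L1 (\<lambda>\<tau>. C * (indicator {0<..} \<tau> * exp (- (cos \<psi> * \<tau>))))"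
 proof (rule integrable_mult_right)
  have "L1 (\<lambda>\<tau>. norm (indicator {0<..} \<tau> *\<^sub>R exp (- (of_real (cos \<psi>) * complex_of_real \<tau>))))"
   using cos_\<psi> by (intro integrable_norm exp_integral) auto
  then show "L1 (\<lambda>\<tau>. indicator {0<..} \<tau> * exp (- (cos \<psi> * \<tau>)))"
   by (simp add: norm_exp_eq_Re)
 qed
 have id: "L1 (heat_density b)"
  by (rule lebesgue_integrable_bound[OF ie]) (use C(2) order_trans[OF _ abs_ge_self] in auto)
 have int: "L1 (\<lambda>\<tau>. norm (heat_density b \<tau>) * (norm (w \<tau>) / Re (w \<tau>)) powr (DIM('a) / 2))"
 proof -
  have e: "norm (heat_density b \<tau>) * (norm (w \<tau>) / Re (w \<tau>)) powr (DIM('a) / 2) = norm (heat_density b \<tau>) * (1 / cos \<psi>) powr (DIM('a) / 2)" for \<tau>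
   using pos[of \<tau>] cos_\<psi> by (cases "heat_density b \<tau> = 0") (auto simp: w_def norm_mult zero_less_mult_iff)
  show ?thesis unfolding e using id by (intro integrable_mult_left integrable_norm)
 qed
 define F where "F x = (LINT \<tau>|lborel. heat_density b \<tau> * heat_kernel (w \<tau>) x)" for x :: 'a
 have F: "L1 F" unfolding F_def
  by (rule integrable_heat_superposition[OF wm _ int]) (rule pos)
 have FF: "fourier F \<xi> = (LINT \<tau>|lborel. heat_density b \<tau> * exp (- (w \<tau> * of_real ((norm \<xi>)\<^sup>2))))" for \<xi>
  unfolding F_def by (rule fourier_heat_superposition[OF wm _ int]) (rule pos)
 have Im: "Im (fourier F \<xi>) = mittag_leffler a b (- ((norm \<xi>)\<^sup>2))" for \<xi>
  unfolding FF w_def by (rule mittag_leffler_heat_density[symmetric]) simp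
 have even: "fourier F (- \<xi>) = fourier F \<xi>" for \<xi> by (simp add: FF)
 have cont: "continuous_on (- {0}) F"
  unfolding continuous_on_eq_continuous_at[OF open_Compl[OF closed_singleton]]
 proof
  fix x :: 'a assume x: "x \<in> - {0}"
  define \<rho> where "\<rho> = norm x / 2"
  have \<rho>: "0 < \<rho>" "\<rho> < norm x" using x by (auto simp: \<rho>_def)
  let ?S = "{x::'a. \<rho> < norm x}"
  obtain K where K: "0 \<le> K" "\<And>\<tau> x::'a. 0 < \<tau> \<Longrightarrow> \<rho> \<le> norm x \<Longrightarrow> norm (heat_kernel (w \<tau>) x) \<le> K"
   using norm_heat_kernel_rotated_le[OF \<rho>(1), where 'a='a] unfolding w_def by blast
  have "continuous_on ?S F"
   unfolding continuous_on_sequentially o_def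
  proof (intro ballI allI impI)
   fix z and X :: "nat \<Rightarrow> 'a" assume z: "z \<in> ?S" and X: "(\<forall>n. X n \<in> ?S) \<and> X \<longlonglongrightarrow> z"
   show "(\<lambda>n. F (X n)) \<longlonglongrightarrow> F z"
    unfolding F_def
   proof (rule integral_dominated_convergence[where w="\<lambda>\<tau>. K * norm (heat_density b \<tau>)"])
    show "L1 (\<lambda>\<tau>. K * norm (heat_density b \<tau>))" using id by simp
    show "AE \<tau> in lborel. (\<lambda>n. heat_density b \<tau> * heat_kernel (w \<tau>) (X n)) \<longlonglongrightarrow> heat_density b \<tau> * heat_kernel (w \<tau>) z"
    proof (rule AE_I2)
     fix \<tau>
     show "(\<lambda>n. heat_density b \<tau> * heat_kernel (w \<tau>) (X n)) \<longlonglongrightarrow> heat_density b \<tau> * heat_kernel (w \<tau>) z"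
     proof (cases "heat_density b \<tau> = 0")
      case False
      then have "4 * w \<tau> \<noteq> 0" using pos by force
      then show ?thesis unfolding heat_kernel_def using X
       by (intro tendsto_mult tendsto_const tendsto_exp tendsto_minus tendsto_divide tendsto_of_real tendsto_power tendsto_norm) auto
     qed simp
    qed
    show "AE \<tau> in lborel. norm (heat_density b \<tau> * heat_kernel (w \<tau>) (X n)) \<le> K * norm (heat_density b \<tau>)" for n
    proof (rule AE_I2)
     fix \<tau>
     show "norm (heat_density b \<tau> * heat_kernel (w \<tau>) (X n)) \<le> K * norm (heat_density b \<tau>)"
     proof (cases "0 < \<tau>")
      case True
      have "\<rho> \<le> norm (X n)" using X by (auto intro: less_imp_le)
      from mult_left_mono[OF K(2)[OF True this], of "norm (heat_density b \<tau>)"] show ?thesis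
       by (simp add: norm_mult mult.commute)
     qed (simp add: heat_density_def)
    qed
   qed measurable
  qed
  moreover have "open ?S" by (intro open_Collect_less continuous_intros)
  ultimately show "isCont F x" using \<rho> by (auto simp: continuous_on_eq_continuous_at)
 qed
 show ?thesis
  using fourier_of_real_Im[OF F even] Im cont
  by (intro exI[of _ "\<lambda>x. of_real (Im (F x))"]) (auto intro!: continuous_intros)
qed

end

theorem mittag_leffler_kernel:
 assumes "0 < a" "a < 2"
 obtains f :: "'a::euclidean_space \<Rightarrow> complex" where "L1 f" "continuous_on (- {0}) f"
  "\<And>\<xi>. fourier f \<xi> = of_real (mittag_leffler a b (- ((norm \<xi>)\<^sup>2)))"
proof -
 obtain \<theta> where \<theta>: "hankel_contour \<theta>" "a * \<theta> < pi" using ex_hankel_contour[OF assms(2)] by blast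
 interpret mittag_leffler_contour \<theta> a
  using \<theta> assms by (simp add: mittag_leffler_contour_def mittag_leffler_contour_axioms_def)
 show ?thesis using ex_mittag_leffler_kernel[of b] that by blast
qed

section \<open>Riemann--Liouville integrals\<close>

text \<open>The power kernels t_+^(a-1) / Gamma(a). Extended by 0 they form a convolution semigroup
  on the whole line, so Fubini can be used without describing triangles of integration.\<close>

definition rl_kernel :: "real \<Rightarrow> real \<Rightarrow> real" where
 "rl_kernel a t = (if 0 < t then t powr (a - 1) / Gamma a else 0)"

text \<open>Values of \<open>f\<close> at positive times alone enter, because the fundamental
  solution is known to be measurable only there.\<close>

definition rl_int :: "real \<Rightarrow> (real \<Rightarrow> complex) \<Rightarrow> real \<Rightarrow> complex" where
 "rl_int a f t = (LINT s|lborel. of_real (rl_kernel a (t - s)) * (indicator {0<..} s * f s))"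

abbreviation rl_integrand :: "real \<Rightarrow> (real \<Rightarrow> complex) \<Rightarrow> real \<Rightarrow> real \<Rightarrow> complex" where
 "rl_integrand a f t \<equiv> \<lambda>s. of_real (rl_kernel a (t - s)) * (indicator {0<..} s * f s)"

lemma borel_measurable_rl_kernel [measurable]: "rl_kernel a \<in> Borel"
 unfolding rl_kernel_def by measurable

lemma rl_kernel_nonneg: "0 < a \<Longrightarrow> 0 \<le> rl_kernel a t"
 by (simp add: rl_kernel_def Gamma_real_nonneg)

lemma RL_integral_eq_rl_int:
 assumes [measurable]: "(\<lambda>s. indicator {0<..} s * f s) \<in> Borel" and c: "0 < c"
 shows "RL_integral c f t = rl_int c f t"
proof -
 have "RL_integral c f t = (LINT s|lebesgue. indicator {0..t} s *\<^sub>R ((t - s) powr (c - 1) *\<^sub>R f s)) /\<^sub>R Gamma c"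
  using c by (simp add: RL_integral_def set_lebesgue_integral_def)
 also have "(LINT s|lebesgue. indicator {0..t} s *\<^sub>R ((t - s) powr (c - 1) *\<^sub>R f s)) =
   (LINT s|lebesgue. of_real (Gamma c) * (of_real (rl_kernel c (t - s)) * (indicator {0<..} s * f s)))"
 proof (rule integral_cong_AE)
  have m: "(\<lambda>s. of_real (Gamma c) * (of_real (rl_kernel c (t - s)) * (indicator {0<..} s * f s))) \<in> borel_measurable lborel"
   by measurable
  then show m2: "(\<lambda>s. of_real (Gamma c) * (of_real (rl_kernel c (t - s)) * (indicator {0<..} s * f s))) \<in> borel_measurable lebesgue"
   by (rule measurable_completion)
  have "AE s in lborel. s \<noteq> 0 \<and> s \<noteq> t" by (intro AE_conjI AE_lborel_singleton)
  then have "AE s in lebesgue. s \<noteq> 0 \<and> s \<noteq> t" by (rule AE_completion)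
  then show ae: "AE s in lebesgue. indicator {0..t} s *\<^sub>R ((t - s) powr (c - 1) *\<^sub>R f s) =
    of_real (Gamma c) * (of_real (rl_kernel c (t - s)) * (indicator {0<..} s * f s))"
   by eventually_elim (use Gamma_real_pos[OF c] in \<open>auto simp: indicator_def rl_kernel_def scaleR_conv_of_real\<close>)
  \<comment> \<open>The value at s = 0 is split off, since measurability of \<open>f\<close> is
    assumed for positive times.\<close>
  have "(\<lambda>s. indicator {0..t} s *\<^sub>R ((t - s) powr (c - 1) *\<^sub>R f s)) =
    (\<lambda>s. indicator {0..t} s *\<^sub>R ((t - s) powr (c - 1) *\<^sub>R (indicator {0<..} s * f s)) +
     indicator {0} s *\<^sub>R (indicator {0..t} 0 *\<^sub>R (t powr (c - 1) *\<^sub>R f 0)))"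
   by (auto simp: indicator_def fun_eq_iff)
  moreover have "\<dots> \<in> borel_measurable lborel" by measurable
  ultimately show "(\<lambda>s. indicator {0..t} s *\<^sub>R ((t - s) powr (c - 1) *\<^sub>R f s)) \<in> borel_measurable lebesgue"
   by (simp only: measurable_completion)
 qed
 also have "\<dots> = of_real (Gamma c) * rl_int c f t"
  unfolding rl_int_def by (subst integral_completion) (simp_all add: measurable_completion)
 finally show ?thesis using Gamma_real_pos[OF c] by (simp add: scaleR_conv_of_real)
qed

lemma has_bochner_integral_Beta:
 assumes "0 < a" "0 < (b::real)"
 shows "has_bochner_integral lborel (\<lambda>u. indicator {0..1} u * (u powr (a - 1) * (1 - u) powr (b - 1))) (Beta a b)"
proof (rule has_bochner_integral_nn_integral)
 show "(\<integral>\<^sup>+ u. ennreal (indicator {0..1} u * (u powr (a - 1) * (1 - u) powr (b - 1))) \<partial>lborel) = ennreal (Beta a b)"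
  using nn_integral_has_integral_lebesgue[OF _ has_integral_Beta_real[OF assms]] by simp
 show "0 \<le> Beta a b" using assms by (simp add: Beta_def Gamma_real_nonneg)
qed auto

text \<open>The substitution s = r + (t - r) u reduces the semigroup law to Euler's Beta
  integral.\<close>

lemma has_bochner_integral_rl_kernel:
 assumes a: "0 < a" and b: "0 < b"
 shows "has_bochner_integral lborel (\<lambda>s. rl_kernel a (t - s) * rl_kernel b (s - r)) (rl_kernel (a + b) (t - r))"
proof (cases "r < t")
 case False
 then have "(\<lambda>s. rl_kernel a (t - s) * rl_kernel b (s - r)) = (\<lambda>_. 0)" by (auto simp: rl_kernel_def)
 then show ?thesis using False by (simp add: rl_kernel_def has_bochner_integral_zero)
next
 case True
 define d where "d = t - r"
 have d: "0 < d" using True by (simp add: d_def)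
 let ?F = "\<lambda>s. rl_kernel a (t - s) * rl_kernel b (s - r)"
 define c where "c = d powr (a + b - 2) / (Gamma a * Gamma b)"
 have e: "?F (r + d * u) = c * (indicator {0..1} u * (u powr (b - 1) * (1 - u) powr (a - 1)))" if "u \<noteq> 0" "u \<noteq> 1" for u
 proof (cases "0 < u \<and> u < 1")
  case u: True
  have "t - (r + d * u) = d * (1 - u)" by (simp add: d_def algebra_simps)
  moreover have "0 < d * (1 - u)" "0 < d * u" using d u by auto
  ultimately have "?F (r + d * u) = (d * (1 - u)) powr (a - 1) / Gamma a * ((d * u) powr (b - 1) / Gamma b)"
   by (simp add: rl_kernel_def)
  also have "\<dots> = (d powr (a - 1) * d powr (b - 1)) * (u powr (b - 1) * (1 - u) powr (a - 1)) / (Gamma a * Gamma b)"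
   using d u by (simp add: powr_mult mult_ac)
  also have "d powr (a - 1) * d powr (b - 1) = d powr (a + b - 2)" by (simp add: powr_add[symmetric])
  finally show ?thesis using u by (simp add: c_def)
 next
  case False
  then have "u < 0 \<or> 1 < u" using that by auto
  then have "rl_kernel a (t - (r + d * u)) * rl_kernel b (r + d * u - r) = 0"
  proof
   assume "u < 0"
   then have "d * u < 0" using d by (simp add: mult_pos_neg)
   then show ?thesis by (simp add: rl_kernel_def)
  next
   assume "1 < u"
   then have "d < d * u" using d by simp
   then show ?thesis by (simp add: rl_kernel_def d_def)
  qed
  then show ?thesis using False that by (auto simp: indicator_def)
 qed
 have hb: "has_bochner_integral lborel (\<lambda>u. c * (indicator {0..1} u * (u powr (b - 1) * (1 - u) powr (a - 1)))) (c * Beta b a)"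
  by (intro has_bochner_integral_mult_right has_bochner_integral_Beta a b)
 have ae: "AE u in lborel. c * (indicator {0..1} u * (u powr (b - 1) * (1 - u) powr (a - 1))) = ?F (r + d * u)"
 proof -
  have "AE u in lborel. u \<noteq> 0 \<and> u \<noteq> (1::real)" by (intro AE_conjI AE_lborel_singleton)
  then show ?thesis by eventually_elim (rule e[symmetric], auto)
 qed
 have "has_bochner_integral lborel (\<lambda>u. ?F (r + d * u)) (c * Beta b a)"
  by (rule has_bochner_integral_cong_AE[THEN iffD1, OF _ _ ae hb]) measurable
 moreover have "c * Beta b a = rl_kernel (a + b) d / \<bar>d\<bar>"
 proof -
  have p: "d powr (a + b - 2) = d powr (a + b - 1) / d"
   using powr_diff[of d "a + b - 1" 1] d by simp
  show ?thesis
   using d Gamma_real_pos[OF a] Gamma_real_pos[OF b]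
   unfolding c_def Beta_def rl_kernel_def p add.commute[of b a] by simp
 qed
 ultimately have "has_bochner_integral lborel (\<lambda>u. ?F (r + d * u)) (rl_kernel (a + b) d /\<^sub>R \<bar>d\<bar>)"
  by (simp add: divide_inverse mult.commute)
 then show ?thesis
  using lborel_has_bochner_integral_real_affine_iff[of d ?F "rl_kernel (a + b) d" r] d by (simp add: d_def)
qed

text \<open>The semigroup law of the kernels also yields absolute convergence of the double
  integral: integrated over s, its modulus becomes that of the integrand of order a + b.\<close>

lemma
 assumes a: "0 < a" and b: "0 < b" and [measurable]: "(\<lambda>s. indicator {0<..} s * f s) \<in> Borel"
  and i: "L1 (rl_integrand (a + b) f t)"
 shows rl_int_rl_int: "rl_int a (rl_int b f) t = rl_int (a + b) f t"
  and integrable_rl_int: "L1 (rl_integrand a (rl_int b f) t)"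
proof -
 let ?H = "\<lambda>r s. complex_of_real (rl_kernel a (t - s) * rl_kernel b (s - r)) * (indicator {0<..} r * f r)"
 note B = has_bochner_integral_rl_kernel[OF a b, unfolded has_bochner_integral_iff]
 have iH: "L1 (\<lambda>s. ?H r s)" for r
  using B[of t r] by (intro integrable_mult_left) (simp only: complex_of_real_integrable_eq)
 have nH: "L1_norm (?H r) = norm (of_real (rl_kernel (a + b) (t - r)) * (indicator {0<..} r * f r))" for r
  using B[of t r] rl_kernel_nonneg[OF a] rl_kernel_nonneg[OF b] rl_kernel_nonneg[OF add_pos_pos[OF a b]]
  by (simp add: norm_mult abs_mult)
 have rs: "integrable (lborel \<Otimes>\<^sub>M lborel) (\<lambda>(r, s). ?H r s)"
 proof (rule lborel_pair.Fubini_integrable)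
  show "L1 (\<lambda>r. LINT s|lborel. norm (case (r, s) of (r, s) \<Rightarrow> ?H r s))"
   unfolding prod.case nH using i by (rule integrable_norm)
  show "AE r in lborel. L1 (\<lambda>s. case (r, s) of (r, s) \<Rightarrow> ?H r s)" using iH by simp
 qed measurable
 have sr: "integrable (lborel \<Otimes>\<^sub>M lborel) (\<lambda>(s, r). ?H r s)"
  using lborel_pair.integrable_product_swap[OF rs] by (simp add: split_beta')
 have e: "(LINT r|lborel. ?H r s) = of_real (rl_kernel a (t - s)) * (indicator {0<..} s * rl_int b f s)" for s
 proof (cases "0 < s")
  case True
  have "(LINT r|lborel. ?H r s) = (LINT r|lborel. of_real (rl_kernel a (t - s)) * (of_real (rl_kernel b (s - r)) * (indicator {0<..} r * f r)))"
   by (simp add: mult.assoc)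
  also have "\<dots> = of_real (rl_kernel a (t - s)) * rl_int b f s"
   unfolding rl_int_def by (rule integral_mult_right_zero)
  finally show ?thesis using True by simp
 next
  case False
  then have z: "?H r s = 0" for r by (auto simp: rl_kernel_def indicator_def)
  show ?thesis unfolding z using False by simp
 qed
 show "L1 (rl_integrand a (rl_int b f) t)"
  using lborel_pair.integrable_fst'[OF sr] unfolding e[symmetric] by (simp only: prod.case)
 have "rl_int a (rl_int b f) t = (LINT s|lborel. LINT r|lborel. ?H r s)" unfolding e rl_int_def ..
 also have "\<dots> = (LINT r|lborel. LINT s|lborel. ?H r s)"
  by (rule lborel_pair.Fubini_integral[OF rs])
 also have "\<dots> = (LINT r|lborel. of_real (rl_kernel (a + b) (t - r)) * (indicator {0<..} r * f r))"
 proof (intro lebesgue_integral_cong refl)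
  fix r
  have "(LINT s|lborel. ?H r s) = (LINT s|lborel. complex_of_real (rl_kernel a (t - s) * rl_kernel b (s - r))) * (indicator {0<..} r * f r)"
   by (rule integral_mult_left_zero)
  also have "(LINT s|lborel. complex_of_real (rl_kernel a (t - s) * rl_kernel b (s - r))) = of_real (rl_kernel (a + b) (t - r))"
   using B[of t r] by (simp only: integral_complex_of_real)
  finally show "(LINT s|lborel. ?H r s) = of_real (rl_kernel (a + b) (t - r)) * (indicator {0<..} r * f r)" .
 qed
 finally show "rl_int a (rl_int b f) t = rl_int (a + b) f t" unfolding rl_int_def .
qed

text \<open>Comparison with power kernels: a bound by a multiple of \<open>rl_kernel b\<close>
  becomes the same multiple of \<open>rl_kernel (a + b)\<close>, with the exact Gamma factors.
  Iteration reproduces the terms of the Mittag-Leffler series.\<close>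

lemma
 assumes a: "0 < a" and m: "(\<lambda>s. indicator {0<..} s * f s) \<in> Borel"
  and b: "\<And>s. 0 < s \<Longrightarrow> s < t \<Longrightarrow> norm (f s) \<le> M * rl_kernel b s" and b0: "0 < b"
 shows integrable_rl_int_bounded: "L1 (rl_integrand a f t)"
  and norm_rl_int_le: "norm (rl_int a f t) \<le> M * rl_kernel (a + b) t"
proof -
 note [measurable] = m
 note B = has_bochner_integral_rl_kernel[OF a b0, of t 0, unfolded has_bochner_integral_iff]
 have iM: "L1 (\<lambda>s. M * (rl_kernel a (t - s) * rl_kernel b (s - 0)))"
  using B by (intro integrable_mult_right) blast
 have le: "norm (of_real (rl_kernel a (t - s)) * (indicator {0<..} s * f s)) \<le> M * (rl_kernel a (t - s) * rl_kernel b (s - 0))" for s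
 proof (cases "0 < s \<and> s < t")
  case True
  then have "norm (of_real (rl_kernel a (t - s)) * (indicator {0<..} s * f s)) = rl_kernel a (t - s) * norm (f s)"
   using rl_kernel_nonneg[OF a] by (simp add: norm_mult)
  also have "\<dots> \<le> rl_kernel a (t - s) * (M * rl_kernel b s)"
   using True b rl_kernel_nonneg[OF a] by (intro mult_left_mono) auto
  finally show ?thesis by (simp add: mult_ac)
 qed (auto simp: rl_kernel_def indicator_def)
 show i: "L1 (rl_integrand a f t)"
 proof (rule lebesgue_integrable_bound[OF iM])
  show "AE s in lborel. norm (of_real (rl_kernel a (t - s)) * (indicator {0<..} s * f s)) \<le> norm (M * (rl_kernel a (t - s) * rl_kernel b (s - 0)))"
   using order_trans[OF le abs_ge_self] by (intro AE_I2) (simp only: real_norm_def)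
 qed measurable
 have "norm (rl_int a f t) \<le> (LINT s|lborel. norm (of_real (rl_kernel a (t - s)) * (indicator {0<..} s * f s)))"
  unfolding rl_int_def by (rule integral_norm_bound)
 also have "\<dots> \<le> (LINT s|lborel. M * (rl_kernel a (t - s) * rl_kernel b (s - 0)))"
  using le by (intro integral_mono integrable_norm i iM)
 also have "\<dots> = M * rl_kernel (a + b) t" using B by simp
 finally show "norm (rl_int a f t) \<le> M * rl_kernel (a + b) t" .
qed

lemma rl_kernel_1: "rl_kernel 1 s = (if 0 < s then 1 else 0)"
 by (simp add: rl_kernel_def)

lemma continuous_on_indicator_measurable:
 fixes f :: "real \<Rightarrow> complex"
 assumes "continuous_on {0<..} f"
 shows "(\<lambda>s. indicator {0<..} s * f s) \<in> Borel"
proof -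
 have "(\<lambda>s. indicator {0<..} s *\<^sub>R f s) \<in> Borel"
  using assms by (intro borel_measurable_continuous_on_indicator) auto
 also have "(\<lambda>s. indicator {0<..} s *\<^sub>R f s) = (\<lambda>s. indicator {0<..} s * f s)"
  by (auto simp: indicator_def fun_eq_iff)
 finally show ?thesis .
qed

lemma continuous_on_bound:
 fixes f :: "real \<Rightarrow> complex"
 assumes "continuous_on {0..} f"
 obtains M where "0 \<le> M" "\<And>s. 0 \<le> s \<Longrightarrow> s \<le> t \<Longrightarrow> norm (f s) \<le> M"
proof -
 have "compact (f ` {0..t})" using assms by (intro compact_continuous_image continuous_on_subset[OF assms]) auto
 then obtain M where "\<forall>y\<in>f ` {0..t}. norm y \<le> M" using compact_imp_bounded bounded_iff by blast
 then have "norm (f s) \<le> max 0 M" if "0 \<le> s" "s \<le> t" for s using that by (auto intro: max.coboundedI2)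
 then show ?thesis using that[of "max 0 M"] by auto
qed

text \<open>Substituting s = t u moves the dependence on t from the singular kernel into
  \<open>f\<close>, so a single integrable majorant serves a whole convergent sequence of
  times.\<close>

lemma rl_int_continuous:
 assumes a: "0 < a" and f: "continuous_on {0..} f"
 shows "continuous_on {0<..} (rl_int a f)"
proof -
 have f': "continuous_on {0<..} f" using f by (rule continuous_on_subset) auto
 note [measurable] = continuous_on_indicator_measurable[OF f']
 have fm[measurable]: "(\<lambda>u. indicator {0<..} u * f (t * u)) \<in> Borel" if "0 < t" for t
 proof -
  have "(\<lambda>u. indicator {0<..} (t * u) * f (t * u)) \<in> Borel"
   by (rule measurable_compose[where f="\<lambda>u. t * u", OF _ continuous_on_indicator_measurable[OF f']]) measurable
  then show ?thesis using that by (simp add: indicator_def zero_less_mult_iff)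
 qed
 have scale: "rl_int a f t = of_real (t powr a) * (LINT u|lborel. of_real (rl_kernel a (1 - u)) * (indicator {0<..} u * f (t * u)))" if t: "0 < t" for t
 proof -
  have "rl_int a f t = \<bar>t\<bar> *\<^sub>R (LINT u|lborel. of_real (rl_kernel a (t - (0 + t * u))) * (indicator {0<..} (0 + t * u) * f (0 + t * u)))"
   unfolding rl_int_def using t by (intro lborel_integral_real_affine) auto
  also have "(LINT u|lborel. of_real (rl_kernel a (t - (0 + t * u))) * (indicator {0<..} (0 + t * u) * f (0 + t * u))) =
    (LINT u|lborel. of_real (t powr (a - 1)) * (of_real (rl_kernel a (1 - u)) * (indicator {0<..} u * f (t * u))))"
  proof (intro lebesgue_integral_cong refl)
   fix u
   have "t - t * u = t * (1 - u)" by (simp add: algebra_simps)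
   then have "rl_kernel a (t - t * u) = t powr (a - 1) * rl_kernel a (1 - u)"
    using t by (simp add: rl_kernel_def powr_mult zero_less_mult_iff)
   then show "of_real (rl_kernel a (t - (0 + t * u))) * (indicator {0<..} (0 + t * u) * f (0 + t * u)) =
     of_real (t powr (a - 1)) * (of_real (rl_kernel a (1 - u)) * (indicator {0<..} u * f (t * u)))"
    using t by (simp add: indicator_def zero_less_mult_iff)
  qed
  also have "\<bar>t\<bar> *\<^sub>R \<dots> = of_real (t * t powr (a - 1)) * (LINT u|lborel. of_real (rl_kernel a (1 - u)) * (indicator {0<..} u * f (t * u)))"
   using t by (simp add: scaleR_conv_of_real)
  also have "t * t powr (a - 1) = t powr a" using t by (simp add: powr_mult_base)
  finally show ?thesis .
 qed
 have "continuous_on {0<..} (\<lambda>t. LINT u|lborel. of_real (rl_kernel a (1 - u)) * (indicator {0<..} u * f (t * u)))"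
  unfolding continuous_on_sequentially o_def
 proof (intro ballI allI impI)
  fix t and X :: "nat \<Rightarrow> real" assume t: "t \<in> {0<..}" and X: "(\<forall>n. X n \<in> {0<..}) \<and> X \<longlonglongrightarrow> t"
  obtain T where T: "\<And>n. X n \<le> T"
  proof -
   have "Bseq X" using X convergent_imp_Bseq convergentI by blast
   then obtain K where "\<And>n. norm (X n) \<le> K" by (auto simp: Bseq_def)
   then show ?thesis using that[of K] by (auto intro: order_trans[OF abs_ge_self])
  qed
  obtain M where M: "0 \<le> M" "\<And>s. 0 \<le> s \<Longrightarrow> s \<le> T \<Longrightarrow> norm (f s) \<le> M"
   using continuous_on_bound[OF f] by blast
  note B = has_bochner_integral_rl_kernel[OF a zero_less_one, of 1 0, unfolded has_bochner_integral_iff]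
  show "(\<lambda>n. LINT u|lborel. of_real (rl_kernel a (1 - u)) * (indicator {0<..} u * f (X n * u))) \<longlonglongrightarrow>
    (LINT u|lborel. of_real (rl_kernel a (1 - u)) * (indicator {0<..} u * f (t * u)))"
  proof (rule integral_dominated_convergence[where w="\<lambda>u. M * (rl_kernel a (1 - u) * rl_kernel 1 (u - 0))"])
   show "L1 (\<lambda>u. M * (rl_kernel a (1 - u) * rl_kernel 1 (u - 0)))"
    using B by (intro integrable_mult_right) blast
   show "(\<lambda>u. of_real (rl_kernel a (1 - u)) * (indicator {0<..} u * f (t * u))) \<in> borel_measurable lborel"
   proof -
    have [measurable]: "(\<lambda>u. indicator {0<..} u * f (t * u)) \<in> Borel" using fm t by simp
    show ?thesis by measurable
   qed
   show "(\<lambda>u. of_real (rl_kernel a (1 - u)) * (indicator {0<..} u * f (X n * u))) \<in> borel_measurable lborel" for n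
   proof -
    have [measurable]: "(\<lambda>u. indicator {0<..} u * f (X n * u)) \<in> Borel" using fm X by simp
    show ?thesis by measurable
   qed
   show "AE u in lborel. (\<lambda>n. of_real (rl_kernel a (1 - u)) * (indicator {0<..} u * f (X n * u))) \<longlonglongrightarrow> of_real (rl_kernel a (1 - u)) * (indicator {0<..} u * f (t * u))"
   proof (rule AE_I2)
    fix u :: real
    show "(\<lambda>n. of_real (rl_kernel a (1 - u)) * (indicator {0<..} u * f (X n * u))) \<longlonglongrightarrow> of_real (rl_kernel a (1 - u)) * (indicator {0<..} u * f (t * u))"
    proof (cases "0 < u")
     case True
     have "(\<lambda>n. f (X n * u)) \<longlonglongrightarrow> f (t * u)"
      by (rule continuous_on_tendsto_compose[OF f'])
       (use X t True in \<open>auto intro!: tendsto_intros always_eventually\<close>)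
     then show ?thesis by (intro tendsto_intros)
    qed simp
   qed
   show "AE u in lborel. norm (of_real (rl_kernel a (1 - u)) * (indicator {0<..} u * f (X n * u))) \<le> M * (rl_kernel a (1 - u) * rl_kernel 1 (u - 0))" for n
   proof (rule AE_I2)
    fix u :: real
    show "norm (of_real (rl_kernel a (1 - u)) * (indicator {0<..} u * f (X n * u))) \<le> M * (rl_kernel a (1 - u) * rl_kernel 1 (u - 0))"
    proof (cases "0 < u \<and> u < 1")
     case True
     have Xn: "0 < X n" using X by auto
     have "X n * u \<le> X n * 1" using Xn True by (intro mult_left_mono) auto
     then have "X n * u \<le> T" using T[of n] by linarith
     then have "norm (f (X n * u)) \<le> M" using Xn True by (intro M) auto
     then show ?thesis using True rl_kernel_nonneg[OF a, of "1 - u"]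
      by (simp add: norm_mult rl_kernel_1 mult.commute[of M] mult.commute[of u] mult_left_mono)
    qed (auto simp: rl_kernel_def)
   qed
  qed
 qed
 then have "continuous_on {0<..} (\<lambda>t. of_real (t powr a) * (LINT u|lborel. of_real (rl_kernel a (1 - u)) * (indicator {0<..} u * f (t * u))))"
  by (intro continuous_intros) auto
 then show ?thesis by (rule continuous_on_eq) (simp add: scale)
qed

text \<open>\<open>f\<close> may be singular at 0, so the integral is split at c = t / 2 and the
  fundamental theorem is used where \<open>f\<close> is continuous.\<close>

lemma rl_int_1_has_vector_derivative:
 assumes i: "\<And>t. 0 < t \<Longrightarrow> L1 (rl_integrand 1 f t)"
  and f: "continuous_on {0<..} f" and t: "0 < t"
 shows "(rl_int 1 f has_vector_derivative f t) (at t)"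
proof -
 define c where "c = t / 2"
 have c: "0 < c" "c < t" using t by (auto simp: c_def)
 have fc: "continuous_on {c..u} f" for u by (rule continuous_on_subset[OF f]) (use c in auto)
 have eq: "rl_int 1 f u = rl_int 1 f c + integral {c..u} f" if u: "u \<in> {c<..<2 * t}" for u
 proof -
  have fi: "L1 (\<lambda>s. indicator {c..u} s *\<^sub>R f s)"
   using fc by (intro borel_integrable_compact) auto
  have "integral {c..u} f = (LINT s|lborel. indicator {c..u} s *\<^sub>R f s)"
   using set_borel_integral_eq_integral(2)[of "{c..u}" f] fi by (simp add: set_lebesgue_integral_def set_integrable_def)
  then have "rl_int 1 f c + integral {c..u} f = (LINT s|lborel. of_real (rl_kernel 1 (c - s)) * (indicator {0<..} s * f s) + indicator {c..u} s *\<^sub>R f s)"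
   unfolding rl_int_def using i[OF c(1)] fi by simp
  also have "\<dots> = rl_int 1 f u"
   unfolding rl_int_def
  proof (rule integral_cong_AE)
   have "AE s in lborel. s \<noteq> u" by (rule AE_lborel_singleton)
   then show "AE s in lborel. of_real (rl_kernel 1 (c - s)) * (indicator {0<..} s * f s) + indicator {c..u} s *\<^sub>R f s = of_real (rl_kernel 1 (u - s)) * (indicator {0<..} s * f s)"
    by eventually_elim (use u c in \<open>auto simp: rl_kernel_1 indicator_def\<close>)
  qed (use i[OF c(1)] i[of u] fi u c in auto)
  finally show ?thesis ..
 qed
 have "((\<lambda>u. integral {c..u} f) has_vector_derivative f t) (at t within {c..2 * t})"
  using fc c t by (intro integral_has_vector_derivative) auto
 then have "((\<lambda>u. integral {c..u} f) has_vector_derivative f t) (at t)"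
  using c t by (subst (asm) at_within_interior) (auto simp: interior_atLeastAtMost_real)
 then have "((\<lambda>u. rl_int 1 f c + integral {c..u} f) has_vector_derivative f t) (at t)"
  by (auto intro!: derivative_eq_intros)
 then show ?thesis
  by (rule has_vector_derivative_transform_within_open[of _ _ _ "{c<..<2 * t}"]) (use eq c t in auto)
qed


lemma rl_int_1_cancel:
 assumes i: "\<And>t. 0 < t \<Longrightarrow> L1 (rl_integrand 1 f t)"
  and f: "continuous_on {0<..} f" and z: "\<And>t. 0 < t \<Longrightarrow> rl_int 1 f t = 0" and t: "0 < t"
 shows "f t = 0"
proof -
 have "((\<lambda>_. 0 :: complex) has_vector_derivative 0) (at t)" by simp
 then have "(rl_int 1 f has_vector_derivative 0) (at t)"
  by (rule has_vector_derivative_transform_within_open[of _ _ _ "{0<..}"]) (use z t in auto)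
 with rl_int_1_has_vector_derivative[OF i f t] show ?thesis
  using vector_derivative_unique_at by blast
qed

lemma rl_int_diff:
 assumes "L1 (rl_integrand a f t)"
  "L1 (rl_integrand a g t)"
 shows "rl_int a (\<lambda>s. f s - g s) t = rl_int a f t - rl_int a g t"
  and "L1 (\<lambda>s. of_real (rl_kernel a (t - s)) * (indicator {0<..} s * (f s - g s)))"
proof -
 have e: "(\<lambda>s. of_real (rl_kernel a (t - s)) * (indicator {0<..} s * (f s - g s))) =
   (\<lambda>s. of_real (rl_kernel a (t - s)) * (indicator {0<..} s * f s) - of_real (rl_kernel a (t - s)) * (indicator {0<..} s * g s))"
  by (simp add: right_diff_distrib fun_eq_iff)
 show "rl_int a (\<lambda>s. f s - g s) t = rl_int a f t - rl_int a g t"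
  unfolding rl_int_def e by (rule lebesgue_integral_diff[OF assms])
 show "L1 (\<lambda>s. of_real (rl_kernel a (t - s)) * (indicator {0<..} s * (f s - g s)))"
  unfolding e by (rule lebesgue_integrable_diff[OF assms])
qed

lemma rl_int_cong:
 assumes "\<And>s. 0 < s \<Longrightarrow> s < t \<Longrightarrow> f s = g s"
 shows "rl_int a f t = rl_int a g t"
 unfolding rl_int_def by (intro lebesgue_integral_cong) (auto simp: indicator_def rl_kernel_def assms)

lemma continuous_rl_kernel_bound:
 fixes f :: "real \<Rightarrow> complex"
 assumes "continuous_on {0..} f"
 obtains M where "0 \<le> M" "\<And>s. 0 < s \<Longrightarrow> s < t \<Longrightarrow> norm (f s) \<le> M * rl_kernel 1 s"
proof -
 obtain M where "0 \<le> M" "\<And>s. 0 \<le> s \<Longrightarrow> s \<le> t \<Longrightarrow> norm (f s) \<le> M" using continuous_on_bound[OF assms] by blast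
 then show ?thesis using that[of M] by (simp add: rl_kernel_1)
qed

lemma integrable_rl_int_continuous:
 fixes f :: "real \<Rightarrow> complex"
 assumes "0 < a" "continuous_on {0..} f"
 shows "L1 (rl_integrand a f t)"
proof -
 obtain M where "0 \<le> M" "\<And>s. 0 < s \<Longrightarrow> s < t \<Longrightarrow> norm (f s) \<le> M * rl_kernel 1 s"
  using continuous_rl_kernel_bound[OF assms(2)] by blast
 then show ?thesis
  by (intro integrable_rl_int_bounded[of a f t M 1] continuous_on_indicator_measurable continuous_on_subset[OF assms(2)] assms) auto
qed

lemma rl_kernel_tendsto_0:
 assumes "1 < a"
 shows "(rl_kernel a \<longlongrightarrow> 0) (at_right 0)"
proof -
 have "((\<lambda>t. t powr (a - 1) / Gamma a) \<longlongrightarrow> 0 powr (a - 1) / Gamma a) (at_right 0)"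
  using assms by (intro tendsto_intros) (auto simp: eventually_at_filter Gamma_eq_zero_iff nonpos_Ints_def)
 moreover have "\<forall>\<^sub>F t in at_right 0. t powr (a - 1) / Gamma a = rl_kernel a t"
  by (auto simp: eventually_at_filter rl_kernel_def)
 ultimately show ?thesis by (simp add: Lim_transform_eventually)
qed

lemma rl_int_tendsto_0:
 assumes a: "0 < a" "continuous_on {0..} f"
 shows "(rl_int a f \<longlongrightarrow> 0) (at_right 0)"
proof -
 obtain M where M: "0 \<le> M" "\<And>s. 0 < s \<Longrightarrow> s < 1 \<Longrightarrow> norm (f s) \<le> M * rl_kernel 1 s"
  using continuous_rl_kernel_bound[OF a(2)] by blast
 have "norm (rl_int a f t) \<le> M * rl_kernel (a + 1) t" if "0 < t" "t < 1" for t
  using M that by (intro norm_rl_int_le continuous_on_indicator_measurable continuous_on_subset[OF a(2)] a) auto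
 then have "\<forall>\<^sub>F t in at_right 0. norm (rl_int a f t) \<le> M * rl_kernel (a + 1) t"
  unfolding eventually_at_right_field by (intro exI[of _ 1]) auto
 moreover have "((\<lambda>t. M * rl_kernel (a + 1) t) \<longlongrightarrow> 0) (at_right 0)"
  using a by (intro tendsto_mult_right_zero rl_kernel_tendsto_0) auto
 ultimately show ?thesis by (rule Lim_null_comparison)
qed

section \<open>From the Caputo equation to the Volterra equation\<close>

lemma time_deriv_eq:
 assumes "f differentiable_on {0<..}" "0 < t"
 shows "(f has_vector_derivative time_deriv f t) (at t)"
proof -
 have "f differentiable (at t)"
  using assms by (simp add: differentiable_on_eq_differentiable_at)
 moreover have "at t within {0..} = at t" using assms by (intro at_within_interior) auto
 ultimately show ?thesis by (simp add: time_deriv_def vector_derivative_works)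
qed

lemma constant_on_pos:
 fixes f :: "real \<Rightarrow> complex"
 assumes "\<And>t. 0 < t \<Longrightarrow> (f has_vector_derivative 0) (at t)"
 obtains c where "\<And>t. 0 < t \<Longrightarrow> f t = c"
proof -
 have "\<exists>c. \<forall>t\<in>{0<..}. f t = c"
  by (rule has_derivative_zero_constant)
   (use assms in \<open>auto simp: has_vector_derivative_def intro: has_derivative_at_withinI\<close>)
 then show ?thesis using that by auto
qed

lemma eq_0_if_tendsto_const:
 assumes "(f \<longlongrightarrow> 0) (at_right (0::real))" "\<And>t. 0 < t \<Longrightarrow> f t = (c::complex)"
 shows "c = 0"
proof -
 have "((\<lambda>_. c) \<longlongrightarrow> 0) (at_right (0::real))"
  by (rule Lim_transform_eventually[OF assms(1)]) (use assms(2) in \<open>auto simp: eventually_at_filter\<close>)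
 then show ?thesis by (simp add: tendsto_const_iff)
qed

lemma rl_kernel_plus1_divide:
 "0 < a \<Longrightarrow> 0 < t \<Longrightarrow> rl_kernel (a + 1) t / t = rl_kernel a t / a"
 using Gamma_plus1[of a] by (simp add: rl_kernel_def powr_diff nonpos_Ints_def)

lemma rl_kernel_bound_tendsto_0:
 fixes f :: "real \<Rightarrow> complex"
 assumes "1 < a" "0 < d" "\<And>t. 0 < t \<Longrightarrow> t < d \<Longrightarrow> norm (f t) \<le> M * rl_kernel (a + 1) t"
 shows "((\<lambda>t. f t / of_real t) \<longlongrightarrow> 0) (at_right 0)"
proof (rule Lim_null_comparison)
 have "norm (f t / of_real t) \<le> M / a * rl_kernel a t" if "0 < t" "t < d" for t
 proof -
  have "norm (f t / of_real t) \<le> M * rl_kernel (a + 1) t / t"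
   using assms(3)[OF that] that by (simp add: norm_divide divide_right_mono)
  also have "\<dots> = M * (rl_kernel (a + 1) t / t)" by simp
  also have "rl_kernel (a + 1) t / t = rl_kernel a t / a"
   using assms that by (intro rl_kernel_plus1_divide) auto
  finally show ?thesis by simp
 qed
 then show "\<forall>\<^sub>F t in at_right 0. norm (f t / of_real t) \<le> M / a * rl_kernel a t"
  unfolding eventually_at_right_field using assms(2) by (intro exI[of _ d]) auto
 show "((\<lambda>t. M / a * rl_kernel a t) \<longlongrightarrow> 0) (at_right 0)"
  using assms by (intro tendsto_mult_right_zero rl_kernel_tendsto_0) auto
qed

text \<open>With w = f - f(0), the equation says that the n-th derivative of v = I^(n - \<alpha>) w
  is h. Integrating n times gives v = I^n h, the constants vanishing by the behaviour at 0. Applying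
  I^\<alpha> yields I^n w = I^n I^\<alpha> h, and I^n is cancelled by differentiation.\<close>

theorem caputo_imp_volterra:
 fixes f h :: "real \<Rightarrow> complex"
 assumes \<alpha>: "0 < \<alpha>" "\<alpha> < 2" and h: "continuous_on {0..} h"
  and d: "caputo_differentiable \<alpha> f" and eq: "\<And>t. 0 < t \<Longrightarrow> caputo_deriv \<alpha> f t = h t"
  and f0: "1 < \<alpha> \<Longrightarrow> time_deriv f 0 = 0" and t: "0 < t"
 shows "f t = f 0 + rl_int \<alpha> h t"
proof -
 define n where "n = nat \<lceil>\<alpha>\<rceil>"
 define w where "w = taylor_remainder n f"
 have n: "n = 1 \<and> \<alpha> \<le> 1 \<or> n = 2 \<and> 1 < \<alpha>"
 proof (cases "\<alpha> \<le> 1")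
  case True
  then have "\<lceil>\<alpha>\<rceil> = 1" using \<alpha> by (simp add: ceiling_eq_iff)
  then show ?thesis using True by (simp add: n_def)
 next
  case False
  then have "\<lceil>\<alpha>\<rceil> = 2" using \<alpha> by (simp add: ceiling_eq_iff)
  then show ?thesis using False by (simp add: n_def)
 qed
 have w: "w t = f t - f 0" for t
  using n f0 by (auto simp: w_def taylor_remainder_def numeral_2_eq_2)
 have tC: "time_C (n - 1) f" and RLd: "RL_differentiable \<alpha> w"
  using d by (simp_all add: caputo_differentiable_def n_def w_def)
 have fc: "continuous_on {0..} f" using tC unfolding time_C_def by (auto dest!: spec[of _ 0])
 have wc: "continuous_on {0..} w" unfolding w[abs_def] by (intro continuous_intros fc)
 define v where "v = RL_integral (real n - \<alpha>) w"
 have vd: "\<And>k. k < n \<Longrightarrow> (time_deriv ^^ k) v differentiable_on {0<..}"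
  using RLd by (simp add: RL_differentiable_def Let_def v_def n_def)
 have vh: "(time_deriv ^^ n) v t = h t" if "0 < t" for t
  using eq[OF that] by (simp add: caputo_deriv_def RL_deriv_def Let_def v_def w_def n_def)
 have wm: "(\<lambda>s. indicator {0<..} s * w s) \<in> Borel" and hm: "(\<lambda>s. indicator {0<..} s * h s) \<in> Borel"
  by (intro continuous_on_indicator_measurable continuous_on_subset[OF wc] continuous_on_subset[OF h]; auto)+
 have ne: "0 \<le> real n - \<alpha>" using n \<alpha> by auto
 have v_eq: "v = rl_int (real n - \<alpha>) w" if "0 < real n - \<alpha>"
  unfolding v_def by (intro ext RL_integral_eq_rl_int wm that)
 have H1: "(rl_int 1 h has_vector_derivative h t) (at t)" if "0 < t" for t
  by (rule rl_int_1_has_vector_derivative[OF integrable_rl_int_continuous[OF zero_less_one h] continuous_on_subset[OF h] that]) auto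
 have v_lim: "(v \<longlongrightarrow> 0) (at_right 0)"
 proof (cases "real n = \<alpha>")
  case True
  then have "v = w" by (simp add: v_def RL_integral_def fun_eq_iff)
  moreover have "(w \<longlongrightarrow> w 0) (at 0 within {0..})" using wc by (simp add: continuous_on_def)
  then have "(w \<longlongrightarrow> w 0) (at_right 0)" by (rule tendsto_within_subset) auto
  ultimately show ?thesis by (simp add: w)
 next
  case False
  then have pos: "0 < real n - \<alpha>" using ne by simp
  show ?thesis unfolding v_eq[OF pos] by (rule rl_int_tendsto_0[OF pos wc])
 qed
 have key: "v t = rl_int (real n) h t" if t: "0 < t" for t
 proof (cases "n = 1")
  case True
  have "((\<lambda>t. v t - rl_int 1 h t) has_vector_derivative 0) (at t)" if "0 < t" for t
  proof -
   have "(v has_vector_derivative h t) (at t)"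
    using time_deriv_eq[of v t] vd[of 0] vh[OF that] True that by simp
   from has_vector_derivative_diff[OF this H1[OF that]] show ?thesis by simp
  qed
  then obtain c where c: "\<And>t. 0 < t \<Longrightarrow> v t - rl_int 1 h t = c" using constant_on_pos by blast
  have "((\<lambda>t. v t - rl_int 1 h t) \<longlongrightarrow> 0 - 0) (at_right 0)"
   by (intro tendsto_diff v_lim rl_int_tendsto_0 h) auto
  then have "c = 0" using eq_0_if_tendsto_const[OF _ c] by simp
  then show ?thesis using c[OF t] True by simp
 next
  case False
  then have n2: "n = 2" "1 < \<alpha>" using n by auto
  have v': "(v has_vector_derivative time_deriv v t) (at t)" if "0 < t" for t
   using time_deriv_eq[of v t] vd[of 0] n2 that by simp
  have v'': "(time_deriv v has_vector_derivative h t) (at t)" if "0 < t" for t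
   using time_deriv_eq[of "time_deriv v" t] vd[of 1] vh[OF that] n2 that by (simp add: numeral_2_eq_2)
  have "((\<lambda>t. time_deriv v t - rl_int 1 h t) has_vector_derivative 0) (at t)" if "0 < t" for t
   using has_vector_derivative_diff[OF v''[OF that] H1[OF that]] by simp
  then obtain c where c: "\<And>t. 0 < t \<Longrightarrow> time_deriv v t - rl_int 1 h t = c" using constant_on_pos by blast
  have i2: "L1 (rl_integrand (1 + 1) h t)" for t
   by (intro integrable_rl_int_continuous h) auto
  have h2: "rl_int 1 (rl_int 1 h) t = rl_int 2 h t" for t
   using rl_int_rl_int[OF zero_less_one zero_less_one hm i2] by simp
  have H2: "(rl_int 2 h has_vector_derivative rl_int 1 h t) (at t)" if "0 < t" for t
  proof -
   have "(rl_int 1 (rl_int 1 h) has_vector_derivative rl_int 1 h t) (at t)"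
    by (rule rl_int_1_has_vector_derivative[OF integrable_rl_int[OF zero_less_one zero_less_one hm i2] rl_int_continuous[OF zero_less_one h] that])
   moreover have "rl_int 1 (rl_int 1 h) = rl_int 2 h" by (rule ext) (rule h2)
   ultimately show ?thesis by simp
  qed
  have "((\<lambda>t. v t - rl_int 2 h t - of_real t * c) has_vector_derivative 0) (at t)" if "0 < t" for t
  proof -
   have "((\<lambda>t. of_real t * c) has_vector_derivative c) (at t)"
    by (auto intro!: derivative_eq_intros)
   from has_vector_derivative_diff[OF has_vector_derivative_diff[OF v'[OF that] H2[OF that]] this]
   show ?thesis using c[OF that] by simp
  qed
  then obtain e where e: "\<And>t. 0 < t \<Longrightarrow> v t - rl_int 2 h t - of_real t * c = e" using constant_on_pos by blast
  have "((\<lambda>t. v t - rl_int 2 h t - of_real t * c) \<longlongrightarrow> 0 - 0 - of_real 0 * c) (at_right 0)"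
   by (intro tendsto_diff tendsto_mult tendsto_of_real tendsto_ident_at tendsto_const v_lim rl_int_tendsto_0 h) auto
  then have e0: "e = 0" using eq_0_if_tendsto_const[OF _ e] by simp
  \<comment> \<open>It remains to remove the slope \<open>c\<close>. Differentiability of
    \<open>f\<close> at 0 gives w = O(t), hence v = O(t^(3 - \<alpha>)) = o(t), and I^2 h =
    O(t^2).\<close>
  have "f differentiable_on {0..}" using tC n2 by (auto simp: time_C_def)
  then have "w differentiable (at 0 within {0..})"
   unfolding w[abs_def] by (auto simp: differentiable_on_def intro!: derivative_intros)
  then obtain w' where w': "(w has_vector_derivative w') (at 0 within {0..})"
   using vector_derivative_works by blast
  then have "\<exists>d>0. \<forall>y\<in>{0..}. norm (y - 0) < d \<longrightarrow> norm (w y - w 0 - (y - 0) *\<^sub>R w') \<le> 1 * norm (y - 0)"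
   unfolding has_vector_derivative_def has_derivative_within_alt by (elim conjE allE[of _ 1]) auto
  then obtain d where d: "0 < d" "\<And>y. 0 \<le> y \<Longrightarrow> y < d \<Longrightarrow> norm (w y - w 0 - y *\<^sub>R w') \<le> y"
   by auto
  define K where "K = norm w' + 1"
  have wK: "norm (w y) \<le> K * rl_kernel 2 y" if "0 < y" "y < d" for y
  proof -
   have "norm (w y) \<le> norm (w y - w 0 - y *\<^sub>R w') + norm (y *\<^sub>R w')"
    using norm_triangle_ineq[of "w y - w 0 - y *\<^sub>R w'" "y *\<^sub>R w'"] by (simp add: w)
   then have "norm (w y) \<le> y + y * norm w'" using d(2)[of y] that by simp
   moreover have "rl_kernel 2 y = y" using that Gamma_numeral[of "num.Bit0 num.One", where 'a = real] by (simp add: rl_kernel_def)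
   ultimately show ?thesis by (simp add: K_def algebra_simps)
  qed
  have e2: "0 < real n - \<alpha>" using n2 \<alpha> by simp
  have "norm (v t) \<le> K * rl_kernel ((real n - \<alpha> + 1) + 1) t" if "0 < t" "t < d" for t
   unfolding v_eq[OF e2] using norm_rl_int_le[OF e2 wm, of t K 2] wK that by (simp add: add.commute add.left_commute)
  from rl_kernel_bound_tendsto_0[OF _ d(1) this]
  have l1: "((\<lambda>t. v t / of_real t) \<longlongrightarrow> 0) (at_right 0)" using e2 by simp
  obtain M where M: "0 \<le> M" "\<And>s. 0 < s \<Longrightarrow> s < 1 \<Longrightarrow> norm (h s) \<le> M * rl_kernel 1 s"
   using continuous_rl_kernel_bound[OF h] by blast
  have "norm (rl_int 2 h t) \<le> M * rl_kernel (2 + 1) t" if "0 < t" "t < 1" for t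
   using M that by (intro norm_rl_int_le hm) auto
  from rl_kernel_bound_tendsto_0[OF _ zero_less_one this]
  have l2: "((\<lambda>t. rl_int 2 h t / of_real t) \<longlongrightarrow> 0) (at_right 0)" by simp
  have "((\<lambda>t. v t / of_real t - rl_int 2 h t / of_real t) \<longlongrightarrow> 0 - 0) (at_right 0)"
   by (intro tendsto_diff l1 l2)
  then have l3: "((\<lambda>t. v t / of_real t - rl_int 2 h t / of_real t) \<longlongrightarrow> 0) (at_right 0)" by simp
  have "v t / of_real t - rl_int 2 h t / of_real t = c" if "0 < t" for t
   using e[OF that] e0 that by (simp add: field_simps)
  from eq_0_if_tendsto_const[OF l3 this] have "c = 0" .
  then show ?thesis using e[OF t] e0 n2 by simp
 qed
 show ?thesis
 proof (cases "real n = \<alpha>")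
  case True
  then have "v = w" by (simp add: v_def RL_integral_def fun_eq_iff)
  then show ?thesis using key[OF t] True by (simp add: w algebra_simps)
 next
  case False
  then have c: "0 < real n - \<alpha>" using ne by simp
  define g where "g s = w s - rl_int \<alpha> h s" for s
  have n0: "0 < real n" using n by auto
  have ih: "L1 (rl_integrand b h t)" if "0 < b" for b t
   by (intro integrable_rl_int_continuous h that)
  have iw: "L1 (rl_integrand b w t)" if "0 < b" for b t
   by (intro integrable_rl_int_continuous wc that)
  have gi: "L1 (rl_integrand b g t)" if "0 < b" for b t
   unfolding g_def by (rule rl_int_diff(2)[OF iw[OF that] integrable_rl_int[OF that \<alpha>(1) hm ih]]) (use that \<alpha> in auto)
  have gc: "continuous_on {0<..} g"
   unfolding g_def[abs_def] by (intro continuous_intros continuous_on_subset[OF wc] rl_int_continuous \<alpha> h) auto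
  have gm: "(\<lambda>s. indicator {0<..} s * g s) \<in> Borel"
   by (rule continuous_on_indicator_measurable[OF gc])
  have gn: "rl_int (real n) g t = 0" if t: "0 < t" for t
  proof -
   have "rl_int (real n) w t = rl_int \<alpha> (rl_int (real n - \<alpha>) w) t"
    using rl_int_rl_int[OF \<alpha>(1) c wm, of t] iw[of "real n" t] n0 by simp
   also have "\<dots> = rl_int \<alpha> (rl_int (real n) h) t"
    by (rule rl_int_cong) (use key v_eq[OF c] in auto)
   also have "\<dots> = rl_int (\<alpha> + real n) h t"
    by (rule rl_int_rl_int[OF \<alpha>(1) n0 hm ih]) (use \<alpha> n0 in auto)
   also have "\<dots> = rl_int (real n) (rl_int \<alpha> h) t"
    using rl_int_rl_int[OF n0 \<alpha>(1) hm ih] \<alpha> n0 by (simp add: add.commute)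
   finally show ?thesis
    unfolding g_def using rl_int_diff(1)[OF iw[OF n0] integrable_rl_int[OF n0 \<alpha>(1) hm ih], of t] \<alpha> n0 by simp
  qed
  have "g t = 0"
  proof (cases "n = 1")
   case True
   then show ?thesis using rl_int_1_cancel[OF gi gc _ t] gn by simp
  next
   case False
   then have n2: "n = 2" using n by auto
   have i2: "L1 (rl_integrand (1 + 1) g t)" for t
    by (rule gi) simp
   have 1: "rl_int 1 (rl_int 1 g) t = 0" if "0 < t" for t
    using rl_int_rl_int[OF zero_less_one zero_less_one gm i2] gn[OF that] n2 by simp
   have cont: "continuous_on {0<..} (rl_int 1 g)"
    by (intro continuous_at_imp_continuous_on ballI has_vector_derivative_continuous[OF rl_int_1_has_vector_derivative[OF gi gc]]) auto
   have 2: "rl_int 1 g t = 0" if "0 < t" for t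
    by (rule rl_int_1_cancel[OF integrable_rl_int[OF zero_less_one zero_less_one gm i2] cont 1 that])
   show ?thesis by (rule rl_int_1_cancel[OF gi gc 2 t]) auto
  qed
  then show ?thesis by (simp add: g_def w algebra_simps)
 qed
qed

section \<open>Mittag-Leffler functions of time\<close>

text \<open>For positive t this is the series with terms (-r)^k
  \<open>rl_kernel (a * k + b) t\<close> (see \<open>ml_time_sums\<close>), so fractional
  integration of order c raises \<open>b\<close> by c. With b = 1 it solves y = 1 - r I^a y.\<close>

definition ml_time :: "real \<Rightarrow> real \<Rightarrow> real \<Rightarrow> real \<Rightarrow> complex" where
 "ml_time a b r t = of_real (t powr (b - 1) * mittag_leffler a b (- (r * t powr a)))"

lemma ml_time_sums:
 assumes a: "0 < a" and b: "0 < b" and t: "0 < t"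
 shows "(\<lambda>k. (- r) ^ k * rl_kernel (a * real k + b) t) sums (t powr (b - 1) * mittag_leffler a b (- (r * t powr a)))"
  and "summable (\<lambda>k. \<bar>r\<bar> ^ k * rl_kernel (a * real k + b) t)"
proof -
 have e: "t powr (b - 1) * (rGamma (a * real k + b) * (- (r * t powr a)) ^ k) = (- r) ^ k * rl_kernel (a * real k + b) t" for k r
 proof -
  have "(- (r * t powr a)) ^ k = (- r) ^ k * (t powr a) ^ k" by (simp add: power_mult_distrib[symmetric])
  also have "(t powr a) ^ k = t powr (a * real k)" using t by (simp add: powr_realpow[symmetric] powr_powr)
  finally have "t powr (b - 1) * (rGamma (a * real k + b) * (- (r * t powr a)) ^ k) =
    rGamma (a * real k + b) * (- r) ^ k * (t powr (b - 1) * t powr (a * real k))" by simp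
  also have "t powr (b - 1) * t powr (a * real k) = t powr (a * real k + b - 1)"
   by (simp add: powr_add[symmetric] algebra_simps)
  finally show ?thesis using t by (simp add: rl_kernel_def rGamma_inverse_Gamma divide_inverse mult_ac)
 qed
 show "(\<lambda>k. (- r) ^ k * rl_kernel (a * real k + b) t) sums (t powr (b - 1) * mittag_leffler a b (- (r * t powr a)))"
  using sums_mult[OF sums_mittag_leffler[OF a, of b "- (r * t powr a)"], of "t powr (b - 1)"] unfolding e .
 have "summable (\<lambda>k. t powr (b - 1) * norm (rGamma (a * real k + b) * (- (r * t powr a)) ^ k))"
  by (intro summable_mult summable_mittag_leffler a)
 also have "(\<lambda>k. t powr (b - 1) * norm (rGamma (a * real k + b) * (- (r * t powr a)) ^ k)) = (\<lambda>k. \<bar>r\<bar> ^ k * rl_kernel (a * real k + b) t)"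
 proof
  fix k
  have "t powr (b - 1) * norm (rGamma (a * real k + b) * (- (r * t powr a)) ^ k) = \<bar>(- r) ^ k * rl_kernel (a * real k + b) t\<bar>"
   unfolding e[symmetric] by (simp add: abs_mult)
  also have "\<dots> = \<bar>r\<bar> ^ k * rl_kernel (a * real k + b) t"
   using a b rl_kernel_nonneg[of "a * real k + b" t] by (simp add: abs_mult power_abs add_nonneg_pos)
  finally show "t powr (b - 1) * norm (rGamma (a * real k + b) * (- (r * t powr a)) ^ k) = \<bar>r\<bar> ^ k * rl_kernel (a * real k + b) t" .
 qed
 finally show "summable (\<lambda>k. \<bar>r\<bar> ^ k * rl_kernel (a * real k + b) t)" .
qed

lemma
 assumes a: "0 < a" and b: "0 < b" and c: "0 < c" and t: "0 < t"
 shows rl_int_ml_time: "rl_int c (ml_time a b r) t = ml_time a (b + c) r t"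
  and integrable_rl_int_ml_time: "L1 (rl_integrand c (ml_time a b r) t)"
proof -
 define f where "f k s = (- complex_of_real r) ^ k * of_real (rl_kernel c (t - s) * rl_kernel (a * real k + b) (s - 0))" for k s
 have akb: "0 < a * real k + b" for k using a b by (simp add: add_nonneg_pos)
 note B = has_bochner_integral_rl_kernel[OF c akb, where t = t and r = 0, unfolded has_bochner_integral_iff]
 have fi: "L1 (f k)" for k
  unfolding f_def by (intro integrable_mult_right) (unfold complex_of_real_integrable_eq, rule conjunct1[OF B])
 have fint: "integral\<^sup>L lborel (f k) = of_real ((- r) ^ k * rl_kernel (a * real k + (b + c)) t)" for k
 proof -
  have "integral\<^sup>L lborel (f k) = (- of_real r) ^ k * of_real (rl_kernel (c + (a * real k + b)) (t - 0))"
   unfolding f_def integral_mult_right_zero integral_complex_of_real using B by simp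
  also have "c + (a * real k + b) = a * real k + (b + c)" by simp
  finally show ?thesis by simp
 qed
 have nf: "norm (f k s) = \<bar>r\<bar> ^ k * (rl_kernel c (t - s) * rl_kernel (a * real k + b) (s - 0))" for k s
  using rl_kernel_nonneg[OF c] rl_kernel_nonneg[OF akb] by (simp add: f_def norm_mult norm_power abs_mult)
 have nfint: "L1_norm (f k) = \<bar>r\<bar> ^ k * rl_kernel (a * real k + (b + c)) t" for k
 proof -
  have "L1_norm (f k) = \<bar>r\<bar> ^ k * rl_kernel (c + (a * real k + b)) (t - 0)"
   unfolding nf using B by simp
  also have "c + (a * real k + b) = a * real k + (b + c)" by simp
  finally show ?thesis by simp
 qed
 have sum: "(\<Sum>k. f k s) = of_real (rl_kernel c (t - s)) * (indicator {0<..} s * ml_time a b r s)"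
  and sumn: "summable (\<lambda>k. norm (f k s))" for s
 proof -
  show "summable (\<lambda>k. norm (f k s))"
  proof (cases "0 < s")
   case True
   have "summable (\<lambda>k. rl_kernel c (t - s) * (\<bar>r\<bar> ^ k * rl_kernel (a * real k + b) s))"
    by (intro summable_mult ml_time_sums a b True)
   then show ?thesis unfolding nf by (simp add: mult_ac)
  qed (simp add: nf rl_kernel_def)
  show "(\<Sum>k. f k s) = of_real (rl_kernel c (t - s)) * (indicator {0<..} s * ml_time a b r s)"
  proof (cases "0 < s")
   case True
   have "(\<lambda>k. complex_of_real (rl_kernel c (t - s) * ((- r) ^ k * rl_kernel (a * real k + b) s))) sums
     of_real (rl_kernel c (t - s) * (s powr (b - 1) * mittag_leffler a b (- (r * s powr a))))"
    by (intro sums_of_real sums_mult ml_time_sums a b True)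
   moreover have "complex_of_real (rl_kernel c (t - s) * ((- r) ^ k * rl_kernel (a * real k + b) s)) = f k s" for k
    by (simp add: f_def mult_ac)
   ultimately show ?thesis using True by (simp add: sums_iff ml_time_def)
  qed (simp add: f_def rl_kernel_def)
 qed
 have sn: "summable (\<lambda>k. L1_norm (f k))"
  unfolding nfint by (rule ml_time_sums(2)) (use a b c t in auto)
 have "L1 (\<lambda>s. \<Sum>k. f k s)" by (rule integrable_suminf[OF fi _ sn]) (use sumn in simp)
 then show "L1 (rl_integrand c (ml_time a b r) t)"
  unfolding sum .
 have "(\<lambda>k. integral\<^sup>L lborel (f k)) sums (LINT s|lborel. (\<Sum>k. f k s))"
  by (rule sums_integral[OF fi _ sn]) (use sumn in simp)
 then have "(\<lambda>k. complex_of_real ((- r) ^ k * rl_kernel (a * real k + (b + c)) t)) sums rl_int c (ml_time a b r) t"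
  unfolding sum fint rl_int_def .
 moreover have "(\<lambda>k. complex_of_real ((- r) ^ k * rl_kernel (a * real k + (b + c)) t)) sums ml_time a (b + c) r t"
  unfolding ml_time_def by (intro sums_of_real ml_time_sums) (use a b c t in auto)
 ultimately show "rl_int c (ml_time a b r) t = ml_time a (b + c) r t" by (rule sums_unique2)
qed

lemma ml_time_volterra:
 assumes "0 < a" "0 < t"
 shows "ml_time a 1 r t = 1 - of_real r * rl_int a (ml_time a 1 r) t"
proof -
 have "rl_int a (ml_time a 1 r) t = ml_time a (1 + a) r t"
  using assms by (intro rl_int_ml_time) auto
 moreover have "r * t powr a * mittag_leffler a (1 + a) (- (r * t powr a)) = 1 - mittag_leffler a 1 (- (r * t powr a))"
  using mittag_leffler_shift[OF assms(1), of "r * t powr a" "1 + a"] by simp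
 ultimately have "of_real r * rl_int a (ml_time a 1 r) t = complex_of_real (1 - mittag_leffler a 1 (- (r * t powr a)))"
  by (simp add: ml_time_def mult.assoc flip: of_real_mult)
 then show ?thesis using assms by (simp add: ml_time_def)
qed

lemma borel_measurable_ml_time:
 assumes "0 < a" "0 < b"
 shows "(\<lambda>s. indicator {0<..} s * ml_time a b r s) \<in> Borel"
proof (rule borel_measurable_LIMSEQ_metric)
 show "(\<lambda>s. \<Sum>k<n. complex_of_real ((- r) ^ k * rl_kernel (a * real k + b) s)) \<in> Borel" for n
  by measurable
 show "(\<lambda>n. \<Sum>k<n. complex_of_real ((- r) ^ k * rl_kernel (a * real k + b) s)) \<longlonglongrightarrow> indicator {0<..} s * ml_time a b r s" for s
 proof (cases "0 < s")
  case True
  have "(\<lambda>k. complex_of_real ((- r) ^ k * rl_kernel (a * real k + b) s)) sums ml_time a b r s"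
   unfolding ml_time_def by (intro sums_of_real ml_time_sums assms True)
  then show ?thesis using True by (simp add: sums_def)
 qed (simp add: rl_kernel_def)
qed

text \<open>The difference from the Mittag-Leffler solution satisfies e = -r I^a e. Iterating n
  times bounds it by a constant times the n-th term of a convergent series, so it vanishes.
  Boundedness up to t = 0 starts the iteration.\<close>

theorem volterra_unique:
 assumes a: "0 < a" and m: "(\<lambda>s. indicator {0<..} s * y s) \<in> Borel"
  and b: "\<And>t. 0 < t \<Longrightarrow> t \<le> \<tau> \<Longrightarrow> norm (y t) \<le> M"
  and eq: "\<And>t. 0 < t \<Longrightarrow> t \<le> \<tau> \<Longrightarrow> y t = 1 - of_real r * rl_int a y t"
  and t: "0 < t" "t \<le> \<tau>"
 shows "y t = ml_time a 1 r t"
proof -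
 define e where "e s = y s - ml_time a 1 r s" for s
 define M' where "M' = M + (\<Sum>k. \<bar>r\<bar> ^ k * rl_kernel (a * real k + 1) \<tau>)"
 note mlm = borel_measurable_ml_time[OF a zero_less_one, of r]
 have em: "(\<lambda>s. indicator {0<..} s * e s) \<in> Borel"
  unfolding e_def right_diff_distrib by (intro borel_measurable_diff m mlm)
 have \<tau>: "0 < \<tau>" using t by simp
 have mlb: "norm (ml_time a 1 r s) \<le> (\<Sum>k. \<bar>r\<bar> ^ k * rl_kernel (a * real k + 1) \<tau>)" if s: "0 < s" "s \<le> \<tau>" for s
 proof -
  have "norm (ml_time a 1 r s) = \<bar>\<Sum>k. (- r) ^ k * rl_kernel (a * real k + 1) s\<bar>"
   using ml_time_sums(1)[OF a zero_less_one s(1), of r] by (simp add: ml_time_def sums_iff)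
  also have "\<dots> \<le> (\<Sum>k. \<bar>(- r) ^ k * rl_kernel (a * real k + 1) s\<bar>)"
  proof (rule summable_rabs)
   show "summable (\<lambda>k. \<bar>(- r) ^ k * rl_kernel (a * real k + 1) s\<bar>)"
    using ml_time_sums(2)[OF a zero_less_one s(1), of r] a rl_kernel_nonneg
    by (simp add: abs_mult power_abs add_nonneg_pos)
  qed
  also have "\<dots> \<le> (\<Sum>k. \<bar>r\<bar> ^ k * rl_kernel (a * real k + 1) \<tau>)"
  proof (rule suminf_le)
   fix k
   have p: "0 < a * real k + 1" using a by (simp add: add_nonneg_pos)
   have "rl_kernel (a * real k + 1) s \<le> rl_kernel (a * real k + 1) \<tau>"
    using s a p \<tau> Gamma_real_pos[OF p] by (simp add: rl_kernel_def divide_right_mono powr_mono2)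
   then show "\<bar>(- r) ^ k * rl_kernel (a * real k + 1) s\<bar> \<le> \<bar>r\<bar> ^ k * rl_kernel (a * real k + 1) \<tau>"
    using rl_kernel_nonneg[OF p, of s] by (simp add: abs_mult power_abs mult_left_mono)
  next
   show "summable (\<lambda>k. \<bar>(- r) ^ k * rl_kernel (a * real k + 1) s\<bar>)"
    using ml_time_sums(2)[OF a zero_less_one s(1), of r] a rl_kernel_nonneg
    by (simp add: abs_mult power_abs add_nonneg_pos)
   show "summable (\<lambda>k. \<bar>r\<bar> ^ k * rl_kernel (a * real k + 1) \<tau>)"
    by (rule ml_time_sums(2)[OF a zero_less_one \<tau>])
  qed
  finally show ?thesis .
 qed
 have e0: "norm (e s) \<le> M'" if "0 < s" "s \<le> \<tau>" for s
  unfolding e_def M'_def using norm_triangle_ineq4[of "y s" "ml_time a 1 r s"] b[OF that] mlb[OF that] by linarith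
 have yi: "L1 (rl_integrand a y t)" if "t \<le> \<tau>" for t
  using b that by (intro integrable_rl_int_bounded[OF a m, of t M 1]) (auto simp: rl_kernel_1)
 have ee: "e t = - of_real r * rl_int a e t" if "0 < t" "t \<le> \<tau>" for t
 proof -
  have "rl_int a e t = rl_int a y t - rl_int a (ml_time a 1 r) t"
   unfolding e_def by (rule rl_int_diff(1)[OF yi integrable_rl_int_ml_time]) (use that a in auto)
  then show ?thesis
   using eq[OF that] ml_time_volterra[OF a that(1), of r] unfolding e_def[of t] by (simp add: right_diff_distrib)
 qed
 have "norm (e t) \<le> M' * \<bar>r\<bar> ^ n * rl_kernel (a * real n + 1) t" if "0 < t" "t \<le> \<tau>" for n t
  using that
 proof (induction n arbitrary: t)
  case 0
  then show ?case using e0 by (simp add: rl_kernel_1)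
 next
  case (Suc n)
  have "norm (rl_int a e t) \<le> M' * \<bar>r\<bar> ^ n * rl_kernel (a + (a * real n + 1)) t"
   by (rule norm_rl_int_le[OF a em]) (use Suc a in \<open>auto simp: add_nonneg_pos\<close>)
  then have "\<bar>r\<bar> * norm (rl_int a e t) \<le> \<bar>r\<bar> * (M' * \<bar>r\<bar> ^ n * rl_kernel (a + (a * real n + 1)) t)"
   by (intro mult_left_mono) auto
  moreover have "norm (e t) = \<bar>r\<bar> * norm (rl_int a e t)" using ee[OF Suc.prems] by (simp add: norm_mult)
  moreover have "a + (a * real n + 1) = a * real (Suc n) + 1" by (simp add: algebra_simps)
  ultimately show ?case by (simp add: mult_ac)
 qed
 note le = this[OF t]
 have "(\<lambda>n. \<bar>r\<bar> ^ n * rl_kernel (a * real n + 1) t) \<longlonglongrightarrow> 0"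
  by (rule summable_LIMSEQ_zero[OF ml_time_sums(2)[OF a zero_less_one t(1)]])
 then have "(\<lambda>n. M' * (\<bar>r\<bar> ^ n * rl_kernel (a * real n + 1) t)) \<longlonglongrightarrow> 0"
  by (rule tendsto_mult_right_zero)
 then have "norm (e t) \<le> 0"
  by (rule LIMSEQ_le_const) (use le in \<open>auto simp: mult.assoc\<close>)
 then show ?thesis by (simp add: e_def)
qed

section \<open>Test functions\<close>

text \<open>Test functions given syntactically, so that partial derivatives and products with
  characters are again of this kind. \<open>radial\<close>, applied to a function vanishing on the
  negative axis, gives bumps supported in the unit ball.\<close>

inductive smooth_expr :: "('a::euclidean_space \<Rightarrow> complex) \<Rightarrow> bool" where
 const: "smooth_expr (\<lambda>_. c)"
| inner: "smooth_expr (\<lambda>x. of_real (x \<bullet> v))"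
| cis: "smooth_expr (\<lambda>x. cis (x \<bullet> \<xi>))"
| radial: "elementary_smooth h \<Longrightarrow> smooth_expr (\<lambda>x. h (1 - x \<bullet> x))"
| add: "smooth_expr f \<Longrightarrow> smooth_expr g \<Longrightarrow> smooth_expr (\<lambda>x. f x + g x)"
| mult: "smooth_expr f \<Longrightarrow> smooth_expr g \<Longrightarrow> smooth_expr (\<lambda>x. f x * g x)"

lemma has_derivative_cis_inner:
 "((\<lambda>x. cis (x \<bullet> \<xi>)) has_derivative (\<lambda>w. (\<i> * of_real (w \<bullet> \<xi>)) * cis (x \<bullet> \<xi>))) (at x)"
proof -
 have "((\<lambda>x. \<i> * complex_of_real (x \<bullet> \<xi>)) has_derivative (\<lambda>w. \<i> * of_real (w \<bullet> \<xi>))) (at x)"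
  by (auto intro!: derivative_eq_intros)
 from has_derivative_compose[OF this DERIV_exp[unfolded has_field_derivative_def]]
 show ?thesis by (simp add: cis_conv_exp mult.commute)
qed

lemma has_vector_derivative_imp_quotient:
 fixes f :: "real \<Rightarrow> complex"
 assumes "(f has_vector_derivative D) (at 0)"
 shows "((\<lambda>r. (f r - f 0) /\<^sub>R r) \<longlongrightarrow> D) (at 0)"
proof -
 have "((\<lambda>y. norm (f y - f 0 - (y - 0) *\<^sub>R D) / norm (y - 0)) \<longlongrightarrow> 0) (at 0)"
  using assms by (simp only: has_vector_derivative_def has_derivative_iff_norm)
 moreover have "\<forall>\<^sub>F y in at 0. norm (f y - f 0 - (y - 0) *\<^sub>R D) / norm (y - 0) = norm ((f y - f 0) /\<^sub>R y - D)"
  unfolding eventually_at_filter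
 proof (intro always_eventually allI impI)
  fix y :: real assume "y \<noteq> 0"
  then have "(f y - f 0) /\<^sub>R y - D = (f y - f 0 - (y - 0) *\<^sub>R D) /\<^sub>R y" by (simp add: scaleR_diff_right)
  then show "norm (f y - f 0 - (y - 0) *\<^sub>R D) / norm (y - 0) = norm ((f y - f 0) /\<^sub>R y - D)"
   by (simp add: divide_inverse mult.commute)
 qed
 ultimately have "((\<lambda>y. norm ((f y - f 0) /\<^sub>R y - D)) \<longlongrightarrow> 0) (at 0)"
  by (rule Lim_transform_eventually)
 then show ?thesis by (rule LIM_zero_cancel[OF tendsto_norm_zero_cancel])
qed

lemma smooth_expr_derivative:
 "smooth_expr f \<Longrightarrow> \<exists>D. (\<forall>x. (f has_derivative D x) (at x)) \<and> (\<forall>v. smooth_expr (\<lambda>x. D x v))"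
proof (induction rule: smooth_expr.induct)
 case (const c)
 show ?case by (intro exI[of _ "\<lambda>x v. 0"]) (auto intro: smooth_expr.const)
next
 case (inner v)
 show ?case by (intro exI[of _ "\<lambda>x w. of_real (w \<bullet> v)"])
   (auto intro!: smooth_expr.const derivative_eq_intros)
next
 case (cis \<xi>)
 note has_derivative_cis_inner[of \<xi>]
 then show ?case
  by (intro exI[of _ "\<lambda>x w. (\<i> * of_real (w \<bullet> \<xi>)) * cis (x \<bullet> \<xi>)"])
   (auto intro!: smooth_expr.mult[OF smooth_expr.const smooth_expr.cis])
next
 case (radial h)
 then obtain h' where h': "elementary_smooth h'" "\<And>x. (h has_vector_derivative h' x) (at x)"
  using elementary_smooth_derivative by blast
 have "((\<lambda>x. h (1 - x \<bullet> x)) has_derivative (\<lambda>w. h' (1 - x \<bullet> x) * ((- 2) * of_real (x \<bullet> w)))) (at x)" for x :: 'a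
 proof -
  have "((\<lambda>x. 1 - x \<bullet> x) has_derivative (\<lambda>w. - 2 * (x \<bullet> w))) (at x)"
   by (auto intro!: derivative_eq_intros simp: inner_commute)
  from diff_chain_at[OF this] h'(2)[of "1 - x \<bullet> x", unfolded has_vector_derivative_def]
  have "((h \<circ> (\<lambda>x. 1 - x \<bullet> x)) has_derivative ((\<lambda>r. r *\<^sub>R h' (1 - x \<bullet> x)) \<circ> (\<lambda>w. - 2 * (x \<bullet> w)))) (at x)" by blast
  then show ?thesis by (simp add: o_def scaleR_conv_of_real mult.commute)
 qed
 moreover have "smooth_expr (\<lambda>x::'a. h' (1 - x \<bullet> x) * ((- 2) * of_real (x \<bullet> w)))" for w
  by (intro smooth_expr.mult smooth_expr.radial h' smooth_expr.const smooth_expr.inner)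
 ultimately show ?case
  by (intro exI[of _ "\<lambda>x w. h' (1 - x \<bullet> x) * ((- 2) * of_real (x \<bullet> w))"]) auto
next
 case (add f g)
 then obtain F G where "\<forall>x. (f has_derivative F x) (at x)" "\<forall>v. smooth_expr (\<lambda>x. F x v)"
  "\<forall>x. (g has_derivative G x) (at x)" "\<forall>v. smooth_expr (\<lambda>x. G x v)" by auto
 then show ?case
  by (intro exI[of _ "\<lambda>x v. F x v + G x v"]) (auto intro!: smooth_expr.add has_derivative_add)
next
 case (mult f g)
 then obtain F G where "\<forall>x. (f has_derivative F x) (at x)" "\<forall>v. smooth_expr (\<lambda>x. F x v)"
  "\<forall>x. (g has_derivative G x) (at x)" "\<forall>v. smooth_expr (\<lambda>x. G x v)" by auto
 then show ?case
  by (intro exI[of _ "\<lambda>x v. f x * G x v + F x v * g x"])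
   (auto intro!: smooth_expr.add smooth_expr.mult[of f] smooth_expr.mult[of _ g] has_derivative_mult mult.hyps)
qed

definition bump_expr :: "('a::euclidean_space \<Rightarrow> complex) \<Rightarrow> bool" where
 "bump_expr f \<longleftrightarrow> smooth_expr f \<and> (\<forall>x. x \<notin> cball 0 1 \<longrightarrow> f x = 0)"

lemma
 assumes "smooth_expr f"
 shows smooth_expr_has_derivative: "(f has_derivative frechet_derivative f (at x)) (at x)"
  and smooth_expr_partial: "smooth_expr (\<lambda>x. frechet_derivative f (at x) v)"
proof -
 obtain D where D: "\<And>x. (f has_derivative D x) (at x)" "\<And>v. smooth_expr (\<lambda>x. D x v)"
  using smooth_expr_derivative[OF assms] by blast
 have e: "frechet_derivative f (at x) = D x" for x using frechet_derivative_at[OF D(1)] by simp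
 show "(f has_derivative frechet_derivative f (at x)) (at x)" "smooth_expr (\<lambda>x. frechet_derivative f (at x) v)"
  using D unfolding e by auto
qed

lemma smooth_expr_partials: "smooth_expr f \<Longrightarrow> smooth_expr (partials vs f)"
 by (induction vs) (auto intro: smooth_expr_partial)

lemma smooth_expr_continuous: "smooth_expr f \<Longrightarrow> continuous_on S f"
 using smooth_expr_has_derivative by (intro continuous_at_imp_continuous_on ballI has_derivative_continuous) auto

lemma smooth_expr_imp_smooth: "smooth_expr f \<Longrightarrow> smooth f"
 unfolding smooth_def times_differentiable_def
 using smooth_expr_has_derivative[OF smooth_expr_partials] by (auto simp: differentiable_def)

lemma bump_expr_partial:
 fixes f :: "'a::euclidean_space \<Rightarrow> complex"
 assumes "bump_expr f"
 shows "bump_expr (\<lambda>x. frechet_derivative f (at x) v)"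
proof -
 have "frechet_derivative f (at x) v = 0" if "x \<notin> cball 0 1" for x
 proof -
  have "(f has_derivative (\<lambda>_. 0)) (at x)"
   by (rule has_derivative_transform_within_open[where f = "\<lambda>_. 0" and s = "- cball 0 1"])
    (use that assms in \<open>auto simp: bump_expr_def\<close>)
  then show ?thesis using frechet_derivative_at by metis
 qed
 then show ?thesis using assms smooth_expr_partial by (auto simp: bump_expr_def)
qed

lemma bump_expr_add: "bump_expr f \<Longrightarrow> bump_expr g \<Longrightarrow> bump_expr (\<lambda>x. f x + g x)"
 by (auto simp: bump_expr_def intro: smooth_expr.add)

lemma bump_expr_zero: "bump_expr (\<lambda>_. 0)"
 by (auto simp: bump_expr_def intro: smooth_expr.const)

lemma bump_expr_sum: "(\<And>b. b \<in> B \<Longrightarrow> bump_expr (f b)) \<Longrightarrow> bump_expr (\<lambda>x. \<Sum>b\<in>B. f b x)"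
 by (induction B rule: infinite_finite_induct) (auto intro: bump_expr_add bump_expr_zero)

lemma bump_expr_laplacian: "bump_expr f \<Longrightarrow> bump_expr (laplacian f)"
 unfolding laplacian_def[abs_def] partials.simps by (intro bump_expr_sum bump_expr_partial)

lemma bump_expr_cis_mult: "bump_expr f \<Longrightarrow> bump_expr (\<lambda>x. cis (x \<bullet> \<xi>) * f x)"
 by (auto simp: bump_expr_def intro: smooth_expr.mult smooth_expr.cis)

lemma bump_expr_integrable: "bump_expr f \<Longrightarrow> L1 f"
 by (rule integrable_continuous_compact_support[of f "cball 0 1"]) (auto simp: bump_expr_def smooth_expr_continuous)

lemma bump_expr_test_function: "bump_expr f \<Longrightarrow> test_function UNIV f"
proof -
 assume f: "bump_expr f"
 then have "closure {x. f x \<noteq> 0} \<subseteq> cball 0 1" by (intro closure_minimal) (auto simp: bump_expr_def)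
 then have "compact (closure {x. f x \<noteq> 0})" using compact_Int_closed[of "cball 0 1" "closure {x. f x \<noteq> 0}"]
  by (simp add: Int_absorb1)
 then show ?thesis using f smooth_expr_imp_smooth by (auto simp: test_function_def bump_expr_def)
qed

lemma bump_expr_bounded:
 assumes "bump_expr f"
 obtains K where "0 \<le> K" "\<And>x. norm (f x) \<le> K"
proof -
 have "compact (f ` cball 0 1)" using assms
  by (intro compact_continuous_image smooth_expr_continuous) (auto simp: bump_expr_def)
 then obtain K where "\<forall>y\<in>f ` cball 0 1. norm y \<le> K" using compact_imp_bounded bounded_iff by blast
 then have "norm (f x) \<le> max 0 K" for x
  using assms by (cases "x \<in> cball 0 1") (auto simp: bump_expr_def intro: max.coboundedI2)
 then show ?thesis using that[of "max 0 K"] by auto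
qed

text \<open>Modulation by the character of frequency \<xi> makes the transform at \<xi> equal to the
  integral of a non-negative bump. The test function may depend on \<xi> because the symbol is
  identified one frequency at a time.\<close>

lemma ex_bump_expr:
 obtains f where "bump_expr f" "fourier f \<xi> \<noteq> 0"
proof -
 define h where "h x = (if x \<le> 0 then 0 else complex_of_real ((1 / x) ^ 0 * exp (- (1 / x))))" for x
 have "elementary_smooth h" unfolding h_def[abs_def] by (rule elementary_smooth.flat)
 then have "smooth_expr (\<lambda>x::'a. h (1 - x \<bullet> x))" by (rule smooth_expr.radial)
 moreover have "h (1 - x \<bullet> x) = 0" if "x \<notin> cball 0 1" for x :: 'a
  using that by (simp add: h_def norm_eq_sqrt_inner)
 ultimately have h: "bump_expr (\<lambda>x::'a. h (1 - x \<bullet> x))" by (simp add: bump_expr_def)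
 define f where "f x = cis (x \<bullet> \<xi>) * h (1 - x \<bullet> x)" for x
 have f: "bump_expr f" unfolding f_def[abs_def] by (rule bump_expr_cis_mult[OF h])
 have r: "h (1 - x \<bullet> x) = of_real (Re (h (1 - x \<bullet> x)))" "0 \<le> Re (h (1 - x \<bullet> x))" for x :: 'a by (auto simp: h_def)
 have ir: "L1 (\<lambda>x::'a. Re (h (1 - x \<bullet> x)))"
  by (intro integrable_Re bump_expr_integrable h)
 have "fourier f \<xi> = (LINT x|lborel. cis (- (x \<bullet> \<xi>)) * f x)"
  using bump_expr_integrable[OF f] by (intro fourier_lborel) (simp add: integrable_iff_bounded)
 also have "\<dots> = (LINT x::'a|lborel. of_real (Re (h (1 - x \<bullet> x))))"
  by (intro lebesgue_integral_cong refl) (simp add: f_def r(1)[symmetric] mult.assoc[symmetric] cis_mult)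
 also have "\<dots> = of_real (LINT x::'a|lborel. Re (h (1 - x \<bullet> x)))" by (rule integral_complex_of_real)
 finally have e: "fourier f \<xi> = of_real (LINT x::'a|lborel. Re (h (1 - x \<bullet> x)))" .
 have "(LINT x::'a|lborel. Re (h (1 - x \<bullet> x))) \<noteq> 0"
 proof
  assume "(LINT x::'a|lborel. Re (h (1 - x \<bullet> x))) = 0"
  then have "AE x::'a in lborel. Re (h (1 - x \<bullet> x)) = 0"
   using integral_nonneg_eq_0_iff_AE[OF ir] r(2) by auto
  then have ae: "AE x::'a in lborel. h (1 - x \<bullet> x) = 0" by eventually_elim (subst r, simp)
  have "h (1 - (0::'a) \<bullet> 0) = 0"
   by (rule continuous_AE_eq[OF _ _ ae]) (use h in \<open>auto simp: bump_expr_def smooth_expr_continuous\<close>)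
  then show False by (simp add: h_def)
 qed
 then show ?thesis using that[OF f] e by simp
qed

section \<open>Derivatives of convolutions\<close>

lemma conv_commute:
 assumes "f \<in> Borel" "g \<in> Borel"
 shows "conv f g x = (LINT y|lborel. f y * g (x - y))"
proof -
 note [measurable] = assms
 have "conv f g x = (LINT y|lborel. f (x - y) * g y)" by (rule conv_lborel[OF assms])
 also have "\<dots> = (LINT y|lborel. f (x - (x - y)) * g (x - y))"
  by (rule lborel_integral_reflect[symmetric]) measurable
 finally show ?thesis by simp
qed

text \<open>Directional quotients are all that is computed here. Differentiability of the
  convolution comes from \<open>frac_heat_solution\<close>, and the two limits must then agree
  (\<open>frechet_derivative_conv\<close>).\<close>

lemma conv_directional_derivative:
 fixes f g :: "'a::euclidean_space \<Rightarrow> complex"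
 assumes f: "L1 f" and g: "bump_expr g"
 shows "((\<lambda>r. (conv f g (x + r *\<^sub>R v) - conv f g x) /\<^sub>R r) \<longlongrightarrow>
  conv f (\<lambda>y. frechet_derivative g (at y) v) x) (at 0)"
proof -
 let ?g' = "\<lambda>y. frechet_derivative g (at y) v"
 have g': "bump_expr ?g'" by (rule bump_expr_partial[OF g])
 obtain K where K: "0 \<le> K" "\<And>y. norm (?g' y) \<le> K" using bump_expr_bounded[OF g'] by blast
 obtain K0 where K0: "0 \<le> K0" "\<And>y. norm (g y) \<le> K0" using bump_expr_bounded[OF g] by blast
 have [measurable]: "f \<in> Borel" "g \<in> Borel" "?g' \<in> Borel"
  using f bump_expr_integrable[OF g] bump_expr_integrable[OF g'] by auto
 have vd: "((\<lambda>r. g (z + r *\<^sub>R v)) has_vector_derivative ?g' (z + r *\<^sub>R v)) (at r)" for z r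
 proof -
  have d: "((\<lambda>r. z + r *\<^sub>R v) has_derivative (\<lambda>h. h *\<^sub>R v)) (at r)" by (auto intro!: derivative_eq_intros)
  have gd: "(g has_derivative frechet_derivative g (at (z + r *\<^sub>R v))) (at (z + r *\<^sub>R v))"
   using g by (intro smooth_expr_has_derivative) (simp add: bump_expr_def)
  have "linear (frechet_derivative g (at (z + r *\<^sub>R v)))" using gd has_derivative_linear by blast
  then show ?thesis
   using diff_chain_at[OF d gd] by (simp add: has_vector_derivative_def o_def linear_cmul)
 qed
 have lip: "norm (g (z + r *\<^sub>R v) - g z) \<le> K * \<bar>r\<bar>" for z r
 proof -
  have "norm (g (z + r *\<^sub>R v) - g (z + 0 *\<^sub>R v)) \<le> K * norm (r - 0)"
  proof (rule differentiable_bound[where S = UNIV and f = "\<lambda>r. g (z + r *\<^sub>R v)" and f' = "\<lambda>r h. h *\<^sub>R ?g' (z + r *\<^sub>R v)"])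
   show "((\<lambda>r. g (z + r *\<^sub>R v)) has_derivative (\<lambda>h. h *\<^sub>R ?g' (z + r *\<^sub>R v))) (at r within UNIV)" for r
    using vd by (simp add: has_vector_derivative_def)
   show "onorm (\<lambda>h. h *\<^sub>R ?g' (z + r *\<^sub>R v)) \<le> K" for r
    using K(2)[of "z + r *\<^sub>R v"] by (intro onorm_le) (simp add: mult.commute[of K] mult_left_mono)
  qed auto
  then show ?thesis by simp
 qed
 have ib: "L1 (\<lambda>y. f y * g (z - y))" for z
 proof (rule lebesgue_integrable_bound[OF integrable_mult_right[OF integrable_norm[OF f], of K0]])
  show "AE y in lborel. norm (f y * g (z - y)) \<le> norm (K0 * norm (f y))"
   using K0 by (intro AE_I2) (simp add: norm_mult abs_mult mult.commute[of K0] mult_left_mono)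
 qed auto
 have q: "(conv f g (x + r *\<^sub>R v) - conv f g x) /\<^sub>R r = (LINT y|lborel. f y * ((g (x - y + r *\<^sub>R v) - g (x - y)) /\<^sub>R r))" for r
 proof -
  have "conv f g (x + r *\<^sub>R v) - conv f g x = (LINT y|lborel. f y * g (x + r *\<^sub>R v - y) - f y * g (x - y))"
   unfolding conv_commute[OF \<open>f \<in> Borel\<close> \<open>g \<in> Borel\<close>]
   by (rule lebesgue_integral_diff[symmetric, OF ib ib])
  also have "\<dots> /\<^sub>R r = (LINT y|lborel. (f y * g (x + r *\<^sub>R v - y) - f y * g (x - y)) /\<^sub>R r)"
   by (rule integral_scaleR_right[symmetric])
  also have "\<dots> = (LINT y|lborel. f y * ((g (x - y + r *\<^sub>R v) - g (x - y)) /\<^sub>R r))"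
   by (intro lebesgue_integral_cong refl) (simp add: right_diff_distrib algebra_simps)
  finally show ?thesis .
 qed
 show ?thesis
  unfolding q conv_commute[OF \<open>f \<in> Borel\<close> \<open>?g' \<in> Borel\<close>]
  unfolding tendsto_at_iff_sequentially o_def
 proof (intro allI impI)
  fix X :: "nat \<Rightarrow> real" assume X: "\<forall>i. X i \<in> UNIV - {0}" "X \<longlonglongrightarrow> 0"
  show "(\<lambda>n. LINT y|lborel. f y * ((g (x - y + X n *\<^sub>R v) - g (x - y)) /\<^sub>R X n)) \<longlonglongrightarrow> (LINT y|lborel. f y * ?g' (x - y))"
  proof (rule integral_dominated_convergence[where w = "\<lambda>y. K * norm (f y)"])
   show "L1 (\<lambda>y. K * norm (f y))" by (intro integrable_mult_right integrable_norm f)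
   show "AE y in lborel. (\<lambda>n. f y * ((g (x - y + X n *\<^sub>R v) - g (x - y)) /\<^sub>R X n)) \<longlonglongrightarrow> f y * ?g' (x - y)"
   proof (rule AE_I2)
    fix y
    have "((\<lambda>r. (g (x - y + r *\<^sub>R v) - g (x - y)) /\<^sub>R r) \<longlongrightarrow> ?g' (x - y)) (at 0)"
     using has_vector_derivative_imp_quotient[OF vd[of "x - y" 0]] by simp
    then have "(\<lambda>n. (g (x - y + X n *\<^sub>R v) - g (x - y)) /\<^sub>R X n) \<longlonglongrightarrow> ?g' (x - y)"
     unfolding tendsto_at_iff_sequentially o_def using X by blast
    then show "(\<lambda>n. f y * ((g (x - y + X n *\<^sub>R v) - g (x - y)) /\<^sub>R X n)) \<longlonglongrightarrow> f y * ?g' (x - y)"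
     by (rule tendsto_mult_left)
   qed
   show "AE y in lborel. norm (f y * ((g (x - y + X n *\<^sub>R v) - g (x - y)) /\<^sub>R X n)) \<le> K * norm (f y)" for n
   proof (rule AE_I2)
    fix y
    have "norm ((g (x - y + X n *\<^sub>R v) - g (x - y)) /\<^sub>R X n) \<le> K"
     using lip[of "x - y" "X n"] X by (simp add: divide_simps mult.commute)
    then have "norm (f y) * norm ((g (x - y + X n *\<^sub>R v) - g (x - y)) /\<^sub>R X n) \<le> norm (f y) * K"
     by (rule mult_left_mono) simp
    then show "norm (f y * ((g (x - y + X n *\<^sub>R v) - g (x - y)) /\<^sub>R X n)) \<le> K * norm (f y)"
     by (simp only: norm_mult mult.commute[of K])
   qed
  qed measurable
 qed
qed

lemma has_derivative_imp_difference_quotient: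
 fixes F :: "'a::euclidean_space \<Rightarrow> complex"
 assumes "(F has_derivative F') (at x)"
 shows "((\<lambda>r. (F (x + r *\<^sub>R v) - F x) /\<^sub>R r) \<longlongrightarrow> F' v) (at 0)"
proof -
 have d: "((\<lambda>r. x + r *\<^sub>R v) has_derivative (\<lambda>h. h *\<^sub>R v)) (at 0)" by (auto intro!: derivative_eq_intros)
 have "linear F'" using assms has_derivative_linear by blast
 then have "((\<lambda>r. F (x + r *\<^sub>R v)) has_vector_derivative F' v) (at 0)"
  using diff_chain_at[OF d, of F F'] assms by (simp add: has_vector_derivative_def o_def linear_cmul)
 from has_vector_derivative_imp_quotient[OF this] show ?thesis by simp
qed

lemma frechet_derivative_conv:
 assumes f: "L1 f" and g: "bump_expr g" and d: "conv f g differentiable (at x)"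
 shows "frechet_derivative (conv f g) (at x) v = conv f (\<lambda>y. frechet_derivative g (at y) v) x"
 by (rule tendsto_unique[OF _ has_derivative_imp_difference_quotient[OF frechet_derivative_works[THEN iffD1, OF d]] conv_directional_derivative[OF f g]]) simp

lemma laplacian_conv:
 fixes f g :: "'a::euclidean_space \<Rightarrow> complex"
 assumes f: "L1 f" and g: "bump_expr g" and d: "times_differentiable 2 (conv f g)"
 shows "laplacian (conv f g) x = conv f (laplacian g) x"
proof -
 have 1: "partials [b] (conv f g) = conv f (\<lambda>y. frechet_derivative g (at y) b)" if "b \<in> Basis" for b
  using d frechet_derivative_conv[OF f g] by (auto simp: times_differentiable_def fun_eq_iff dest!: spec[of _ "[]"])
 have 2: "partials [b, b] (conv f g) x = conv f (partials [b, b] g) x" if b: "b \<in> Basis" for b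
 proof -
  have "partials [b] (conv f g) differentiable (at x)"
   using d b unfolding times_differentiable_def by (auto dest!: spec[of _ "[b]"])
  then have "frechet_derivative (conv f (\<lambda>y. frechet_derivative g (at y) b)) (at x) b =
    conv f (partials [b, b] g) x"
   using frechet_derivative_conv[OF f bump_expr_partial[OF g]] unfolding 1[OF b] by simp
  then show ?thesis using 1[OF b] by simp
 qed
 have bp: "bump_expr (partials [b, b] g)" for b using g by (simp add: bump_expr_partial)
 have [measurable]: "f \<in> Borel" "partials [b, b] g \<in> Borel" for b
  using f bump_expr_integrable[OF bp, of b] by auto
 have i: "L1 (\<lambda>y. f y * partials [b, b] g (x - y))" for b
 proof -
  obtain K where K: "0 \<le> K" "\<And>y. norm (partials [b, b] g y) \<le> K" using bump_expr_bounded[OF bp, of b] by blast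
  show ?thesis
  proof (rule lebesgue_integrable_bound[OF integrable_mult_right[OF integrable_norm[OF f], of K]])
   show "AE y in lborel. norm (f y * partials [b, b] g (x - y)) \<le> norm (K * norm (f y))"
    using K by (intro AE_I2) (simp add: norm_mult abs_mult mult.commute[of K] mult_left_mono del: partials.simps)
  qed measurable
 qed
 have lm: "laplacian g \<in> Borel" using bump_expr_integrable[OF bump_expr_laplacian[OF g]] by simp
 have "laplacian (conv f g) x = (\<Sum>b\<in>Basis. LINT y|lborel. f y * partials [b, b] g (x - y))"
  unfolding laplacian_def using 2 conv_commute[of f "partials [_, _] g" x] by (intro sum.cong) (auto simp del: partials.simps)
 also have "\<dots> = (LINT y|lborel. (\<Sum>b\<in>Basis. f y * partials [b, b] g (x - y)))"
  by (rule lebesgue_integral_sum[symmetric]) (rule i)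
 also have "\<dots> = conv f (laplacian g) x"
  by (simp only: conv_commute[OF \<open>f \<in> Borel\<close> lm] laplacian_def sum_distrib_left)
 finally show ?thesis .
qed

lemma integrable_continuous_indicator_cball:
 "L1 (\<lambda>x. indicator (cball (0::'a::euclidean_space) r) x :: complex)"
proof -
 have "L1 (\<lambda>x. indicator (cball (0::'a) r) x *\<^sub>R (1::complex))"
  using emeasure_compact_finite[of "cball (0::'a) r"] by (intro integrable_indicator) (auto simp: top.not_eq_extremum)
 then show ?thesis by (simp add: scaleR_conv_of_real of_real_indicator)
qed

text \<open>The convolution of a bump with the indicator of a large ball is constant near 0, equal
  to the integral of the bump, so its derivative there vanishes. Radius 3 suffices: x - y has norm
  at most 2 for |x| <= 1 and y in the unit ball.\<close>

lemma integral_partial_bump_expr: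
 fixes f :: "'a::euclidean_space \<Rightarrow> complex"
 assumes f: "bump_expr f"
 shows "(LINT x|lborel. frechet_derivative f (at x) v) = 0"
proof -
 let ?f' = "\<lambda>y. frechet_derivative f (at y) v"
 have f': "bump_expr ?f'" by (rule bump_expr_partial[OF f])
 define I where "I x = (indicator (cball 0 3) x :: complex)" for x :: 'a
 have I: "L1 I" unfolding I_def[abs_def]
  by (intro integrable_continuous_indicator_cball)
 have [measurable]: "I \<in> Borel" "f \<in> Borel" "?f' \<in> Borel"
  using I bump_expr_integrable[OF f] bump_expr_integrable[OF f'] by auto
 have c: "conv I g x = (LINT y|lborel. g y)" if g: "bump_expr g" and x: "norm x \<le> 1" for g :: "'a \<Rightarrow> complex" and x
 proof -
  have [measurable]: "g \<in> Borel" using bump_expr_integrable[OF g] by auto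
  have "conv I g x = (LINT y|lborel. I (x - y) * g y)" by (intro conv_lborel) auto
  also have "\<dots> = (LINT y|lborel. g y)"
  proof (intro lebesgue_integral_cong refl)
   fix y show "I (x - y) * g y = g y"
    using g x norm_triangle_ineq4[of x y] by (cases "y \<in> cball 0 1") (auto simp: I_def bump_expr_def)
  qed
  finally show ?thesis .
 qed
 have "\<forall>\<^sub>F r in at 0. norm (0 + r *\<^sub>R v) \<le> 1"
 proof -
  have "((\<lambda>r. norm (0 + r *\<^sub>R v)) \<longlongrightarrow> norm (0 + 0 *\<^sub>R v)) (at 0)" by (intro tendsto_intros)
  then have "\<forall>\<^sub>F r in at 0. norm (0 + r *\<^sub>R v) < 1" by (intro order_tendstoD(2)) auto
  then show ?thesis by eventually_elim simp
 qed
 then have "\<forall>\<^sub>F r in at 0. (conv I f (0 + r *\<^sub>R v) - conv I f 0) /\<^sub>R r = 0"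
  by eventually_elim (simp add: c[OF f])
 then have "((\<lambda>r. (conv I f (0 + r *\<^sub>R v) - conv I f 0) /\<^sub>R r) \<longlongrightarrow> 0) (at 0)"
  by (rule tendsto_eventually)
 from tendsto_unique[OF _ conv_directional_derivative[OF I f] this]
 have "conv I ?f' 0 = 0" by simp
 then show ?thesis using c[OF f', of 0] by simp
qed

text \<open>Integration by parts against a character: the preceding lemma is applied to the
  modulated bump cis(-(x \<bullet> \<xi>)) f(x).\<close>

lemma fourier_partial_bump_expr:
 fixes f :: "'a::euclidean_space \<Rightarrow> complex"
 assumes f: "bump_expr f"
 shows "fourier (\<lambda>x. frechet_derivative f (at x) v) \<xi> = \<i> * of_real (v \<bullet> \<xi>) * fourier f \<xi>"
proof -
 let ?f' = "\<lambda>y. frechet_derivative f (at y) v"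
 let ?g = "\<lambda>x. cis (x \<bullet> (- \<xi>)) * f x"
 have f': "bump_expr ?f'" by (rule bump_expr_partial[OF f])
 have i: "L1 (\<lambda>x. cis (- (x \<bullet> \<xi>)) * f x)" "L1 (\<lambda>x. cis (- (x \<bullet> \<xi>)) * ?f' x)"
  using bump_expr_integrable[OF f] bump_expr_integrable[OF f'] by auto
 have "frechet_derivative ?g (at x) v = cis (- (x \<bullet> \<xi>)) * ?f' x - \<i> * of_real (v \<bullet> \<xi>) * (cis (- (x \<bullet> \<xi>)) * f x)" for x
 proof -
  have c: "((\<lambda>x. cis (x \<bullet> (- \<xi>))) has_derivative (\<lambda>w. - (\<i> * of_real (w \<bullet> \<xi>)) * cis (- (x \<bullet> \<xi>)))) (at x)"
   using has_derivative_cis_inner[of "- \<xi>" x] by simp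
  have fd: "(f has_derivative frechet_derivative f (at x)) (at x)"
   using f by (intro smooth_expr_has_derivative) (simp add: bump_expr_def)
  have "frechet_derivative ?g (at x) = (\<lambda>w. cis (x \<bullet> (- \<xi>)) * frechet_derivative f (at x) w + (- (\<i> * of_real (w \<bullet> \<xi>)) * cis (- (x \<bullet> \<xi>))) * f x)"
   using frechet_derivative_at[OF has_derivative_mult[OF c fd]] by simp
  then show ?thesis by (simp add: algebra_simps)
 qed
 then have "(LINT x|lborel. cis (- (x \<bullet> \<xi>)) * ?f' x - \<i> * of_real (v \<bullet> \<xi>) * (cis (- (x \<bullet> \<xi>)) * f x)) = 0"
  using integral_partial_bump_expr[OF bump_expr_cis_mult[OF f, of "- \<xi>"], of v] by simp
 then have "(LINT x|lborel. cis (- (x \<bullet> \<xi>)) * ?f' x) - \<i> * of_real (v \<bullet> \<xi>) * (LINT x|lborel. cis (- (x \<bullet> \<xi>)) * f x) = 0"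
  using i by (subst (asm) lebesgue_integral_diff) (auto simp del: mult_minus_left)
 moreover have "fourier f \<xi> = (LINT x|lborel. cis (- (x \<bullet> \<xi>)) * f x)" "fourier ?f' \<xi> = (LINT x|lborel. cis (- (x \<bullet> \<xi>)) * ?f' x)"
  using bump_expr_integrable[OF f] bump_expr_integrable[OF f'] by (intro fourier_lborel; auto)+
 ultimately show ?thesis by simp
qed

lemma fourier_sum:
 assumes "finite B" "\<And>b. b \<in> B \<Longrightarrow> L1 (f b)"
 shows "fourier (\<lambda>x. \<Sum>b\<in>B. f b x) \<xi> = (\<Sum>b\<in>B. fourier (f b) \<xi>)"
proof -
 have "fourier (\<lambda>x. \<Sum>b\<in>B. f b x) \<xi> = (LINT x|lborel. (\<Sum>b\<in>B. cis (- (x \<bullet> \<xi>)) * f b x))"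
  using assms(2) by (subst fourier_lborel) (auto simp: sum_distrib_left intro!: borel_measurable_sum)
 also have "\<dots> = (\<Sum>b\<in>B. LINT x|lborel. cis (- (x \<bullet> \<xi>)) * f b x)"
  using assms(2) by (intro lebesgue_integral_sum) auto
 also have "\<dots> = (\<Sum>b\<in>B. fourier (f b) \<xi>)"
  by (intro sum.cong refl fourier_lborel[symmetric]) (use assms(2) in auto)
 finally show ?thesis .
qed

lemma fourier_laplacian_bump_expr:
 fixes f :: "'a::euclidean_space \<Rightarrow> complex"
 assumes f: "bump_expr f"
 shows "fourier (laplacian f) \<xi> = - of_real ((norm \<xi>)\<^sup>2) * fourier f \<xi>"
proof -
 have "fourier (laplacian f) \<xi> = (\<Sum>b\<in>Basis. fourier (partials [b, b] f) \<xi>)"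
  unfolding laplacian_def[abs_def]
  by (rule fourier_sum) (auto intro!: bump_expr_integrable bump_expr_partial f)
 also have "\<dots> = (\<Sum>b\<in>Basis. - (of_real ((\<xi> \<bullet> b) * (\<xi> \<bullet> b))) * fourier f \<xi>)"
 proof (intro sum.cong refl)
  fix b :: 'a
  have "fourier (partials [b, b] f) \<xi> = (\<i> * \<i>) * (of_real (b \<bullet> \<xi>) * of_real (b \<bullet> \<xi>)) * fourier f \<xi>"
   by (simp only: partials.simps fourier_partial_bump_expr[OF bump_expr_partial[OF f]] fourier_partial_bump_expr[OF f] mult_ac)
  then show "fourier (partials [b, b] f) \<xi> = - (of_real ((\<xi> \<bullet> b) * (\<xi> \<bullet> b))) * fourier f \<xi>"
   by (simp add: inner_commute)
 qed
 also have "\<dots> = - of_real ((norm \<xi>)\<^sup>2) * fourier f \<xi>"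
  by (simp add: sum_distrib_right[symmetric] sum_negf euclidean_inner[of \<xi> \<xi>] power2_norm_eq_inner del: of_real_mult)
 finally show ?thesis .
qed

section \<open>The symbol of the kernel\<close>

text \<open>Serves \<open>q_kernel\<close>, which is only known to agree almost everywhere with an
  explicit Borel kernel; completeness of the measure then supplies measurability.\<close>

lemma borel_measurable_lebesgue_AE:
 fixes f g :: "'a::euclidean_space \<Rightarrow> complex"
 assumes f: "f \<in> Borel" and ae: "AE x in lborel. f x = g x"
 shows "g \<in> borel_measurable lebesgue"
proof (rule measurableI)
 fix A :: "complex set" assume A: "A \<in> sets borel"
 have "f \<in> borel_measurable lebesgue" using f by (intro measurable_completion) simp
 then have fA: "f -` A \<inter> space lebesgue \<in> sets lebesgue" using A by (rule measurable_sets)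
 have "AE x in lebesgue. f x = g x" using ae by (rule AE_completion)
 then have "AE x in lebesgue. (x \<in> f -` A \<inter> space lebesgue) = (x \<in> g -` A \<inter> space lebesgue)"
  by eventually_elim auto
 then show "g -` A \<inter> space lebesgue \<in> sets lebesgue"
  by (rule completion.in_sets_AE[OF _ fA]) simp
qed simp

lemma fourier_cong_AE:
 fixes f g :: "'a::euclidean_space \<Rightarrow> complex"
 assumes f: "f \<in> Borel" and ae: "AE x in lborel. f x = g x"
 shows "fourier g \<xi> = fourier f \<xi>"
proof -
 have fg [measurable]: "f \<in> borel_measurable lebesgue" "g \<in> borel_measurable lebesgue"
  using f borel_measurable_lebesgue_AE[OF f ae] by (auto intro: measurable_completion)
 have c [measurable]: "(\<lambda>x. cis (- (x \<bullet> \<xi>))) \<in> borel_measurable lebesgue"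
  by (intro measurable_completion) measurable
 show ?thesis unfolding fourier_def
 proof (rule integral_cong_AE)
  show "AE x in lebesgue. cis (- (x \<bullet> \<xi>)) * g x = cis (- (x \<bullet> \<xi>)) * f x"
   using AE_completion[OF ae] by eventually_elim simp
 qed measurable
qed

lemma rl_int_mult_right: "rl_int a (\<lambda>s. f s * c) t = rl_int a f t * c"
 unfolding rl_int_def by (simp add: mult.assoc[symmetric])

text \<open>Interchanges the fractional integral in time with the Fourier transform in space. The
  bound by \<open>rl_kernel b\<close> with b > 0 admits an integrable blow-up of the L1 norms at
  time 0.\<close>

lemma
 fixes F :: "real \<Rightarrow> 'a::euclidean_space \<Rightarrow> complex"
 assumes c: "0 < c" and b: "0 < b"
  and m: "(\<lambda>(s, x). indicator {0<..} s * F s x) \<in> borel_measurable (borel \<Otimes>\<^sub>M borel)"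
  and i: "\<And>s. 0 < s \<Longrightarrow> L1 (F s)"
  and B: "\<And>s. 0 < s \<Longrightarrow> s < t \<Longrightarrow> (L1_norm (F s)) \<le> M * rl_kernel b s"
 shows AE_integrable_rl_int_param: "AE x in lborel. L1 (\<lambda>s. of_real (rl_kernel c (t - s)) * (indicator {0<..} s * F s x))"
  and integrable_rl_int_param: "L1 (\<lambda>x. rl_int c (\<lambda>s. F s x) t)"
  and fourier_rl_int: "fourier (\<lambda>x. rl_int c (\<lambda>s. F s x) t) \<xi> = rl_int c (\<lambda>s. fourier (F s) \<xi>) t"
proof -
 let ?H = "\<lambda>s x. complex_of_real (rl_kernel c (t - s)) * (indicator {0<..} s * F s x)"
 have [measurable]: "(\<lambda>(s, x). indicator {0<..} s * F s x) \<in> borel_measurable (lborel \<Otimes>\<^sub>M lborel)"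
  using m by (simp cong: measurable_cong_sets sets_pair_measure_cong add: split_beta')
 have Hm [measurable]: "(\<lambda>(s, x). ?H s x) \<in> borel_measurable (lborel \<Otimes>\<^sub>M lborel)"
 proof -
  have "(\<lambda>p. complex_of_real (rl_kernel c (t - fst p)) * (case p of (s, x) \<Rightarrow> indicator {0<..} s * F s x)) \<in> borel_measurable (lborel \<Otimes>\<^sub>M lborel)"
   by measurable
  then show ?thesis by (simp add: split_beta')
 qed
 note K = has_bochner_integral_rl_kernel[OF c b, where t = t and r = 0, unfolded has_bochner_integral_iff]
 have iH: "L1 (?H s)" for s using i[of s] by (cases "0 < s") auto
 have nH: "L1_norm (?H s) \<le> M * (rl_kernel c (t - s) * rl_kernel b (s - 0))" for s
 proof (cases "0 < s \<and> s < t")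
  case True
  then have "L1_norm (?H s) = rl_kernel c (t - s) * L1_norm (F s)"
   using rl_kernel_nonneg[OF c] by (simp add: norm_mult)
  also have "\<dots> \<le> rl_kernel c (t - s) * (M * rl_kernel b s)"
   using True B by (intro mult_left_mono rl_kernel_nonneg c) auto
  finally show ?thesis by (simp add: mult.assoc mult.left_commute)
 qed (auto simp: rl_kernel_def)
 have pair: "integrable (lborel \<Otimes>\<^sub>M lborel) (\<lambda>(s, x). ?H s x)"
 proof (rule lborel_pair.Fubini_integrable[OF Hm])
  show "L1 (\<lambda>s. LINT x|lborel. norm (case (s, x) of (s, x) \<Rightarrow> ?H s x))"
  proof (rule lebesgue_integrable_bound)
   show "L1 (\<lambda>s. M * (rl_kernel c (t - s) * rl_kernel b (s - 0)))"
    using K by (intro integrable_mult_right) blast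
   show "AE s in lborel. norm (LINT x|lborel. norm (case (s, x) of (s, x) \<Rightarrow> ?H s x)) \<le> norm (M * (rl_kernel c (t - s) * rl_kernel b (s - 0)))"
   proof (rule AE_I2)
    fix s
    have "0 \<le> L1_norm (?H s)" by (rule lebesgue_integral_nonneg) simp
    then show "norm (LINT x|lborel. norm (case (s, x) of (s, x) \<Rightarrow> ?H s x)) \<le> norm (M * (rl_kernel c (t - s) * rl_kernel b (s - 0)))"
     using nH[of s] unfolding prod.case real_norm_def by linarith
   qed
  qed measurable
  show "AE s in lborel. L1 (\<lambda>x. case (s, x) of (s, x) \<Rightarrow> ?H s x)" using iH by simp
 qed
 have swap: "integrable (lborel \<Otimes>\<^sub>M lborel) (\<lambda>(x, s). ?H s x)"
  using lborel_pair.integrable_product_swap[OF pair] by (simp add: split_beta')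
 show "AE x in lborel. L1 (\<lambda>s. of_real (rl_kernel c (t - s)) * (indicator {0<..} s * F s x))"
  using lborel_pair.AE_integrable_fst'[OF swap] by simp
 show int: "L1 (\<lambda>x. rl_int c (\<lambda>s. F s x) t)"
  using lborel_pair.integrable_fst'[OF swap] by (simp add: rl_int_def)
 have pc: "integrable (lborel \<Otimes>\<^sub>M lborel) (\<lambda>(s, x). cis (- (x \<bullet> \<xi>)) * ?H s x)"
 proof (rule lebesgue_integrable_bound[OF pair])
  have "(\<lambda>p. cis (- (snd p \<bullet> \<xi>)) * (case p of (s, x) \<Rightarrow> ?H s x)) \<in> borel_measurable (lborel \<Otimes>\<^sub>M lborel)" by measurable
  then show "(\<lambda>(s, x). cis (- (x \<bullet> \<xi>)) * ?H s x) \<in> borel_measurable (lborel \<Otimes>\<^sub>M lborel)" by (simp add: split_beta')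
  show "AE p in lborel \<Otimes>\<^sub>M lborel. norm (case p of (s, x) \<Rightarrow> cis (- (x \<bullet> \<xi>)) * ?H s x) \<le> norm (case p of (s, x) \<Rightarrow> ?H s x)"
   by (intro AE_I2) (simp add: split_beta' norm_mult)
 qed
 have "fourier (\<lambda>x. rl_int c (\<lambda>s. F s x) t) \<xi> = (LINT x|lborel. cis (- (x \<bullet> \<xi>)) * (LINT s|lborel. ?H s x))"
  using int by (subst fourier_lborel) (auto simp: rl_int_def)
 also have "\<dots> = (LINT x|lborel. LINT s|lborel. cis (- (x \<bullet> \<xi>)) * ?H s x)" by simp
 also have "\<dots> = (LINT s|lborel. LINT x|lborel. cis (- (x \<bullet> \<xi>)) * ?H s x)"
  by (rule lborel_pair.Fubini_integral[OF pc])
 also have "\<dots> = rl_int c (\<lambda>s. fourier (F s) \<xi>) t"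
  unfolding rl_int_def
 proof (intro lebesgue_integral_cong refl)
  fix s :: real
  show "(LINT x|lborel. cis (- (x \<bullet> \<xi>)) * ?H s x) = of_real (rl_kernel c (t - s)) * (indicator {0<..} s * fourier (F s) \<xi>)"
  proof (cases "0 < s")
   case True
   have "(LINT x|lborel. cis (- (x \<bullet> \<xi>)) * ?H s x) = (LINT x|lborel. of_real (rl_kernel c (t - s)) * (cis (- (x \<bullet> \<xi>)) * F s x))"
    using True by (simp add: mult.left_commute)
   then show ?thesis using True i[OF True] by (simp add: fourier_lborel)
  qed simp
 qed
 finally show "fourier (\<lambda>x. rl_int c (\<lambda>s. F s x) t) \<xi> = rl_int c (\<lambda>s. fourier (F s) \<xi>) t" .
qed

section \<open>The symbols of the fundamental solution and of its fractional integrals and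
  derivatives\<close>

locale fractional_heat =
 fixes \<alpha> :: real and P :: "real \<Rightarrow> 'a::euclidean_space \<Rightarrow> complex"
 assumes \<alpha>: "0 < \<alpha>" "\<alpha> < 2" and fundamental: "fundamental_solution \<alpha> P"
begin

text \<open>Extended by 0 to non-positive times, so as to be jointly Borel on the whole product
  space.\<close>

definition Q :: "real \<Rightarrow> 'a \<Rightarrow> complex" where "Q s x = indicator {0<..} s * P s x"

lemma Q_measurable_pair: "(\<lambda>(s, x). indicator {0<..} s * P s x) \<in> borel_measurable (borel \<Otimes>\<^sub>M borel)"
proof -
 have "(\<lambda>(t, x). P t x) \<in> borel_measurable (restrict_space borel ({0<..} \<times> UNIV))"
  using fundamental by (simp add: fundamental_solution_def)
 then have "(\<lambda>p. indicator ({0<..} \<times> UNIV) p *\<^sub>R (case p of (t, x) \<Rightarrow> P t x)) \<in> Borel"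
  by (subst (asm) borel_measurable_restrict_space_iff) (auto simp: open_Times)
 moreover have "(\<lambda>p. indicator ({0<..} \<times> UNIV) p *\<^sub>R (case p of (t, x) \<Rightarrow> P t x)) = (\<lambda>(s, x). indicator {0<..} s * P s x)"
  by (auto simp: indicator_def fun_eq_iff)
 ultimately show ?thesis by (simp add: borel_prod)
qed

lemma Q_measurable [measurable (raw)]:
 assumes [measurable]: "f \<in> borel_measurable M" "g \<in> borel_measurable M"
 shows "(\<lambda>z. Q (f z) (g z)) \<in> borel_measurable M"
 using measurable_compose[OF _ Q_measurable_pair, of "\<lambda>z. (f z, g z)" M] by (simp add: Q_def)

lemma Q_section_measurable: "(\<lambda>s. indicator {0<..} s * P s x) \<in> Borel"
 unfolding Q_def[symmetric] by measurable

lemma P_integrable: "0 < t \<Longrightarrow> L1 (P t)"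
 using fundamental by (simp add: fundamental_solution_def)

lemma P_bound:
 obtains M where "0 \<le> M" "\<And>s. 0 < s \<Longrightarrow> s \<le> t \<Longrightarrow> (L1_norm (P s)) \<le> M"
proof -
 obtain M where M: "\<forall>s\<in>{0<..t}. (L1_norm (P s)) \<le> M"
  using fundamental unfolding fundamental_solution_def by blast
 show ?thesis by (rule that[of "max 0 M"]) (use M in \<open>auto intro: max.coboundedI2\<close>)
qed

text \<open>The Laplacian is moved onto the test function. The right-hand side is then itself a
  solution, with initial value \<open>laplacian v\<close>, and so is continuous down to t = 0 as
  \<open>caputo_imp_volterra\<close> requires.\<close>

lemma conv_P_volterra:
 assumes v: "bump_expr v" and t: "0 < t"
 shows "conv (P t) v x = v x + rl_int \<alpha> (\<lambda>s. conv (P s) (laplacian v) x) t"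
proof -
 let ?u = "\<lambda>v t. if t = 0 then v else conv (P t) v"
 note w = bump_expr_laplacian[OF v]
 have sv: "frac_heat_solution \<alpha> v (?u v)" and sw: "frac_heat_solution \<alpha> (laplacian v) (?u (laplacian v))"
  using fundamental bump_expr_test_function[OF v] bump_expr_test_function[OF w] by (auto simp: fundamental_solution_def)
 have c: "continuous_on {0..} (\<lambda>t. ?u (laplacian v) t x)"
 proof -
  have "time_C (nat \<lceil>\<alpha>\<rceil> - 1) (\<lambda>t. ?u (laplacian v) t x)"
   using sw unfolding frac_heat_solution_def caputo_differentiable_def by blast
  then show ?thesis unfolding time_C_def by (auto dest!: spec[of _ 0])
 qed
 have "?u v t x = ?u v 0 x + rl_int \<alpha> (\<lambda>t. ?u (laplacian v) t x) t"
 proof (rule caputo_imp_volterra[OF \<alpha> c _ _ _ t])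
  show "caputo_differentiable \<alpha> (\<lambda>t. ?u v t x)" using sv unfolding frac_heat_solution_def by blast
  show "caputo_deriv \<alpha> (\<lambda>t. ?u v t x) t = ?u (laplacian v) t x" if t: "0 < t" for t
  proof -
   have "times_differentiable 2 (?u v t)" using sv t unfolding frac_heat_solution_def by blast
   then have td: "times_differentiable 2 (conv (P t) v)" using t by simp
   have "caputo_deriv \<alpha> (\<lambda>t. ?u v t x) t = laplacian (?u v t) x" using sv t unfolding frac_heat_solution_def by blast
   also have "\<dots> = conv (P t) (laplacian v) x"
    using laplacian_conv[OF P_integrable[OF t] v td] t by simp
   finally show ?thesis using t by simp
  qed
  show "time_deriv (\<lambda>t. ?u v t x) 0 = 0" if "1 < \<alpha>" using sv that unfolding frac_heat_solution_def by blast
 qed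
 also have "rl_int \<alpha> (\<lambda>t. ?u (laplacian v) t x) t = rl_int \<alpha> (\<lambda>s. conv (P s) (laplacian v) x) t"
  by (rule rl_int_cong) auto
 finally show ?thesis using t by simp
qed

text \<open>Transforming the Volterra equation in space and dividing by the non-zero number
  \<open>fourier v \<xi>\<close> leaves a scalar equation for the symbol. The locally uniform L1
  bound makes its solution bounded, hence unique.\<close>

theorem fourier_fundamental_solution:
 assumes t: "0 < t"
 shows "fourier (P t) \<xi> = ml_time \<alpha> 1 ((norm \<xi>)\<^sup>2) t"
proof -
 obtain v :: "'a \<Rightarrow> complex" where v: "bump_expr v" "fourier v \<xi> \<noteq> 0" using ex_bump_expr by blast
 define w where "w = laplacian v"
 have w: "bump_expr w" unfolding w_def by (rule bump_expr_laplacian[OF v(1)])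
 note iv = bump_expr_integrable[OF v(1)] and iw = bump_expr_integrable[OF w]
 have [measurable]: "w \<in> Borel" using iw by simp
 define y where "y s = fourier (P s) \<xi>" for s
 have ym: "(\<lambda>s. indicator {0<..} s * y s) \<in> Borel"
 proof -
  have "(\<lambda>s. LINT x|lborel. cis (- (x \<bullet> \<xi>)) * Q s x) \<in> Borel" by measurable
  also have "(\<lambda>s. LINT x|lborel. cis (- (x \<bullet> \<xi>)) * Q s x) = (\<lambda>s. indicator {0<..} s * y s)"
   using P_integrable by (auto simp: fun_eq_iff Q_def y_def indicator_def fourier_lborel)
  finally show ?thesis .
 qed
 obtain M where M: "0 \<le> M" "\<And>s. 0 < s \<Longrightarrow> s \<le> t \<Longrightarrow> (L1_norm (P s)) \<le> M" using P_bound[of t] by blast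
 have cm: "(\<lambda>(s, x). indicator {0<..} s * conv (P s) w x) \<in> borel_measurable (borel \<Otimes>\<^sub>M borel)"
 proof -
  have "(\<lambda>(s, x). LINT y|lborel. Q s (x - y) * w y) \<in> borel_measurable (borel \<Otimes>\<^sub>M borel)" by measurable
  also have "(\<lambda>(s, x). LINT y|lborel. Q s (x - y) * w y) = (\<lambda>(s, x). indicator {0<..} s * conv (P s) w x)"
   using P_integrable by (auto simp: fun_eq_iff Q_def indicator_def conv_lborel)
  finally show ?thesis .
 qed
 have cb: "L1_norm (conv (P s) w) \<le> (M * (L1_norm w)) * rl_kernel 1 s" if "0 < s" "s < t" for s
 proof -
  have "L1_norm (conv (P s) w) \<le> L1_norm (P s) * L1_norm w"
   by (rule norm_conv_L1_le[OF P_integrable[OF that(1)] iw])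
  also have "\<dots> \<le> M * L1_norm w" using M(2)[of s] that by (intro mult_right_mono) auto
  finally show ?thesis using that by (simp add: rl_kernel_1)
 qed
 have eq: "y s = 1 - of_real ((norm \<xi>)\<^sup>2) * rl_int \<alpha> y s" if s: "0 < s" "s \<le> t" for s
 proof -
  have ci: "L1 (conv (P s) w)" if "0 < s" for s by (rule integrable_conv[OF P_integrable[OF that] iw])
  have B: "L1_norm (conv (P r) w) \<le> (M * (L1_norm w)) * rl_kernel 1 r" if "0 < r" "r < s" for r
   using cb[of r] that s by auto
  note R = integrable_rl_int_param[OF \<alpha>(1) zero_less_one cm ci B] fourier_rl_int[OF \<alpha>(1) zero_less_one cm ci B, where \<xi> = \<xi>]
  have "fourier (conv (P s) v) \<xi> = y s * fourier v \<xi>" unfolding y_def by (rule fourier_conv[OF P_integrable[OF s(1)] iv])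
  moreover have "fourier (conv (P s) v) \<xi> = fourier v \<xi> + fourier (\<lambda>x. rl_int \<alpha> (\<lambda>s. conv (P s) w x) s) \<xi>"
  proof -
   have e: "conv (P s) v = (\<lambda>x. v x + rl_int \<alpha> (\<lambda>s. conv (P s) w x) s)"
    using conv_P_volterra[OF v(1) s(1)] by (simp add: w_def fun_eq_iff)
   have [measurable]: "v \<in> Borel" "(\<lambda>x. rl_int \<alpha> (\<lambda>s. conv (P s) w x) s) \<in> Borel"
    using iv R(1) by auto
   show ?thesis unfolding e using iv R(1)
    by (simp add: fourier_lborel distrib_left lebesgue_integral_add)
  qed
  moreover have "fourier (\<lambda>x. rl_int \<alpha> (\<lambda>s. conv (P s) w x) s) \<xi> = rl_int \<alpha> (\<lambda>s. y s * fourier w \<xi>) s"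
  proof -
   have "fourier (\<lambda>x. rl_int \<alpha> (\<lambda>s. conv (P s) w x) s) \<xi> = rl_int \<alpha> (\<lambda>s. fourier (conv (P s) w) \<xi>) s"
    by (rule R(2))
   also have "\<dots> = rl_int \<alpha> (\<lambda>s. y s * fourier w \<xi>) s"
    by (rule rl_int_cong) (simp add: y_def fourier_conv[OF P_integrable iw])
   finally show ?thesis .
  qed
  ultimately have "y s * fourier v \<xi> = fourier v \<xi> + rl_int \<alpha> y s * fourier w \<xi>" by (simp add: rl_int_mult_right)
  also have "fourier w \<xi> = - of_real ((norm \<xi>)\<^sup>2) * fourier v \<xi>" unfolding w_def by (rule fourier_laplacian_bump_expr[OF v(1)])
  finally have "y s * fourier v \<xi> = (1 - of_real ((norm \<xi>)\<^sup>2) * rl_int \<alpha> y s) * fourier v \<xi>"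
   by (simp add: left_diff_distrib mult.assoc mult.left_commute)
  then show ?thesis using v(2) by simp
 qed
 have yb: "norm (y s) \<le> M" if "0 < s" "s \<le> t" for s
  unfolding y_def using norm_fourier_le[OF P_integrable[OF that(1)]] M(2)[OF that] by (rule order_trans)
 have "y t = ml_time \<alpha> 1 ((norm \<xi>)\<^sup>2) t"
  by (rule volterra_unique[OF \<alpha>(1) ym yb eq t order_refl])
 then show ?thesis by (simp add: y_def)
qed

text \<open>For \<alpha> < \<beta> the pointwise time derivative is not known to exist beforehand.
  The kernel \<open>k\<close> that should result is built explicitly, \<open>P\<close> is recognised
  as its fractional integral of order \<gamma> = \<beta> - \<alpha> < 1, and one derivative of I^(1
  - \<gamma>) P = I^1 k returns \<open>k\<close>.\<close>

theorem fourier_q_kernel: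
 assumes t: "0 < t" and \<beta>: "\<beta> < \<alpha> + 1"
 shows "fourier (q_kernel P \<alpha> \<beta> t) \<xi> = ml_time \<alpha> (1 + \<alpha> - \<beta>) ((norm \<xi>)\<^sup>2) t"
proof -
 obtain M where M: "0 \<le> M" "\<And>s. 0 < s \<Longrightarrow> s \<le> t \<Longrightarrow> (L1_norm (P s)) \<le> M" using P_bound[of t] by blast
 consider "\<alpha> = \<beta>" | "\<beta> < \<alpha>" | "\<alpha> < \<beta>" by linarith
 then show ?thesis
 proof cases
  case 1
  then have "q_kernel P \<alpha> \<beta> t = P t" by (simp add: q_kernel_def RL_integral_def fun_eq_iff)
  then show ?thesis using fourier_fundamental_solution[OF t] 1 by simp
 next
  case 2
  then have c: "0 < \<alpha> - \<beta>" by simp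
  have q: "q_kernel P \<alpha> \<beta> t = (\<lambda>x. rl_int (\<alpha> - \<beta>) (\<lambda>s. P s x) t)"
   using 2 RL_integral_eq_rl_int[OF Q_section_measurable c] by (simp add: q_kernel_def fun_eq_iff)
  have "fourier (q_kernel P \<alpha> \<beta> t) \<xi> = rl_int (\<alpha> - \<beta>) (\<lambda>s. fourier (P s) \<xi>) t"
   unfolding q by (rule fourier_rl_int[OF c zero_less_one Q_measurable_pair P_integrable, where M = M])
    (use M in \<open>auto simp: rl_kernel_1\<close>)
  also have "\<dots> = rl_int (\<alpha> - \<beta>) (ml_time \<alpha> 1 ((norm \<xi>)\<^sup>2)) t"
   by (rule rl_int_cong) (rule fourier_fundamental_solution)
  also have "\<dots> = ml_time \<alpha> (1 + (\<alpha> - \<beta>)) ((norm \<xi>)\<^sup>2) t"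
   by (rule rl_int_ml_time[OF \<alpha>(1) zero_less_one c t])
  finally show ?thesis by (simp add: add_diff_eq)
 next
  case 3
  define \<gamma> where "\<gamma> = \<beta> - \<alpha>"
  have \<gamma>: "0 < \<gamma>" "\<gamma> < 1" "0 < 1 - \<gamma>" using 3 \<beta> by (auto simp: \<gamma>_def)
  obtain \<kappa> :: "'a \<Rightarrow> complex" where \<kappa>: "L1 \<kappa>" "continuous_on (- {0}) \<kappa>"
    "\<And>\<xi>. fourier \<kappa> \<xi> = of_real (mittag_leffler \<alpha> (1 - \<gamma>) (- ((norm \<xi>)\<^sup>2)))"
   using mittag_leffler_kernel[OF \<alpha>] by blast
  have [measurable]: "\<kappa> \<in> Borel" using \<kappa>(1) by simp
  define c where "c s = s powr (- \<alpha> / 2)" for s :: real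
  have c: "0 < c s" if "0 < s" for s using that by (simp add: c_def)
  \<comment> \<open>Rescaled from a single profile so that its transform is
    \<open>ml_time \<alpha> (1 - \<gamma>)\<close>, the formal derivative of order \<gamma> of the
    symbol of \<open>P\<close>.\<close>
  define k where "k s x = of_real (s powr (- \<gamma>) * c s ^ DIM('a)) * \<kappa> (c s *\<^sub>R x)" for s x
  have kpair: "(\<lambda>(s, x). indicator {0<..} s * k s x) \<in> borel_measurable (borel \<Otimes>\<^sub>M borel)"
   unfolding k_def c_def by measurable
  have kmeas [measurable (raw)]: "(\<lambda>z. indicator {0<..} (f z) * k (f z) (g z)) \<in> borel_measurable N"
   if "f \<in> borel_measurable N" "g \<in> borel_measurable N" for N :: "'c measure" and f g
   using measurable_compose[OF _ kpair, of "\<lambda>z. (f z, g z)" N] that by simp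
  have ki: "L1 (k s)" if "0 < s" for s
   unfolding k_def using lborel_integrable_affine_iff[of \<kappa> "c s" 0] \<kappa>(1) c[OF that] by (intro integrable_mult_right) simp
  have kF: "fourier (k s) \<xi> = ml_time \<alpha> (1 - \<gamma>) ((norm \<xi>)\<^sup>2) s" if s: "0 < s" for s \<xi>
  proof -
   have [measurable]: "k s \<in> Borel" using ki[OF s] by simp
   have "fourier \<kappa> (\<xi> /\<^sub>R c s) = (LINT x|lborel. cis (- (x \<bullet> (\<xi> /\<^sub>R c s))) * \<kappa> x)" by (rule fourier_lborel) measurable
   also have "\<dots> = (\<bar>c s\<bar> ^ DIM('a)) *\<^sub>R (LINT x|lborel. cis (- ((0 + c s *\<^sub>R x) \<bullet> (\<xi> /\<^sub>R c s))) * \<kappa> (0 + c s *\<^sub>R x))"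
    by (rule lborel_integral_affine) (use c[OF s] in auto)
   also have "\<dots> = of_real (c s ^ DIM('a)) * (LINT x|lborel. cis (- (x \<bullet> \<xi>)) * \<kappa> (c s *\<^sub>R x))"
    using c[OF s] by (simp add: scaleR_conv_of_real mult.assoc[symmetric])
   finally have e: "fourier \<kappa> (\<xi> /\<^sub>R c s) = of_real (c s ^ DIM('a)) * (LINT x|lborel. cis (- (x \<bullet> \<xi>)) * \<kappa> (c s *\<^sub>R x))" .
   have "fourier (k s) \<xi> = (LINT x|lborel. of_real (s powr (- \<gamma>) * c s ^ DIM('a)) * (cis (- (x \<bullet> \<xi>)) * \<kappa> (c s *\<^sub>R x)))"
    by (simp add: fourier_lborel k_def mult.left_commute)
   also have "\<dots> = of_real (s powr (- \<gamma>)) * fourier \<kappa> (\<xi> /\<^sub>R c s)"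
    unfolding e by simp
   also have "\<dots> = of_real (s powr (- \<gamma>) * mittag_leffler \<alpha> (1 - \<gamma>) (- ((norm \<xi>)\<^sup>2 * s powr \<alpha>)))"
   proof -
    have "(norm (\<xi> /\<^sub>R c s))\<^sup>2 = (norm \<xi>)\<^sup>2 * (inverse (c s))\<^sup>2" using c[OF s] by (simp add: power_mult_distrib mult.commute)
    also have "(inverse (c s))\<^sup>2 = s powr \<alpha>" using s unfolding c_def
     by (simp add: powr_minus[symmetric] power2_eq_square powr_add[symmetric])
    finally show ?thesis by (simp add: \<kappa>(3))
   qed
   finally show ?thesis by (simp add: ml_time_def)
  qed
  define N where "N = (L1_norm \<kappa>) * Gamma (1 - \<gamma>)"
  have kN: "L1_norm (k s) \<le> N * rl_kernel (1 - \<gamma>) s" if s: "0 < s" for s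
  proof -
   have "L1_norm (k s) = s powr (- \<gamma>) * (c s ^ DIM('a) * (LINT x|lborel. norm (\<kappa> (c s *\<^sub>R x))))"
    using c[OF s] by (simp add: k_def norm_mult norm_power mult.assoc abs_mult)
   also have "c s ^ DIM('a) * (LINT x|lborel. norm (\<kappa> (c s *\<^sub>R x))) = (L1_norm \<kappa>)"
    using lborel_integral_affine[of "\<lambda>x. norm (\<kappa> x)" "c s" 0] c[OF s] by simp
   finally show ?thesis using s Gamma_real_pos[OF \<gamma>(3)] by (simp add: N_def rl_kernel_def)
  qed
  have PK: "AE x in lborel. P s x = rl_int \<gamma> (\<lambda>s. k s x) s" if s: "0 < s" for s
  proof (rule fourier_injective_AE[OF P_integrable[OF s]])
   show "L1 (\<lambda>x. rl_int \<gamma> (\<lambda>s. k s x) s)"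
    by (rule integrable_rl_int_param[OF \<gamma>(1) \<gamma>(3) kpair ki kN])
   show "fourier (P s) \<xi> = fourier (\<lambda>x. rl_int \<gamma> (\<lambda>s. k s x) s) \<xi>" for \<xi>
   proof -
    have "fourier (\<lambda>x. rl_int \<gamma> (\<lambda>s. k s x) s) \<xi> = rl_int \<gamma> (\<lambda>s. fourier (k s) \<xi>) s"
     by (rule fourier_rl_int[OF \<gamma>(1) \<gamma>(3) kpair ki kN])
    also have "\<dots> = rl_int \<gamma> (ml_time \<alpha> (1 - \<gamma>) ((norm \<xi>)\<^sup>2)) s" by (rule rl_int_cong) (rule kF)
    also have "\<dots> = ml_time \<alpha> (1 - \<gamma> + \<gamma>) ((norm \<xi>)\<^sup>2) s" by (rule rl_int_ml_time[OF \<alpha>(1) \<gamma>(3) \<gamma>(1) s])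
    finally show ?thesis using fourier_fundamental_solution[OF s] by simp
   qed
  qed
  define K where "K s x = indicator {0<..} s * rl_int \<gamma> (\<lambda>s. k s x) s" for s x
  have Km [measurable]: "(\<lambda>(s, x). K s x) \<in> borel_measurable (lborel \<Otimes>\<^sub>M lborel)"
   unfolding K_def rl_int_def by measurable
  \<comment> \<open>For each time the identity holds off a null set of x that depends on the time.
    Exchanging the two quantifiers allows x to be fixed.\<close>
  have "AE s in lborel. AE x in lborel. Q s x = K s x"
  proof (rule AE_I2)
   fix s show "AE x in lborel. Q s x = K s x"
   proof (cases "0 < s")
    case True
    then show ?thesis using PK[OF True] by (auto simp: Q_def K_def)
   qed (simp add: Q_def K_def)
  qed
  moreover have "{z \<in> space (lborel \<Otimes>\<^sub>M lborel). Q (fst z) (snd z) = K (fst z) (snd z)} \<in> sets (lborel \<Otimes>\<^sub>M lborel)"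
  proof -
   have [measurable]: "(\<lambda>z. K (fst z) (snd z)) \<in> borel_measurable (lborel \<Otimes>\<^sub>M lborel)" using Km by (simp add: split_beta')
   show ?thesis by measurable
  qed
  ultimately have ae1: "AE x in lborel. AE s in lborel. Q s x = K s x"
   using lborel_pair.AE_commute[of "\<lambda>s x. Q s x = K s x"] by simp
  \<comment> \<open>Integer horizons suffice: the integrand for horizon r is dominated by the one
    for any integer n >= r.\<close>
  have ae2: "AE x in lborel. \<forall>n::nat. L1 (\<lambda>s. of_real (rl_kernel 1 (real n - s)) * (indicator {0<..} s * k s x))"
   unfolding AE_all_countable by (intro allI AE_integrable_rl_int_param[OF zero_less_one \<gamma>(3) kpair ki kN])
  \<comment> \<open>The point x = 0 is discarded because the profile is known to be continuous off 0
    only.\<close>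
  have "AE x in lborel. k t x = q_kernel P \<alpha> \<beta> t x"
   using ae1 ae2 AE_lborel_singleton[of 0]
  proof eventually_elim
   case (elim x)
   have km: "(\<lambda>s. indicator {0<..} s * k s x) \<in> Borel" by measurable
   have i: "L1 (\<lambda>s. of_real (rl_kernel 1 (r - s)) * (indicator {0<..} s * k s x))" for r
   proof -
    obtain n where n: "r \<le> real n" using real_arch_simple by blast
    show ?thesis
    proof (rule lebesgue_integrable_bound[OF elim(2)[THEN spec, of n]])
     show "AE s in lborel. norm (complex_of_real (rl_kernel 1 (r - s)) * (indicator {0<..} s * k s x)) \<le>
       norm (complex_of_real (rl_kernel 1 (real n - s)) * (indicator {0<..} s * k s x))"
      using n by (intro AE_I2) (auto simp: rl_kernel_1 norm_mult)
    qed (use km in measurable)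
   qed
   have kc: "continuous_on {0<..} (\<lambda>s. k s x)"
   proof -
    have "continuous_on {0<..} (\<lambda>s. \<kappa> (c s *\<^sub>R x))"
    proof (rule continuous_on_compose2[OF \<kappa>(2)])
     show "continuous_on {0<..} (\<lambda>s. c s *\<^sub>R x)" unfolding c_def by (intro continuous_intros) auto
     show "(\<lambda>s. c s *\<^sub>R x) ` {0<..} \<subseteq> - {0}" using c elim(3) by force
    qed
    moreover have "continuous_on {0<..} (\<lambda>s. complex_of_real (s powr (- \<gamma>) * c s ^ DIM('a)))"
     unfolding c_def by (intro continuous_intros) auto
    ultimately show ?thesis unfolding k_def by (rule continuous_on_mult[rotated])
   qed
   have eq: "rl_int (1 - \<gamma>) (\<lambda>s. P s x) r = rl_int 1 (\<lambda>s. k s x) r" for r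
   proof -
    have "rl_int (1 - \<gamma>) (\<lambda>s. P s x) r = rl_int (1 - \<gamma>) (rl_int \<gamma> (\<lambda>s. k s x)) r"
     unfolding rl_int_def[of "1 - \<gamma>"]
    proof (rule integral_cong_AE)
     have K1: "(\<lambda>s. K s x) \<in> Borel" unfolding K_def rl_int_def by measurable
     then show "(\<lambda>s. complex_of_real (rl_kernel (1 - \<gamma>) (r - s)) * (indicator {0<..} s * rl_int \<gamma> (\<lambda>s. k s x) s)) \<in> borel_measurable lborel"
      unfolding K_def by measurable
     show "(\<lambda>s. complex_of_real (rl_kernel (1 - \<gamma>) (r - s)) * (indicator {0<..} s * P s x)) \<in> borel_measurable lborel"
      unfolding Q_def[symmetric] by measurable
     show "AE s in lborel. complex_of_real (rl_kernel (1 - \<gamma>) (r - s)) * (indicator {0<..} s * P s x) =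
       complex_of_real (rl_kernel (1 - \<gamma>) (r - s)) * (indicator {0<..} s * rl_int \<gamma> (\<lambda>s. k s x) s)"
      using elim(1) by eventually_elim (simp add: Q_def K_def)
    qed
    also have "\<dots> = rl_int (1 - \<gamma> + \<gamma>) (\<lambda>s. k s x) r"
     by (rule rl_int_rl_int[OF \<gamma>(3) \<gamma>(1) km]) (use i in simp)
    finally show ?thesis by simp
   qed
   have R: "RL_integral (1 - \<gamma>) (\<lambda>s. P s x) = rl_int 1 (\<lambda>s. k s x)"
    using RL_integral_eq_rl_int[OF Q_section_measurable \<gamma>(3)] eq by (simp add: fun_eq_iff)
   have "\<lceil>\<gamma>\<rceil> = 1" using \<gamma> by (simp add: ceiling_eq_iff)
   then have n: "nat \<lceil>\<gamma>\<rceil> = 1" by simp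
   have "(rl_int 1 (\<lambda>s. k s x) has_vector_derivative k t x) (at t)"
    by (rule rl_int_1_has_vector_derivative[OF i kc t])
   moreover have "at t within {0..} = at t" by (rule at_within_interior) (use t in simp)
   ultimately have "time_deriv (rl_int 1 (\<lambda>s. k s x)) t = k t x"
    by (simp add: time_deriv_def vector_derivative_at)
   moreover have "q_kernel P \<alpha> \<beta> t x = time_deriv (rl_int 1 (\<lambda>s. k s x)) t"
    using 3 by (simp add: q_kernel_def RL_deriv_def \<gamma>_def[symmetric] n R)
   ultimately show ?case by simp
  qed
  then have "fourier (q_kernel P \<alpha> \<beta> t) \<xi> = fourier (k t) \<xi>"
   using ki[OF t] by (intro fourier_cong_AE) auto
  also have "\<dots> = ml_time \<alpha> (1 + \<alpha> - \<beta>) ((norm \<xi>)\<^sup>2) t"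
   unfolding kF[OF t] by (simp add: \<gamma>_def algebra_simps)
  finally show ?thesis .
 qed
qed

end

section \<open>Littlewood--Paley decomposition\<close>

lemma smooth_imp_continuous:
 assumes "smooth f"
 shows "continuous_on UNIV f"
proof -
 have "f differentiable (at x)" for x
  using assms unfolding smooth_def times_differentiable_def by (metis empty_set empty_subsetI length_0_conv less_one partials.simps(1))
 then show ?thesis by (intro continuous_at_imp_continuous_on ballI differentiable_imp_continuous_within) auto
qed

text \<open>Decay of order 2 d, with d the dimension, beats the product of 1 / (1 + x_b^2) over the
  coordinates, and that product is integrable by
  \<open>integrable_lborel_prod_Basis\<close>.\<close>

lemma schwartz_integrable:
 fixes f :: "'a::euclidean_space \<Rightarrow> complex"
 assumes "schwartz f"
 shows "L1 f"
proof -
 define d where "d = DIM('a)"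
 have "smooth f" and "\<exists>B. \<forall>x. (1 + norm x) ^ (2 * d) * norm (partials [] f x) \<le> B"
  using assms unfolding schwartz_def by (blast, metis empty_set empty_subsetI)
 then obtain B where B: "\<And>x. (1 + norm x) ^ (2 * d) * norm (f x) \<le> B" by auto
 have fm: "f \<in> Borel"
  by (rule borel_measurable_continuous_onI[OF smooth_imp_continuous[OF \<open>smooth f\<close>]])
 have "L1 (\<lambda>t::real. complex_of_real (inverse (1 + t\<^sup>2)))"
 proof -
  have "L1 (\<lambda>t::real. inverse (1 + t\<^sup>2))"
   using integrable_inverse_1_plus_square by (simp add: set_integrable_def einterval_def)
  then show ?thesis by (simp only: complex_of_real_integrable_eq)
 qed
 from integrable_lborel_prod_Basis[where 'a = 'a, OF this]
 have "L1 (\<lambda>x::'a. complex_of_real (\<Prod>b\<in>Basis. inverse (1 + (x \<bullet> b)\<^sup>2)))" by simp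
 then have i: "L1 (\<lambda>x::'a. \<Prod>b\<in>Basis. inverse (1 + (x \<bullet> b)\<^sup>2))"
  by (simp only: complex_of_real_integrable_eq)
 show ?thesis
 proof (rule lebesgue_integrable_bound[OF integrable_mult_right[OF i, of B]])
  show "f \<in> borel_measurable lborel" using fm by simp
  show "AE x in lborel. norm (f x) \<le> norm (B * (\<Prod>b\<in>Basis. inverse (1 + (x \<bullet> b)\<^sup>2)))"
  proof (rule AE_I2)
   fix x :: 'a
   have "(\<Prod>b\<in>(Basis :: 'a set). 1 + (x \<bullet> b)\<^sup>2) \<le> (\<Prod>b\<in>(Basis :: 'a set). (1 + norm x)\<^sup>2)"
   proof (rule prod_mono, rule conjI)
    fix b :: 'a assume "b \<in> Basis"
    then have "\<bar>x \<bullet> b\<bar> \<le> norm x" by (rule Basis_le_norm)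
    then have "(x \<bullet> b)\<^sup>2 \<le> (norm x)\<^sup>2" by (simp add: abs_le_square_iff[symmetric])
    then show "1 + (x \<bullet> b)\<^sup>2 \<le> (1 + norm x)\<^sup>2"
     using norm_ge_zero[of x] unfolding power2_sum one_power2 by linarith
   qed simp
   also have "\<dots> = (1 + norm x) ^ (2 * d)" by (simp add: d_def power_mult)
   finally have le: "(\<Prod>b\<in>(Basis :: 'a set). 1 + (x \<bullet> b)\<^sup>2) \<le> (1 + norm x) ^ (2 * d)" .
   have pos: "0 < (\<Prod>b\<in>(Basis :: 'a set). 1 + (x \<bullet> b)\<^sup>2)" by (intro prod_pos) (simp add: add_pos_nonneg)
   have "(\<Prod>b\<in>(Basis :: 'a set). 1 + (x \<bullet> b)\<^sup>2) * norm (f x) \<le> B"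
    using mult_right_mono[OF le, of "norm (f x)"] B[of x] by simp
   then have "norm (f x) \<le> B * inverse (\<Prod>b\<in>(Basis :: 'a set). 1 + (x \<bullet> b)\<^sup>2)"
    using pos by (simp add: field_simps)
   also have "\<dots> = B * (\<Prod>b\<in>(Basis :: 'a set). inverse (1 + (x \<bullet> b)\<^sup>2))"
    by (simp add: prod_inversef[symmetric] o_def)
   also have "\<dots> \<le> norm \<dots>" by simp
   finally show "norm (f x) \<le> norm (B * (\<Prod>b\<in>Basis. inverse (1 + (x \<bullet> b)\<^sup>2)))" .
  qed
 qed
qed

locale littlewood_paley_function =
 fixes \<Psi> :: "'a::euclidean_space \<Rightarrow> complex"
 assumes lp: "littlewood_paley \<Psi>"
begin

lemma \<Psi>_integrable: "L1 \<Psi>"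
 using lp unfolding littlewood_paley_def by (intro schwartz_integrable) blast

lemma fourier_\<Psi>_eq_0: "norm \<xi> < 1/2 \<or> 2 < norm \<xi> \<Longrightarrow> fourier \<Psi> \<xi> = 0"
 using lp unfolding littlewood_paley_def by (meson linorder_not_less)

lemma fourier_\<Psi>_summable: "summable (\<lambda>k. fourier \<Psi> (\<xi> /\<^sub>R 2 ^ Suc k))"
proof -
 obtain n where "2 * norm \<xi> < 2 ^ n" using real_arch_pow[of 2 "2 * norm \<xi>"] by auto
 then have "norm (\<xi> /\<^sub>R 2 ^ Suc k) < 1/2" if "n \<le> k" for k
 proof -
  have "(2::real) ^ n \<le> 2 ^ Suc k" using that by (intro power_increasing) auto
  then have "2 * norm \<xi> < 2 ^ Suc k" using \<open>2 * norm \<xi> < 2 ^ n\<close> by linarith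
  then show ?thesis by (simp add: field_simps)
 qed
 then show ?thesis by (intro summable_finite[of "{..<n}"]) (auto intro!: fourier_\<Psi>_eq_0 simp: not_less)
qed

lemma dyadic_symbol_double:
 "dyadic_symbol \<Psi> 0 (\<xi> /\<^sub>R 2) = dyadic_symbol \<Psi> 0 \<xi> + fourier \<Psi> (\<xi> /\<^sub>R 2)"
 using suminf_split_head[OF fourier_\<Psi>_summable[of \<xi>]]
 by (simp add: dyadic_symbol_def algebra_simps)

text \<open>Telescoping by \<open>dyadic_symbol_double\<close>. The partial sums are thus dilates of
  one bounded continuous function, which gives both their uniform bound and their limit 1.\<close>

lemma sum_dyadic_symbol: "(\<Sum>j<Suc n. dyadic_symbol \<Psi> j \<xi>) = dyadic_symbol \<Psi> 0 (\<xi> /\<^sub>R 2 ^ n)"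
proof (induction n)
 case (Suc n)
 have "dyadic_symbol \<Psi> 0 (\<xi> /\<^sub>R 2 ^ Suc n) = dyadic_symbol \<Psi> 0 (\<xi> /\<^sub>R 2 ^ n /\<^sub>R 2)" by (simp add: mult.commute)
 also have "\<dots> = dyadic_symbol \<Psi> 0 (\<xi> /\<^sub>R 2 ^ n) + fourier \<Psi> (\<xi> /\<^sub>R 2 ^ n /\<^sub>R 2)" by (rule dyadic_symbol_double)
 also have "fourier \<Psi> (\<xi> /\<^sub>R 2 ^ n /\<^sub>R 2) = dyadic_symbol \<Psi> (Suc n) \<xi>" by (simp add: dyadic_symbol_def mult.commute)
 finally show ?case using Suc by simp
qed simp

text \<open>Beyond |\<xi>| = 2 the terms of the partition of unity with j <= 0 vanish, so those with
  j >= 1 already sum to 1.\<close>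

lemma dyadic_symbol_0_eq_0:
 assumes "2 < norm \<xi>"
 shows "dyadic_symbol \<Psi> 0 \<xi> = 0"
proof -
 let ?f = "\<lambda>j::int. fourier \<Psi> ((2 powi (- j)) *\<^sub>R \<xi>)"
 have nz: "\<xi> \<noteq> 0" using assms by auto
 then have s: "(?f has_sum 1) UNIV" using lp by (simp add: littlewood_paley_def)
 have "?f j = 0" if "j \<le> 0" for j
 proof (rule fourier_\<Psi>_eq_0)
  have "(2::real) powi (- j) = 2 ^ nat (- j)" using that by (simp add: power_int_def)
  moreover have "(1::real) \<le> 2 ^ nat (- j)" by simp
  ultimately have "norm \<xi> \<le> norm ((2 powi (- j)) *\<^sub>R \<xi>)" using mult_right_mono[of 1 "2 ^ nat (- j)" "norm \<xi>"] by simp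
  then show "norm ((2 powi (- j)) *\<^sub>R \<xi>) < 1/2 \<or> 2 < norm ((2 powi (- j)) *\<^sub>R \<xi>)" using assms by simp
 qed
 then have "(?f has_sum 1) UNIV \<longleftrightarrow> (?f has_sum 1) {1..}"
  by (intro has_sum_cong_neutral) auto
 with s have "(?f has_sum 1) {1..}" by blast
 moreover have "{1..} = range (\<lambda>k. int (Suc k))"
 proof -
  have "j \<in> range (\<lambda>k. int (Suc k))" if "1 \<le> j" for j
   by (rule image_eqI[of _ _ "nat (j - 1)"]) (use that in auto)
  then show ?thesis by auto
 qed
 moreover have "inj (\<lambda>k. int (Suc k))" by (auto simp: inj_def)
 ultimately have "((?f \<circ> (\<lambda>k. int (Suc k))) has_sum 1) UNIV" by (simp add: has_sum_reindex)
 then have "(\<lambda>k. ?f (int (Suc k))) sums 1" using has_sum_imp_sums by (auto simp: o_def)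
 moreover have "?f (int (Suc k)) = fourier \<Psi> (\<xi> /\<^sub>R 2 ^ Suc k)" for k
 proof -
  have "(2::real) powi (- int (Suc k)) = inverse (2 ^ Suc k)" by (simp only: power_int_minus power_int_of_nat)
  then show ?thesis by (simp only:)
 qed
 ultimately show ?thesis by (simp add: dyadic_symbol_def sums_iff del: power_Suc)
qed

text \<open>Where |\<xi>|^2 < 5, at most two terms of the series survive. The cutoff changes nothing
  because the symbol vanishes for |\<xi>| > 2, and it turns the constant 1 into the transform of an
  integrable function.\<close>

lemma dyadic_symbol_0_eq:
 "dyadic_symbol \<Psi> 0 \<xi> = (1 + (- 1) * fourier \<Psi> ((1/2) *\<^sub>R \<xi>) + (- 1) * fourier \<Psi> ((1/4) *\<^sub>R \<xi>)) * ball_cutoff ((norm \<xi>)\<^sup>2)"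
proof (cases "5 \<le> (norm \<xi>)\<^sup>2")
 case True
 have "2 < norm \<xi>"
 proof (rule ccontr)
  assume "\<not> 2 < norm \<xi>"
  then have "(norm \<xi>)\<^sup>2 \<le> 2\<^sup>2" by (intro power_mono) auto
  then show False using True by simp
 qed
 then show ?thesis using True by (simp add: dyadic_symbol_0_eq_0 ball_cutoff_eq)
next
 case False
 have n3: "norm \<xi> < 3"
 proof (rule ccontr)
  assume "\<not> norm \<xi> < 3"
  then have "3\<^sup>2 \<le> (norm \<xi>)\<^sup>2" by (intro power_mono) auto
  then show False using False by simp
 qed
 have z: "fourier \<Psi> (\<xi> /\<^sub>R 2 ^ Suc k) = 0" if "k \<notin> {0, 1}" for k
 proof (rule fourier_\<Psi>_eq_0, rule disjI1)
  have "2 \<le> k" using that by auto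
  then have "(2::real) ^ 3 \<le> 2 ^ Suc k" by (intro power_increasing) auto
  then have "2 * norm \<xi> < 2 ^ Suc k" using n3 by simp
  then show "norm (\<xi> /\<^sub>R 2 ^ Suc k) < 1/2" by (simp add: field_simps)
 qed
 have "(\<Sum>k. fourier \<Psi> (\<xi> /\<^sub>R 2 ^ Suc k)) = (\<Sum>k\<in>{0,1}. fourier \<Psi> (\<xi> /\<^sub>R 2 ^ Suc k))"
  by (rule suminf_finite) (use z in auto)
 then have e: "dyadic_symbol \<Psi> 0 \<xi> = 1 + (- 1) * fourier \<Psi> ((1/2) *\<^sub>R \<xi>) + (- 1) * fourier \<Psi> ((1/4) *\<^sub>R \<xi>)"
  by (simp add: dyadic_symbol_def inverse_eq_divide)
 show ?thesis
 proof (cases "2 < norm \<xi>")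
  case True
  then show ?thesis using e dyadic_symbol_0_eq_0[OF True] by simp
 next
  case False
  then have "(norm \<xi>)\<^sup>2 \<le> 2\<^sup>2" by (intro power_mono) auto
  then show ?thesis using e by (simp add: ball_cutoff_eq)
 qed
qed

lemma dyadic_symbol_multiplier: "\<exists>B. L1_multiplier B (dyadic_symbol \<Psi> j)"
proof -
 let ?N = "LINT x|lborel. norm (\<Psi> x)"
 have \<Psi>: "L1_multiplier ?N (fourier \<Psi>)" using \<Psi>_integrable by (intro L1_multiplierI) auto
 show ?thesis
 proof (cases "j = 0")
  case True
  obtain B where B: "L1_multiplier B (\<lambda>\<xi>::'a. ball_cutoff ((norm \<xi>)\<^sup>2))"
   using radial_multiplier[OF elementary_smooth_cutoffs(1) ball_cutoff_eq(2)] by blast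
  have D: "L1_multiplier ?N (\<lambda>\<xi>. fourier \<Psi> (c *\<^sub>R \<xi>))" if "0 < c" for c
   by (rule L1_multiplier_dilate[OF \<Psi> that])
  have "L1_multiplier (B + (norm (- 1 :: complex) * ?N) * B + (norm (- 1 :: complex) * ?N) * B)
   (\<lambda>\<xi>. ball_cutoff ((norm \<xi>)\<^sup>2) + ((- 1) * fourier \<Psi> ((1/2) *\<^sub>R \<xi>)) * ball_cutoff ((norm \<xi>)\<^sup>2) +
    ((- 1) * fourier \<Psi> ((1/4) *\<^sub>R \<xi>)) * ball_cutoff ((norm \<xi>)\<^sup>2))"
   by (intro L1_multiplier_add L1_multiplier_mult[OF L1_multiplier_cmult[OF D] B] B) auto
  also have "(\<lambda>\<xi>. ball_cutoff ((norm \<xi>)\<^sup>2) + ((- 1) * fourier \<Psi> ((1/2) *\<^sub>R \<xi>)) * ball_cutoff ((norm \<xi>)\<^sup>2) +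
    ((- 1) * fourier \<Psi> ((1/4) *\<^sub>R \<xi>)) * ball_cutoff ((norm \<xi>)\<^sup>2)) = dyadic_symbol \<Psi> j"
   unfolding True by (rule ext) (simp only: dyadic_symbol_0_eq distrib_right mult_1_left)
  finally show ?thesis by blast
 next
  case False
  then have "dyadic_symbol \<Psi> j = (\<lambda>\<xi>. fourier \<Psi> (inverse (2 ^ j) *\<^sub>R \<xi>))" by (simp add: dyadic_symbol_def fun_eq_iff)
  then show ?thesis using L1_multiplier_dilate[OF \<Psi>, of "inverse (2 ^ j)"] by auto
 qed
qed

lemma dyadic_symbol_support:
 assumes "dyadic_symbol \<Psi> j \<xi> \<noteq> 0"
 shows "norm \<xi> \<le> 2 * 2 ^ j" "0 < j \<Longrightarrow> 2 ^ j / 2 \<le> norm \<xi>"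
proof -
 have "norm \<xi> \<le> 2 * 2 ^ j \<and> (0 < j \<longrightarrow> 2 ^ j / 2 \<le> norm \<xi>)"
 proof (cases "j = 0")
  case True
  then show ?thesis using assms dyadic_symbol_0_eq_0[of \<xi>] by (cases "2 < norm \<xi>") auto
 next
  case False
  then have "fourier \<Psi> (\<xi> /\<^sub>R 2 ^ j) \<noteq> 0" using assms by (simp add: dyadic_symbol_def)
  then have "1/2 \<le> norm (\<xi> /\<^sub>R 2 ^ j)" "norm (\<xi> /\<^sub>R 2 ^ j) \<le> 2" using fourier_\<Psi>_eq_0[of "\<xi> /\<^sub>R 2 ^ j"] by linarith+
  then show ?thesis by (auto simp: field_simps)
 qed
 then show "norm \<xi> \<le> 2 * 2 ^ j" "0 < j \<Longrightarrow> 2 ^ j / 2 \<le> norm \<xi>" by auto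
qed

lemma dyadic_symbol_continuous: "continuous_on UNIV (dyadic_symbol \<Psi> j)"
proof -
 obtain B where "L1_multiplier B (dyadic_symbol \<Psi> j)" using dyadic_symbol_multiplier by blast
 then obtain f where f: "L1 f" "\<And>\<xi>. fourier f \<xi> = dyadic_symbol \<Psi> j \<xi>" by (rule L1_multiplierE) blast
 have "fourier f = dyadic_symbol \<Psi> j" using f(2) by (rule ext)
 then show ?thesis using continuous_on_fourier[OF f(1)] by simp
qed

lemma dyadic_symbol_measurable [measurable]: "dyadic_symbol \<Psi> j \<in> Borel"
 by (rule borel_measurable_continuous_onI[OF dyadic_symbol_continuous])

lemma dyadic_symbol_integrable: "L1 (dyadic_symbol \<Psi> j)"
 by (rule integrable_continuous_compact_support[OF dyadic_symbol_continuous, of "cball 0 (2 * 2 ^ j)"])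
  (use dyadic_symbol_support(1)[of j] in \<open>auto simp flip: not_le\<close>)

lemma dyadic_symbol_bounded: "\<exists>B. \<forall>\<xi>. norm (dyadic_symbol \<Psi> j \<xi>) \<le> B"
proof -
 obtain B where "L1_multiplier B (dyadic_symbol \<Psi> j)" using dyadic_symbol_multiplier by blast
 then obtain f where f: "L1 f" "\<And>\<xi>. fourier f \<xi> = dyadic_symbol \<Psi> j \<xi>" by (rule L1_multiplierE) blast
 show ?thesis using norm_fourier_le[OF f(1)] unfolding f(2) by blast
qed

lemma dyadic_symbol_0_0: "dyadic_symbol \<Psi> 0 0 = 1"
 using fourier_\<Psi>_eq_0[of 0] by (simp add: dyadic_symbol_def)

lemma dyadic_symbol_sums: "(\<lambda>j. dyadic_symbol \<Psi> j \<xi>) sums 1"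
proof -
 have lim: "(\<lambda>n. \<xi> /\<^sub>R 2 ^ n) \<longlonglongrightarrow> 0"
 proof -
  have "(\<lambda>n. inverse ((2::real) ^ n)) \<longlonglongrightarrow> 0" by (intro LIMSEQ_inverse_realpow_zero) auto
  from tendsto_scaleR[OF this tendsto_const[of \<xi>]] show ?thesis by simp
 qed
 have "(\<lambda>n. dyadic_symbol \<Psi> 0 (\<xi> /\<^sub>R 2 ^ n)) \<longlonglongrightarrow> 1"
  using continuous_on_tendsto_compose[OF dyadic_symbol_continuous[of 0] lim] by (simp add: dyadic_symbol_0_0)
 then have "(\<lambda>n. \<Sum>j<Suc n. dyadic_symbol \<Psi> j \<xi>) \<longlonglongrightarrow> 1" by (simp only: sum_dyadic_symbol)
 then show ?thesis unfolding sums_def by (rule LIMSEQ_imp_Suc)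
qed

lemma dyadic_symbol_partial_sums_bounded: "\<exists>B. \<forall>n \<xi>. norm (\<Sum>j<n. dyadic_symbol \<Psi> j \<xi>) \<le> B"
proof -
 obtain B where B: "\<And>\<xi>. norm (dyadic_symbol \<Psi> 0 \<xi>) \<le> B" using dyadic_symbol_bounded by blast
 have "norm (\<Sum>j<n. dyadic_symbol \<Psi> j \<xi>) \<le> B" for n \<xi>
 proof (cases n)
  case 0
  then show ?thesis using order_trans[OF norm_ge_zero B] by simp
 qed (simp only: sum_dyadic_symbol B)
 then show ?thesis by blast
qed

text \<open>The inverse transform of the symbol is, almost everywhere, the integrable function
  behind \<open>dyadic_symbol_multiplier\<close>; the blocks of the Besov norm are therefore genuine
  convolutions.\<close>

lemma
 shows dyadic_kernel_integrable: "L1 (inv_fourier (dyadic_symbol \<Psi> j))"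
  and fourier_dyadic_kernel: "fourier (inv_fourier (dyadic_symbol \<Psi> j)) \<xi> = dyadic_symbol \<Psi> j \<xi>"
proof -
 obtain B where "L1_multiplier B (dyadic_symbol \<Psi> j)" using dyadic_symbol_multiplier by blast
 then obtain f where f: "L1 f" "\<And>\<xi>. fourier f \<xi> = dyadic_symbol \<Psi> j \<xi>" by (rule L1_multiplierE) blast
 have ff: "fourier f = dyadic_symbol \<Psi> j" using f(2) by (rule ext)
 have ae: "AE x in lborel. inv_fourier (dyadic_symbol \<Psi> j) x = f x"
  using fourier_inversion_AE[OF f(1)] dyadic_symbol_integrable unfolding ff by blast
 have m: "inv_fourier (dyadic_symbol \<Psi> j) \<in> Borel"
  by (intro borel_measurable_continuous_onI continuous_on_inv_fourier dyadic_symbol_integrable)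
 show "L1 (inv_fourier (dyadic_symbol \<Psi> j))"
  by (rule integrable_cong_AE_imp[OF f(1)]) (use m ae in \<open>auto elim: eventually_mono\<close>)
 show "fourier (inv_fourier (dyadic_symbol \<Psi> j)) \<xi> = dyadic_symbol \<Psi> j \<xi>"
  using fourier_cong_AE[OF m ae, of \<xi>] f(2)[of \<xi>] by simp
qed

lemma
 assumes "L1 \<phi>"
 shows dyadic_block_integrable: "L1 (dyadic_block \<Psi> j \<phi>)"
  and fourier_dyadic_block: "fourier (dyadic_block \<Psi> j \<phi>) \<xi> = dyadic_symbol \<Psi> j \<xi> * fourier \<phi> \<xi>"
 unfolding dyadic_block_def
 using integrable_conv[OF dyadic_kernel_integrable assms] fourier_conv[OF dyadic_kernel_integrable assms]
 by (auto simp: fourier_dyadic_kernel)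

end

section \<open>Bounds for the dyadic pieces of the symbol\<close>

lemma mittag_leffler_multiplier:
 assumes "0 < a" "a < 2"
 shows "\<exists>B. \<forall>u>0. L1_multiplier B (\<lambda>\<xi>::'a::euclidean_space. of_real (mittag_leffler a b (- ((norm \<xi>)\<^sup>2 * u powr a))))"
proof -
 obtain f :: "'a \<Rightarrow> complex" where f: "L1 f"
   "\<And>\<xi>. fourier f \<xi> = of_real (mittag_leffler a b (- ((norm \<xi>)\<^sup>2)))"
  using mittag_leffler_kernel[OF assms] by blast
 have m: "L1_multiplier (L1_norm f) (\<lambda>\<xi>::'a. of_real (mittag_leffler a b (- ((norm \<xi>)\<^sup>2))))"
  by (rule L1_multiplierI[OF f(1) order_refl f(2)])
 have "L1_multiplier (L1_norm f) (\<lambda>\<xi>::'a. of_real (mittag_leffler a b (- ((norm \<xi>)\<^sup>2 * u powr a))))"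
  if u: "0 < u" for u
 proof -
  have "(norm ((u powr (a / 2)) *\<^sub>R \<xi>))\<^sup>2 = (norm \<xi>)\<^sup>2 * u powr a" for \<xi> :: 'a
   by (simp add: power_mult_distrib power2_eq_square powr_add[symmetric])
  then show ?thesis using L1_multiplier_dilate[OF m, of "u powr (a / 2)"] u by simp
 qed
 then show ?thesis by blast
qed

lemma powr_real_of_nat_mult: "2 powr (c * real j) = (2 ^ j) powr c"
 by (simp add: powr_realpow[symmetric] powr_powr mult.commute)

text \<open>Put y = u^\<alpha> 4^j. For y <= 1 boundedness of the Mittag-Leffler symbol is enough.
  For y > 1 \<open>mittag_leffler_shift\<close> allows division by |\<xi>|^2 u^\<alpha>, which on
  the annulus is comparable to y and produces the factor 1/y. On the ball j = 0 division by
  |\<xi>|^2 is impossible; there y <= T^\<alpha>, so the minimum is bounded below.\<close>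

lemma symbol_multiplier:
 assumes \<alpha>: "0 < \<alpha>" "\<alpha> < 2" and T: "0 < T" and a: "0 \<le> c1 + \<epsilon>"
 shows "\<exists>D>0. \<forall>u\<in>{0<..T}. \<forall>j. \<exists>m. L1_multiplier (2 powr (\<epsilon> * real j) *
   (D * (u powr (\<alpha> - \<beta>) * (2 powr (c1 * real j) * min 1 (1 / (u powr \<alpha> * 4 ^ j)))))) m \<and>
  (\<forall>\<xi>::'a::euclidean_space. \<xi> \<noteq> 0 \<longrightarrow> norm \<xi> \<le> 2 * 2 ^ j \<longrightarrow> (0 < j \<longrightarrow> 2 ^ j / 2 \<le> norm \<xi>) \<longrightarrow>
   m \<xi> = of_real (norm \<xi> powr (c1 + \<epsilon>)) * ml_time \<alpha> (1 + \<alpha> - \<beta>) ((norm \<xi>)\<^sup>2) u)"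
proof -
 define a where "a = c1 + \<epsilon>"
 define b where "b = 1 + \<alpha> - \<beta>"
 obtain M0 where M0: "\<And>u. 0 < u \<Longrightarrow> L1_multiplier M0 (\<lambda>\<xi>::'a. of_real (mittag_leffler \<alpha> b (- ((norm \<xi>)\<^sup>2 * u powr \<alpha>))))"
  using mittag_leffler_multiplier[OF \<alpha>, of b] by blast
 obtain M1 where M1: "\<And>u. 0 < u \<Longrightarrow> L1_multiplier M1 (\<lambda>\<xi>::'a. of_real (mittag_leffler \<alpha> (b - \<alpha>) (- ((norm \<xi>)\<^sup>2 * u powr \<alpha>))))"
  using mittag_leffler_multiplier[OF \<alpha>, of "b - \<alpha>"] by blast
 define ann where "ann s \<xi> = of_real ((norm \<xi>)\<^sup>2 powr s) * annulus_cutoff ((norm \<xi>)\<^sup>2)" for s and \<xi> :: 'a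
 obtain A1 where A1: "L1_multiplier A1 (ann (a / 2))" using annulus_power_multiplier[of "a / 2"] unfolding ann_def by blast
 obtain A2 where A2: "L1_multiplier A2 (ann (a / 2 - 1))" using annulus_power_multiplier[of "a / 2 - 1"] unfolding ann_def by blast
 obtain A3 m3 where A3: "L1_multiplier A3 m3" "\<And>\<xi>::'a. \<xi> \<noteq> 0 \<Longrightarrow> m3 \<xi> = of_real (norm \<xi> powr a) * ball_cutoff ((norm \<xi>)\<^sup>2)"
  using ball_power_multiplier[OF assms(4)] unfolding a_def by blast
 define G where "G = complex_of_real (rGamma (b - \<alpha>))"
 define H where "H = norm G * A2 + norm (- 1 :: complex) * (A2 * M1)"
 \<comment> \<open>For j = 0 one has y <= S, so \<open>S * min 1 (1 / y)\<close> is at least 1. This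
   is where the constant depends on T.\<close>
 define S where "S = max 1 (T powr \<alpha>)"
 \<comment> \<open>Dominates the constants of the three cases; the summand 1 ensures
   positivity.\<close>
 define D where "D = 1 + A1 * M0 + H + A3 * M0 * S"
 note nn = L1_multiplier_nonneg[OF A1] L1_multiplier_nonneg[OF A2] L1_multiplier_nonneg[OF A3(1)]
  L1_multiplier_nonneg[OF M0[OF zero_less_one]] L1_multiplier_nonneg[OF M1[OF zero_less_one]]
 have S: "1 \<le> S" by (simp add: S_def)
 have nn1: "0 \<le> A1 * M0" "0 \<le> H" "0 \<le> A3 * M0 * S" using nn S by (auto simp: H_def intro!: mult_nonneg_nonneg add_nonneg_nonneg)
 then have D: "0 < D" "A1 * M0 \<le> D" "H \<le> D" "A3 * M0 * S \<le> D" by (auto simp: D_def)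
 have main: "\<exists>m. L1_multiplier (2 powr (\<epsilon> * real j) *
   (D * (u powr (\<alpha> - \<beta>) * (2 powr (c1 * real j) * min 1 (1 / (u powr \<alpha> * 4 ^ j)))))) m \<and>
  (\<forall>\<xi>::'a. \<xi> \<noteq> 0 \<longrightarrow> norm \<xi> \<le> 2 * 2 ^ j \<longrightarrow> (0 < j \<longrightarrow> 2 ^ j / 2 \<le> norm \<xi>) \<longrightarrow>
   m \<xi> = of_real (norm \<xi> powr a) * ml_time \<alpha> b ((norm \<xi>)\<^sup>2) u)" if u: "0 < u" "u \<le> T" for u j
 proof -
  define E where "E \<xi> = complex_of_real (mittag_leffler \<alpha> b (- ((norm \<xi>)\<^sup>2 * u powr \<alpha>)))" for \<xi> :: 'a
  define E' where "E' \<xi> = complex_of_real (mittag_leffler \<alpha> (b - \<alpha>) (- ((norm \<xi>)\<^sup>2 * u powr \<alpha>)))" for \<xi> :: 'a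
  have E: "L1_multiplier M0 E" and E': "L1_multiplier M1 E'" using M0[OF u(1)] M1[OF u(1)] by (simp_all add: E_def[abs_def] E'_def[abs_def])
  have tgt: "of_real (norm \<xi> powr a) * ml_time \<alpha> b ((norm \<xi>)\<^sup>2) u = of_real (u powr (\<alpha> - \<beta>)) * (of_real (norm \<xi> powr a) * E \<xi>)" for \<xi>
   by (simp add: ml_time_def E_def b_def)
  have e2: "2 powr (\<epsilon> * real j) * 2 powr (c1 * real j) = (2 ^ j) powr a"
   by (simp add: a_def powr_real_of_nat_mult powr_add)
  define y where "y = u powr \<alpha> * 4 ^ j"
  have y: "0 < y" using u by (simp add: y_def)
  have bound: "2 powr (\<epsilon> * real j) * (D * (u powr (\<alpha> - \<beta>) * (2 powr (c1 * real j) * min 1 (1 / y)))) =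
    u powr (\<alpha> - \<beta>) * (2 ^ j) powr a * (D * min 1 (1 / y))"
   unfolding e2[symmetric] by (simp only: mult_ac)
  show ?thesis
  proof (cases "j = 0")
   case True
   define m where "m \<xi> = of_real (u powr (\<alpha> - \<beta>)) * (m3 \<xi> * E \<xi>)" for \<xi>
   have "L1_multiplier (norm (complex_of_real (u powr (\<alpha> - \<beta>))) * (A3 * M0)) m"
    unfolding m_def[abs_def] by (intro L1_multiplier_cmult L1_multiplier_mult A3(1) E)
   moreover have "norm (complex_of_real (u powr (\<alpha> - \<beta>))) * (A3 * M0) \<le> u powr (\<alpha> - \<beta>) * (2 ^ j) powr a * (D * min 1 (1 / y))"
   proof -
    have "u powr \<alpha> \<le> T powr \<alpha>" using u \<alpha> by (intro powr_mono2) auto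
    then have yS: "y \<le> S" using True by (simp add: y_def S_def)
    have "1 \<le> S * min 1 (1 / y)" using yS S y by (auto simp: min_def field_simps)
    then have "A3 * M0 * 1 \<le> A3 * M0 * (S * min 1 (1 / y))" using nn by (intro mult_left_mono mult_nonneg_nonneg)
    also have "\<dots> = (A3 * M0 * S) * min 1 (1 / y)" by simp
    also have "\<dots> \<le> D * min 1 (1 / y)" using D(4) y by (intro mult_right_mono) auto
    finally have "A3 * M0 \<le> D * min 1 (1 / y)" by simp
    then show ?thesis using True by (simp add: mult_left_mono)
   qed
   ultimately have "L1_multiplier (u powr (\<alpha> - \<beta>) * (2 ^ j) powr a * (D * min 1 (1 / y))) m" by (rule L1_multiplier_mono)
   moreover have "m \<xi> = of_real (norm \<xi> powr a) * ml_time \<alpha> b ((norm \<xi>)\<^sup>2) u" if "\<xi> \<noteq> 0" "norm \<xi> \<le> 2 * 2 ^ j" for \<xi>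
   proof -
    have "(norm \<xi>)\<^sup>2 \<le> 2\<^sup>2" using that True by (intro power_mono) auto
    then show ?thesis unfolding tgt m_def A3(2)[OF that(1)] by (simp add: ball_cutoff_eq)
   qed
   ultimately show ?thesis unfolding bound[unfolded y_def] y_def by blast
  next
   case False
   define q where "q = inverse ((2::real) ^ j)"
   have q: "0 < q" by (simp add: q_def)
   have reg: "norm (q *\<^sub>R \<xi>) = norm \<xi> / 2 ^ j" "norm \<xi> = 2 ^ j * norm (q *\<^sub>R \<xi>)" for \<xi> :: 'a
    by (simp_all add: q_def divide_inverse mult.commute)
   have cut: "annulus_cutoff ((norm (q *\<^sub>R \<xi>))\<^sup>2) = 1" if "norm \<xi> \<le> 2 * 2 ^ j" "2 ^ j / 2 \<le> norm \<xi>" for \<xi> :: 'a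
   proof -
    have "1/2 \<le> norm (q *\<^sub>R \<xi>)" "norm (q *\<^sub>R \<xi>) \<le> 2" unfolding reg(1) using that by (auto simp: field_simps)
    then have "(1/2)\<^sup>2 \<le> (norm (q *\<^sub>R \<xi>))\<^sup>2" "(norm (q *\<^sub>R \<xi>))\<^sup>2 \<le> 2\<^sup>2" by (intro power_mono; simp)+
    then show ?thesis by (intro annulus_cutoff_eq) (auto simp: power2_eq_square)
   qed
   have sq: "(norm \<xi>)\<^sup>2 powr s = norm \<xi> powr (2 * s)" if "\<xi> \<noteq> 0" for s and \<xi> :: 'a
   proof -
    have "(norm \<xi>)\<^sup>2 = norm \<xi> powr 2" using that by simp
    then show ?thesis by (simp only: powr_powr)
   qed
   have np: "norm \<xi> powr s = (2 ^ j) powr s * norm (q *\<^sub>R \<xi>) powr s" for s and \<xi> :: 'a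
    unfolding reg(2)[of \<xi>] by (rule powr_mult)
   show ?thesis
   proof (cases "1 \<le> 1 / y")
    case True
    define m where "m \<xi> = of_real (u powr (\<alpha> - \<beta>) * (2 ^ j) powr a) * (ann (a / 2) (q *\<^sub>R \<xi>) * E \<xi>)" for \<xi>
    have "L1_multiplier (norm (complex_of_real (u powr (\<alpha> - \<beta>) * (2 ^ j) powr a)) * (A1 * M0)) m"
     unfolding m_def[abs_def] by (intro L1_multiplier_cmult L1_multiplier_mult L1_multiplier_dilate[OF A1] E q)
    moreover have "norm (complex_of_real (u powr (\<alpha> - \<beta>) * (2 ^ j) powr a)) * (A1 * M0) \<le> u powr (\<alpha> - \<beta>) * (2 ^ j) powr a * (D * min 1 (1 / y))"
     using True D(2) by (simp add: mult_left_mono norm_mult)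
    ultimately have "L1_multiplier (u powr (\<alpha> - \<beta>) * (2 ^ j) powr a * (D * min 1 (1 / y))) m" by (rule L1_multiplier_mono)
    moreover have "m \<xi> = of_real (norm \<xi> powr a) * ml_time \<alpha> b ((norm \<xi>)\<^sup>2) u" if "\<xi> \<noteq> 0" "norm \<xi> \<le> 2 * 2 ^ j" "2 ^ j / 2 \<le> norm \<xi>" for \<xi>
    proof -
     have "q *\<^sub>R \<xi> \<noteq> 0" using that q by simp
     then have "ann (a / 2) (q *\<^sub>R \<xi>) = of_real (norm (q *\<^sub>R \<xi>) powr a)"
      unfolding ann_def cut[OF that(2,3)] sq[OF \<open>q *\<^sub>R \<xi> \<noteq> 0\<close>] by simp
     then show ?thesis unfolding tgt unfolding m_def np[of \<xi> a] by simp
    qed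
    ultimately show ?thesis using False unfolding bound[unfolded y_def] y_def by blast
   next
    case ny: False
    \<comment> \<open>On the annulus \<open>ann (a / 2 - 1)\<close> is |.|^(a - 2): two powers are
      given up to the division, and G - E' is what \<open>mittag_leffler_shift\<close> leaves in
      exchange.\<close>
    define m where "m \<xi> = of_real (u powr (\<alpha> - \<beta>) * (2 ^ j) powr a * (1 / y)) * (G * ann (a / 2 - 1) (q *\<^sub>R \<xi>) + (- 1) * (ann (a / 2 - 1) (q *\<^sub>R \<xi>) * E' \<xi>))" for \<xi>
    have "L1_multiplier (norm (complex_of_real (u powr (\<alpha> - \<beta>) * (2 ^ j) powr a * (1 / y))) * H) m"
     unfolding m_def[abs_def] H_def by (intro L1_multiplier_cmult L1_multiplier_add L1_multiplier_mult L1_multiplier_dilate[OF A2] E' q)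
    moreover have "norm (complex_of_real (u powr (\<alpha> - \<beta>) * (2 ^ j) powr a * (1 / y))) * H \<le> u powr (\<alpha> - \<beta>) * (2 ^ j) powr a * (D * min 1 (1 / y))"
    proof -
     have "H * (1 / y) \<le> D * (1 / y)" using D(3) y by (intro mult_right_mono) auto
     then have "u powr (\<alpha> - \<beta>) * (2 ^ j) powr a * (H * (1 / y)) \<le> u powr (\<alpha> - \<beta>) * (2 ^ j) powr a * (D * min 1 (1 / y))"
      using ny by (intro mult_left_mono) auto
     moreover have "norm (complex_of_real (u powr (\<alpha> - \<beta>) * (2 ^ j) powr a * (1 / y))) = u powr (\<alpha> - \<beta>) * (2 ^ j) powr a * (1 / y)"
      unfolding norm_of_real using y by (intro abs_of_nonneg) simp
     ultimately show ?thesis by (simp only: mult.assoc mult.commute[of _ H] mult.left_commute[of _ H])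
    qed
    ultimately have "L1_multiplier (u powr (\<alpha> - \<beta>) * (2 ^ j) powr a * (D * min 1 (1 / y))) m" by (rule L1_multiplier_mono)
    moreover have "m \<xi> = of_real (norm \<xi> powr a) * ml_time \<alpha> b ((norm \<xi>)\<^sup>2) u" if "\<xi> \<noteq> 0" "norm \<xi> \<le> 2 * 2 ^ j" "2 ^ j / 2 \<le> norm \<xi>" for \<xi>
    proof -
     have qn: "q *\<^sub>R \<xi> \<noteq> 0" using that q by simp
     define n where "n = norm (q *\<^sub>R \<xi>)"
     have n: "0 < n" using qn by (simp add: n_def)
     have an: "ann (a / 2 - 1) (q *\<^sub>R \<xi>) = of_real (n powr a / n\<^sup>2)"
     proof -
      have "n powr (2 * (a / 2 - 1)) = n powr a / n\<^sup>2" using n by (simp add: right_diff_distrib powr_diff powr_numeral)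
      then show ?thesis unfolding ann_def cut[OF that(2,3)] sq[OF qn] n_def by simp
     qed
     define r where "r = (norm \<xi>)\<^sup>2 * u powr \<alpha>"
     have four: "((2::real) ^ j)\<^sup>2 = 4 ^ j" by (simp add: power2_eq_square power_mult_distrib[symmetric])
     have "r = n\<^sup>2 * y"
      unfolding r_def y_def reg(2)[of \<xi>] n_def[symmetric] by (simp add: power_mult_distrib four)
     moreover have "of_real r * E \<xi> = G - E' \<xi>"
      using mittag_leffler_shift[OF \<alpha>(1), of r b] unfolding E_def E'_def G_def r_def
      by (simp only: of_real_mult[symmetric] of_real_diff[symmetric])
     ultimately have GE: "G - E' \<xi> = of_real (n\<^sup>2 * y) * E \<xi>" by simp
     have "m \<xi> = of_real (u powr (\<alpha> - \<beta>) * (2 ^ j) powr a * (1 / y)) * (ann (a / 2 - 1) (q *\<^sub>R \<xi>) * (G - E' \<xi>))"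
      by (simp add: m_def algebra_simps)
     also have "\<dots> = of_real (u powr (\<alpha> - \<beta>) * (2 ^ j) powr a * (1 / y) * (n powr a / n\<^sup>2) * (n\<^sup>2 * y)) * E \<xi>"
      unfolding an GE by simp
     also have "u powr (\<alpha> - \<beta>) * (2 ^ j) powr a * (1 / y) * (n powr a / n\<^sup>2) * (n\<^sup>2 * y) = u powr (\<alpha> - \<beta>) * ((2 ^ j) powr a * n powr a)"
      using y n by simp
     finally show ?thesis unfolding tgt unfolding np[of \<xi> a] n_def by simp
    qed
    ultimately show ?thesis using False unfolding bound[unfolded y_def] y_def by blast
   qed
  qed
 qed
 show ?thesis using D(1) main unfolding a_def b_def by (intro exI[of _ D]) auto
qed

section \<open>Summation over the dyadic scales\<close>

text \<open>The sum is split at \<open>k\<close>; on either side the exponents are distinct, so each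
  part is at most the full geometric series.\<close>

lemma sum_power_dist_le:
 fixes \<rho> :: real
 assumes "0 \<le> \<rho>" "\<rho> < 1"
 shows "(\<Sum>j<n. \<rho> ^ nat \<bar>int j - k\<bar>) \<le> 2 / (1 - \<rho>)"
proof -
 let ?h = "\<lambda>j. nat \<bar>int j - k\<bar>"
 have le: "(\<Sum>j\<in>S. \<rho> ^ ?h j) \<le> 1 / (1 - \<rho>)" if S: "finite S" "inj_on ?h S" for S
 proof -
  have "(\<Sum>j\<in>S. \<rho> ^ ?h j) = (\<Sum>i\<in>?h ` S. \<rho> ^ i)" using sum.reindex[OF S(2), of "\<lambda>i. \<rho> ^ i"] by simp
  also have "\<dots> \<le> (\<Sum>i. \<rho> ^ i)" using assms S by (intro sum_le_suminf) auto
  finally show ?thesis using assms by (simp add: suminf_geometric)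
 qed
 have "(\<Sum>j<n. \<rho> ^ ?h j) = (\<Sum>j\<in>{j. j < n \<and> k \<le> int j} \<union> {j. j < n \<and> int j < k}. \<rho> ^ ?h j)"
  by (rule sum.cong) auto
 also have "\<dots> = (\<Sum>j\<in>{j. j < n \<and> k \<le> int j}. \<rho> ^ ?h j) + (\<Sum>j\<in>{j. j < n \<and> int j < k}. \<rho> ^ ?h j)"
  by (rule sum.union_disjoint) auto
 also have "\<dots> \<le> 1 / (1 - \<rho>) + 1 / (1 - \<rho>)"
  by (intro add_mono le) (auto simp: inj_on_def)
 finally show ?thesis by simp
qed

text \<open>The terms grow like 2^(c j) while 4^j < u^(-\<alpha>) and fall like 2^((c - 2) j)
  afterwards. For 0 < c < 2 both tails are geometric, with the common rate e = min c (2 -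
  c).\<close>

lemma dyadic_min_sum:
 assumes c: "0 < c" "c < 2"
 shows "\<exists>A>0. \<forall>u>0. \<forall>n. (\<Sum>j<n. 2 powr (c * real j) * min 1 (1 / (u powr \<alpha> * 4 ^ j))) \<le> A * u powr (- (\<alpha> * c / 2))"
proof -
 define e where "e = min c (2 - c)"
 have e: "0 < e" "e \<le> c" "e \<le> 2 - c" using c by (auto simp: e_def)
 define \<rho> where "\<rho> = 2 powr (- e)"
 have \<rho>: "0 < \<rho>" "\<rho> < 1" using e by (auto simp: \<rho>_def powr_less_one)
 define A where "A = 2 powr e * (2 / (1 - \<rho>))"
 have A: "0 < A" using \<rho> by (simp add: A_def)
 have "(\<Sum>j<n. 2 powr (c * real j) * min 1 (1 / (u powr \<alpha> * 4 ^ j))) \<le> A * u powr (- (\<alpha> * c / 2))" if u: "0 < u" for u n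
 proof -
  \<comment> \<open>The real index with u^\<alpha> 4^l = 1; rounding it down costs the factor 2^e in
    \<open>A\<close>.\<close>
  define l where "l = - (\<alpha> / 2) * log 2 u"
  have ul: "u powr x = 2 powr (log 2 u * x)" for x using u by (simp add: powr_powr[symmetric])
  have t: "2 powr (c * real j) * min 1 (1 / (u powr \<alpha> * 4 ^ j)) \<le> u powr (- (\<alpha> * c / 2)) * (2 powr e * \<rho> ^ nat \<bar>int j - \<lfloor>l\<rfloor>\<bar>)" for j
  proof -
   define z where "z = real j - l"
   have y: "1 / (u powr \<alpha> * 4 ^ j) = 2 powr (- 2 * z)"
   proof -
    have "(4::real) ^ j = 2 powr (2 * real j)" by (simp add: powr_realpow powr_powr[symmetric])
    then have "u powr \<alpha> * 4 ^ j = 2 powr (2 * z)" by (simp add: ul powr_add[symmetric] z_def l_def algebra_simps)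
    then show ?thesis by (simp add: powr_minus divide_inverse)
   qed
   have "2 powr (c * real j) = u powr (- (\<alpha> * c / 2)) * 2 powr (c * z)"
    by (simp add: ul powr_add[symmetric] z_def l_def algebra_simps)
   then have "2 powr (c * real j) * min 1 (1 / (u powr \<alpha> * 4 ^ j)) = u powr (- (\<alpha> * c / 2)) * (2 powr (c * z) * min 1 (2 powr (- 2 * z)))"
    unfolding y by simp
   also have "2 powr (c * z) * min 1 (2 powr (- 2 * z)) \<le> 2 powr (- e * \<bar>z\<bar>)"
   proof (cases "0 \<le> z")
    case True
    have "2 powr (c * z) * min 1 (2 powr (- 2 * z)) \<le> 2 powr (c * z) * 2 powr (- 2 * z)" by (intro mult_left_mono) auto
    also have "\<dots> = 2 powr ((c - 2) * z)" by (simp add: powr_add[symmetric] algebra_simps)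
    also have "\<dots> \<le> 2 powr (- e * \<bar>z\<bar>)"
     using True e mult_right_mono[of "c - 2" "- e" z] by (intro powr_mono) auto
    finally show ?thesis .
   next
    case False
    have "2 powr (c * z) * min 1 (2 powr (- 2 * z)) \<le> 2 powr (c * z) * 1" by (intro mult_left_mono) auto
    also have "\<dots> \<le> 2 powr (- e * \<bar>z\<bar>)"
     using False e mult_right_mono_neg[of e c z] by (simp add: abs_if)
    finally show ?thesis .
   qed
   also have "2 powr (- e * \<bar>z\<bar>) \<le> 2 powr (e + (- e) * real (nat \<bar>int j - \<lfloor>l\<rfloor>\<bar>))"
   proof -
    have "real (nat \<bar>int j - \<lfloor>l\<rfloor>\<bar>) = \<bar>real j - real_of_int \<lfloor>l\<rfloor>\<bar>" by simp
    moreover have "\<bar>real j - real_of_int \<lfloor>l\<rfloor>\<bar> \<le> \<bar>z\<bar> + 1" unfolding z_def by linarith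
    ultimately have "e * real (nat \<bar>int j - \<lfloor>l\<rfloor>\<bar>) \<le> e * (\<bar>z\<bar> + 1)" using e by (intro mult_left_mono) auto
    then show ?thesis by (intro powr_mono) (auto simp: algebra_simps)
   qed
   also have "\<dots> = 2 powr e * \<rho> ^ nat \<bar>int j - \<lfloor>l\<rfloor>\<bar>"
    by (simp only: powr_add \<rho>_def powr_realpow[symmetric] powr_powr powr_gt_zero zero_less_numeral)
   finally show ?thesis by (simp add: mult_left_mono)
  qed
  have "(\<Sum>j<n. 2 powr (c * real j) * min 1 (1 / (u powr \<alpha> * 4 ^ j))) \<le> (\<Sum>j<n. u powr (- (\<alpha> * c / 2)) * (2 powr e * \<rho> ^ nat \<bar>int j - \<lfloor>l\<rfloor>\<bar>))"
   by (rule sum_mono) (rule t)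
  also have "\<dots> = u powr (- (\<alpha> * c / 2)) * (2 powr e * (\<Sum>j<n. \<rho> ^ nat \<bar>int j - \<lfloor>l\<rfloor>\<bar>))" by (simp only: sum_distrib_left)
  also have "\<dots> \<le> u powr (- (\<alpha> * c / 2)) * (2 powr e * (2 / (1 - \<rho>)))"
   using \<rho> by (intro mult_left_mono sum_power_dist_le) auto
  finally show ?thesis by (simp add: A_def mult.commute)
 qed
 then show ?thesis using A by blast
qed

text \<open>The integral is split at the time \<open>U\<close> with U^\<alpha> 4^j = 1. Both pieces
  scale out completely, so the bound does not depend on j; 0 < l gives convergence at 0 and l <
  \<alpha> at infinity.\<close>

lemma dyadic_min_integral:
 assumes l: "0 < l" "l < \<alpha>"
 shows "(\<integral>\<^sup>+u. ennreal (u powr (l - 1) * (2 powr (2 * l / \<alpha> * real j) * min 1 (1 / (u powr \<alpha> * 4 ^ j)))) * indicator {0<..} u \<partial>lborel) \<le>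
  ennreal (1 / l + 1 / (\<alpha> - l))"
proof -
 define U where "U = 2 powr (- (2 * real j / \<alpha>))"
 have U: "0 < U" by (simp add: U_def)
 define c where "c = 2 powr (2 * l / \<alpha> * real j)"
 have Uc: "U powr l * c = 1" using l by (simp add: U_def c_def powr_powr powr_add[symmetric])
 have U4: "U powr (- \<alpha>) = 4 ^ j"
 proof -
  have "U powr (- \<alpha>) = 2 powr (2 * real j)" using l by (simp add: U_def powr_powr)
  then show ?thesis by (simp add: powr_realpow powr_powr[symmetric])
 qed
 have i1: "(\<integral>\<^sup>+u. ennreal (u powr (l - 1) * indicator {0..U} u) \<partial>lborel) = ennreal (U powr l / l)"
  using nn_integral_has_integral_lebesgue[OF _ has_integral_powr_from_0[of "l - 1" U]] l U by (simp add: mult.commute)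
 have i2: "(\<integral>\<^sup>+u. ennreal (u powr (l - \<alpha> - 1) * indicator {U..} u) \<partial>lborel) = ennreal (U powr (l - \<alpha>) / (\<alpha> - l))"
  using nn_integral_has_integral_lebesgue[OF _ has_integral_powr_to_inf[of "l - \<alpha> - 1" U]] l U
  by (simp add: mult.commute minus_divide_right)
 have "(\<integral>\<^sup>+u. ennreal (u powr (l - 1) * (c * min 1 (1 / (u powr \<alpha> * 4 ^ j)))) * indicator {0<..} u \<partial>lborel) \<le>
   (\<integral>\<^sup>+u. ennreal c * ennreal (u powr (l - 1) * indicator {0..U} u) + ennreal (c / 4 ^ j) * ennreal (u powr (l - \<alpha> - 1) * indicator {U..} u) \<partial>lborel)"
 proof (rule nn_integral_mono)
  fix u :: real
  have cp: "0 \<le> c" by (simp add: c_def)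
  consider "u \<le> 0" | "0 < u" "u \<le> U" | "U < u" using U by linarith
  then show "ennreal (u powr (l - 1) * (c * min 1 (1 / (u powr \<alpha> * 4 ^ j)))) * indicator {0<..} u \<le>
    ennreal c * ennreal (u powr (l - 1) * indicator {0..U} u) + ennreal (c / 4 ^ j) * ennreal (u powr (l - \<alpha> - 1) * indicator {U..} u)"
  proof cases
   case 2
   have "u powr (l - 1) * (c * min 1 (1 / (u powr \<alpha> * 4 ^ j))) \<le> u powr (l - 1) * (c * 1)"
    using cp by (intro mult_left_mono) auto
   then have "ennreal (u powr (l - 1) * (c * min 1 (1 / (u powr \<alpha> * 4 ^ j)))) \<le> ennreal c * ennreal (u powr (l - 1))"
    using cp by (simp add: ennreal_mult[symmetric] mult.commute ennreal_leI)
   then show ?thesis using 2 by (simp add: add_increasing2)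
  next
   case 3
   have "u powr (l - 1) * (c * min 1 (1 / (u powr \<alpha> * 4 ^ j))) \<le> u powr (l - 1) * (c * (1 / (u powr \<alpha> * 4 ^ j)))"
    using cp by (intro mult_left_mono) auto
   also have "\<dots> = c / 4 ^ j * (u powr (l - 1) / u powr \<alpha>)" by (simp add: mult.commute)
   also have "u powr (l - 1) / u powr \<alpha> = u powr (l - \<alpha> - 1)" by (simp add: powr_diff[symmetric] algebra_simps)
   finally have "ennreal (u powr (l - 1) * (c * min 1 (1 / (u powr \<alpha> * 4 ^ j)))) \<le> ennreal (c / 4 ^ j) * ennreal (u powr (l - \<alpha> - 1))"
    using cp by (simp add: ennreal_mult[symmetric] ennreal_leI)
   then show ?thesis using 3 U by (simp add: add_increasing)
  qed simp
 qed
 also have "\<dots> = ennreal c * ennreal (U powr l / l) + ennreal (c / 4 ^ j) * ennreal (U powr (l - \<alpha>) / (\<alpha> - l))"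
  unfolding i1[symmetric] i2[symmetric] by (subst nn_integral_add) (auto simp: nn_integral_cmult)
 also have "\<dots> = ennreal (c * (U powr l / l) + c / 4 ^ j * (U powr (l - \<alpha>) / (\<alpha> - l)))"
  using l by (simp add: c_def ennreal_mult[symmetric] ennreal_plus[symmetric] del: ennreal_plus)
 also have "c * (U powr l / l) + c / 4 ^ j * (U powr (l - \<alpha>) / (\<alpha> - l)) = 1 / l + 1 / (\<alpha> - l)"
 proof -
  have "U powr (l - \<alpha>) = U powr l * 4 ^ j" unfolding U4[symmetric] powr_add[symmetric] by simp
  then show ?thesis using Uc by (simp add: mult.commute)
 qed
 finally show ?thesis unfolding c_def .
qed

section \<open>Summing the dyadic pieces\<close>

lemma integrable_cis_mult_iff:
 fixes F :: "'a::euclidean_space \<Rightarrow> complex"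
 assumes "F \<in> Borel"
 shows "L1 (\<lambda>\<xi>. cis (x \<bullet> \<xi>) * F \<xi>) \<longleftrightarrow> L1 F"
proof
 assume i: "L1 (\<lambda>\<xi>. cis (x \<bullet> \<xi>) * F \<xi>)"
 show "L1 F"
  by (rule lebesgue_integrable_bound[OF i]) (use assms in \<open>auto simp: norm_mult\<close>)
qed simp

text \<open>Characters have modulus 1, so integrability does not depend on x, and the integral of a
  non-integrable function is 0 by convention. The left side of the estimate then vanishes.\<close>

lemma inv_fourier_not_integrable:
 fixes F :: "'a::euclidean_space \<Rightarrow> complex"
 assumes "F \<in> Borel" "\<not> L1 F"
 shows "inv_fourier F x = 0"
 using assms integrable_cis_mult_iff[OF assms(1), of x]
 by (simp add: inv_fourier_lborel not_integrable_integral_eq)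

text \<open>The inverse transform of y \<mapsto> \<phi>(x - y) is a modulated multiple of
  \<open>fourier \<phi>\<close>, so the distributional convolution becomes an inverse transform of a
  product of symbols.\<close>

lemma conv_distr_frac_laplacian:
 fixes \<phi> :: "'a::euclidean_space \<Rightarrow> complex"
 assumes [measurable]: "\<phi> \<in> Borel"
 shows "conv_distr (frac_laplacian (a / 2) q) \<phi> x =
  inv_fourier (\<lambda>\<xi>. of_real (norm \<xi> powr a) * fourier q \<xi> * fourier \<phi> \<xi>) x"
proof -
 have "inv_fourier (\<lambda>y. \<phi> (x - y)) \<xi> = (cis (x \<bullet> \<xi>) * fourier \<phi> \<xi>) /\<^sub>R (2 * pi) ^ DIM('a)" for \<xi>
 proof -
  have "inv_fourier (\<lambda>y. \<phi> (x - y)) \<xi> = (LINT y|lborel. cis (\<xi> \<bullet> y) * \<phi> (x - y)) /\<^sub>R (2 * pi) ^ DIM('a)"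
   by (rule inv_fourier_lborel) measurable
  also have "(LINT y|lborel. cis (\<xi> \<bullet> y) * \<phi> (x - y)) = (LINT y|lborel. cis (\<xi> \<bullet> (x - y)) * \<phi> (x - (x - y)))"
   by (rule lborel_integral_reflect[symmetric]) measurable
  also have "\<dots> = (LINT y|lborel. cis (x \<bullet> \<xi>) * (cis (- (y \<bullet> \<xi>)) * \<phi> y))"
   by (intro lebesgue_integral_cong refl) (simp add: inner_diff_right inner_commute mult.assoc[symmetric] cis_mult)
  also have "\<dots> = cis (x \<bullet> \<xi>) * fourier \<phi> \<xi>" by (simp add: fourier_lborel)
  finally show ?thesis .
 qed
 then have "conv_distr (frac_laplacian (a / 2) q) \<phi> x =
   (LINT \<xi>|lebesgue. (cis (x \<bullet> \<xi>) * (of_real (norm \<xi> powr a) * fourier q \<xi> * fourier \<phi> \<xi>)) /\<^sub>R (2 * pi) ^ DIM('a))"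
  by (simp add: conv_distr_def frac_laplacian_def inv_fourier_distr_def mult.left_commute)
 then show ?thesis unfolding inv_fourier_def by simp
qed

context littlewood_paley_function
begin

text \<open>Jensen with the weights w_j gives |\<Sum> h_j|^p <= A^(p - 1) \<Sum> w_j |h_j / w_j|^p,
  and Young bounds the L_p norm of h_j by e_j w_j times that of the block. All powers of w_j but one
  cancel, leaving w_j e_j^p. Hence the factored operator norm: \<open>w j\<close> is what sums to
  \<open>A\<close>, while \<open>e j\<close> is destined for the Besov norm.\<close>

lemma dyadic_multiplier_estimate:
 assumes p: "1 < p" and \<phi>: "L1 \<phi>" and [measurable]: "M \<in> Borel"
  and w: "\<And>j. 0 < w j" and e: "\<And>j. 0 < e j"
  and m: "\<And>j. \<exists>m. L1_multiplier (e j * w j) m \<and> (\<forall>\<xi>. \<xi> \<noteq> 0 \<longrightarrow> norm \<xi> \<le> 2 * 2 ^ j \<longrightarrow> (0 < j \<longrightarrow> 2 ^ j / 2 \<le> norm \<xi>) \<longrightarrow> m \<xi> = M \<xi>)"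
  and A: "\<And>n. (\<Sum>j<n. w j) \<le> A" "0 < A"
 shows "(\<integral>\<^sup>+x. ennreal (norm (inv_fourier (\<lambda>\<xi>. M \<xi> * fourier \<phi> \<xi>) x) powr p) \<partial>lebesgue) \<le>
  ennreal (A powr (p - 1)) * (\<Sum>j. ennreal (w j * e j powr p) * (Lp_integral p (dyadic_block \<Psi> j \<phi>)))"
proof -
 define F where "F \<xi> = M \<xi> * fourier \<phi> \<xi>" for \<xi>
 have Fm [measurable]: "F \<in> Borel" unfolding F_def[abs_def] using \<phi> by measurable
 show ?thesis
 proof (cases "L1 F")
  case False
  then show ?thesis using inv_fourier_not_integrable[OF Fm] p by (simp add: F_def[abs_def, symmetric])
 next
  case Fi: True
  have "\<forall>j. \<exists>f. L1 f \<and> L1_norm f \<le> e j * w j \<and>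
    (\<forall>\<xi>. \<xi> \<noteq> 0 \<longrightarrow> norm \<xi> \<le> 2 * 2 ^ j \<longrightarrow> (0 < j \<longrightarrow> 2 ^ j / 2 \<le> norm \<xi>) \<longrightarrow> fourier f \<xi> = M \<xi>)"
  proof
   fix j
   obtain m where m': "L1_multiplier (e j * w j) m" "\<forall>\<xi>. \<xi> \<noteq> 0 \<longrightarrow> norm \<xi> \<le> 2 * 2 ^ j \<longrightarrow> (0 < j \<longrightarrow> 2 ^ j / 2 \<le> norm \<xi>) \<longrightarrow> m \<xi> = M \<xi>"
    using m by blast
   obtain f where "L1 f" "L1_norm f \<le> e j * w j" "\<And>\<xi>. fourier f \<xi> = m \<xi>"
    using m'(1) by (rule L1_multiplierE) blast
   with m'(2) show "\<exists>f. L1 f \<and> L1_norm f \<le> e j * w j \<and>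
    (\<forall>\<xi>. \<xi> \<noteq> 0 \<longrightarrow> norm \<xi> \<le> 2 * 2 ^ j \<longrightarrow> (0 < j \<longrightarrow> 2 ^ j / 2 \<le> norm \<xi>) \<longrightarrow> fourier f \<xi> = M \<xi>)" by auto
  qed
  then obtain f where f: "\<And>j. L1 (f j)" "\<And>j. (L1_norm (f j)) \<le> e j * w j"
    "\<And>j \<xi>. \<xi> \<noteq> 0 \<Longrightarrow> norm \<xi> \<le> 2 * 2 ^ j \<Longrightarrow> (0 < j \<Longrightarrow> 2 ^ j / 2 \<le> norm \<xi>) \<Longrightarrow> fourier (f j) \<xi> = M \<xi>"
   by metis
  define h where "h j = conv (f j) (dyadic_block \<Psi> j \<phi>)" for j
  note block = dyadic_block_integrable[OF \<phi>]
  have hi: "L1 (h j)" for j unfolding h_def by (rule integrable_conv[OF f(1) block])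
  have [measurable]: "h j \<in> Borel" for j using hi[of j] by simp
  have hF: "fourier (h j) \<xi> = F \<xi> * dyadic_symbol \<Psi> j \<xi>" if "\<xi> \<noteq> 0" for j \<xi>
  proof -
   have "fourier (h j) \<xi> = fourier (f j) \<xi> * (dyadic_symbol \<Psi> j \<xi> * fourier \<phi> \<xi>)"
    unfolding h_def fourier_conv[OF f(1) block] fourier_dyadic_block[OF \<phi>] ..
   also have "\<dots> = M \<xi> * (dyadic_symbol \<Psi> j \<xi> * fourier \<phi> \<xi>)"
    using f(3)[OF that, of j] dyadic_symbol_support[of j \<xi>] by (cases "dyadic_symbol \<Psi> j \<xi> = 0") auto
   finally show ?thesis by (simp add: F_def mult_ac)
  qed
  have bm: "L1 (\<lambda>\<xi>. F \<xi> * s \<xi>)" if "s \<in> Borel" "\<And>\<xi>. norm (s \<xi>) \<le> B" for s :: "'a \<Rightarrow> complex" and B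
  proof (rule lebesgue_integrable_bound[OF integrable_mult_right[OF integrable_norm[OF Fi], of B]])
   show "AE \<xi> in lborel. norm (F \<xi> * s \<xi>) \<le> norm (B * norm (F \<xi>))"
   proof (rule AE_I2)
    fix \<xi>
    have "norm (F \<xi>) * norm (s \<xi>) \<le> norm (F \<xi>) * B" using that(2) by (intro mult_left_mono) auto
    also have "\<dots> \<le> \<bar>B * norm (F \<xi>)\<bar>" by (simp add: mult.commute)
    finally show "norm (F \<xi> * s \<xi>) \<le> norm (B * norm (F \<xi>))" by (simp add: norm_mult)
   qed
  qed (use that in measurable)
  have Fs: "L1 (\<lambda>\<xi>. F \<xi> * dyadic_symbol \<Psi> j \<xi>)" for j
   using dyadic_symbol_bounded[of j] bm[OF dyadic_symbol_measurable] by blast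
  \<comment> \<open>The multipliers reproduce the symbol only for \<xi> \<noteq> 0; the origin is a
    null set.\<close>
  have nz: "AE \<xi> in lborel. \<xi> \<noteq> (0::'a)" by (rule AE_lborel_singleton)
  have hFm: "fourier (h j) \<in> Borel" for j by (rule borel_measurable_fourier[OF hi])
  have hAE: "AE \<xi> in lborel. F \<xi> * dyadic_symbol \<Psi> j \<xi> = fourier (h j) \<xi>" for j
   using nz by eventually_elim (simp add: hF)
  have hFi: "L1 (fourier (h j))" for j
   by (rule integrable_cong_AE_imp[OF Fs[of j]]) (use hFm hAE[of j] in \<open>auto elim: eventually_mono\<close>)
  have inv: "inv_fourier (fourier (h j)) x = inv_fourier (\<lambda>\<xi>. F \<xi> * dyadic_symbol \<Psi> j \<xi>) x" for j x
  proof -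
   have "(LINT \<xi>|lborel. cis (x \<bullet> \<xi>) * fourier (h j) \<xi>) = (LINT \<xi>|lborel. cis (x \<bullet> \<xi>) * (F \<xi> * dyadic_symbol \<Psi> j \<xi>))"
   proof (rule integral_cong_AE)
    show "AE \<xi> in lborel. cis (x \<bullet> \<xi>) * fourier (h j) \<xi> = cis (x \<bullet> \<xi>) * (F \<xi> * dyadic_symbol \<Psi> j \<xi>)"
     using hAE[of j] by eventually_elim simp
   qed (use hFm in measurable)
   then show ?thesis using hFm by (simp add: inv_fourier_lborel)
  qed
  have AEh: "AE x in lborel. \<forall>j. inv_fourier (\<lambda>\<xi>. F \<xi> * dyadic_symbol \<Psi> j \<xi>) x = h j x"
   unfolding AE_all_countable using fourier_inversion_AE[OF hi hFi] by (simp add: inv)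
  obtain B where B: "\<And>n \<xi>. norm (\<Sum>j<n. dyadic_symbol \<Psi> j \<xi>) \<le> B" using dyadic_symbol_partial_sums_bounded by blast
  have lim: "(\<lambda>n. \<Sum>j<n. inv_fourier (\<lambda>\<xi>. F \<xi> * dyadic_symbol \<Psi> j \<xi>) x) \<longlonglongrightarrow> inv_fourier F x" for x
  proof -
   have "(\<lambda>n. LINT \<xi>|lborel. cis (x \<bullet> \<xi>) * (F \<xi> * (\<Sum>j<n. dyadic_symbol \<Psi> j \<xi>))) \<longlonglongrightarrow> (LINT \<xi>|lborel. cis (x \<bullet> \<xi>) * F \<xi>)"
   proof (rule integral_dominated_convergence[where w = "\<lambda>\<xi>. B * norm (F \<xi>)"])
    show "L1 (\<lambda>\<xi>. B * norm (F \<xi>))" by (intro integrable_mult_right integrable_norm Fi)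
    show "AE \<xi> in lborel. (\<lambda>n. cis (x \<bullet> \<xi>) * (F \<xi> * (\<Sum>j<n. dyadic_symbol \<Psi> j \<xi>))) \<longlonglongrightarrow> cis (x \<bullet> \<xi>) * F \<xi>"
    proof (rule AE_I2)
     fix \<xi>
     have "(\<lambda>n. cis (x \<bullet> \<xi>) * (F \<xi> * (\<Sum>j<n. dyadic_symbol \<Psi> j \<xi>))) \<longlonglongrightarrow> cis (x \<bullet> \<xi>) * (F \<xi> * 1)"
      by (intro tendsto_mult tendsto_const dyadic_symbol_sums[unfolded sums_def])
     then show "(\<lambda>n. cis (x \<bullet> \<xi>) * (F \<xi> * (\<Sum>j<n. dyadic_symbol \<Psi> j \<xi>))) \<longlonglongrightarrow> cis (x \<bullet> \<xi>) * F \<xi>" by simp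
    qed
    show "AE \<xi> in lborel. norm (cis (x \<bullet> \<xi>) * (F \<xi> * (\<Sum>j<n. dyadic_symbol \<Psi> j \<xi>))) \<le> B * norm (F \<xi>)" for n
    proof (rule AE_I2)
     fix \<xi>
     have "norm (F \<xi>) * norm (\<Sum>j<n. dyadic_symbol \<Psi> j \<xi>) \<le> norm (F \<xi>) * B" using B by (intro mult_left_mono) auto
     then show "norm (cis (x \<bullet> \<xi>) * (F \<xi> * (\<Sum>j<n. dyadic_symbol \<Psi> j \<xi>))) \<le> B * norm (F \<xi>)"
      by (simp only: norm_mult norm_cis mult_1_left mult.commute[of B])
    qed
   qed measurable
   moreover have "(LINT \<xi>|lborel. cis (x \<bullet> \<xi>) * (F \<xi> * (\<Sum>j<n. dyadic_symbol \<Psi> j \<xi>))) = (\<Sum>j<n. LINT \<xi>|lborel. cis (x \<bullet> \<xi>) * (F \<xi> * dyadic_symbol \<Psi> j \<xi>))" for n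
    unfolding sum_distrib_left by (intro lebesgue_integral_sum integrable_cis_mult Fs)
   ultimately have "(\<lambda>n. (\<Sum>j<n. LINT \<xi>|lborel. cis (x \<bullet> \<xi>) * (F \<xi> * dyadic_symbol \<Psi> j \<xi>)) /\<^sub>R (2 * pi) ^ DIM('a)) \<longlonglongrightarrow>
     (LINT \<xi>|lborel. cis (x \<bullet> \<xi>) * F \<xi>) /\<^sub>R (2 * pi) ^ DIM('a)" by (intro tendsto_scaleR tendsto_const) simp
   then show ?thesis by (simp add: inv_fourier_lborel scaleR_sum_right)
  qed
  define R where "R j x = ennreal (w j * (norm (h j x) / w j) powr p)" for j x
  have "AE x in lborel. ennreal (norm (inv_fourier F x) powr p) \<le> ennreal (A powr (p - 1)) * (\<Sum>j. R j x)"
   using AEh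
  proof eventually_elim
   case (elim x)
   have l: "(\<lambda>n. \<Sum>j<n. h j x) \<longlonglongrightarrow> inv_fourier F x" using lim[of x] elim by simp
   have lp: "(\<lambda>n. norm (\<Sum>j<n. h j x) powr p) \<longlonglongrightarrow> norm (inv_fourier F x) powr p"
    using p by (intro tendsto_powr'[OF tendsto_norm[OF l] tendsto_const]) auto
   \<comment> \<open>Jensen is applied to finite sums with a bound free of n, since the full series
     is known only as a limit of them.\<close>
   have le: "ennreal (norm (\<Sum>j<n. h j x) powr p) \<le> ennreal (A powr (p - 1)) * (\<Sum>j. R j x)" for n
   proof -
    have "norm (\<Sum>j<n. h j x) \<le> (\<Sum>j<n. w j * (norm (h j x) / w j))"
     using norm_sum[of "\<lambda>j. h j x" "{..<n}"] w by (simp add: less_imp_neq[OF w, symmetric])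
    then have "norm (\<Sum>j<n. h j x) powr p \<le> (\<Sum>j<n. w j * (norm (h j x) / w j)) powr p"
     using p by (intro powr_mono2) auto
    also have "\<dots> \<le> A powr (p - 1) * (\<Sum>j<n. w j * (norm (h j x) / w j) powr p)"
     using w A p by (intro weighted_jensen_sum_powr) (auto simp: less_imp_le)
    finally have "ennreal (norm (\<Sum>j<n. h j x) powr p) \<le> ennreal (A powr (p - 1)) * ennreal (\<Sum>j<n. w j * (norm (h j x) / w j) powr p)"
     using w by (simp add: ennreal_mult[symmetric] ennreal_leI sum_nonneg less_imp_le)
    also have "ennreal (\<Sum>j<n. w j * (norm (h j x) / w j) powr p) = (\<Sum>j<n. R j x)"
     unfolding R_def using w by (intro sum_ennreal[symmetric]) (simp add: less_imp_le)
    also have "\<dots> \<le> (\<Sum>j. R j x)" by (rule sum_le_suminf) auto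
    finally show ?thesis by (simp add: mult_left_mono)
   qed
   show ?case by (rule LIMSEQ_le_const2[OF tendsto_ennrealI[OF lp]]) (use le in blast)
  qed
  then have AER: "AE x in lborel. ennreal (norm (inv_fourier F x) powr p) \<le> ennreal (A powr (p - 1)) * (\<Sum>j. R j x)" .
  have Rm: "R j \<in> Borel" for j unfolding R_def[abs_def] by measurable
  have invm: "(\<lambda>x. ennreal (norm (inv_fourier F x) powr p)) \<in> Borel"
  proof -
   have [measurable]: "inv_fourier F \<in> Borel"
    by (intro borel_measurable_continuous_onI continuous_on_inv_fourier Fi)
   show ?thesis by measurable
  qed
  have "(\<integral>\<^sup>+x. ennreal (norm (inv_fourier F x) powr p) \<partial>lebesgue) = Lp_integral p (inv_fourier F)"
   by (rule nn_integral_completion)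
  also have "\<dots> \<le> (\<integral>\<^sup>+x. ennreal (A powr (p - 1)) * (\<Sum>j. R j x) \<partial>lborel)"
   by (rule nn_integral_mono_AE[OF AER])
  also have "\<dots> = ennreal (A powr (p - 1)) * (\<Sum>j. \<integral>\<^sup>+x. R j x \<partial>lborel)"
   using Rm by (simp add: nn_integral_cmult nn_integral_suminf)
  also have "\<dots> \<le> ennreal (A powr (p - 1)) * (\<Sum>j. ennreal (w j * e j powr p) * (Lp_integral p (dyadic_block \<Psi> j \<phi>)))"
  proof (intro mult_left_mono suminf_le)
   fix j
   have "(\<integral>\<^sup>+x. R j x \<partial>lborel) = (\<integral>\<^sup>+x. ennreal (w j * (1 / w j) powr p) * ennreal (norm (h j x) powr p) \<partial>lborel)"
   proof (intro nn_integral_cong)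
    fix x
    have "(norm (h j x) / w j) powr p = (1 / w j) powr p * norm (h j x) powr p"
     using w[of j] by (simp add: powr_mult[symmetric])
    then show "R j x = ennreal (w j * (1 / w j) powr p) * ennreal (norm (h j x) powr p)"
     unfolding R_def using w[of j] by (simp add: ennreal_mult[symmetric] mult.assoc)
   qed
   also have "\<dots> = ennreal (w j * (1 / w j) powr p) * Lp_integral p (h j)"
    by (rule nn_integral_cmult) measurable
   also have "\<dots> \<le> ennreal (w j * (1 / w j) powr p) * (ennreal ((e j * w j) powr p) * (Lp_integral p (dyadic_block \<Psi> j \<phi>)))"
    unfolding h_def using e w f(2) p by (intro mult_left_mono young_convolution f(1) block) auto
   also have "\<dots> = ennreal (w j * e j powr p) * Lp_integral p (dyadic_block \<Psi> j \<phi>)"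
   proof -
    have "w j * (1 / w j) powr p * (e j * w j) powr p = w j * (1 / w j * (e j * w j)) powr p"
     using w[of j] e[of j] by (subst powr_mult) (auto simp: less_imp_le)
    also have "1 / w j * (e j * w j) = e j" using w[of j] by simp
    finally have eq: "w j * (1 / w j) powr p * (e j * w j) powr p = w j * e j powr p" .
    have "ennreal (w j * (1 / w j) powr p) * ennreal ((e j * w j) powr p) = ennreal (w j * e j powr p)"
     unfolding eq[symmetric] using w[of j] by (subst ennreal_mult[symmetric]) (auto simp: less_imp_le)
    then show ?thesis by (simp only: mult.assoc[symmetric])
   qed
   finally show "(\<integral>\<^sup>+x. R j x \<partial>lborel) \<le> ennreal (w j * e j powr p) * Lp_integral p (dyadic_block \<Psi> j \<phi>)" .
  qed auto
  finally show ?thesis unfolding F_def[abs_def] .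
 qed
qed

end

section \<open>The estimate\<close>

lemma epowr_mono: "a \<le> b \<Longrightarrow> 0 < r \<Longrightarrow> epowr a r \<le> epowr b r"
 by (cases a; cases b) (auto simp: epowr_def top_unique intro!: ennreal_leI powr_mono2)

lemma epowr_epowr_inverse: "0 < p \<Longrightarrow> epowr (epowr a (1 / p)) p = a"
 by (cases a) (auto simp: epowr_def powr_powr)

lemma test_function_measurable:
 assumes "test_function U g"
 shows "g \<in> Borel"
 using assms by (intro borel_measurable_continuous_onI smooth_imp_continuous) (simp add: test_function_def)

lemma test_function_section_integrable:
 fixes g :: "real \<times> 'a::euclidean_space \<Rightarrow> complex"
 assumes "test_function U g"
 shows "L1 (\<lambda>x. g (s, x))"
proof (rule integrable_continuous_compact_support)
 show "continuous_on UNIV (\<lambda>x. g (s, x))"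
  using assms by (intro continuous_on_compose2[OF smooth_imp_continuous[of g]] continuous_intros) (auto simp: test_function_def)
 show "compact (snd ` closure {x. g x \<noteq> 0})"
  using assms by (intro compact_continuous_image continuous_intros) (simp add: test_function_def)
 fix x assume "x \<notin> snd ` closure {x. g x \<noteq> 0}"
 then have "(s, x) \<notin> closure {x. g x \<noteq> 0}" by (metis image_eqI snd_conv)
 then have "(s, x) \<notin> {x. g x \<noteq> 0}" using closure_subset[of "{x. g x \<noteq> 0}"] by (rule contra_subsetD[rotated])
 then show "g (s, x) = 0" by simp
qed

context littlewood_paley_function
begin

text \<open>Each of the two summands of the norm is at most the whole, so their p-th powers add up
  to at most twice the p-th power of the norm; hence the factor 1/2.\<close>

lemma sum_blocks_le_besov_norm:
 fixes \<phi> :: "'a \<Rightarrow> complex"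
 assumes p: "0 < p" and \<phi>: "L1 \<phi>"
 shows "ennreal (1/2) * (\<Sum>j. ennreal (2 powr (\<epsilon> * p * real j)) * (Lp_integral p (dyadic_block \<Psi> j \<phi>))) \<le>
  epowr (besov_norm \<Psi> \<epsilon> p \<phi>) p"
proof -
 define N where "N j = Lp_integral p (dyadic_block \<Psi> j \<phi>)" for j
 have N: "epowr (Lp_norm p (dyadic_block \<Psi> j \<phi>)) p = N j" for j
 proof -
  have [measurable]: "dyadic_block \<Psi> j \<phi> \<in> Borel" using dyadic_block_integrable[OF \<phi>, of j] by simp
  have "(\<integral>\<^sup>+x. ennreal (norm (dyadic_block \<Psi> j \<phi> x) powr p) \<partial>lebesgue) = N j"
   unfolding N_def by (rule nn_integral_completion)
  then show ?thesis by (simp add: Lp_norm_def epowr_epowr_inverse[OF p])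
 qed
 define S where "S = (\<Sum>k. ennreal (2 powr (\<epsilon> * p * real (Suc k))) * N (Suc k))"
 have besov: "besov_norm \<Psi> \<epsilon> p \<phi> = Lp_norm p (dyadic_block \<Psi> 0 \<phi>) + epowr S (1 / p)"
  unfolding besov_norm_def N S_def ..
 have "N 0 \<le> epowr (besov_norm \<Psi> \<epsilon> p \<phi>) p"
  unfolding N[symmetric] besov by (intro epowr_mono p) simp
 moreover have "S \<le> epowr (besov_norm \<Psi> \<epsilon> p \<phi>) p"
 proof -
  have "epowr (epowr S (1 / p)) p \<le> epowr (besov_norm \<Psi> \<epsilon> p \<phi>) p"
   unfolding besov by (intro epowr_mono p) simp
  then show ?thesis by (simp add: epowr_epowr_inverse[OF p])
 qed
 ultimately have NS: "S + N 0 \<le> 2 * epowr (besov_norm \<Psi> \<epsilon> p \<phi>) p"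
  using add_mono[of S "epowr (besov_norm \<Psi> \<epsilon> p \<phi>) p" "N 0" "epowr (besov_norm \<Psi> \<epsilon> p \<phi>) p"] by (simp add: mult_2)
 have "(\<lambda>k. ennreal (2 powr (\<epsilon> * p * real (Suc k))) * N (Suc k)) sums S"
  unfolding S_def by (rule summable_sums) simp
 from sums_Suc[OF this] have "(\<Sum>j. ennreal (2 powr (\<epsilon> * p * real j)) * N j) = S + N 0" by (simp add: sums_iff)
 then have "ennreal (1/2) * (\<Sum>j. ennreal (2 powr (\<epsilon> * p * real j)) * N j) \<le> ennreal (1/2) * (2 * epowr (besov_norm \<Psi> \<epsilon> p \<phi>) p)"
  using NS by (simp add: mult_left_mono)
 also have "ennreal (1/2) * (2 * epowr (besov_norm \<Psi> \<epsilon> p \<phi>) p) = epowr (besov_norm \<Psi> \<epsilon> p \<phi>) p"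
 proof -
  have "ennreal (1/2) * 2 = ennreal (1/2) * ennreal 2" by simp
  also have "\<dots> = 1" by (subst ennreal_mult[symmetric]) auto
  finally show ?thesis by (simp add: mult.assoc[symmetric])
 qed
 finally show ?thesis unfolding N_def .
qed

text \<open>Measurability in time of the block norms, for Tonelli in the two time variables.\<close>

lemma block_norm_measurable:
 assumes [measurable]: "g \<in> Borel"
 shows "(\<lambda>s::real. \<integral>\<^sup>+x. ennreal (norm (dyadic_block \<Psi> j (\<lambda>x. g (s, x)) x) powr p) \<partial>lborel) \<in> Borel"
proof -
 have gm [measurable (raw)]: "(\<lambda>z. g (f z, h z)) \<in> borel_measurable N"
  if [measurable]: "f \<in> borel_measurable N" "h \<in> borel_measurable N" for N :: "'c measure" and f :: "'c \<Rightarrow> real" and h :: "'c \<Rightarrow> 'a"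
  by (rule measurable_compose[OF _ assms]) measurable
 have [measurable]: "inv_fourier (dyadic_symbol \<Psi> j) \<in> Borel"
  using dyadic_kernel_integrable[of j] by simp
 have "(\<lambda>s. \<integral>\<^sup>+x. ennreal (norm (LINT y|lborel. inv_fourier (dyadic_symbol \<Psi> j) (x - y) * g (s, y)) powr p) \<partial>lborel) \<in> Borel"
  by measurable
 then show ?thesis unfolding dyadic_block_def by (simp add: conv_lborel)
qed

end

theorem theorem3p7:
  fixes p \<alpha> \<beta> \<epsilon> \<delta> c1 T :: real and \<Psi> :: "'a::euclidean_space \<Rightarrow> complex"
  assumes "2 \<le> p" and "0 < \<alpha>" and "\<alpha> < 2" and "1 / p < \<beta>" and "\<beta> < \<alpha> + 1 / p"
    and "c1 = 2 * (\<alpha> + 1 / p - \<beta>) / \<alpha>"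
    and "1 / p < \<beta> - \<alpha> / 2 * \<epsilon>" and "0 \<le> c1 + \<epsilon>"
    and "\<beta> - \<alpha> < 1 / p - \<delta>" and "1 / p - \<delta> < 1 / p"
    and "0 < T"
    and "littlewood_paley \<Psi>"
  shows "\<exists>C::real. \<forall>P. fundamental_solution \<alpha> P \<longrightarrow>
    (\<forall>g :: real \<times> 'a \<Rightarrow> complex. test_function ({0<..} \<times> UNIV) g \<longrightarrow>
      (\<integral>\<^sup>+t\<in>{0..T}. (\<integral>\<^sup>+s\<in>{0..t}. (\<integral>\<^sup>+x.
          ennreal (norm (conv_distr (frac_laplacian ((c1 + \<epsilon>) / 2) (q_kernel P \<alpha> \<beta> (t - s)))
                           (\<lambda>y. g (s, y)) x) powr p) \<partial>lebesgue) \<partial>lebesgue) \<partial>lebesgue)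
      \<le> ennreal C * (\<integral>\<^sup>+t\<in>{0..T}. epowr (besov_norm \<Psi> \<epsilon> p (\<lambda>x. g (t, x))) p \<partial>lebesgue))"
proof -
 interpret littlewood_paley_function \<Psi> by unfold_locales fact
 \<comment> \<open>Here \<alpha> c1 / 2 = l, and 0 < l < \<alpha> restates 1/p < \<beta> < \<alpha>
   + 1/p.\<close>
 define l where "l = \<alpha> + 1 / p - \<beta>"
 have p: "1 < p" "0 < p" using assms(1) by auto
 have l: "0 < l" "l < \<alpha>" and c1: "c1 = 2 * l / \<alpha>" using assms by (auto simp: l_def)
 have c1_bounds: "0 < c1" "c1 < 2" using l assms(2) by (auto simp: c1 field_simps)
 obtain D where D: "0 < D" "\<And>u j. 0 < u \<Longrightarrow> u \<le> T \<Longrightarrow> \<exists>m. L1_multiplier (2 powr (\<epsilon> * real j) *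
   (D * (u powr (\<alpha> - \<beta>) * (2 powr (c1 * real j) * min 1 (1 / (u powr \<alpha> * 4 ^ j)))))) m \<and>
  (\<forall>\<xi>::'a. \<xi> \<noteq> 0 \<longrightarrow> norm \<xi> \<le> 2 * 2 ^ j \<longrightarrow> (0 < j \<longrightarrow> 2 ^ j / 2 \<le> norm \<xi>) \<longrightarrow>
   m \<xi> = of_real (norm \<xi> powr (c1 + \<epsilon>)) * ml_time \<alpha> (1 + \<alpha> - \<beta>) ((norm \<xi>)\<^sup>2) u)"
  using symbol_multiplier[OF assms(2,3,11,8), of \<beta>] by (metis greaterThanAtMost_iff)
 obtain A where A: "0 < A" "\<And>u n. 0 < u \<Longrightarrow> (\<Sum>j<n. 2 powr (c1 * real j) * min 1 (1 / (u powr \<alpha> * 4 ^ j))) \<le> A * u powr (- (\<alpha> * c1 / 2))"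
  using dyadic_min_sum[OF c1_bounds, of \<alpha>] by blast
 define B where "B = 1 / l + 1 / (\<alpha> - l)"
 have B: "0 \<le> B" using l by (simp add: B_def)
 define K where "K j u = 2 powr (c1 * real j) * min 1 (1 / (u powr \<alpha> * 4 ^ j))" for j u
 have K: "0 < K j u" if "0 < u" for j u using that by (simp add: K_def)
 \<comment> \<open>The weights sum to at most D A u^(-1/p), whose power p - 1 comes from Jensen, and
   one further factor D sits in each weight.\<close>
 define C1 where "C1 = (D * A) powr (p - 1) * D"
 have C1: "0 \<le> C1" using D(1) by (simp add: C1_def)
 define N where "N \<phi> j = Lp_integral p (dyadic_block \<Psi> j \<phi>)" for \<phi> :: "'a \<Rightarrow> complex" and j
 \<comment> \<open>Jensen's u^(1/p - 1) times u^(\<alpha> - \<beta>) from the weight is u^(l - 1).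
   The indicator discards s >= t once u = t - s.\<close>
 define rr where "rr j u = ennreal (u powr (l - 1) * K j u) * indicator {0<..} u" for j u
 have rrm [measurable]: "rr j \<in> Borel" for j unfolding rr_def[abs_def] K_def by measurable
 have rrB: "(\<integral>\<^sup>+u. rr j u \<partial>lborel) \<le> ennreal B" for j
  using dyadic_min_integral[OF l, of j] by (simp add: rr_def K_def B_def c1)
 show ?thesis
 \<comment> \<open>All constants are fixed before \<open>P\<close> and \<open>g\<close>; the 2
   undoes the 1/2 of \<open>sum_blocks_le_besov_norm\<close>.\<close>
 proof (intro exI[of _ "C1 * B * 2"] allI impI)
  fix P :: "real \<Rightarrow> 'a \<Rightarrow> complex" and g :: "real \<times> 'a \<Rightarrow> complex"
  assume P: "fundamental_solution \<alpha> P" and g: "test_function ({0<..} \<times> UNIV) g"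
  interpret fractional_heat \<alpha> P by unfold_locales fact+
  define \<phi> where "\<phi> s = (\<lambda>x. g (s, x))" for s
  have \<phi>: "L1 (\<phi> s)" for s unfolding \<phi>_def by (rule test_function_section_integrable[OF g])
  have Nm [measurable]: "(\<lambda>s. N (\<phi> s) j) \<in> Borel" for j
   unfolding N_def \<phi>_def by (rule block_norm_measurable[OF test_function_measurable[OF g]])
  define X where "X t s = (\<integral>\<^sup>+x. ennreal (norm (conv_distr (frac_laplacian ((c1 + \<epsilon>) / 2) (q_kernel P \<alpha> \<beta> (t - s))) (\<phi> s) x) powr p) \<partial>lebesgue)" for t s
  define R where "R u s = (\<Sum>j. rr j u * (ennreal (2 powr (\<epsilon> * p * real j)) * N (\<phi> s) j))" for u s
  have X: "X t s \<le> ennreal C1 * R (t - s) s" if "s < t" "t - s \<le> T" for t s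
  proof -
   define u where "u = t - s"
   have u: "0 < u" "u \<le> T" using that by (auto simp: u_def)
   define M where "M \<xi> = complex_of_real (norm \<xi> powr (c1 + \<epsilon>)) * fourier (q_kernel P \<alpha> \<beta> u) \<xi>" for \<xi> :: 'a
   have "\<beta> < \<alpha> + 1" using assms(1,5) p by (smt (verit) divide_le_eq_1_pos)
   note q = fourier_q_kernel[OF u(1) this]
   \<comment> \<open>Read off from the explicit symbol, since \<open>q_kernel\<close> itself need
     not be Borel.\<close>
   have Mm: "M \<in> Borel"
   proof -
    obtain G where G: "L1_multiplier G (\<lambda>\<xi>::'a. of_real (mittag_leffler \<alpha> (1 + \<alpha> - \<beta>) (- ((norm \<xi>)\<^sup>2 * u powr \<alpha>))))"
     using mittag_leffler_multiplier[OF assms(2,3)] u(1) by blast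
    then obtain f :: "'a \<Rightarrow> complex" where f: "L1 f" "\<And>\<xi>. fourier f \<xi> = of_real (mittag_leffler \<alpha> (1 + \<alpha> - \<beta>) (- ((norm \<xi>)\<^sup>2 * u powr \<alpha>)))"
     by (rule L1_multiplierE) blast
    have "M = (\<lambda>\<xi>. complex_of_real (norm \<xi> powr (c1 + \<epsilon>)) * (of_real (u powr (\<alpha> - \<beta>)) * fourier f \<xi>))"
     unfolding M_def[abs_def] q f(2) by (simp add: ml_time_def)
    moreover have [measurable]: "fourier f \<in> Borel" by (rule borel_measurable_fourier[OF f(1)])
    ultimately show ?thesis by simp
   qed
   define w where "w j = D * (u powr (\<alpha> - \<beta>) * K j u)" for j
   have w: "0 < w j" for j using D(1) K u by (simp add: w_def)
   have m: "\<exists>m. L1_multiplier (2 powr (\<epsilon> * real j) * w j) m \<and>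
     (\<forall>\<xi>::'a. \<xi> \<noteq> 0 \<longrightarrow> norm \<xi> \<le> 2 * 2 ^ j \<longrightarrow> (0 < j \<longrightarrow> 2 ^ j / 2 \<le> norm \<xi>) \<longrightarrow> m \<xi> = M \<xi>)" for j
    using D(2)[OF u, of j] unfolding w_def K_def M_def q by simp
   have ulp: "u powr (\<alpha> - \<beta>) * u powr (- (\<alpha> * c1 / 2)) = u powr (- (1 / p))"
   proof -
    have "\<alpha> - \<beta> + - (\<alpha> * c1 / 2) = - (1 / p)" using assms(2) by (simp add: c1) (simp add: l_def)
    then show ?thesis by (simp only: powr_add[symmetric])
   qed
   have sw: "(\<Sum>j<n. w j) \<le> D * A * u powr (- (1 / p))" for n
   proof -
    have "(\<Sum>j<n. w j) = D * (u powr (\<alpha> - \<beta>) * (\<Sum>j<n. K j u))" by (simp only: w_def sum_distrib_left)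
    also have "\<dots> \<le> D * (u powr (\<alpha> - \<beta>) * (A * u powr (- (\<alpha> * c1 / 2))))"
     using D(1) A(2)[OF u(1), of n] unfolding K_def by (intro mult_left_mono) auto
    also have "\<dots> = D * A * (u powr (\<alpha> - \<beta>) * u powr (- (\<alpha> * c1 / 2)))" by (simp only: mult_ac)
    finally show ?thesis unfolding ulp .
   qed
   have DAu: "0 < D * A * u powr (- (1 / p))" using D(1) A(1) u by simp
   have "X t s = (\<integral>\<^sup>+x. ennreal (norm (inv_fourier (\<lambda>\<xi>. M \<xi> * fourier (\<phi> s) \<xi>) x) powr p) \<partial>lebesgue)"
    using \<phi>[of s] by (simp add: X_def u_def[symmetric] conv_distr_frac_laplacian M_def)
   also have "\<dots> \<le> ennreal ((D * A * u powr (- (1 / p))) powr (p - 1)) *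
     (\<Sum>j. ennreal (w j * (2 powr (\<epsilon> * real j)) powr p) * N (\<phi> s) j)"
    unfolding N_def by (rule dyadic_multiplier_estimate[OF p(1) \<phi> Mm w _ m sw DAu]) simp
   also have "\<dots> = ennreal C1 * R u s"
   proof -
    have "ennreal ((D * A * u powr (- (1 / p))) powr (p - 1)) * ennreal (w j * (2 powr (\<epsilon> * real j)) powr p) =
      ennreal C1 * (rr j u * ennreal (2 powr (\<epsilon> * p * real j)))" for j
    proof -
     have e1: "(2 powr (\<epsilon> * real j)) powr p = 2 powr (\<epsilon> * p * real j)" by (simp add: powr_powr mult_ac)
     have e2: "(D * A * u powr (- (1 / p))) powr (p - 1) = (D * A) powr (p - 1) * u powr (1 / p - 1)"
      using D(1) A(1) p by (simp add: powr_mult powr_powr right_diff_distrib)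
     have e3: "u powr (1 / p - 1) * u powr (\<alpha> - \<beta>) = u powr (l - 1)"
      by (simp add: powr_add[symmetric] l_def algebra_simps)
     have "(D * A * u powr (- (1 / p))) powr (p - 1) * (w j * (2 powr (\<epsilon> * real j)) powr p) =
       C1 * ((u powr (1 / p - 1) * u powr (\<alpha> - \<beta>)) * K j u * 2 powr (\<epsilon> * p * real j))"
      unfolding e1 e2 w_def C1_def by (simp only: mult_ac)
     also have "\<dots> = C1 * (u powr (l - 1) * K j u * 2 powr (\<epsilon> * p * real j))" unfolding e3 ..
     finally show ?thesis
      using C1 w[of j] K[OF u(1), of j] u by (simp add: rr_def ennreal_mult[symmetric] less_imp_le)
    qed
    then have "ennreal ((D * A * u powr (- (1 / p))) powr (p - 1)) * (ennreal (w j * (2 powr (\<epsilon> * real j)) powr p) * N (\<phi> s) j) =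
      ennreal C1 * (rr j u * (ennreal (2 powr (\<epsilon> * p * real j)) * N (\<phi> s) j))" for j
     by (metis mult.assoc)
    then show ?thesis unfolding R_def ennreal_suminf_cmult[symmetric] by simp
   qed
   finally show ?thesis unfolding u_def .
  qed
  have Rm [measurable]: "(\<lambda>z. R (f z) (h z)) \<in> borel_measurable L"
   if [measurable]: "f \<in> borel_measurable L" "h \<in> borel_measurable L" for f h and L :: "'c measure"
  proof -
   have [measurable]: "(\<lambda>z. rr j (f z)) \<in> borel_measurable L" "(\<lambda>z. N (\<phi> (h z)) j) \<in> borel_measurable L" for j
    by (rule measurable_compose[OF that(1) rrm], rule measurable_compose[OF that(2) Nm])
   show ?thesis unfolding R_def by measurable
  qed
  \<comment> \<open>A jointly measurable majorant of \<open>X\<close> for 0 <= s < t <= T, to which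
    Tonelli applies. Enlarging the range of s to {0..T} decouples it from t.\<close>
  define W where "W t s = ennreal C1 * R (t - s) s * indicator {0..T} s" for t s
  have Wm: "(\<lambda>(t, s). W t s) \<in> borel_measurable (lborel \<Otimes>\<^sub>M lborel)" unfolding W_def by measurable
  have Wm1: "W t \<in> Borel" for t unfolding W_def by measurable
  have inner: "(\<integral>\<^sup>+s\<in>{0..t}. X t s \<partial>lebesgue) * indicator {0..T} t \<le> (\<integral>\<^sup>+s. W t s \<partial>lborel)" for t
  proof (cases "t \<in> {0..T}")
   case True
   have "(\<integral>\<^sup>+s\<in>{0..t}. X t s \<partial>lebesgue) \<le> (\<integral>\<^sup>+s. W t s \<partial>lebesgue)"
   proof (rule nn_integral_mono_AE)
    \<comment> \<open>\<open>X\<close> is bounded by \<open>W\<close> only for s < t; the diagonal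
      is a null set.\<close>
    have "AE s in lborel. s \<noteq> t" by (rule AE_lborel_singleton)
    from AE_completion[OF this] show "AE s in lebesgue. X t s * indicator {0..t} s \<le> W t s"
    proof eventually_elim
     case (elim s)
     show ?case
     proof (cases "s \<in> {0..t}")
      case s: True
      then show ?thesis using X[of s t] elim True by (simp add: W_def)
     qed simp
    qed
   qed
   also have "\<dots> = (\<integral>\<^sup>+s. W t s \<partial>lborel)" by (rule nn_integral_completion)
   finally show ?thesis using True by simp
  qed simp
  have Wm2: "(\<lambda>t. \<integral>\<^sup>+s. W t s \<partial>lborel) \<in> borel_measurable lborel"
   using lborel.borel_measurable_nn_integral_fst[OF Wm] by simp
  have "(\<integral>\<^sup>+t\<in>{0..T}. (\<integral>\<^sup>+s\<in>{0..t}. X t s \<partial>lebesgue) \<partial>lebesgue) \<le> (\<integral>\<^sup>+t. (\<integral>\<^sup>+s. W t s \<partial>lborel) \<partial>lebesgue)"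
   by (rule nn_integral_mono) (rule inner)
  also have "\<dots> = (\<integral>\<^sup>+t. (\<integral>\<^sup>+s. W t s \<partial>lborel) \<partial>lborel)" by (rule nn_integral_completion)
  also have "\<dots> = (\<integral>\<^sup>+s. (\<integral>\<^sup>+t. W t s \<partial>lborel) \<partial>lborel)"
   using lborel_pair.Fubini'[OF Wm] by simp
  also have "\<dots> \<le> (\<integral>\<^sup>+s. ennreal (C1 * B * 2) * (ennreal (1/2) * (\<Sum>j. ennreal (2 powr (\<epsilon> * p * real j)) * N (\<phi> s) j) * indicator {0..T} s) \<partial>lborel)"
  proof (rule nn_integral_mono)
   fix s :: real
   let ?c = "\<lambda>j. ennreal (2 powr (\<epsilon> * p * real j)) * N (\<phi> s) j"
   have "(\<integral>\<^sup>+t. W t s \<partial>lborel) = ennreal C1 * (\<integral>\<^sup>+t. R (t - s) s \<partial>lborel) * indicator {0..T} s"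
    unfolding W_def by (subst nn_integral_multc, measurable, subst nn_integral_cmult, measurable)
   also have "(\<integral>\<^sup>+t. R (t - s) s \<partial>lborel) = (\<Sum>j. \<integral>\<^sup>+t. rr j (t - s) * ?c j \<partial>lborel)"
    unfolding R_def by (rule nn_integral_suminf) measurable
   also have "\<dots> = (\<Sum>j. (\<integral>\<^sup>+u. rr j u \<partial>lborel) * ?c j)"
   proof (rule suminf_cong)
    fix j
    have "(\<integral>\<^sup>+t. rr j (t - s) * ?c j \<partial>lborel) = (\<integral>\<^sup>+t. rr j (t - s) \<partial>lborel) * ?c j"
     by (rule nn_integral_multc) measurable
    then show "(\<integral>\<^sup>+t. rr j (t - s) * ?c j \<partial>lborel) = (\<integral>\<^sup>+u. rr j u \<partial>lborel) * ?c j"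
     using nn_integral_lborel_translate[OF rrm, of j s] by simp
   qed
   also have "\<dots> \<le> (\<Sum>j. ennreal B * ?c j)"
    by (intro suminf_le mult_right_mono rrB) auto
   also have "\<dots> = ennreal B * (\<Sum>j. ?c j)" by simp
   finally have le: "(\<integral>\<^sup>+t. W t s \<partial>lborel) \<le> ennreal C1 * (ennreal B * (\<Sum>j. ?c j)) * indicator {0..T} s"
    by (simp add: mult_left_mono mult_right_mono)
   have "ennreal (C1 * B * 2) * ennreal (1/2) = ennreal (C1 * B * 2 * (1/2))"
    using C1 B by (intro ennreal_mult[symmetric]) auto
   also have "\<dots> = ennreal C1 * ennreal B" using C1 B by (simp add: ennreal_mult)
   finally have cc: "ennreal (C1 * B * 2) * ennreal (1/2) = ennreal C1 * ennreal B" .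
   have "ennreal (C1 * B * 2) * (ennreal (1/2) * (\<Sum>j. ?c j) * indicator {0..T} s) = ennreal C1 * (ennreal B * (\<Sum>j. ?c j)) * indicator {0..T} s"
    by (simp only: mult.assoc[symmetric] cc)
   with le show "(\<integral>\<^sup>+t. W t s \<partial>lborel) \<le> ennreal (C1 * B * 2) * (ennreal (1/2) * (\<Sum>j. ?c j) * indicator {0..T} s)" by simp
  qed
  also have "\<dots> = ennreal (C1 * B * 2) * (\<integral>\<^sup>+s. ennreal (1/2) * (\<Sum>j. ennreal (2 powr (\<epsilon> * p * real j)) * N (\<phi> s) j) * indicator {0..T} s \<partial>lborel)"
   by (rule nn_integral_cmult) measurable
  also have "(\<integral>\<^sup>+s. ennreal (1/2) * (\<Sum>j. ennreal (2 powr (\<epsilon> * p * real j)) * N (\<phi> s) j) * indicator {0..T} s \<partial>lborel) =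
    (\<integral>\<^sup>+s. ennreal (1/2) * (\<Sum>j. ennreal (2 powr (\<epsilon> * p * real j)) * N (\<phi> s) j) * indicator {0..T} s \<partial>lebesgue)"
   by (rule nn_integral_completion[symmetric])
  also have "ennreal (C1 * B * 2) * \<dots> \<le> ennreal (C1 * B * 2) * (\<integral>\<^sup>+s\<in>{0..T}. epowr (besov_norm \<Psi> \<epsilon> p (\<phi> s)) p \<partial>lebesgue)"
   unfolding N_def by (intro mult_left_mono nn_integral_mono mult_right_mono sum_blocks_le_besov_norm p \<phi>) auto
  finally show "(\<integral>\<^sup>+t\<in>{0..T}. (\<integral>\<^sup>+s\<in>{0..t}. (\<integral>\<^sup>+x.
     ennreal (norm (conv_distr (frac_laplacian ((c1 + \<epsilon>) / 2) (q_kernel P \<alpha> \<beta> (t - s)))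
             (\<lambda>y. g (s, y)) x) powr p) \<partial>lebesgue) \<partial>lebesgue) \<partial>lebesgue)
   \<le> ennreal (C1 * B * 2) * (\<integral>\<^sup>+t\<in>{0..T}. epowr (besov_norm \<Psi> \<epsilon> p (\<lambda>x. g (t, x))) p \<partial>lebesgue)"
   unfolding X_def \<phi>_def .
 qed
qed

end
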